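(* Consider the model in which $P\sim\mathrm{NRM}(\theta,G_0,\rho)$, $X_1,\dots,X_{n+1}\mid P$ are i.i.d. from $P$, $h\sim\mathscr H_J$ is independent of $(P,X_1,\dots,X_{n+1})$, and $C_j=\sum_{i=1}^nI[h(X_i)=j]$ for $j\in[J]$. When $\mathbf C_J=\mathbf c$ and $h(X_{n+1})=j$, let $$\hat f^{\mathrm{NRM}}_{X_{n+1}}=\mathbb E_{P\sim\mathrm{NRM}(\theta,G_0,\rho),\,h\sim\mathscr H_J}\Big[c_j\sum_{s\in\mathbb S_j}\Big(\frac{p_s}{q_j}\Big)^2\Big]$$ (the expectation being taken with $c_j$ held fixed) be the smoothed estimator of $f_{X_{n+1}}=\sum_{i=1}^nI[X_i=X_{n+1}]$, and let $$\hat f^{\mathrm{BNP}}_{X_{n+1}}=\sum_{r=0}^{c_j}r\,\pi_j^F(r),\qquad \pi_j^F(r)=\frac{\mathbb E_{P\sim\mathrm{NRM}(\theta,G_0,\rho),\,h\sim\mathscr H_J}\big[\Pr[f_{X_{n+1}}=r,\ \mathbf C_J=\mathbf c,\ h(X_{n+1})=j\mid P,h]\big]}{\mathbb E_{P\sim\mathrm{NRM}(\theta,G_0,\rho),\,h\sim\mathscr H_J}\big[\Pr[\mathbf C_J=\mathbf c,\ h(X_{n+1})=j\mid P,h]\big]}$$ be the Bayesian nonparametric (BNP) estimator, i.e. the posterior mean of $f_{X_{n+1}}$ given the full sketch and the bucket of $X_{n+1}$. Then the two estimators coincide (for all $J$, $n$, $\mathbf c$ and $j$) if and only if the normalized random measure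 is the Dirichlet process.
   Context: Hashing: $[J]=\{1,\dots,J\}$; $\mathscr H_J$ is a strongly universal (pairwise independent) hash family, i.e. a distribution over functions $h:\mathbb S\to[J]$ with $\Pr[h(x_1)=j_1,h(x_2)=j_2]=J^{-2}$ for all $j_1,j_2\in[J]$ and all fixed $x_1\ne x_2$ in $\mathbb S$. The sketch is $\mathbf C_J=(C_1,\dots,C_J)$. For a discrete distribution $P=\sum_s p_s\delta_s$ write $\mathbb S_j=\{s\in\mathbb S:h(s)=j\}$ and $q_j=\sum_{s\in\mathbb S_j}p_s$, sums over $s$ running over the atoms of $P$. Normalized random measures: let $\theta>0$, $G_0$ a non-atomic probability measure on $\mathbb S$ (with its Borel $\sigma$-algebra), and $\rho$ a nonnegative function on $\mathbb R_+$ with $\int_{\mathbb R_+}\rho(x)\mathrm dx=+\infty$ and $\int_{\mathbb R_+}(1-e^{-ux})\rho(x)\mathrm dx<+\infty$ for all $u>0$. Let $\tilde\mu=\sum_{k\ge1}J_k\delta_{S_k}$ be the purely atomic completely random measure on $\mathbb S$ with Lévy intensity $\nu(\mathrm dx,\mathrm ds)=\theta G_0(\mathrm ds)\rho(x)\mathrm dx$, i.e. $\{(J_k,S_k)\}$ are the points of a Poisson process on $\mathbb R_+\times\mathbb S$ with intensity $\nu$; its total mass $T=\tilde\mu(\mathbb S)$ is a.s. positive and finite. Then $P\sim\mathrm{NRM}(\theta,G_0,\rho)$ means $P=\tilde\mu/T$. The Dirichlet process is the normalized random measure obtained with $\rho(x)=x^{-1}e^{-x}$; "the normalized random measure is the Dirichlet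 process" means that the law of $P$ is that of a Dirichlet process. *)

theory Defs
  imports "HOL-Probability.Probability"
begin

section \<open>Random discrete distributions\<close>

text \<open>
  A discrete distribution \<open>P = \<Sum>s. p\<^sub>s \<delta>\<^sub>s\<close> is an element of type \<open>'s pmf\<close>: the weights are
  \<open>p\<^sub>s = pmf P s\<close> and the atoms are the elements of \<open>set_pmf P\<close>. The laws of random discrete
  distributions live on the sigma-algebra inherited from the probability measures on the Borel
  sets, i.e. the one generated by the maps \<open>P \<mapsto> P(A)\<close> for Borel \<open>A\<close>.
\<close>

definition discrete_distr_space :: "'s::topological_space pmf measure" where
  "discrete_distr_space =
     vimage_algebra UNIV (\<lambda>P. distr (measure_pmf P) borel (\<lambda>s. s)) (prob_algebra borel)"


section \<open>Poisson processes and normalized random measures\<close>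

definition num_points :: "(nat \<Rightarrow> 'b) \<Rightarrow> 'b set \<Rightarrow> enat" where
  "num_points w B = (if finite {k. w k \<in> B} then enat (card {k. w k \<in> B}) else \<infinity>)"

text \<open>
  The law \<open>N\<close> of a sequence \<open>w\<close> is that of an enumeration of the points of a Poisson process with
  intensity \<open>\<nu>\<close>. Only processes with infinitely many points can be enumerated in this way; this is
  the case here because the Levy density below has infinite integral.
\<close>

definition poisson_process_points :: "'b measure \<Rightarrow> (nat \<Rightarrow> 'b) measure \<Rightarrow> bool" where
  "poisson_process_points \<nu> N \<longleftrightarrow>
     prob_space N \<and> sets N = sets (PiM UNIV (\<lambda>_. \<nu>)) \<and>
     (\<forall>B\<in>sets \<nu>. emeasure \<nu> B < \<infinity> \<longrightarrow>
        (\<forall>m. measure N {w \<in> space N. num_points w B = enat m} =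
               measure \<nu> B ^ m / fact m * exp (- measure \<nu> B))) \<and>
     (\<forall>B\<in>sets \<nu>. emeasure \<nu> B = \<infinity> \<longrightarrow> (AE w in N. num_points w B = \<infinity>)) \<and>
     (\<forall>(I :: nat set) B. finite I \<longrightarrow> (\<forall>i\<in>I. B i \<in> sets \<nu>) \<longrightarrow> disjoint_family_on B I \<longrightarrow>
        prob_space.indep_vars N (\<lambda>_. count_space UNIV) (\<lambda>i w. num_points w (B i)) I)"

definition nonatomic_prob :: "'s::topological_space measure \<Rightarrow> bool" where
  "nonatomic_prob G \<longleftrightarrow> prob_space G \<and> sets G = sets borel \<and> (\<forall>s. emeasure G {s} = 0)"

definition levy_density :: "(real \<Rightarrow> real) \<Rightarrow> bool" where
  "levy_density \<rho> \<longleftrightarrow>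
     (\<forall>x>0. 0 \<le> \<rho> x) \<and> set_borel_measurable lborel {0<..} \<rho> \<and>
     (\<integral>\<^sup>+x\<in>{0<..}. ennreal (\<rho> x) \<partial>lborel) = \<infinity> \<and>
     (\<forall>u>0. (\<integral>\<^sup>+x\<in>{0<..}. ennreal ((1 - exp (- u * x)) * \<rho> x) \<partial>lborel) < \<infinity>)"

definition levy_intensity ::
    "real \<Rightarrow> 's measure \<Rightarrow> (real \<Rightarrow> real) \<Rightarrow> (real \<times> 's) measure" where
  "levy_intensity \<theta> G \<rho> =
     density (lborel \<Otimes>\<^sub>M G) (\<lambda>(x, s). indicator {0<..} x * ennreal (\<theta> * \<rho> x))"

text \<open>
  \<open>P = \<mu> / T\<close> for \<open>\<mu> = \<Sum>k. J\<^sub>k \<delta>\<^bsub>S\<^sub>k\<^esub>\<close>, \<open>T = \<Sum>k. J\<^sub>k\<close> and \<open>w k = (J\<^sub>k, S\<^sub>k)\<close>. The default branch is only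
  taken on a null event when \<open>w\<close> enumerates a Poisson process whose intensity is as above.
\<close>

definition normalized_measure :: "(nat \<Rightarrow> real \<times> 's) \<Rightarrow> 's pmf" where
  "normalized_measure w =
     (if (\<forall>k. 0 < fst (w k)) \<and> summable (\<lambda>k. fst (w k))
      then map_pmf (\<lambda>k. snd (w k)) (embed_pmf (\<lambda>k. fst (w k) / (\<Sum>i. fst (w i))))
      else return_pmf undefined)"

text \<open>
  \<open>Q\<close> is the law of a random \<open>P \<sim> NRM(\<theta>, G, \<rho>)\<close>. The points may be taken on the canonical space of
  sequences, since only their joint law matters.
\<close>

definition NRM_law ::
    "real \<Rightarrow> 's::topological_space measure \<Rightarrow> (real \<Rightarrow> real) \<Rightarrow> 's pmf measure \<Rightarrow> bool" where
  "NRM_law \<theta> G \<rho> Q \<longleftrightarrow>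
     (\<exists>N. poisson_process_points (levy_intensity \<theta> G \<rho>) N \<and>
          Q = distr N discrete_distr_space normalized_measure)"

definition dirichlet_process_law :: "'s::topological_space pmf measure \<Rightarrow> bool" where
  "dirichlet_process_law Q \<longleftrightarrow>
     (\<exists>\<alpha> G. 0 < \<alpha> \<and> nonatomic_prob G \<and> NRM_law \<alpha> G (\<lambda>x. exp (- x) / x) Q)"


section \<open>Hash families\<close>

definition strongly_universal :: "nat \<Rightarrow> ('s \<Rightarrow> nat) measure \<Rightarrow> bool" where
  "strongly_universal J H \<longleftrightarrow>
     prob_space H \<and> sets H = sets (PiM UNIV (\<lambda>_. count_space {1..J})) \<and>
     (\<forall>x1 x2. x1 \<noteq> x2 \<longrightarrow> (\<forall>j1\<in>{1..J}. \<forall>j2\<in>{1..J}.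
        measure H {h \<in> space H. h x1 = j1 \<and> h x2 = j2} = 1 / real J ^ 2))"

text \<open>
  The probabilities \<open>Pr[h(x\<^sub>1) = b\<^sub>1, \<dots>, h(x\<^sub>m) = b\<^sub>m]\<close> are Borel functions of \<open>(x\<^sub>1, \<dots>, x\<^sub>m)\<close>.
  This is what it takes for \<open>h(X\<^sub>1), \<dots>, h(X\<^sub>m)\<close> to have a joint law when \<open>h\<close> is independent of
  \<open>X\<^sub>1, \<dots>, X\<^sub>m\<close>; it holds for instance for fully independent uniform hash values. Joint
  measurability of \<open>(h, x) \<mapsto> h(x)\<close> would be too strong: for \<open>J \<ge> 2\<close> it contradicts pairwise
  independence as soon as a non-atomic probability measure exists on the space.
\<close>

definition measurable_hash :: "('s::topological_space \<Rightarrow> nat) measure \<Rightarrow> bool" where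
  "measurable_hash H \<longleftrightarrow>
     (\<forall>m b. (\<lambda>x :: nat \<Rightarrow> 's. measure H {h \<in> space H. \<forall>i<m. h (x i) = b i})
              \<in> borel_measurable (PiM {..<m} (\<lambda>_. borel :: 's measure)))"


section \<open>Sketches and the two estimators\<close>

definition bucket :: "'s pmf \<Rightarrow> ('s \<Rightarrow> nat) \<Rightarrow> nat \<Rightarrow> 's set" where
  "bucket P h j = {s \<in> set_pmf P. h s = j}"

definition bucket_mass :: "'s pmf \<Rightarrow> ('s \<Rightarrow> nat) \<Rightarrow> nat \<Rightarrow> real" where
  "bucket_mass P h j = (\<Sum>\<^sub>\<infinity>s\<in>bucket P h j. pmf P s)"

text \<open>A sample \<open>X\<^sub>1, \<dots>, X\<^bsub>n+1\<^esub>\<close> is a function \<open>x\<close> on the indices \<open>{1..n+1}\<close>.\<close>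

definition sample_freq :: "nat \<Rightarrow> (nat \<Rightarrow> 's) \<Rightarrow> nat" where
  "sample_freq n x = (\<Sum>i=1..n. of_bool (x i = x (n + 1)))"

definition sketch :: "nat \<Rightarrow> ('s \<Rightarrow> nat) \<Rightarrow> (nat \<Rightarrow> 's) \<Rightarrow> nat \<Rightarrow> nat" where
  "sketch n h x j = (\<Sum>i=1..n. of_bool (h (x i) = j))"

definition iid_sample :: "nat \<Rightarrow> 's pmf \<Rightarrow> (nat \<Rightarrow> 's) pmf" where
  "iid_sample n P = Pi_pmf {1..n + 1} undefined (\<lambda>_. P)"

text \<open>
  Expectation over independent \<open>P \<sim> Q\<close> and \<open>h \<sim> H\<close>, with \<open>h\<close> integrated out first. For fixed \<open>P\<close>
  the integrands below depend on \<open>h\<close> only through its values at the countably many atoms of \<open>P\<close>.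
\<close>

definition expect_P_h ::
    "'s pmf measure \<Rightarrow> ('s \<Rightarrow> nat) measure \<Rightarrow> ('s pmf \<Rightarrow> ('s \<Rightarrow> nat) \<Rightarrow> real) \<Rightarrow> real" where
  "expect_P_h Q H \<Phi> = (\<integral>P. (\<integral>h. \<Phi> P h \<partial>H) \<partial>Q)"

definition f_NRM ::
    "'s pmf measure \<Rightarrow> ('s \<Rightarrow> nat) measure \<Rightarrow> (nat \<Rightarrow> nat) \<Rightarrow> nat \<Rightarrow> real" where
  "f_NRM Q H c j =
     expect_P_h Q H (\<lambda>P h.
       real (c j) * (\<Sum>\<^sub>\<infinity>s\<in>bucket P h j. (pmf P s / bucket_mass P h j)\<^sup>2))"

definition posterior_freq ::
    "nat \<Rightarrow> nat \<Rightarrow> 's pmf measure \<Rightarrow> ('s \<Rightarrow> nat) measure \<Rightarrow> (nat \<Rightarrow> nat) \<Rightarrow> nat \<Rightarrow> nat \<Rightarrow> real" where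
  "posterior_freq J n Q H c j r =
     expect_P_h Q H (\<lambda>P h. measure_pmf.prob (iid_sample n P)
       {x. sample_freq n x = r \<and> (\<forall>k\<in>{1..J}. sketch n h x k = c k) \<and> h (x (n + 1)) = j}) /
     expect_P_h Q H (\<lambda>P h. measure_pmf.prob (iid_sample n P)
       {x. (\<forall>k\<in>{1..J}. sketch n h x k = c k) \<and> h (x (n + 1)) = j})"

definition f_BNP ::
    "nat \<Rightarrow> nat \<Rightarrow> 's pmf measure \<Rightarrow> ('s \<Rightarrow> nat) measure \<Rightarrow> (nat \<Rightarrow> nat) \<Rightarrow> nat \<Rightarrow> real" where
  "f_BNP J n Q H c j = (\<Sum>r=0..c j. real r * posterior_freq J n Q H c j r)"

end

theory Submission
  imports Defs "HOL-Real_Asymp.Real_Asymp"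
begin

text \<open>
  Only the pattern of coincidences in the sample \<open>X\<^sub>1, \<dots>, X\<^bsub>n+1\<^esub>\<close> and the hash labels matter, and in an
  NRM with nonatomic \<open>G\<^sub>0\<close> the locations of the atoms are iid and independent of the weights. Averaging
  over these locations makes the labels of the atoms iid uniform, even though the hash family is only
  pairwise independent. So the bucket masses are, up to normalization, the masses of \<open>J\<close> independent
  completely random measures with parameter \<open>a = \<theta> / J\<close>, and with \<open>S\<^sub>j = \<Sum>\<^bsub>h(s) = j\<^esub> p\<^sub>s\<^sup>2\<close> the two estimators
  coincide iff \<open>E[S\<^sub>j \<Prod>\<^sub>b q\<^sub>b] = r E[q\<^sub>j\<^sup>2 \<Prod>\<^sub>b q\<^sub>b]\<close> for all products of bucket masses, where \<open>r = E[S\<^sub>j / q\<^sub>j\<^sup>2]\<close>.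

  Write \<open>\<psi>\<close> for the Laplace exponent, \<open>\<kappa>\<^sub>n(u)\<close> for the integral of \<open>x\<^sup>n exp (- u x) \<rho>(x)\<close> and express inverse
  powers of the total mass as gamma integrals. Summing the moment identities in the buckets outside a
  set of \<open>m\<close> buckets gives, with \<open>c = m \<theta> / J\<close>,
  \<open>(1 - r) \<integral> u \<kappa>\<^sub>2(u) exp (- c \<psi>(u)) du = r a \<integral> u \<kappa>\<^sub>1(u)\<^sup>2 exp (- c \<psi>(u)) du\<close>.
  The case \<open>m = J\<close> shows that \<open>\<Lambda> = r a / (1 - r)\<close> does not depend on \<open>J\<close>. Hence two Laplace transforms in
  \<open>c\<close> agree on a set with an accumulation point, so everywhere, which forces \<open>\<kappa>\<^sub>2 = \<Lambda> \<kappa>\<^sub>1\<^sup>2\<close>. As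
  \<open>\<kappa>\<^sub>1' = - \<kappa>\<^sub>2\<close>, it follows that \<open>\<kappa>\<^sub>1(u) = 1 / (\<Lambda> (u + \<beta>))\<close>, i.e. \<open>\<rho>(x) = exp (- \<beta> x) / (\<Lambda> x)\<close>, a Dirichlet
  process after rescaling. Conversely the gamma process satisfies \<open>\<kappa>\<^sub>2 = \<kappa>\<^sub>1\<^sup>2\<close>, which yields the moment
  identities.
\<close>

section \<open>Laplace functionals of Poisson processes\<close>

text \<open>The Poisson law determines only symmetric functionals of the points: the order of the
  enumeration is arbitrary and may couple positions to weights. So the law of \<open>P\<close> is
  accessed through finite samples, whose law is a mean of products of ratios and hence depends on
  Laplace functionals alone; this allows \<open>N\<close> to be exchanged for a sequence whose
  positions are redrawn independently of the weights. Expectations live in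
  \<open>[0, \<infinity>]\<close>, where moments arise as monotone limits of difference quotients of
  exponentials. Since hash functions cannot be jointly measurable in general, \<open>h\<close>
  enters only through probabilities of label events of finite samples, and the ratio
  \<open>S\<^sub>j / q\<^sub>j\<^sup>2\<close> is expanded into countably many such events by
  \<open>1 / q\<^sup>2 = \<Sum>k (k + 1) (1 - q)^k\<close>. The integral identities hold just at
  \<open>c = m \<theta> / J\<close>; the values with \<open>m = J - 1\<close> accumulate at
  \<open>\<theta>\<close> as \<open>J\<close> grows, and this is where infinitely many
  \<open>J\<close> are used. In the differential equation, \<open>\<beta> = 0\<close> is excluded
  because \<open>\<psi>(1)\<close> is finite.\<close>

definition nexp :: "ennreal \<Rightarrow> ennreal" where
  "nexp t = (if t = top then 0 else ennreal (exp (- enn2real t)))"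

lemma nexp_ennreal: "0 \<le> x \<Longrightarrow> nexp (ennreal x) = ennreal (exp (- x))"
  by (simp add: nexp_def)

lemma nexp_top [simp]: "nexp top = 0" and nexp_0 [simp]: "nexp 0 = 1"
  by (simp_all add: nexp_def)

lemma nexp_add: "nexp (a + b) = nexp a * nexp b"
  by (cases a; cases b) (auto simp: nexp_ennreal ennreal_plus[symmetric] ennreal_mult[symmetric] exp_add[symmetric] simp del: ennreal_plus)

lemma nexp_sum: "nexp (\<Sum>i\<in>I. f i) = (\<Prod>i\<in>I. nexp (f i))"
  by (induction I rule: infinite_finite_induct) (auto simp: nexp_add)

lemma nexp_le_1 [simp]: "nexp t \<le> 1"
  by (cases t) (auto simp: nexp_ennreal)

lemma nexp_finite [simp]: "nexp t < top" "nexp t \<noteq> top"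
  by (cases t, auto simp: nexp_ennreal)+

lemma nexp_eq_0_iff [simp]: "nexp t = 0 \<longleftrightarrow> t = top"
  by (cases t) (auto simp: nexp_ennreal)

lemma nexp_eq_1_iff [simp]: "nexp t = 1 \<longleftrightarrow> t = 0"
  by (cases t) (auto simp: nexp_ennreal ennreal_eq_1)

lemma one_minus_nexp_eq_0_iff [simp]: "1 - nexp t = 0 \<longleftrightarrow> t = 0"
  using nexp_le_1[of t] nexp_eq_1_iff[of t]
  by (auto simp: diff_eq_0_iff_ennreal simp del: nexp_le_1 nexp_eq_1_iff)

lemma nexp_antimono: "a \<le> b \<Longrightarrow> nexp b \<le> nexp a"
  by (cases a; cases b) (auto simp: nexp_ennreal top_unique)

lemma nexp_measurable [measurable]: "nexp \<in> borel_measurable borel"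
  unfolding nexp_def by measurable

lemma tendsto_nexp:
  assumes "(f \<longlongrightarrow> L) F"
  shows "((\<lambda>x. nexp (f x)) \<longlongrightarrow> nexp L) F"
proof (cases L)
  case (real r)
  have ev: "\<forall>\<^sub>F x in F. f x < top"
    using assms real by (intro order_tendstoD) auto
  have "((\<lambda>x. ennreal (exp (- enn2real (f x)))) \<longlongrightarrow> ennreal (exp (- r))) F"
    using assms real by (intro tendsto_ennrealI tendsto_exp tendsto_minus tendsto_enn2real) auto
  then show ?thesis
    using real ev by (subst tendsto_cong[where g = "\<lambda>x. ennreal (exp (- enn2real (f x)))"])
      (auto simp: nexp_ennreal nexp_def elim!: eventually_mono)
next
  case top
  show ?thesis
  proof (rule order_tendstoI)
    fix a assume "nexp L < a"
    then have "0 < a" using top by simp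
    then obtain e :: real where e: "0 < e" "ennreal e < a"
    proof (cases a)
      case (real s)
      then show ?thesis using \<open>0 < a\<close> that[of "s / 2"] by (auto simp: ennreal_less_iff)
    qed (use that[of 1] in auto)
    have "\<forall>\<^sub>F x in F. ennreal (max 0 (- ln e)) < f x"
      using assms top by (intro order_tendstoD) auto
    then show "\<forall>\<^sub>F x in F. nexp (f x) < a"
    proof (eventually_elim)
      case (elim x)
      have "nexp (f x) \<le> nexp (ennreal (max 0 (- ln e)))"
        using elim by (intro nexp_antimono) auto
      also have "\<dots> \<le> ennreal e"
        using e by (subst nexp_ennreal) (auto intro!: ennreal_leI simp: max_def exp_minus)
      finally show ?case using e by simp
    qed
  qed (use top in auto)
qed

section \<open>Difference quotients of the exponential\<close>

definition dquot :: "nat \<Rightarrow> ennreal \<Rightarrow> ennreal" where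
  "dquot k x = 2 ^ k * (1 - nexp (x / 2 ^ k))"

lemma pow2_ennreal: "(2::ennreal) ^ k = ennreal (2 ^ k)"
  by (simp add: ennreal_power[symmetric])

lemma dquot_ennreal: "0 \<le> x \<Longrightarrow> dquot k (ennreal x) = ennreal (2 ^ k * (1 - exp (- x / 2 ^ k)))"
  unfolding dquot_def pow2_ennreal
  by (simp add: divide_ennreal nexp_ennreal ennreal_minus ennreal_1[symmetric] ennreal_mult'[symmetric] del: ennreal_1)

lemma dquot_top: "dquot k top = 2 ^ k"
  by (simp add: dquot_def pow2_ennreal ennreal_top_divide)

lemma dquot_measurable [measurable]: "dquot k \<in> borel_measurable borel"
  unfolding dquot_def by measurable

lemma dquot_mono: "x \<le> y \<Longrightarrow> dquot k x \<le> dquot k y"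
  unfolding dquot_def by (intro mult_left_mono ennreal_minus_mono nexp_antimono divide_right_mono_ennreal) auto

text \<open>With \<open>y = exp (- x / 2 ^ Suc k)\<close> the claim is
  \<open>1 - y ^ 2 \<le> 2 * (1 - y)\<close>, that is \<open>0 \<le> (1 - y) ^ 2\<close>. Halving
  the step is what makes the two quotients comparable so easily.\<close>

lemma dquot_Suc: "dquot k x \<le> dquot (Suc k) x"
proof (cases x)
  case (real r)
  define y where "y = exp (- r / 2 ^ Suc k)"
  have "exp (- r / 2 ^ k) = y ^ 2"
    unfolding y_def exp_of_nat_mult[symmetric] by (simp add: field_simps)
  moreover have "2 * (1 - y) \<ge> 1 - y ^ 2"
    using zero_le_power2[of "1 - y"] by (simp add: power2_eq_square algebra_simps)
  ultimately show ?thesis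
    using real by (simp add: dquot_ennreal y_def ennreal_leI del: minus_divide_left)
next
  case top
  have "ennreal (2 ^ k) \<le> ennreal (2 ^ Suc k)" by (rule ennreal_leI) simp
  then show ?thesis using top by (simp only: dquot_top pow2_ennreal)
qed

lemma incseq_dquot: "incseq (\<lambda>k. dquot k x)"
  by (rule incseq_SucI) (rule dquot_Suc)

text \<open>This is the derivative of the exponential at 0, reached from below. A factor
  \<open>x\<close> under an integral can therefore be replaced by quotients that are combinations of
  two exponentials, and recovered by monotone convergence.\<close>

lemma SUP_dquot: "(SUP k. dquot k x) = x"
proof (rule LIMSEQ_unique[OF LIMSEQ_SUP[OF incseq_dquot]])
  show "(\<lambda>k. dquot k x) \<longlonglongrightarrow> x"
  proof (cases x)
    case (real r)
    have "((\<lambda>h. (exp (- r * h) - 1) / h) \<longlongrightarrow> - r) (at 0)"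
    proof -
      have "((\<lambda>h. exp (- r * h)) has_field_derivative - r) (at 0)"
        by (auto intro!: derivative_eq_intros)
      from DERIV_D[OF this] show ?thesis by simp
    qed
    moreover have "filterlim (\<lambda>k. inverse (2 ^ k) :: real) (at 0) sequentially"
      by (intro filterlim_atI) (auto intro!: LIMSEQ_inverse_realpow_zero)
    ultimately have "(\<lambda>k. - ((exp (- r * inverse (2 ^ k)) - 1) / inverse (2 ^ k))) \<longlonglongrightarrow> - (- r)"
      by (intro tendsto_minus) (rule filterlim_compose)
    then have "(\<lambda>k. 2 ^ k * (1 - exp (- r / 2 ^ k))) \<longlonglongrightarrow> r"
      by (simp add: field_simps)
    then show ?thesis using real by (auto simp: dquot_ennreal intro!: tendsto_ennrealI)
  next
    case top
    have "(\<lambda>k. ennreal (2 ^ k)) \<longlonglongrightarrow> top"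
      by (subst ennreal_tendsto_top_eq_at_top) real_asymp
    then show ?thesis using top by (simp add: dquot_top pow2_ennreal)
  qed
qed

lemma dquot_le: "dquot k x \<le> x"
  using SUP_upper[of k UNIV "\<lambda>k. dquot k x"] by (simp add: SUP_dquot)

text \<open>The step and the argument may tend to their limits together: the quotient is monotone in
  both, so the double supremum is attained along the diagonal. The Campbell formula produces
  quotients whose argument itself depends on \<open>k\<close>.\<close>

lemma SUP_dquot_diag:
  assumes "incseq d"
  shows "(SUP k. dquot k (d k)) = (SUP k. d k)"
proof (rule antisym)
  show "(SUP k. dquot k (d k)) \<le> (SUP k. d k)"
    by (intro SUP_mono) (auto intro: dquot_le)
  have "dquot i (d j) \<le> dquot (max i j) (d (max i j))" for i j
    using incseqD[OF incseq_dquot, of i "max i j" "d j"] incseqD[OF assms, of j "max i j"]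
    by (meson dquot_mono max.cobounded1 max.cobounded2 order_trans)
  then have "(SUP i. dquot i (d j)) \<le> (SUP k. dquot k (d k))" for j
    by (intro SUP_mono) auto
  then show "(SUP k. d k) \<le> (SUP k. dquot k (d k))"
    by (intro SUP_least) (simp add: SUP_dquot)
qed

text \<open>The analysis of the estimators uses a Poisson process only through its Laplace
  functional. This form passes easily to marked sequences, whereas the counting form would require
  independence of counts to be proved again.\<close>

definition laplace_poisson :: "'b measure \<Rightarrow> (nat \<Rightarrow> 'b) measure \<Rightarrow> bool" where
  "laplace_poisson \<nu> N \<longleftrightarrow> prob_space N \<and> sets N = sets (PiM UNIV (\<lambda>_. \<nu>)) \<and>
     (\<forall>f\<in>borel_measurable \<nu>.
        (\<integral>\<^sup>+w. nexp (\<Sum>k. f (w k)) \<partial>N) = nexp (\<integral>\<^sup>+x. 1 - nexp (f x) \<partial>\<nu>))"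

lemma suminf_indicator_num_points:
  "(\<Sum>k. indicator B (w k)) = ennreal_of_enat (num_points w B)"
proof -
  have "(\<Sum>k. indicator B (w k)) = (\<Sum>k. indicator {k. w k \<in> B} k :: ennreal)"
    by (intro suminf_cong) (auto simp: indicator_def)
  also have "\<dots> = emeasure (count_space UNIV) {k. w k \<in> B}"
    by (simp add: nn_integral_count_space_nat[symmetric])
  also have "\<dots> = ennreal_of_enat (num_points w B)"
    by (cases "finite {k. w k \<in> B}") (auto simp: num_points_def ennreal_of_nat_eq_real_of_nat)
  finally show ?thesis .
qed

lemma num_points_measurable:
  assumes N: "sets N = sets (PiM UNIV (\<lambda>_. \<nu>))" and B [measurable]: "B \<in> sets \<nu>"
  shows "(\<lambda>w. num_points w B) \<in> N \<rightarrow>\<^sub>M count_space UNIV"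
proof (rule measurable_count_space_eq2_countable[THEN iffD2], intro conjI ballI)
  have [measurable_cong]: "sets N = sets (PiM UNIV (\<lambda>_. \<nu>))" by fact
  have m [measurable]: "(\<lambda>w. \<Sum>k. indicator B (w k) :: ennreal) \<in> borel_measurable N" by measurable
  fix a :: enat
  have "(\<lambda>w. num_points w B) -` {a} \<inter> space N = {w \<in> space N. (\<Sum>k. indicator B (w k)) = ennreal_of_enat a}"
    by (auto simp: suminf_indicator_num_points)
  also have "\<dots> \<in> sets N" by measurable
  finally show "(\<lambda>w. num_points w B) -` {a} \<inter> space N \<in> sets N" .
qed auto

text \<open>For finite mass \<open>l\<close> this is the generating function
  \<open>exp (- l (1 - s))\<close> of the Poisson distribution at \<open>s = exp (- c)\<close>. For
  infinite mass the count is infinite, and both sides are 0, or 1 if \<open>c = 0\<close>.\<close>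

lemma nn_integral_nexp_num_points:
  assumes pp: "poisson_process_points \<nu> N" and B: "B \<in> sets \<nu>" and c: "c < top"
  shows "(\<integral>\<^sup>+w. nexp (c * ennreal_of_enat (num_points w B)) \<partial>N) = nexp ((1 - nexp c) * emeasure \<nu> B)"
proof -
  interpret prob_space N using pp by (simp add: poisson_process_points_def)
  note m [measurable] = num_points_measurable[OF conjunct1[OF conjunct2[OF pp[unfolded poisson_process_points_def]]] B]
  obtain r where r: "c = ennreal r" "0 \<le> r" using c by (cases c) auto
  show ?thesis
  proof (cases "emeasure \<nu> B = \<infinity>")
    case True
    then have "AE w in N. num_points w B = \<infinity>"
      using pp B unfolding poisson_process_points_def by blast
    then have "(\<integral>\<^sup>+w. nexp (c * ennreal_of_enat (num_points w B)) \<partial>N) = (\<integral>\<^sup>+w. nexp (c * \<infinity>) \<partial>N)"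
      by (intro nn_integral_cong_AE) auto
    also have "\<dots> = nexp ((1 - nexp c) * \<infinity>)"
      by (cases "c = 0") (simp_all add: emeasure_space_1 ennreal_mult_top)
    finally show ?thesis by (simp add: True)
  next
    case False
    define l where "l = measure \<nu> B"
    have l: "emeasure \<nu> B = ennreal l" "0 \<le> l"
      using False by (auto simp: l_def emeasure_eq_ennreal_measure)
    have p: "emeasure N {w \<in> space N. num_points w B = enat m} = ennreal (l ^ m / fact m * exp (- l))" for m
    proof -
      have "measure N {w \<in> space N. num_points w B = enat m} = l ^ m / fact m * exp (- l)"
        using pp B False unfolding poisson_process_points_def l_def by (auto simp: less_top)
      then show ?thesis by (simp add: emeasure_eq_measure)
    qed
    have S: "(\<Sum>m. ennreal (exp (- (r * real m))) * ennreal (l ^ m / fact m * exp (- l)))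
        = ennreal (exp (- (l * (1 - exp (- r)))))" if "0 \<le> r" for r
    proof -
      have "(\<lambda>m. (l * exp (- r)) ^ m /\<^sub>R fact m) sums exp (l * exp (- r))"
        by (rule exp_converges)
      then have "(\<lambda>m. exp (- l) * ((l * exp (- r)) ^ m /\<^sub>R fact m)) sums (exp (- l) * exp (l * exp (- r)))"
        by (rule sums_mult)
      also have "exp (- l) * exp (l * exp (- r)) = exp (- (l * (1 - exp (- r))))"
        by (simp add: exp_add[symmetric] algebra_simps)
      also have "(\<lambda>m. exp (- l) * ((l * exp (- r)) ^ m /\<^sub>R fact m))
          = (\<lambda>m. exp (- (r * real m)) * (l ^ m / fact m * exp (- l)))"
        by (auto simp: power_mult_distrib exp_of_nat_mult[symmetric] field_simps)
      finally have *: "(\<lambda>m. exp (- (r * real m)) * (l ^ m / fact m * exp (- l))) sums exp (- (l * (1 - exp (- r))))" .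
      have "(\<Sum>m. ennreal (exp (- (r * real m)) * (l ^ m / fact m * exp (- l)))) = ennreal (exp (- (l * (1 - exp (- r)))))"
        using l by (intro suminf_ennreal_eq[OF _ *]) auto
      moreover have "ennreal (exp (- (r * real m)) * (l ^ m / fact m * exp (- l)))
          = ennreal (exp (- (r * real m))) * ennreal (l ^ m / fact m * exp (- l))" for m
        by (rule ennreal_mult') simp
      ultimately show ?thesis by simp
    qed
    have disj: "(\<integral>\<^sup>+w. (\<Sum>m. g m * indicator {w \<in> space N. num_points w B = enat m} w) \<partial>N)
        = (\<Sum>m. g m * ennreal (l ^ m / fact m * exp (- l)))" for g
      by (subst nn_integral_suminf) (auto simp: nn_integral_cmult p)
    have val: "(\<Sum>m. g m * indicator {w \<in> space N. num_points w B = enat m} w)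
        = (case num_points w B of enat m \<Rightarrow> g m | \<infinity> \<Rightarrow> 0)" if "w \<in> space N" for w and g :: "nat \<Rightarrow> ennreal"
    proof (cases "num_points w B")
      case (enat m0)
      have "(\<Sum>m. g m * indicator {w \<in> space N. num_points w B = enat m} w)
          = (\<Sum>m\<in>{m0}. g m * indicator {w \<in> space N. num_points w B = enat m} w)"
        by (intro suminf_finite) (auto simp: enat)
      then show ?thesis using that by (simp add: enat)
    qed auto
    \<comment> \<open>The Poisson probabilities, the series \<open>S\<close> at
      \<open>r = 0\<close>, already add up to 1, so no mass is left for an infinite count.\<close>
    have "AE w in N. num_points w B \<noteq> \<infinity>"
    proof (rule AE_I_eq_1)
      have "emeasure N {w \<in> space N. num_points w B \<noteq> \<infinity>} =
          (\<integral>\<^sup>+w. (\<Sum>m. 1 * indicator {w \<in> space N. num_points w B = enat m} w) \<partial>N)"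
      proof -
        have "emeasure N {w \<in> space N. num_points w B \<noteq> \<infinity>}
            = (\<integral>\<^sup>+w. indicator {w \<in> space N. num_points w B \<noteq> \<infinity>} w \<partial>N)"
          by (rule nn_integral_indicator[symmetric]) measurable
        also have "\<dots> = (\<integral>\<^sup>+w. (\<Sum>m. 1 * indicator {w \<in> space N. num_points w B = enat m} w) \<partial>N)"
          by (intro nn_integral_cong, subst val) (auto split: enat.split)
        finally show ?thesis .
      qed
      also have "\<dots> = 1" unfolding disj using S[of 0] by simp
      finally show "emeasure N {w \<in> space N. num_points w B \<noteq> \<infinity>} = 1" .
    qed measurable
    with AE_space have "AE w in N. nexp (c * ennreal_of_enat (num_points w B))
        = (\<Sum>m. nexp (c * of_nat m) * indicator {w \<in> space N. num_points w B = enat m} w)"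
    proof eventually_elim
      case (elim w)
      then show ?case by (subst val) (auto split: enat.split)
    qed
    then have "(\<integral>\<^sup>+w. nexp (c * ennreal_of_enat (num_points w B)) \<partial>N)
        = (\<integral>\<^sup>+w. (\<Sum>m. nexp (c * of_nat m) * indicator {w \<in> space N. num_points w B = enat m} w) \<partial>N)"
      by (rule nn_integral_cong_AE)
    also have "\<dots> = (\<Sum>m. ennreal (exp (- (r * real m))) * ennreal (l ^ m / fact m * exp (- l)))"
      unfolding disj using r
    proof (intro suminf_cong arg_cong2[where f = "(*)"] refl)
      fix m
      have "ennreal r * of_nat m = ennreal (r * real m)"
        using r by (simp add: ennreal_mult'' ennreal_of_nat_eq_real_of_nat)
      then show "nexp (c * of_nat m) = ennreal (exp (- (r * real m)))"
        using r by (simp add: nexp_ennreal)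
    qed
    also have "\<dots> = nexp ((1 - nexp c) * emeasure \<nu> B)"
    proof -
      have "(1 - nexp c) * emeasure \<nu> B = ennreal (l * (1 - exp (- r)))"
        using r l by (simp add: nexp_ennreal ennreal_minus ennreal_mult' mult.commute flip: ennreal_1)
      then show ?thesis using r l by (simp only: S[OF r(2)], subst nexp_ennreal) auto
    qed
    finally show ?thesis .
  qed
qed

text \<open>The sum of a simple function over the points is a combination of the counts in its
  disjoint level sets. These counts are independent, so the exponential factorizes into one
  generating function per level set.\<close>

lemma laplace_simple:
  assumes pp: "poisson_process_points \<nu> N" and f: "simple_function \<nu> f" "\<And>x. f x < top"
  shows "(\<integral>\<^sup>+w. nexp (\<Sum>k. f (w k)) \<partial>N) = nexp (\<integral>\<^sup>+x. 1 - nexp (f x) \<partial>\<nu>)"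
proof -
  interpret prob_space N using pp by (simp add: poisson_process_points_def)
  have sN: "sets N = sets (PiM UNIV (\<lambda>_. \<nu>))" using pp by (simp add: poisson_process_points_def)
  have fin: "finite (f ` space \<nu>)" using f(1) by (simp add: simple_function_def)
  define n where "n = card (f ` space \<nu>)"
  obtain c where c: "bij_betw c {..<n} (f ` space \<nu>)"
    using ex_bij_betw_nat_finite[OF fin] by (auto simp: n_def atLeast0LessThan)
  define B where "B i = f -` {c i} \<inter> space \<nu>" for i
  have B [measurable]: "B i \<in> sets \<nu>" for i
    using f(1) unfolding B_def by (rule simple_functionD)
  have disj: "disjoint_family_on B {..<n}"
    using c by (auto simp: disjoint_family_on_def B_def bij_betw_def inj_on_def)
  have dec: "g (f x) = (\<Sum>i<n. g (c i) * indicator (B i) x)" if "x \<in> space \<nu>" for x and g :: "ennreal \<Rightarrow> ennreal"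
  proof -
    have "f x \<in> c ` {..<n}" using bij_betw_imp_surj_on[OF c] that by simp
    then obtain j where j: "j < n" "c j = f x" by auto
    have "(\<Sum>i<n. g (c i) * indicator (B i) x) = (\<Sum>i<n. if i = j then g (c j) else 0)"
      using inj_onD[OF bij_betw_imp_inj_on[OF c]] j that
      by (intro sum.cong) (auto simp: B_def indicator_def)
    then show ?thesis using j by simp
  qed
  have cf: "c i < top" if "i < n" for i 
  proof -
    have "c i \<in> f ` space \<nu>" using bij_betwE[OF c] that by simp
    then show ?thesis using f(2) by auto
  qed
  have sp: "w k \<in> space \<nu>" if "w \<in> space N" for w k
    using that sets_eq_imp_space_eq[OF sN] by (auto simp: space_PiM)
  have "(\<Sum>k. f (w k)) = (\<Sum>i<n. c i * ennreal_of_enat (num_points w (B i)))" if "w \<in> space N" for w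
  proof -
    have "(\<Sum>k. f (w k)) = (\<Sum>k. \<Sum>i<n. c i * indicator (B i) (w k))"
      using sp[OF that] dec[of _ "\<lambda>x. x"] by (intro suminf_cong) auto
    also have "\<dots> = (\<Sum>i<n. \<Sum>k. c i * indicator (B i) (w k))"
      by (subst suminf_sum) auto
    finally show ?thesis by (simp add: suminf_indicator_num_points)
  qed
  then have "(\<integral>\<^sup>+w. nexp (\<Sum>k. f (w k)) \<partial>N)
      = (\<integral>\<^sup>+w. (\<Prod>i<n. nexp (c i * ennreal_of_enat (num_points w (B i)))) \<partial>N)"
    by (intro nn_integral_cong) (auto simp: nexp_sum)
  also have "\<dots> = (\<Prod>i<n. \<integral>\<^sup>+w. nexp (c i * ennreal_of_enat (num_points w (B i))) \<partial>N)"
  proof (rule indep_vars_nn_integral)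
    have "\<forall>(I :: nat set) B. finite I \<longrightarrow> (\<forall>i\<in>I. B i \<in> sets \<nu>) \<longrightarrow> disjoint_family_on B I \<longrightarrow>
        indep_vars (\<lambda>_. count_space UNIV) (\<lambda>i w. num_points w (B i)) I"
      using pp unfolding poisson_process_points_def by blast
    then have "indep_vars (\<lambda>_. count_space UNIV) (\<lambda>i w. num_points w (B i)) {..<n}"
      using B disj by blast
    then show "indep_vars (\<lambda>_. borel) (\<lambda>i w. nexp (c i * ennreal_of_enat (num_points w (B i)))) {..<n}"
      by (rule indep_vars_compose2) auto
  qed auto
  also have "\<dots> = (\<Prod>i<n. nexp ((1 - nexp (c i)) * emeasure \<nu> (B i)))"
    using cf by (intro prod.cong refl nn_integral_nexp_num_points[OF pp B]) auto
  also have "\<dots> = nexp (\<Sum>i<n. (1 - nexp (c i)) * emeasure \<nu> (B i))"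
    by (simp add: nexp_sum)
  also have "(\<Sum>i<n. (1 - nexp (c i)) * emeasure \<nu> (B i)) = (\<integral>\<^sup>+x. (\<Sum>i<n. (1 - nexp (c i)) * indicator (B i) x) \<partial>\<nu>)"
    by (subst nn_integral_sum) (auto simp: nn_integral_cmult)
  also have "\<dots> = (\<integral>\<^sup>+x. 1 - nexp (f x) \<partial>\<nu>)"
    by (intro nn_integral_cong) (auto simp: dec[of _ "\<lambda>x. 1 - nexp x"])
  finally show ?thesis .
qed

text \<open>Simple functions increase to \<open>f\<close>. The left side converges by dominated
  convergence, since \<open>nexp\<close> is at most 1 on a probability space, and the right side by
  monotone convergence of \<open>1 - nexp (f x)\<close>.\<close>

lemma poisson_imp_laplace:
  assumes pp: "poisson_process_points \<nu> N"
  shows "laplace_poisson \<nu> N"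
  unfolding laplace_poisson_def
proof (intro conjI ballI)
  show "prob_space N" "sets N = sets (PiM UNIV (\<lambda>_. \<nu>))" using pp by (auto simp: poisson_process_points_def)
  interpret prob_space N by fact
  fix f :: "'a \<Rightarrow> ennreal" assume [measurable]: "f \<in> borel_measurable \<nu>"
  from borel_measurable_implies_simple_function_sequence[OF \<open>f \<in> borel_measurable \<nu>\<close>]
  obtain F where F: "incseq F" "\<And>i x. F i x < top" "\<And>i. simple_function \<nu> (F i)" "f = (SUP i. F i)" by blast
  have [measurable]: "F i \<in> borel_measurable \<nu>" for i using F(3) by (rule borel_measurable_simple_function)
  have [measurable_cong]: "sets N = sets (PiM UNIV (\<lambda>_. \<nu>))" by fact
  have inc: "incseq (\<lambda>i. F i x)" for x using F(1) by (auto simp: incseq_def le_fun_def)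
  have lim: "(\<lambda>i. F i x) \<longlonglongrightarrow> f x" for x
    using LIMSEQ_SUP[OF inc, of x] by (simp add: F(4) image_comp)
  have "(\<lambda>i. \<integral>\<^sup>+w. nexp (\<Sum>k. F i (w k)) \<partial>N) \<longlonglongrightarrow> (\<integral>\<^sup>+w. nexp (\<Sum>k. f (w k)) \<partial>N)"
  proof (rule nn_integral_dominated_convergence[where w = "\<lambda>_. 1"])
    have "(\<lambda>i. \<Sum>k. F i (w k)) \<longlonglongrightarrow> (\<Sum>k. f (w k))" for w
    proof -
      have "incseq (\<lambda>i. \<Sum>k. F i (w k))"
        using inc by (auto simp: incseq_def intro!: suminf_le)
      then have "(\<lambda>i. \<Sum>k. F i (w k)) \<longlonglongrightarrow> (SUP i. \<Sum>k. F i (w k))" by (rule LIMSEQ_SUP)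
      also have "(SUP i. \<Sum>k. F i (w k)) = (\<Sum>k. SUP i. F i (w k))"
        by (rule ennreal_suminf_SUP_eq[symmetric]) (use inc in auto)
      finally show ?thesis by (simp add: F(4) image_comp)
    qed
    then show "AE w in N. (\<lambda>i. nexp (\<Sum>k. F i (w k))) \<longlonglongrightarrow> nexp (\<Sum>k. f (w k))"
      by (intro AE_I2 tendsto_nexp)
  qed (auto simp: emeasure_space_1)
  moreover have "(\<lambda>i. \<integral>\<^sup>+w. nexp (\<Sum>k. F i (w k)) \<partial>N) \<longlonglongrightarrow> nexp (\<integral>\<^sup>+x. 1 - nexp (f x) \<partial>\<nu>)"
  proof -
    have inc': "incseq (\<lambda>i x. 1 - nexp (F i x))"
      using inc by (auto simp: incseq_def le_fun_def intro!: ennreal_minus_mono nexp_antimono)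
    have "(\<lambda>i. \<integral>\<^sup>+x. 1 - nexp (F i x) \<partial>\<nu>) \<longlonglongrightarrow> (\<integral>\<^sup>+x. 1 - nexp (f x) \<partial>\<nu>)"
    proof (rule nn_integral_LIMSEQ[OF inc'])
      show "(\<lambda>i. 1 - nexp (F i x)) \<longlonglongrightarrow> 1 - nexp (f x)" for x
        by (intro tendsto_diff_ennreal tendsto_const tendsto_nexp lim) auto
    qed auto
    then show ?thesis using laplace_simple[OF pp F(3) F(2)] by (auto intro: tendsto_nexp)
  qed
  ultimately show "(\<integral>\<^sup>+w. nexp (\<Sum>k. f (w k)) \<partial>N) = nexp (\<integral>\<^sup>+x. 1 - nexp (f x) \<partial>\<nu>)"
    by (rule LIMSEQ_unique)
qed

section \<open>Marking and Campbell formulas\<close>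

text \<open>Inverse of \<open>nexp\<close> on \<open>[0, 1]\<close>, with value \<open>top\<close>
  at 0. It turns a product over the points of factors at most 1 into a Laplace functional.\<close>

definition nlog :: "ennreal \<Rightarrow> ennreal" where
  "nlog y = (if y = 0 then top else ennreal (- ln (enn2real y)))"

lemma nexp_nlog: "y \<le> 1 \<Longrightarrow> nexp (nlog y) = y"
proof (cases y)
  case (real r)
  assume "y \<le> 1"
  then have "r \<le> 1" using real by (simp add: ennreal_le_1)
  then show ?thesis using real by (auto simp: nlog_def nexp_ennreal)
qed (simp add: top_unique)

lemma nlog_measurable [measurable]: "nlog \<in> borel_measurable borel"
  unfolding nlog_def by measurable

lemma one_minus_mult: "a \<le> 1 \<Longrightarrow> b \<le> 1 \<Longrightarrow> 1 - a * b = (1 - a) + a * (1 - b :: ennreal)"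
proof (cases a; cases b)
  fix r s assume *: "a \<le> 1" "b \<le> 1" "a = ennreal r" "b = ennreal s" "0 \<le> r" "0 \<le> s"
  then have "r \<le> 1" "s \<le> 1" by (auto simp: ennreal_le_1)
  moreover from this have "r * s \<le> 1" using * mult_le_one by blast
  ultimately show ?thesis using *
    by (simp add: ennreal_mult[symmetric] ennreal_minus ennreal_plus[symmetric] mult_left_le algebra_simps
        flip: ennreal_1 del: ennreal_plus)
qed (auto simp: top_unique)

lemma nn_integral_PiM_UNIV_prod:
  assumes K: "prob_space K" and J: "finite J" and g [measurable]: "\<And>k. k \<in> J \<Longrightarrow> g k \<in> borel_measurable K"
  shows "(\<integral>\<^sup>+Y. (\<Prod>k\<in>J. g k (Y k)) \<partial>PiM UNIV (\<lambda>_. K)) = (\<Prod>k\<in>J. \<integral>\<^sup>+y. g k y \<partial>K)"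
proof -
  interpret K: prob_space K by fact
  interpret P: product_prob_space "\<lambda>_. K" UNIV ..
  have "(\<integral>\<^sup>+Y. (\<Prod>k\<in>J. g k (Y k)) \<partial>PiM UNIV (\<lambda>_. K))
      = (\<integral>\<^sup>+Y. (\<Prod>k\<in>J. g k (restrict Y J k)) \<partial>PiM UNIV (\<lambda>_. K))"
    by (intro nn_integral_cong prod.cong) auto
  also have "\<dots> = (\<integral>\<^sup>+Y. (\<Prod>k\<in>J. g k (Y k)) \<partial>distr (PiM UNIV (\<lambda>_. K)) (PiM J (\<lambda>_. K)) (\<lambda>Y. restrict Y J))"
    by (subst nn_integral_distr) (auto intro!: measurable_restrict_subset)
  also have "\<dots> = (\<integral>\<^sup>+Y. (\<Prod>k\<in>J. g k (Y k)) \<partial>PiM J (\<lambda>_. K))"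
    by (subst P.distr_PiM_restrict_finite) (use J in auto)
  also have "\<dots> = (\<Prod>k\<in>J. \<integral>\<^sup>+y. g k y \<partial>K)"
    by (rule P.product_nn_integral_prod) (use J in auto)
  finally show ?thesis .
qed

definition levy_weight :: "real \<Rightarrow> (real \<Rightarrow> real) \<Rightarrow> real \<Rightarrow> ennreal" where
  "levy_weight \<theta> \<rho> x = indicator {0<..} x * ennreal (\<theta> * \<rho> x)"

lemma levy_weight_measurable:
  assumes "set_borel_measurable lborel {0<..} \<rho>"
  shows "levy_weight \<theta> \<rho> \<in> borel_measurable borel"
proof -
  have [measurable]: "(\<lambda>x. indicator {0<..} x *\<^sub>R \<rho> x) \<in> borel_measurable borel"
    using assms by (simp add: set_borel_measurable_def)
  have "levy_weight \<theta> \<rho> = (\<lambda>x. ennreal (\<theta> * (indicator {0<..} x *\<^sub>R \<rho> x)))"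
    by (auto simp: levy_weight_def fun_eq_iff indicator_def)
  then show ?thesis by (simp only:) measurable
qed

lemma sets_levy_intensity: "sets (levy_intensity \<theta> G \<rho>) = sets (borel \<Otimes>\<^sub>M G)"
  unfolding levy_intensity_def by (simp cong: sets_pair_measure_cong)

lemma nn_integral_levy_intensity:
  assumes \<rho>: "set_borel_measurable lborel {0<..} \<rho>" and G: "prob_space G"
    and F [measurable]: "F \<in> borel_measurable (borel \<Otimes>\<^sub>M G)"
  shows "(\<integral>\<^sup>+z. F z \<partial>levy_intensity \<theta> G \<rho>)
    = (\<integral>\<^sup>+x. levy_weight \<theta> \<rho> x * (\<integral>\<^sup>+s. F (x, s) \<partial>G) \<partial>lborel)"
proof -
  interpret G: prob_space G by fact
  note [measurable] = levy_weight_measurable[OF \<rho>, of \<theta>]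
  have s: "sets (lborel \<Otimes>\<^sub>M G) = sets (borel \<Otimes>\<^sub>M G)" by (simp cong: sets_pair_measure_cong)
  have F' [measurable]: "F \<in> borel_measurable (lborel \<Otimes>\<^sub>M G)"
    using F measurable_cong_sets[OF s refl] by blast
  have "levy_intensity \<theta> G \<rho> = density (lborel \<Otimes>\<^sub>M G) (\<lambda>z. levy_weight \<theta> \<rho> (fst z))"
    by (simp add: levy_intensity_def levy_weight_def case_prod_unfold)
  then have "(\<integral>\<^sup>+z. F z \<partial>levy_intensity \<theta> G \<rho>)
      = (\<integral>\<^sup>+z. levy_weight \<theta> \<rho> (fst z) * F z \<partial>(lborel \<Otimes>\<^sub>M G))"
    by (simp add: nn_integral_density)
  also have "\<dots> = (\<integral>\<^sup>+x. \<integral>\<^sup>+s. levy_weight \<theta> \<rho> x * F (x, s) \<partial>G \<partial>lborel)"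
    by (subst G.nn_integral_fst[symmetric]) auto
  also have "\<dots> = (\<integral>\<^sup>+x. levy_weight \<theta> \<rho> x * (\<integral>\<^sup>+s. F (x, s) \<partial>G) \<partial>lborel)"
    by (intro nn_integral_cong nn_integral_cmult) measurable
  finally show ?thesis .
qed

text \<open>Keeps the weights and replaces the second coordinates by independent draws from
  \<open>K\<close>. Under \<open>N\<close> the order of the points may depend on weights and
  positions together; the new marks are independent of everything. With \<open>K = G\<close> this
  redraws the positions, with \<open>K\<close> uniform on \<open>{1..J}\<close> it attaches
  labels.\<close>

definition marked :: "(nat \<Rightarrow> real \<times> 's) measure \<Rightarrow> 'm measure \<Rightarrow> (nat \<Rightarrow> real \<times> 'm) measure" where
  "marked N K = distr (N \<Otimes>\<^sub>M PiM UNIV (\<lambda>_. K)) (PiM UNIV (\<lambda>_. borel \<Otimes>\<^sub>M K))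
     (\<lambda>(w, Y) k. (fst (w k), Y k))"

lemma laplace_poissonD:
  assumes "laplace_poisson \<nu> N"
  shows "prob_space N" "sets N = sets (PiM UNIV (\<lambda>_. \<nu>))"
    "f \<in> borel_measurable \<nu> \<Longrightarrow> (\<integral>\<^sup>+w. nexp (\<Sum>k. f (w k)) \<partial>N) = nexp (\<integral>\<^sup>+x. 1 - nexp (f x) \<partial>\<nu>)"
  using assms by (auto simp: laplace_poisson_def)

lemma sets_laplace_levy:
  assumes "laplace_poisson (levy_intensity \<theta> G \<rho>) N"
  shows "sets N = sets (PiM UNIV (\<lambda>_. borel \<Otimes>\<^sub>M G))"
  using laplace_poissonD(2)[OF assms] sets_PiM_cong[OF refl, of UNIV "\<lambda>_. levy_intensity \<theta> G \<rho>" "\<lambda>_. borel \<Otimes>\<^sub>M G"]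
  by (simp add: sets_levy_intensity)

lemma measurable_marking:
  assumes "sets N = sets (PiM UNIV (\<lambda>_. borel \<Otimes>\<^sub>M G))"
  shows "(\<lambda>(w, Y) k. (fst (w k), Y k)) \<in> N \<Otimes>\<^sub>M PiM UNIV (\<lambda>_. K) \<rightarrow>\<^sub>M PiM UNIV (\<lambda>_. borel \<Otimes>\<^sub>M K)"
proof -
  note [measurable_cong] = assms
  have "(\<lambda>z. (fst (fst z k), snd z k)) \<in> N \<Otimes>\<^sub>M PiM UNIV (\<lambda>_. K) \<rightarrow>\<^sub>M borel \<Otimes>\<^sub>M K" for k
    by measurable
  then show ?thesis
    unfolding case_prod_unfold
    by (intro measurable_PiM_single') (auto dest: measurable_space simp: space_pair_measure space_PiM)
qed

lemma nn_integral_marked: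
  assumes N: "laplace_poisson (levy_intensity \<theta> G \<rho>) N" and K: "prob_space K"
    and F [measurable]: "F \<in> borel_measurable (PiM UNIV (\<lambda>_. borel \<Otimes>\<^sub>M K))"
  shows "(\<integral>\<^sup>+z. F z \<partial>marked N K) = (\<integral>\<^sup>+w. \<integral>\<^sup>+Y. F (\<lambda>k. (fst (w k), Y k)) \<partial>PiM UNIV (\<lambda>_. K) \<partial>N)"
proof -
  interpret N: prob_space N by (rule laplace_poissonD[OF N])
  interpret K: prob_space K by fact
  interpret P: product_prob_space "\<lambda>_. K" UNIV ..
  note s = sets_laplace_levy[OF N]
  note [measurable] = measurable_marking[OF s, of K]
  have "(\<integral>\<^sup>+z. F z \<partial>marked N K)
      = (\<integral>\<^sup>+(w, Y). F (\<lambda>k. (fst (w k), Y k)) \<partial>(N \<Otimes>\<^sub>M PiM UNIV (\<lambda>_. K)))"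
    unfolding marked_def by (subst nn_integral_distr) (auto simp: case_prod_unfold)
  also have "\<dots> = (\<integral>\<^sup>+w. \<integral>\<^sup>+Y. F (\<lambda>k. (fst (w k), Y k)) \<partial>PiM UNIV (\<lambda>_. K) \<partial>N)"
    using measurable_compose[OF measurable_marking[OF s, of K] F]
    by (subst P.nn_integral_fst[symmetric]) (auto simp: case_prod_unfold)
  finally show ?thesis .
qed

text \<open>Marking theorem. Integrating out the mark of a point of weight \<open>x\<close> replaces
  \<open>exp (- f (x, y))\<close> by its mean \<open>g x\<close>, and the product of these means
  over the points is the Laplace functional of \<open>- ln g\<close> under \<open>N\<close>, which
  depends on the weights alone.\<close>

lemma laplace_marked:
  assumes \<rho>: "set_borel_measurable lborel {0<..} \<rho>" and G: "prob_space G"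
    and N: "laplace_poisson (levy_intensity \<theta> G \<rho>) N" and K: "prob_space K"
  shows "laplace_poisson (levy_intensity \<theta> K \<rho>) (marked N K)"
  unfolding laplace_poisson_def
proof (intro conjI ballI)
  interpret N: prob_space N by (rule laplace_poissonD[OF N])
  interpret G: prob_space G by fact
  interpret K: prob_space K by fact
  interpret P: product_prob_space "\<lambda>_. K" UNIV ..
  interpret NP: pair_prob_space N "PiM UNIV (\<lambda>_. K)" ..
  note s = sets_laplace_levy[OF N]
  show "prob_space (marked N K)"
    unfolding marked_def by (intro NP.prob_space_distr measurable_marking[OF s])
  show "sets (marked N K) = sets (PiM UNIV (\<lambda>_. levy_intensity \<theta> K \<rho>))"
    unfolding marked_def by (simp add: sets_levy_intensity cong: sets_PiM_cong)
  fix f :: "real \<times> 'b \<Rightarrow> ennreal" assume "f \<in> borel_measurable (levy_intensity \<theta> K \<rho>)"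
  then have f [measurable]: "f \<in> borel_measurable (borel \<Otimes>\<^sub>M K)"
    using measurable_cong_sets[OF sets_levy_intensity refl] by blast
  define g where "g x = (\<integral>\<^sup>+y. nexp (f (x, y)) \<partial>K)" for x
  have g [measurable]: "g \<in> borel_measurable borel" unfolding g_def by measurable
  have g1: "g x \<le> 1" for x
  proof -
    have "g x \<le> (\<integral>\<^sup>+y. 1 \<partial>K)" unfolding g_def by (intro nn_integral_mono) simp
    then show ?thesis by (simp add: K.emeasure_space_1)
  qed
  have lim: "(\<lambda>n. \<Prod>k<n. nexp (a k)) \<longlonglongrightarrow> nexp (\<Sum>k. a k)" for a :: "nat \<Rightarrow> ennreal"
    unfolding nexp_sum[symmetric] by (intro tendsto_nexp summable_LIMSEQ) simp
  \<comment> \<open>The infinite product of independent factors is the limit of the finite ones, and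
    all of them are bounded by 1.\<close>
  have inner: "(\<integral>\<^sup>+Y. nexp (\<Sum>k. f (fst (w k), Y k)) \<partial>PiM UNIV (\<lambda>_. K)) = nexp (\<Sum>k. nlog (g (fst (w k))))"
    for w :: "nat \<Rightarrow> real \<times> 'a"
  proof (rule LIMSEQ_unique)
    show "(\<lambda>n. \<integral>\<^sup>+Y. (\<Prod>k<n. nexp (f (fst (w k), Y k))) \<partial>PiM UNIV (\<lambda>_. K))
        \<longlonglongrightarrow> (\<integral>\<^sup>+Y. nexp (\<Sum>k. f (fst (w k), Y k)) \<partial>PiM UNIV (\<lambda>_. K))"
    proof (rule nn_integral_dominated_convergence[where w = "\<lambda>_. 1"])
      show "AE Y in PiM UNIV (\<lambda>_. K). (\<Prod>k<n. nexp (f (fst (w k), Y k))) \<le> 1" for n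
        by (intro AE_I2 prod_le_1) auto
    qed (auto simp: P.emeasure_space_1 lim)
    have "(\<lambda>n. \<Prod>k<n. g (fst (w k))) \<longlonglongrightarrow> nexp (\<Sum>k. nlog (g (fst (w k))))"
      using lim[of "\<lambda>k. nlog (g (fst (w k)))"] by (simp add: nexp_nlog g1)
    then show "(\<lambda>n. \<integral>\<^sup>+Y. (\<Prod>k<n. nexp (f (fst (w k), Y k))) \<partial>PiM UNIV (\<lambda>_. K))
        \<longlonglongrightarrow> nexp (\<Sum>k. nlog (g (fst (w k))))"
      by (subst nn_integral_PiM_UNIV_prod[OF K]) (auto simp: g_def)
  qed
  have "(\<integral>\<^sup>+z. nexp (\<Sum>k. f (z k)) \<partial>marked N K) = (\<integral>\<^sup>+w. nexp (\<Sum>k. nlog (g (fst (w k)))) \<partial>N)"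
    by (subst nn_integral_marked[OF N K]) (simp_all add: inner)
  also have "\<dots> = nexp (\<integral>\<^sup>+x. 1 - nexp (nlog (g (fst x))) \<partial>levy_intensity \<theta> G \<rho>)"
  proof (rule laplace_poissonD(3)[OF N])
    show "(\<lambda>x. nlog (g (fst x))) \<in> borel_measurable (levy_intensity \<theta> G \<rho>)"
      unfolding measurable_cong_sets[OF sets_levy_intensity refl] by measurable
  qed
  also have "(\<integral>\<^sup>+x. 1 - nexp (nlog (g (fst x))) \<partial>levy_intensity \<theta> G \<rho>)
      = (\<integral>\<^sup>+x. levy_weight \<theta> \<rho> x * (1 - g x) \<partial>lborel)"
    by (subst nn_integral_levy_intensity[OF \<rho> G]) (auto simp: nexp_nlog g1 G.emeasure_space_1)
  also have "\<dots> = (\<integral>\<^sup>+x. 1 - nexp (f x) \<partial>levy_intensity \<theta> K \<rho>)"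
  proof (subst nn_integral_levy_intensity[OF \<rho> K])
    have "(\<integral>\<^sup>+s. 1 - nexp (f (x, s)) \<partial>K) = 1 - g x" for x
      using g1[of x] unfolding g_def
      by (subst nn_integral_diff) (auto simp: K.emeasure_space_1 top_unique)
    then show "(\<integral>\<^sup>+x. levy_weight \<theta> \<rho> x * (1 - g x) \<partial>lborel)
        = (\<integral>\<^sup>+x. levy_weight \<theta> \<rho> x * (\<integral>\<^sup>+s. 1 - nexp (f (x, s)) \<partial>K) \<partial>lborel)"
      by simp
  qed measurable
  finally show "(\<integral>\<^sup>+z. nexp (\<Sum>k. f (z k)) \<partial>marked N K) = nexp (\<integral>\<^sup>+x. 1 - nexp (f x) \<partial>levy_intensity \<theta> K \<rho>)" .
qed

section \<open>First and second moments of sums over the points under an exponential tilt\<close>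

lemma mult_dquot: "a * nexp b * dquot k c = 2 ^ k * (a * nexp b - a * nexp (b + c / 2 ^ k))" if "a \<noteq> top"
proof -
  have "a * nexp b - a * nexp (b + c / 2 ^ k) = a * nexp b * (1 - nexp (c / 2 ^ k))"
    using that by (subst ennreal_right_diff_distrib) (auto simp: nexp_add ennreal_mult_eq_top_iff mult.assoc)
  then show ?thesis by (simp add: dquot_def mult_ac)
qed

lemma SUP_mult_dquot:
  assumes [measurable]: "a \<in> borel_measurable M" "c \<in> borel_measurable M"
  shows "(SUP k. \<integral>\<^sup>+x. a x * dquot k (c x) \<partial>M) = (\<integral>\<^sup>+x. a x * c x \<partial>M)"
proof -
  have "(SUP k. \<integral>\<^sup>+x. a x * dquot k (c x) \<partial>M) = (\<integral>\<^sup>+x. (SUP k. a x * dquot k (c x)) \<partial>M)"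
    by (intro nn_integral_monotone_convergence_SUP[symmetric])
      (auto simp: incseq_def le_fun_def intro!: mult_left_mono incseqD[OF incseq_dquot])
  then show ?thesis by (simp add: SUP_mult_left_ennreal[symmetric] SUP_dquot)
qed

lemma incseq_mult_dquot: "incseq (\<lambda>k. \<integral>\<^sup>+x. a x * dquot k (c x) \<partial>M)"
  by (auto simp: incseq_def intro!: nn_integral_mono mult_left_mono incseqD[OF incseq_dquot])

context
  fixes \<nu> :: "'b measure" and N
  assumes lap: "laplace_poisson \<nu> N"
begin

lemma laplace_sets_cong [measurable_cong]: "sets N = sets (PiM UNIV (\<lambda>_. \<nu>))"
  by (rule laplace_poissonD[OF lap])

text \<open>The identity \<open>1 - a b = (1 - a) + a (1 - b)\<close> splits the exponent: after the
  tilt by \<open>f\<close>, the perturbation \<open>g / 2 ^ n\<close> is integrated against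
  \<open>exp (- f)\<close> with respect to \<open>\<nu>\<close>.\<close>

lemma laplace_add:
  assumes [measurable]: "f \<in> borel_measurable \<nu>" "g \<in> borel_measurable \<nu>"
  shows "(\<integral>\<^sup>+w. nexp ((\<Sum>k. f (w k)) + (\<Sum>k. g (w k)) / 2 ^ n) \<partial>N)
    = nexp (\<integral>\<^sup>+x. 1 - nexp (f x) \<partial>\<nu>) * nexp ((\<integral>\<^sup>+x. nexp (f x) * dquot n (g x) \<partial>\<nu>) / 2 ^ n)"
proof -
  have "(\<Sum>k. f (w k)) + (\<Sum>k. g (w k)) / 2 ^ n = (\<Sum>k. f (w k) + g (w k) / 2 ^ n)" for w
    by (simp add: divide_ennreal_def suminf_add[OF summableI summableI] flip: ennreal_suminf_multc)
  then have "(\<integral>\<^sup>+w. nexp ((\<Sum>k. f (w k)) + (\<Sum>k. g (w k)) / 2 ^ n) \<partial>N)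
      = nexp (\<integral>\<^sup>+x. 1 - nexp (f x + g x / 2 ^ n) \<partial>\<nu>)"
    using laplace_poissonD(3)[OF lap, of "\<lambda>x. f x + g x / 2 ^ n"] by simp
  also have "(\<integral>\<^sup>+x. 1 - nexp (f x + g x / 2 ^ n) \<partial>\<nu>)
      = (\<integral>\<^sup>+x. (1 - nexp (f x)) + nexp (f x) * (1 - nexp (g x / 2 ^ n)) \<partial>\<nu>)"
    by (simp add: nexp_add one_minus_mult)
  also have "\<dots> = (\<integral>\<^sup>+x. 1 - nexp (f x) \<partial>\<nu>) + (\<integral>\<^sup>+x. nexp (f x) * (1 - nexp (g x / 2 ^ n)) \<partial>\<nu>)"
    by (rule nn_integral_add) measurable
  also have "(\<integral>\<^sup>+x. nexp (f x) * (1 - nexp (g x / 2 ^ n)) \<partial>\<nu>) = (\<integral>\<^sup>+x. nexp (f x) * dquot n (g x) \<partial>\<nu>) / 2 ^ n"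
  proof -
    have "(\<integral>\<^sup>+x. nexp (f x) * dquot n (g x) \<partial>\<nu>) = (\<integral>\<^sup>+x. 2 ^ n * (nexp (f x) * (1 - nexp (g x / 2 ^ n))) \<partial>\<nu>)"
      by (simp add: dquot_def mult_ac)
    also have "\<dots> = 2 ^ n * (\<integral>\<^sup>+x. nexp (f x) * (1 - nexp (g x / 2 ^ n)) \<partial>\<nu>)"
      by (rule nn_integral_cmult) measurable
    finally show ?thesis
      by (simp add: pow2_ennreal mult.commute[of "ennreal _"] ennreal_mult_divide_eq)
  qed
  finally show ?thesis by (simp add: nexp_add)
qed

text \<open>Derivative at \<open>s = 0\<close> of the Laplace functional of \<open>f + s g\<close>,
  along the steps \<open>s = 2 ^ - n\<close>. The quotients are monotone on both sides, so no
  integrability of \<open>g\<close> is involved.\<close>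

lemma campbell:
  assumes [measurable]: "f \<in> borel_measurable \<nu>" "g \<in> borel_measurable \<nu>"
  shows "(\<integral>\<^sup>+w. nexp (\<Sum>k. f (w k)) * (\<Sum>k. g (w k)) \<partial>N)
    = nexp (\<integral>\<^sup>+x. 1 - nexp (f x) \<partial>\<nu>) * (\<integral>\<^sup>+x. nexp (f x) * g x \<partial>\<nu>)"
proof -
  interpret prob_space N by (rule laplace_poissonD[OF lap])
  let ?E = "nexp (\<integral>\<^sup>+x. 1 - nexp (f x) \<partial>\<nu>)"
  define d where "d k = (\<integral>\<^sup>+x. nexp (f x) * dquot k (g x) \<partial>\<nu>)" for k
  have "(\<integral>\<^sup>+w. nexp (\<Sum>k. f (w k)) * dquot n (\<Sum>k. g (w k)) \<partial>N) = ?E * dquot n (d n)" for n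
  proof -
    have "(\<integral>\<^sup>+w. nexp (\<Sum>k. f (w k)) * dquot n (\<Sum>k. g (w k)) \<partial>N)
        = (\<integral>\<^sup>+w. 2 ^ n * (nexp (\<Sum>k. f (w k)) - nexp ((\<Sum>k. f (w k)) + (\<Sum>k. g (w k)) / 2 ^ n)) \<partial>N)"
      using mult_dquot[of 1] by simp
    also have "\<dots> = 2 ^ n * (\<integral>\<^sup>+w. nexp (\<Sum>k. f (w k)) - nexp ((\<Sum>k. f (w k)) + (\<Sum>k. g (w k)) / 2 ^ n) \<partial>N)"
      by (rule nn_integral_cmult) measurable
    also have "(\<integral>\<^sup>+w. nexp (\<Sum>k. f (w k)) - nexp ((\<Sum>k. f (w k)) + (\<Sum>k. g (w k)) / 2 ^ n) \<partial>N)
        = ?E - ?E * nexp (d n / 2 ^ n)"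
    proof (subst nn_integral_diff)
      show "(\<integral>\<^sup>+w. nexp (\<Sum>k. f (w k)) \<partial>N) - (\<integral>\<^sup>+w. nexp ((\<Sum>k. f (w k)) + (\<Sum>k. g (w k)) / 2 ^ n) \<partial>N)
         = ?E - ?E * nexp (d n / 2 ^ n)"
        by (simp add: laplace_add laplace_poissonD(3)[OF lap] d_def)
      show "(\<integral>\<^sup>+w. nexp ((\<Sum>k. f (w k)) + (\<Sum>k. g (w k)) / 2 ^ n) \<partial>N) \<noteq> \<infinity>"
        by (simp add: laplace_add ennreal_mult_eq_top_iff)
    qed (auto intro!: nexp_antimono)
    also have "?E - ?E * nexp (d n / 2 ^ n) = ?E * (1 - nexp (d n / 2 ^ n))"
      by (subst ennreal_right_diff_distrib) auto
    finally show ?thesis by (simp add: dquot_def mult_ac)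
  qed
  then have "(\<integral>\<^sup>+w. nexp (\<Sum>k. f (w k)) * (\<Sum>k. g (w k)) \<partial>N) = (SUP n. ?E * dquot n (d n))"
    by (subst SUP_mult_dquot[symmetric]) auto
  also have "\<dots> = ?E * (SUP n. d n)"
    by (subst SUP_mult_left_ennreal[symmetric], subst SUP_dquot_diag) (auto simp: d_def[abs_def] incseq_mult_dquot)
  also have "(SUP n. d n) = (\<integral>\<^sup>+x. nexp (f x) * g x \<partial>\<nu>)"
    unfolding d_def by (rule SUP_mult_dquot) measurable
  finally show ?thesis .
qed

text \<open>Derivative of the first-order formula in the direction \<open>h\<close>. By the product
  rule \<open>h\<close> acts either on the integral of \<open>exp (- f) g\<close>, which gives the
  diagonal term, or on the exponential in front, which gives the product of the two first moments.
  Finiteness of the three integrals justifies the subtractions and makes the perturbed integral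
  \<open>a n\<close> converge to \<open>?A\<close>.\<close>

lemma campbell2:
  assumes [measurable]: "f \<in> borel_measurable \<nu>" "g \<in> borel_measurable \<nu>" "h \<in> borel_measurable \<nu>"
    and A: "(\<integral>\<^sup>+x. nexp (f x) * g x \<partial>\<nu>) < top" and B: "(\<integral>\<^sup>+x. nexp (f x) * h x \<partial>\<nu>) < top"
    and C: "(\<integral>\<^sup>+x. nexp (f x) * g x * h x \<partial>\<nu>) < top"
  shows "(\<integral>\<^sup>+w. nexp (\<Sum>k. f (w k)) * (\<Sum>k. g (w k)) * (\<Sum>k. h (w k)) \<partial>N)
    = nexp (\<integral>\<^sup>+x. 1 - nexp (f x) \<partial>\<nu>) *
      ((\<integral>\<^sup>+x. nexp (f x) * g x * h x \<partial>\<nu>) + (\<integral>\<^sup>+x. nexp (f x) * g x \<partial>\<nu>) * (\<integral>\<^sup>+x. nexp (f x) * h x \<partial>\<nu>))"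
proof -
  interpret prob_space N by (rule laplace_poissonD[OF lap])
  let ?E = "nexp (\<integral>\<^sup>+x. 1 - nexp (f x) \<partial>\<nu>)"
  let ?A = "\<integral>\<^sup>+x. nexp (f x) * g x \<partial>\<nu>"
  define d where "d n = (\<integral>\<^sup>+x. nexp (f x) * dquot n (h x) \<partial>\<nu>)" for n
  define a where "a n = (\<integral>\<^sup>+x. nexp (f x + h x / 2 ^ n) * g x \<partial>\<nu>)" for n
  define b where "b n = (\<integral>\<^sup>+x. nexp (f x) * g x * dquot n (h x) \<partial>\<nu>)" for n
  have int: "(\<integral>\<^sup>+w. nexp (\<Sum>k. f (w k)) * (\<Sum>k. g (w k)) \<partial>N) = ?E * ?A" by (rule campbell) measurable
  then have fin: "(\<integral>\<^sup>+w. nexp (\<Sum>k. f (w k)) * (\<Sum>k. g (w k)) \<partial>N) < top"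
    using A by (simp add: ennreal_mult_less_top)
  have "AE w in N. nexp (\<Sum>k. f (w k)) * (\<Sum>k. g (w k)) \<noteq> \<infinity>"
    by (rule nn_integral_noteq_infinite) (use fin in auto)
  \<comment> \<open>Where the sum of \<open>g\<close> is infinite, the exponential factor has to
    vanish; both sides of the pointwise quotient identity are then 0, although
    \<open>mult_dquot\<close> does not apply.\<close>
  then have AE0: "AE w in N. nexp (\<Sum>k. f (w k)) = 0 \<or> (\<Sum>k. g (w k)) \<noteq> top"
    by eventually_elim (auto simp: ennreal_mult_eq_top_iff)
  have an: "a n \<le> ?A" for n
    unfolding a_def by (intro nn_integral_mono mult_right_mono nexp_antimono) auto
  \<comment> \<open>The effect of the perturbation on the integral of \<open>exp (- f) g\<close>,
    written additively and scaled by \<open>2 ^ n\<close> to avoid a subtraction in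
    \<open>[0, \<infinity>]\<close>.\<close>
  have ab: "2 ^ n * ?A = 2 ^ n * a n + b n" for n
  proof -
    have "2 ^ n * (nexp (f x) * g x) = 2 ^ n * (nexp (f x + h x / 2 ^ n) * g x) + nexp (f x) * g x * dquot n (h x)" for x
    proof -
      have "nexp (h x / 2 ^ n) + (1 - nexp (h x / 2 ^ n)) = 1"
        by (rule add_diff_inverse_ennreal) simp
      then have "2 ^ n * (nexp (f x) * g x) = 2 ^ n * (nexp (f x) * g x) * (nexp (h x / 2 ^ n) + (1 - nexp (h x / 2 ^ n)))"
        by (simp only: mult_1_right)
      also have "\<dots> = 2 ^ n * (nexp (f x + h x / 2 ^ n) * g x) + nexp (f x) * g x * dquot n (h x)"
        by (simp add: distrib_left nexp_add dquot_def mult_ac)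
      finally show ?thesis .
    qed
    then have "(\<integral>\<^sup>+x. 2 ^ n * (nexp (f x) * g x) \<partial>\<nu>)
        = (\<integral>\<^sup>+x. 2 ^ n * (nexp (f x + h x / 2 ^ n) * g x) + nexp (f x) * g x * dquot n (h x) \<partial>\<nu>)"
      by simp
    then show ?thesis
      by (simp add: nn_integral_add nn_integral_cmult a_def b_def)
  qed
  have step: "(\<integral>\<^sup>+w. nexp (\<Sum>k. f (w k)) * (\<Sum>k. g (w k)) * dquot n (\<Sum>k. h (w k)) \<partial>N)
      = ?E * (b n + a n * dquot n (d n))" for n
  proof -
    have sum: "(\<Sum>k. f (w k)) + (\<Sum>k. h (w k)) / 2 ^ n = (\<Sum>k. f (w k) + h (w k) / 2 ^ n)" for w
      by (simp add: divide_ennreal_def suminf_add[OF summableI summableI] flip: ennreal_suminf_multc)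
    have i2: "(\<integral>\<^sup>+w. nexp ((\<Sum>k. f (w k)) + (\<Sum>k. h (w k)) / 2 ^ n) * (\<Sum>k. g (w k)) \<partial>N)
        = ?E * nexp (d n / 2 ^ n) * a n"
    proof -
      have "(\<integral>\<^sup>+w. nexp ((\<Sum>k. f (w k)) + (\<Sum>k. h (w k)) / 2 ^ n) * (\<Sum>k. g (w k)) \<partial>N)
          = nexp (\<integral>\<^sup>+x. 1 - nexp (f x + h x / 2 ^ n) \<partial>\<nu>) * a n"
        unfolding sum a_def by (rule campbell) measurable
      also have "nexp (\<integral>\<^sup>+x. 1 - nexp (f x + h x / 2 ^ n) \<partial>\<nu>) = ?E * nexp (d n / 2 ^ n)"
        using laplace_add[OF assms(1,3), of n] laplace_poissonD(3)[OF lap, of "\<lambda>x. f x + h x / 2 ^ n"]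
        unfolding sum d_def by simp
      finally show ?thesis .
    qed
    have "(\<integral>\<^sup>+w. nexp (\<Sum>k. f (w k)) * (\<Sum>k. g (w k)) * dquot n (\<Sum>k. h (w k)) \<partial>N)
        = (\<integral>\<^sup>+w. 2 ^ n * (nexp (\<Sum>k. f (w k)) * (\<Sum>k. g (w k))
            - nexp ((\<Sum>k. f (w k)) + (\<Sum>k. h (w k)) / 2 ^ n) * (\<Sum>k. g (w k))) \<partial>N)"
      using AE0
    proof (intro nn_integral_cong_AE, eventually_elim)
      case (elim w)
      then show ?case
        using mult_dquot[of "\<Sum>k. g (w k)" "\<Sum>k. f (w k)" n "\<Sum>k. h (w k)"]
        by (auto simp: mult_ac)
    qed
    also have "\<dots> = 2 ^ n * (\<integral>\<^sup>+w. nexp (\<Sum>k. f (w k)) * (\<Sum>k. g (w k))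
            - nexp ((\<Sum>k. f (w k)) + (\<Sum>k. h (w k)) / 2 ^ n) * (\<Sum>k. g (w k)) \<partial>N)"
      by (rule nn_integral_cmult) measurable
    also have "(\<integral>\<^sup>+w. nexp (\<Sum>k. f (w k)) * (\<Sum>k. g (w k))
            - nexp ((\<Sum>k. f (w k)) + (\<Sum>k. h (w k)) / 2 ^ n) * (\<Sum>k. g (w k)) \<partial>N)
        = ?E * ?A - ?E * nexp (d n / 2 ^ n) * a n"
    proof (subst nn_integral_diff)
      show "(\<integral>\<^sup>+w. nexp ((\<Sum>k. f (w k)) + (\<Sum>k. h (w k)) / 2 ^ n) * (\<Sum>k. g (w k)) \<partial>N) \<noteq> \<infinity>"
        unfolding i2 using an[of n] A by (auto simp: ennreal_mult_eq_top_iff top_unique)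
    qed (auto intro!: nexp_antimono mult_right_mono simp: int i2)
    also have "2 ^ n * \<dots> = 2 ^ n * (?E * ?A) - 2 ^ n * (?E * nexp (d n / 2 ^ n) * a n)"
      by (subst ennreal_right_diff_distrib) (use A in \<open>auto simp: ennreal_mult_eq_top_iff pow2_ennreal\<close>)
    also have "2 ^ n * (?E * ?A) = ?E * (2 ^ n * a n + b n)"
      unfolding ab[symmetric] by (simp only: mult_ac)
    also have "\<dots> = ?E * (b n + a n * dquot n (d n)) + 2 ^ n * (?E * nexp (d n / 2 ^ n) * a n)"
    proof -
      have "nexp (d n / 2 ^ n) + (1 - nexp (d n / 2 ^ n)) = 1"
        by (rule add_diff_inverse_ennreal) simp
      then have "2 ^ n * a n = 2 ^ n * a n * (nexp (d n / 2 ^ n) + (1 - nexp (d n / 2 ^ n)))"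
        by (simp only: mult_1_right)
      also have "\<dots> = 2 ^ n * nexp (d n / 2 ^ n) * a n + a n * dquot n (d n)"
        by (simp only: distrib_left dquot_def mult_ac)
      finally have "2 ^ n * a n + b n = (b n + a n * dquot n (d n)) + 2 ^ n * nexp (d n / 2 ^ n) * a n"
        by (simp only: add_ac)
      then show ?thesis by (simp only: distrib_left mult_ac)
    qed
    also have "\<dots> - 2 ^ n * (?E * nexp (d n / 2 ^ n) * a n) = ?E * (b n + a n * dquot n (d n))"
      using an[of n] A by (intro ennreal_add_diff_cancel_right)
        (auto simp: ennreal_mult_eq_top_iff top_unique pow2_ennreal)
    finally show ?thesis .
  qed
  have "(\<lambda>n. ?E * (b n + a n * dquot n (d n))) \<longlonglongrightarrow>
      ?E * ((\<integral>\<^sup>+x. nexp (f x) * g x * h x \<partial>\<nu>) + ?A * (\<integral>\<^sup>+x. nexp (f x) * h x \<partial>\<nu>))"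
  proof (intro ennreal_tendsto_cmult tendsto_add tendsto_mult_ennreal)
    show "b \<longlonglongrightarrow> (\<integral>\<^sup>+x. nexp (f x) * g x * h x \<partial>\<nu>)"
      using LIMSEQ_SUP[OF incseq_mult_dquot[of \<nu> "\<lambda>x. nexp (f x) * g x" h]]
        SUP_mult_dquot[of "\<lambda>x. nexp (f x) * g x" \<nu> h] unfolding b_def[abs_def] by simp
    show "(\<lambda>n. dquot n (d n)) \<longlonglongrightarrow> (\<integral>\<^sup>+x. nexp (f x) * h x \<partial>\<nu>)"
    proof -
      have "incseq d" unfolding d_def[abs_def] by (rule incseq_mult_dquot)
      moreover have "dquot i (d i) \<le> dquot j (d j)" if "i \<le> j" for i j
        using incseqD[OF incseq_dquot that, of "d i"] dquot_mono[OF incseqD[OF \<open>incseq d\<close> that], of j]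
        by (rule order_trans)
      ultimately show ?thesis
        using LIMSEQ_SUP[of "\<lambda>n. dquot n (d n)"] SUP_dquot_diag[of d] SUP_mult_dquot[of "\<lambda>x. nexp (f x)" \<nu> h]
        by (auto simp: incseq_def d_def)
    qed
    define c where "c = enn2real (\<integral>\<^sup>+x. nexp (f x) * g x * h x \<partial>\<nu>)"
    have c: "b n \<le> ennreal c" for n
      using C unfolding b_def c_def by (auto intro!: nn_integral_mono mult_left_mono dquot_le)
    \<comment> \<open>As \<open>b n\<close> is bounded by the finite diagonal term, the perturbation
      changes the integral by at most \<open>c / 2 ^ n\<close>.\<close>
    have "a n = ?A - b n / 2 ^ n" for n
    proof -
      have bt: "b n \<noteq> top" using c[of n] by (auto simp: top_unique)
      have "?A = 2 ^ n * ?A / 2 ^ n"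
        by (simp add: pow2_ennreal mult.commute[of "ennreal _"] ennreal_mult_divide_eq)
      also have "\<dots> = 2 ^ n * a n / 2 ^ n + b n / 2 ^ n"
        unfolding ab by (rule add_divide_distrib_ennreal)
      also have "2 ^ n * a n / 2 ^ n = a n"
        by (simp add: pow2_ennreal mult.commute[of "ennreal _"] ennreal_mult_divide_eq)
      finally show ?thesis
        using bt by (simp add: pow2_ennreal ennreal_divide_eq_top_iff)
    qed
    moreover have "(\<lambda>n. b n / 2 ^ n) \<longlonglongrightarrow> 0"
    proof (rule tendsto_sandwich[of "\<lambda>_. 0"])
      have "(\<lambda>n. ennreal (c / 2 ^ n)) \<longlonglongrightarrow> ennreal 0" by (intro tendsto_ennrealI) real_asymp
      then show "(\<lambda>n. ennreal (c / 2 ^ n)) \<longlonglongrightarrow> 0" by simp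
      have "b n / 2 ^ n \<le> ennreal (c / 2 ^ n)" for n
        using divide_right_mono_ennreal[OF c[of n], of "2 ^ n"]
        by (simp add: pow2_ennreal divide_ennreal c_def)
      then show "\<forall>\<^sub>F n in sequentially. b n / 2 ^ n \<le> ennreal (c / 2 ^ n)" by simp
    qed auto
    then have "(\<lambda>n. ?A - b n / 2 ^ n) \<longlonglongrightarrow> ?A - 0"
      using A by (intro tendsto_diff_ennreal tendsto_const) auto
    ultimately show "a \<longlonglongrightarrow> ?A" by (intro Lim_transform_eventually[of "\<lambda>n. ?A - b n / 2 ^ n" _ _ a]) auto
  qed (use A B in auto)
  moreover have "(\<lambda>n. ?E * (b n + a n * dquot n (d n))) \<longlonglongrightarrow>
      (\<integral>\<^sup>+w. nexp (\<Sum>k. f (w k)) * (\<Sum>k. g (w k)) * (\<Sum>k. h (w k)) \<partial>N)"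
    unfolding step[symmetric]
    using LIMSEQ_SUP[OF incseq_mult_dquot[of N "\<lambda>w. nexp (\<Sum>k. f (w k)) * (\<Sum>k. g (w k))" "\<lambda>w. \<Sum>k. h (w k)"]]
      SUP_mult_dquot[of "\<lambda>w. nexp (\<Sum>k. f (w k)) * (\<Sum>k. g (w k))" N "\<lambda>w. \<Sum>k. h (w k)"] by simp
  ultimately show ?thesis by (rule LIMSEQ_unique[symmetric])
qed

end

text \<open>Mixed moments are obtained from joint Laplace transforms by differentiating once in each
  \<open>t i\<close>. The set of variables already differentiated grows by induction, and finiteness
  of the moment over each subset allows the difference of tilted integrals to be taken.\<close>

lemma prod_laplace_eq:
  fixes X :: "'i \<Rightarrow> 'a \<Rightarrow> ennreal" and Y :: "'i \<Rightarrow> 'b \<Rightarrow> ennreal"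
  assumes I: "finite I"
    and X [measurable]: "\<And>i. i \<in> I \<Longrightarrow> X i \<in> borel_measurable M1"
    and Y [measurable]: "\<And>i. i \<in> I \<Longrightarrow> Y i \<in> borel_measurable M2"
    and eq: "\<And>t. (\<integral>\<^sup>+w. nexp (\<Sum>i\<in>I. t i * X i w) \<partial>M1) = (\<integral>\<^sup>+w. nexp (\<Sum>i\<in>I. t i * Y i w) \<partial>M2)"
    and finX: "\<And>A. A \<subseteq> I \<Longrightarrow> (\<integral>\<^sup>+w. (\<Prod>i\<in>A. X i w) \<partial>M1) < top"
    and finY: "\<And>A. A \<subseteq> I \<Longrightarrow> (\<integral>\<^sup>+w. (\<Prod>i\<in>A. Y i w) \<partial>M2) < top"
  shows "(\<integral>\<^sup>+w. (\<Prod>i\<in>I. X i w) \<partial>M1) = (\<integral>\<^sup>+w. (\<Prod>i\<in>I. Y i w) \<partial>M2)"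
proof -
  have step: "(\<integral>\<^sup>+w. (\<Prod>i\<in>A. Z i w) * nexp (\<Sum>i\<in>I. t i * Z i w) * dquot k (Z a w) \<partial>M)
      = 2 ^ k * ((\<integral>\<^sup>+w. (\<Prod>i\<in>A. Z i w) * nexp (\<Sum>i\<in>I. t i * Z i w) \<partial>M)
          - (\<integral>\<^sup>+w. (\<Prod>i\<in>A. Z i w) * nexp (\<Sum>i\<in>I. (t(a := t a + 1 / 2 ^ k)) i * Z i w) \<partial>M))"
    if a: "a \<in> I" and A: "A \<subseteq> I"
      and Z [measurable]: "\<And>i. i \<in> I \<Longrightarrow> Z i \<in> borel_measurable M"
      and fin: "(\<integral>\<^sup>+w. (\<Prod>i\<in>A. Z i w) \<partial>M) < top"
    for A a t k and Z :: "'i \<Rightarrow> 'c \<Rightarrow> ennreal" and M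
  proof -
    have [measurable]: "(\<lambda>w. \<Prod>i\<in>A. Z i w) \<in> borel_measurable M"
      using A by (intro borel_measurable_prod_ennreal) auto
    have [measurable]: "Z a \<in> borel_measurable M" using a by simp
    have sum: "(\<Sum>i\<in>I. (t(a := t a + 1 / 2 ^ k)) i * Z i w) = (\<Sum>i\<in>I. t i * Z i w) + Z a w / 2 ^ k" for w
    proof -
      have "(\<Sum>i\<in>I. (t(a := t a + 1 / 2 ^ k)) i * Z i w) = (\<Sum>i\<in>I. t i * Z i w + (if i = a then Z a w / 2 ^ k else 0))"
        by (intro sum.cong) (auto simp: distrib_left distrib_right divide_ennreal_def mult.commute)
      then show ?thesis using I a by (simp add: sum.distrib)
    qed
    have "AE w in M. (\<Prod>i\<in>A. Z i w) \<noteq> \<infinity>"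
      by (rule nn_integral_noteq_infinite) (use fin in auto)
    then have "(\<integral>\<^sup>+w. (\<Prod>i\<in>A. Z i w) * nexp (\<Sum>i\<in>I. t i * Z i w) * dquot k (Z a w) \<partial>M)
       = (\<integral>\<^sup>+w. 2 ^ k * ((\<Prod>i\<in>A. Z i w) * nexp (\<Sum>i\<in>I. t i * Z i w)
            - (\<Prod>i\<in>A. Z i w) * nexp (\<Sum>i\<in>I. (t(a := t a + 1 / 2 ^ k)) i * Z i w)) \<partial>M)"
      by (intro nn_integral_cong_AE, eventually_elim) (simp only: sum mult_dquot infinity_ennreal_def not_False_eq_True)
    also have "\<dots> = 2 ^ k * (\<integral>\<^sup>+w. (\<Prod>i\<in>A. Z i w) * nexp (\<Sum>i\<in>I. t i * Z i w)
            - (\<Prod>i\<in>A. Z i w) * nexp (\<Sum>i\<in>I. (t(a := t a + 1 / 2 ^ k)) i * Z i w) \<partial>M)"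
      unfolding sum by (rule nn_integral_cmult) measurable
    also have "(\<integral>\<^sup>+w. (\<Prod>i\<in>A. Z i w) * nexp (\<Sum>i\<in>I. t i * Z i w)
            - (\<Prod>i\<in>A. Z i w) * nexp (\<Sum>i\<in>I. (t(a := t a + 1 / 2 ^ k)) i * Z i w) \<partial>M) =
        (\<integral>\<^sup>+w. (\<Prod>i\<in>A. Z i w) * nexp (\<Sum>i\<in>I. t i * Z i w) \<partial>M)
          - (\<integral>\<^sup>+w. (\<Prod>i\<in>A. Z i w) * nexp (\<Sum>i\<in>I. (t(a := t a + 1 / 2 ^ k)) i * Z i w) \<partial>M)"
      unfolding sum
    proof (rule nn_integral_diff)
      have "(\<integral>\<^sup>+w. (\<Prod>i\<in>A. Z i w) * nexp ((\<Sum>i\<in>I. t i * Z i w) + Z a w / 2 ^ k) \<partial>M)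
          \<le> (\<integral>\<^sup>+w. (\<Prod>i\<in>A. Z i w) * 1 \<partial>M)"
        by (intro nn_integral_mono mult_left_mono) auto
      then show "(\<integral>\<^sup>+w. (\<Prod>i\<in>A. Z i w) * nexp ((\<Sum>i\<in>I. t i * Z i w) + Z a w / 2 ^ k) \<partial>M) \<noteq> \<infinity>"
        using fin by (auto simp: top_unique)
      show "AE w in M. (\<Prod>i\<in>A. Z i w) * nexp ((\<Sum>i\<in>I. t i * Z i w) + Z a w / 2 ^ k)
          \<le> (\<Prod>i\<in>A. Z i w) * nexp (\<Sum>i\<in>I. t i * Z i w)"
        by (intro AE_I2 mult_left_mono nexp_antimono) auto
    qed measurable
    finally show ?thesis .
  qed
  \<comment> \<open>The claim is needed for all tilts at once, since the difference quotient in the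
    variable \<open>a\<close> shifts \<open>t a\<close> by \<open>1 / 2 ^ k\<close>.\<close>
  have "\<forall>t. (\<integral>\<^sup>+w. (\<Prod>i\<in>A. X i w) * nexp (\<Sum>i\<in>I. t i * X i w) \<partial>M1)
      = (\<integral>\<^sup>+w. (\<Prod>i\<in>A. Y i w) * nexp (\<Sum>i\<in>I. t i * Y i w) \<partial>M2)" if "A \<subseteq> I" for A
    using finite_subset[OF that I] that
  proof (induction A rule: finite_induct)
    case empty
    then show ?case using eq by simp
  next
    case (insert a A)
    have [measurable]: "X a \<in> borel_measurable M1" "Y a \<in> borel_measurable M2"
      "(\<lambda>w. \<Prod>i\<in>A. X i w) \<in> borel_measurable M1" "(\<lambda>w. \<Prod>i\<in>A. Y i w) \<in> borel_measurable M2"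
      using insert.prems X Y by (auto intro!: borel_measurable_prod_ennreal)
    show ?case
    proof
      fix t
      have "(\<integral>\<^sup>+w. (\<Prod>i\<in>A. X i w) * nexp (\<Sum>i\<in>I. t i * X i w) * X a w \<partial>M1)
          = (\<integral>\<^sup>+w. (\<Prod>i\<in>A. Y i w) * nexp (\<Sum>i\<in>I. t i * Y i w) * Y a w \<partial>M2)"
      proof (subst (1 2) SUP_mult_dquot[symmetric])
        show "(SUP k. \<integral>\<^sup>+w. (\<Prod>i\<in>A. X i w) * nexp (\<Sum>i\<in>I. t i * X i w) * dquot k (X a w) \<partial>M1)
            = (SUP k. \<integral>\<^sup>+w. (\<Prod>i\<in>A. Y i w) * nexp (\<Sum>i\<in>I. t i * Y i w) * dquot k (Y a w) \<partial>M2)"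
          using insert.prems insert.IH
          by (intro SUP_cong refl, subst (1 2) step) (auto simp: finX finY)
      qed measurable
      then show "(\<integral>\<^sup>+w. (\<Prod>i\<in>insert a A. X i w) * nexp (\<Sum>i\<in>I. t i * X i w) \<partial>M1)
          = (\<integral>\<^sup>+w. (\<Prod>i\<in>insert a A. Y i w) * nexp (\<Sum>i\<in>I. t i * Y i w) \<partial>M2)"
        using insert.hyps by (simp add: mult_ac)
    qed
  qed
  from this[OF order_refl, rule_format, of "\<lambda>_. 0"] show ?thesis by simp
qed

section \<open>Inverse powers of the total mass as mixtures of exponentials\<close>

lemma nn_integral_power_exp:
  assumes t: "0 < t"
  shows "(\<integral>\<^sup>+u. indicator {0..} u * ennreal (u ^ k * exp (- (u * t))) \<partial>lborel) = ennreal (fact k / t ^ Suc k)"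
proof -
  have "ennreal (fact k) = (\<integral>\<^sup>+x. ennreal (x ^ k * exp (- x)) * indicator {0..} x \<partial>lborel)"
    by (simp add: nn_intergal_power_times_exp_Ici)
  also have "\<dots> = ennreal \<bar>t\<bar> * (\<integral>\<^sup>+x. ennreal ((0 + t * x) ^ k * exp (- (0 + t * x))) * indicator {0..} (0 + t * x) \<partial>lborel)"
    using t by (intro nn_integral_real_affine) auto
  also have "\<dots> = ennreal t * (\<integral>\<^sup>+x. ennreal (t ^ k) * (indicator {0..} x * ennreal (x ^ k * exp (- (x * t)))) \<partial>lborel)"
    unfolding abs_of_pos[OF t]
  proof (rule arg_cong2[where f = "(*)", OF refl nn_integral_cong])
    fix x
    have "(t * x) ^ k * exp (- (t * x)) = t ^ k * (x ^ k * exp (- (x * t)))"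
      by (simp add: power_mult_distrib mult_ac)
    then show "ennreal ((0 + t * x) ^ k * exp (- (0 + t * x))) * indicator {0..} (0 + t * x)
        = ennreal (t ^ k) * (indicator {0..} x * ennreal (x ^ k * exp (- (x * t))))"
      using t by (cases "0 \<le> x") (simp_all add: ennreal_mult zero_le_mult_iff)
  qed
  also have "\<dots> = ennreal (t ^ Suc k) * (\<integral>\<^sup>+x. indicator {0..} x * ennreal (x ^ k * exp (- (x * t))) \<partial>lborel)"
    using t by (subst nn_integral_cmult) (auto simp: ennreal_mult mult_ac)
  finally have "ennreal (fact k) / ennreal (t ^ Suc k)
      = ennreal (t ^ Suc k) * (\<integral>\<^sup>+x. indicator {0..} x * ennreal (x ^ k * exp (- (x * t))) \<partial>lborel) / ennreal (t ^ Suc k)"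
    by simp
  also have "\<dots> = (\<integral>\<^sup>+x. indicator {0..} x * ennreal (x ^ k * exp (- (x * t))) \<partial>lborel)"
    using t by (subst mult.commute) (simp add: ennreal_mult_divide_eq)
  finally show ?thesis using t by (simp add: divide_ennreal)
qed

text \<open>Mixing density under which \<open>exp (- u T)\<close> integrates to
  \<open>1 / T ^ (k + 1)\<close>; the index is one less than the power it produces.\<close>

definition gamma_weight :: "nat \<Rightarrow> real \<Rightarrow> ennreal" where
  "gamma_weight k u = indicator {0..} u * ennreal (u ^ k / fact k)"

lemma gamma_weight_measurable [measurable]: "gamma_weight k \<in> borel_measurable borel"
  unfolding gamma_weight_def by measurable

lemma inverse_power_eq_nn_integral:
  assumes "0 < T" "T < top"
  shows "inverse (T ^ Suc k) = (\<integral>\<^sup>+u. gamma_weight k u * nexp (ennreal u * T) \<partial>lborel)"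
proof -
  obtain t where t: "T = ennreal t" "0 < t"
    using assms by (cases T) auto
  have "(\<integral>\<^sup>+u. gamma_weight k u * nexp (ennreal u * T) \<partial>lborel)
      = (\<integral>\<^sup>+u. ennreal (1 / fact k) * (indicator {0..} u * ennreal (u ^ k * exp (- (u * t)))) \<partial>lborel)"
    using t by (intro nn_integral_cong)
      (auto simp: gamma_weight_def indicator_def ennreal_mult'[symmetric] nexp_ennreal ennreal_mult''[symmetric])
  also have "\<dots> = ennreal (1 / fact k) * ennreal (fact k / t ^ Suc k)"
    using t by (subst nn_integral_cmult) (auto simp: nn_integral_power_exp[OF t(2)])
  also have "\<dots> = ennreal (1 / t ^ Suc k)"
    using t by (simp add: ennreal_mult'[symmetric])
  also have "\<dots> = inverse (T ^ Suc k)"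
    using t by (simp add: ennreal_power inverse_ennreal divide_inverse del: power_Suc)
  finally show ?thesis by simp
qed

text \<open>One term of the exponential series is at most the whole. After a tilt by
  \<open>u > 0\<close> all powers of the total mass are bounded, although its own moments may be
  infinite.\<close>

lemma power_mult_nexp_le:
  assumes u: "0 < u"
  shows "T ^ m * nexp (ennreal u * T) \<le> ennreal (fact m / u ^ m)"
proof (cases T)
  case (real t)
  have "(u * t) ^ m /\<^sub>R fact m \<le> exp (u * t)"
    using sum_le_suminf[OF summable_exp_generic, of "{m}" "u * t"] u real by (simp add: exp_def)
  then have "t ^ m * exp (- (u * t)) \<le> fact m / u ^ m"
    using u by (simp add: exp_minus field_simps power_mult_distrib)
  then show ?thesis using real u
    by (simp add: ennreal_mult'[symmetric] nexp_ennreal ennreal_power ennreal_leI)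
next
  case top
  then show ?thesis using u by (simp add: ennreal_mult_top)
qed

lemma AE_nexp_eq_1:
  assumes "prob_space N" and [measurable]: "S \<in> borel_measurable N" and "(\<integral>\<^sup>+w. nexp (S w) \<partial>N) = 1"
  shows "AE w in N. S w = 0"
proof -
  interpret prob_space N by fact
  have "(\<integral>\<^sup>+w. 1 - nexp (S w) \<partial>N) = 0"
    using assms(3) by (subst nn_integral_diff) (auto simp: emeasure_space_1)
  then show ?thesis by (subst (asm) nn_integral_0_iff_AE) auto
qed

lemma levy_weight_mult_nexp:
  assumes "levy_density \<rho>" "0 \<le> \<theta>" "0 \<le> u"
  shows "levy_weight \<theta> \<rho> x * (1 - nexp (ennreal (u * x)))
    = ennreal \<theta> * (ennreal ((1 - exp (- u * x)) * \<rho> x) * indicator {0<..} x)"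
  using assms by (auto simp: levy_weight_def levy_density_def indicator_def nexp_ennreal ennreal_minus
      ennreal_mult'[symmetric] ennreal_mult''[symmetric] mult_ac simp flip: ennreal_1)

lemma laplace_exponent_finite:
  assumes \<rho>: "levy_density \<rho>" and \<theta>: "0 \<le> \<theta>" and u: "0 \<le> u"
  shows "(\<integral>\<^sup>+x. levy_weight \<theta> \<rho> x * (1 - nexp (ennreal (u * x))) \<partial>lborel) < top"
proof (cases "u = 0")
  case False
  have [measurable]: "levy_weight 1 \<rho> \<in> borel_measurable borel"
    using \<rho> by (intro levy_weight_measurable) (simp add: levy_density_def)
  have "(\<integral>\<^sup>+x. levy_weight \<theta> \<rho> x * (1 - nexp (ennreal (u * x))) \<partial>lborel)
     = (\<integral>\<^sup>+x. ennreal \<theta> * (levy_weight 1 \<rho> x * (1 - nexp (ennreal (u * x)))) \<partial>lborel)"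
    using assms by (simp add: levy_weight_mult_nexp)
  also have "\<dots> = ennreal \<theta> * (\<integral>\<^sup>+x. levy_weight 1 \<rho> x * (1 - nexp (ennreal (u * x))) \<partial>lborel)"
    by (rule nn_integral_cmult) measurable
  also have "\<dots> < top"
    using \<rho> u False by (auto simp: levy_weight_mult_nexp levy_density_def ennreal_mult_less_top)
  finally show ?thesis .
qed simp

text \<open>The intensity gives no mass to \<open>x \<le> 0\<close>, so the Laplace functional of
  the indicator of that set is 1. For the total mass \<open>T\<close>,
  \<open>E[exp (- T / 2 ^ n)] = exp (- \<phi> n)\<close> with
  \<open>\<phi> n \<longlonglongrightarrow> 0\<close> by dominated convergence, while the event
  \<open>T = top\<close> contributes 0 to each of these expectations; hence it is null.\<close>

lemma AE_positive_summable:
  assumes \<rho>: "levy_density \<rho>" and \<theta>: "0 < \<theta>" and G: "prob_space G"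
    and N: "laplace_poisson (levy_intensity \<theta> G \<rho>) N"
  shows "AE w in N. (\<forall>k. 0 < fst (w k)) \<and> summable (\<lambda>k. fst (w k))"
proof -
  interpret N: prob_space N by (rule laplace_poissonD[OF N])
  interpret G: prob_space G by fact
  note [measurable_cong] = sets_laplace_levy[OF N]
  have \<rho>m: "set_borel_measurable lborel {0<..} \<rho>" using \<rho> by (simp add: levy_density_def)
  note [measurable] = levy_weight_measurable[OF \<rho>m]
  note m = measurable_cong_sets[OF sets_levy_intensity refl]
  define f :: "real \<times> 'a \<Rightarrow> ennreal" where "f z = indicator {..0} (fst z)" for z
  have [measurable]: "f \<in> borel_measurable (borel \<Otimes>\<^sub>M G)" unfolding f_def by measurable
  have "(\<integral>\<^sup>+w. nexp (\<Sum>k. f (w k)) \<partial>N) = nexp (\<integral>\<^sup>+x. levy_weight \<theta> \<rho> x * (\<integral>\<^sup>+s. 1 - nexp (f (x, s)) \<partial>G) \<partial>lborel)"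
    by (subst laplace_poissonD(3)[OF N]) (simp_all add: m nn_integral_levy_intensity[OF \<rho>m G])
  also have "(\<integral>\<^sup>+x. levy_weight \<theta> \<rho> x * (\<integral>\<^sup>+s. 1 - nexp (f (x, s)) \<partial>G) \<partial>lborel) = (\<integral>\<^sup>+(x::real). 0 \<partial>lborel)"
    by (intro nn_integral_cong) (auto simp: levy_weight_def f_def indicator_def)
  finally have "AE w in N. (\<Sum>k. f (w k)) = 0"
    by (intro AE_nexp_eq_1 N.prob_space_axioms) auto
  then have pos: "AE w in N. \<forall>k. 0 < fst (w k)"
  proof eventually_elim
    case (elim w)
    then have "f (w k) = 0" for k
      using sum_le_suminf[OF summableI, of "{k}" "\<lambda>k. f (w k)"] by simp
    then show ?case by (auto simp: f_def indicator_def not_le split: if_splits)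
  qed
  define T :: "(nat \<Rightarrow> real \<times> 'a) \<Rightarrow> ennreal" where "T w = (\<Sum>k. ennreal (fst (w k)))" for w
  have T [measurable]: "T \<in> borel_measurable N" unfolding T_def by measurable
  define \<phi> where "\<phi> n = (\<integral>\<^sup>+x. levy_weight \<theta> \<rho> x * (1 - nexp (ennreal (1 / 2 ^ n * x))) \<partial>lborel)" for n :: nat
  have lapT: "(\<integral>\<^sup>+w. nexp (T w / 2 ^ n) \<partial>N) = nexp (\<phi> n)" for n
  proof -
    have "T w / 2 ^ n = (\<Sum>k. ennreal (1 / 2 ^ n * fst (w k)))" for w
    proof -
      have "T w / 2 ^ n = (\<Sum>k. ennreal (fst (w k)) / 2 ^ n)"
        by (simp add: T_def divide_ennreal_def flip: ennreal_suminf_multc)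
      also have "\<dots> = (\<Sum>k. ennreal (1 / 2 ^ n * fst (w k)))"
      proof (intro suminf_cong)
        fix k show "ennreal (fst (w k)) / 2 ^ n = ennreal (1 / 2 ^ n * fst (w k))"
          by (cases "0 \<le> fst (w k)") (auto simp: pow2_ennreal divide_ennreal ennreal_neg divide_nonpos_pos)
      qed
      finally show ?thesis .
    qed
    then have "(\<integral>\<^sup>+w. nexp (T w / 2 ^ n) \<partial>N) = (\<integral>\<^sup>+w. nexp (\<Sum>k. ennreal (1 / 2 ^ n * fst (w k))) \<partial>N)"
      by simp
    also have "\<dots> = nexp (\<integral>\<^sup>+z. 1 - nexp (ennreal (1 / 2 ^ n * fst z)) \<partial>levy_intensity \<theta> G \<rho>)"
      by (subst laplace_poissonD(3)[OF N, of "\<lambda>z. ennreal (1 / 2 ^ n * fst z)"]) (simp_all add: m)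
    also have "(\<integral>\<^sup>+z. 1 - nexp (ennreal (1 / 2 ^ n * fst z)) \<partial>levy_intensity \<theta> G \<rho>) = \<phi> n"
      by (subst nn_integral_levy_intensity[OF \<rho>m G]) (simp_all add: \<phi>_def G.emeasure_space_1)
    finally show ?thesis .
  qed
  have "\<phi> \<longlonglongrightarrow> (\<integral>\<^sup>+(x::real). 0 \<partial>lborel)"
    unfolding \<phi>_def[abs_def]
  proof (rule nn_integral_dominated_convergence[where w = "\<lambda>x. levy_weight \<theta> \<rho> x * (1 - nexp (ennreal (1 * x)))"])
    show "(\<integral>\<^sup>+x. levy_weight \<theta> \<rho> x * (1 - nexp (ennreal (1 * x))) \<partial>lborel) < \<infinity>"
      using laplace_exponent_finite[OF \<rho>, of \<theta> 1] \<theta> by simp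
    show "AE x in lborel. levy_weight \<theta> \<rho> x * (1 - nexp (ennreal (1 / 2 ^ n * x)))
        \<le> levy_weight \<theta> \<rho> x * (1 - nexp (ennreal (1 * x)))" for n
    proof (intro AE_I2)
      fix x :: real
      show "levy_weight \<theta> \<rho> x * (1 - nexp (ennreal (1 / 2 ^ n * x))) \<le> levy_weight \<theta> \<rho> x * (1 - nexp (ennreal (1 * x)))"
      proof (cases "0 < x")
        case True
        then have "1 / 2 ^ n * x \<le> 1 * x" by (intro mult_right_mono) auto
        then show ?thesis by (intro mult_left_mono ennreal_minus_mono nexp_antimono ennreal_leI) auto
      qed (simp add: levy_weight_def)
    qed
    show "AE x in lborel. (\<lambda>n. levy_weight \<theta> \<rho> x * (1 - nexp (ennreal (1 / 2 ^ n * x)))) \<longlonglongrightarrow> 0"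
    proof (intro AE_I2)
      fix x :: real
      have "(\<lambda>n. 1 / 2 ^ n * x) \<longlonglongrightarrow> 0" by real_asymp
      then have "(\<lambda>n. 1 - nexp (ennreal (1 / 2 ^ n * x))) \<longlonglongrightarrow> 1 - nexp (ennreal 0)"
        by (intro tendsto_diff_ennreal tendsto_const tendsto_nexp tendsto_ennrealI) auto
      then have "(\<lambda>n. levy_weight \<theta> \<rho> x * (1 - nexp (ennreal (1 / 2 ^ n * x)))) \<longlonglongrightarrow> levy_weight \<theta> \<rho> x * 0"
        by (intro ennreal_tendsto_cmult) (auto simp: levy_weight_def indicator_def)
      then show "(\<lambda>n. levy_weight \<theta> \<rho> x * (1 - nexp (ennreal (1 / 2 ^ n * x)))) \<longlonglongrightarrow> 0" by simp
    qed
  qed measurable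
  then have "(\<lambda>n. 1 - nexp (\<phi> n)) \<longlonglongrightarrow> 1 - nexp 0"
    by (intro tendsto_diff_ennreal tendsto_const tendsto_nexp) auto
  moreover have "emeasure N {w \<in> space N. T w = top} \<le> 1 - nexp (\<phi> n)" for n
  proof -
    have "emeasure N {w \<in> space N. T w = top} = (\<integral>\<^sup>+w. indicator {w \<in> space N. T w = top} w \<partial>N)"
      by (rule nn_integral_indicator[symmetric]) measurable
    also have "\<dots> \<le> (\<integral>\<^sup>+w. 1 - nexp (T w / 2 ^ n) \<partial>N)"
      by (intro nn_integral_mono) (auto simp: indicator_def pow2_ennreal ennreal_top_divide)
    also have "\<dots> = 1 - nexp (\<phi> n)"
      by (subst nn_integral_diff) (auto simp: lapT N.emeasure_space_1)
    finally show ?thesis .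
  qed
  ultimately have "emeasure N {w \<in> space N. T w = top} \<le> 1 - nexp 0"
    by (intro LIMSEQ_le_const) auto
  then have "AE w in N. T w \<noteq> top"
    by (intro AE_I'[of "{w \<in> space N. T w = top}"]) (auto simp: null_sets_def)
  with pos show ?thesis
  proof eventually_elim
    case (elim w)
    then show ?case
      using summable_suminf_not_top[of "\<lambda>k. fst (w k)"] by (auto simp: T_def less_imp_le)
  qed
qed

lemma suminf_ennreal_bounds:
  assumes "\<forall>k. 0 < fst (w k)" "summable (\<lambda>k. fst (w k))"
  shows "(\<Sum>k. ennreal (fst (w k))) = ennreal (\<Sum>k. fst (w k))" "0 < (\<Sum>k. fst (w k))"
  using assms by (auto intro!: suminf_ennreal2 suminf_pos simp: less_imp_le)

lemma prod_mono_ennreal: "(\<And>i. i \<in> A \<Longrightarrow> f i \<le> g i) \<Longrightarrow> (\<Prod>i\<in>A. f i) \<le> (\<Prod>i\<in>A. g i :: ennreal)"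
  by (induction A rule: infinite_finite_induct) (auto intro!: mult_mono)

text \<open>Tonelli. An integral with an inverse power of \<open>T\<close> becomes a mixture over
  \<open>u\<close> of integrals tilted by \<open>exp (- u T)\<close>, which Laplace functionals can
  evaluate.\<close>

lemma nn_integral_gamma_mixture:
  assumes M: "sigma_finite_measure M" and F [measurable]: "F \<in> borel_measurable M" and T [measurable]: "T \<in> borel_measurable M"
    and pos: "AE z in M. 0 < T z \<and> T z < top"
  shows "(\<integral>\<^sup>+z. F z * inverse (T z ^ Suc k) \<partial>M)
    = (\<integral>\<^sup>+u. gamma_weight k u * (\<integral>\<^sup>+z. nexp (ennreal u * T z) * F z \<partial>M) \<partial>lborel)"
proof -
  interpret sigma_finite_measure M by fact
  interpret lN: pair_sigma_finite lborel M by standard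
  have "(\<integral>\<^sup>+z. F z * inverse (T z ^ Suc k) \<partial>M)
      = (\<integral>\<^sup>+z. \<integral>\<^sup>+u. gamma_weight k u * (nexp (ennreal u * T z) * F z) \<partial>lborel \<partial>M)"
    using pos
  proof (intro nn_integral_cong_AE, eventually_elim)
    case (elim z)
    have "F z * inverse (T z ^ Suc k) = (\<integral>\<^sup>+u. F z * (gamma_weight k u * nexp (ennreal u * T z)) \<partial>lborel)"
      unfolding inverse_power_eq_nn_integral[OF conjunct1[OF elim(2)] conjunct2[OF elim(2)]]
      by (rule nn_integral_cmult[symmetric]) measurable
    then show ?case by (simp add: mult_ac del: power_Suc)
  qed
  also have "\<dots> = (\<integral>\<^sup>+u. \<integral>\<^sup>+z. gamma_weight k u * (nexp (ennreal u * T z) * F z) \<partial>M \<partial>lborel)"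
  proof (rule lN.Fubini')
    have "(\<lambda>(u, z). gamma_weight k u * (nexp (ennreal u * T z) * F z)) \<in> borel_measurable (borel \<Otimes>\<^sub>M M)"
      by measurable
    then show "(\<lambda>(u, z). gamma_weight k u * (nexp (ennreal u * T z) * F z)) \<in> borel_measurable (lborel \<Otimes>\<^sub>M M)"
      by (simp cong: measurable_cong_sets sets_pair_measure_cong)
  qed
  also have "\<dots> = (\<integral>\<^sup>+u. gamma_weight k u * (\<integral>\<^sup>+z. nexp (ennreal u * T z) * F z \<partial>M) \<partial>lborel)"
    by (intro nn_integral_cong nn_integral_cmult) measurable
  finally show ?thesis .
qed

text \<open>The point \<open>u = 0\<close>, where the tilt does nothing and moments may be infinite,
  is a null set.\<close>

lemma gamma_weight_cong_AE:
  assumes "\<And>u. 0 < u \<Longrightarrow> F u = F' u"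
  shows "(\<integral>\<^sup>+u. gamma_weight k u * F u \<partial>lborel) = (\<integral>\<^sup>+u. gamma_weight k u * F' u \<partial>lborel)"
proof (rule nn_integral_cong_AE)
  have "AE u in lborel. u \<noteq> (0::real)" by (rule AE_lborel_singleton)
  then show "AE u in lborel. gamma_weight k u * F u = gamma_weight k u * F' u"
    by eventually_elim (use assms in \<open>auto simp: gamma_weight_def indicator_def\<close>)
qed

text \<open>A product of \<open>n + 1\<close> ratios carries the factor
  \<open>T ^ - (n + 1)\<close>, a mixture of the tilts \<open>exp (- u T)\<close>. For each
  \<open>u > 0\<close> the tilted sums have finite mixed moments and a joint Laplace transform given
  by the intensity alone. The way in which a sequence enumerates the points therefore has no
  influence.\<close>

lemma nn_integral_prod_ratio_eq:
  assumes \<rho>: "levy_density \<rho>" and \<theta>: "0 < \<theta>" and G: "prob_space G"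
    and N1: "laplace_poisson (levy_intensity \<theta> G \<rho>) N1" and N2: "laplace_poisson (levy_intensity \<theta> G \<rho>) N2"
    and I: "finite I"
    and g: "\<And>i. i \<in> I \<Longrightarrow> g i \<in> borel_measurable (borel \<Otimes>\<^sub>M G)" "\<And>i z. i \<in> I \<Longrightarrow> g i z \<le> ennreal (fst z)"
  shows "(\<integral>\<^sup>+w. (\<Prod>i\<in>I. (\<Sum>k. g i (w k)) / (\<Sum>k. ennreal (fst (w k)))) \<partial>N1)
      = (\<integral>\<^sup>+w. (\<Prod>i\<in>I. (\<Sum>k. g i (w k)) / (\<Sum>k. ennreal (fst (w k)))) \<partial>N2)"
\<comment> \<open>The empty product carries the power 0 of the total mass, which the gamma mixture
  does not reach.\<close>
proof (cases "I = {}")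
  case True
  then show ?thesis
    using prob_space.emeasure_space_1[OF laplace_poissonD(1)[OF N1]]
      prob_space.emeasure_space_1[OF laplace_poissonD(1)[OF N2]] by simp
next
  case False
  then obtain n where n: "card I = Suc n" using I by (metis card_0_eq not0_implies_Suc)
  define T :: "(nat \<Rightarrow> real \<times> 'a) \<Rightarrow> ennreal" where "T w = (\<Sum>k. ennreal (fst (w k)))" for w
  define X where "X i w = (\<Sum>k. g i (w k))" for i and w :: "nat \<Rightarrow> real \<times> 'a"
  have XT: "X i w \<le> T w" if "i \<in> I" for i w
    using g(2)[OF that] unfolding X_def T_def by (intro suminf_le) auto
  have meas: "X i \<in> borel_measurable N" "T \<in> borel_measurable N"
    if N: "laplace_poisson (levy_intensity \<theta> G \<rho>) N" and i: "i \<in> I" for i N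
  proof -
    note [measurable_cong] = sets_laplace_levy[OF N]
    note [measurable] = g(1)[OF i]
    show "X i \<in> borel_measurable N" "T \<in> borel_measurable N"
      unfolding X_def[abs_def] T_def[abs_def] by measurable
  qed
  have bound: "(\<integral>\<^sup>+w. nexp (ennreal u * T w) * (\<Prod>i\<in>A. X i w) \<partial>N) < top"
    if "A \<subseteq> I" and N: "laplace_poisson (levy_intensity \<theta> G \<rho>) N" and u: "0 < u" for A N u
  proof -
    interpret prob_space N by (rule laplace_poissonD[OF N])
    have "nexp (ennreal u * T w) * (\<Prod>i\<in>A. X i w) \<le> ennreal (fact (card A) / u ^ card A)" for w
    proof -
      have "(\<Prod>i\<in>A. X i w) \<le> (\<Prod>i\<in>A. T w)"
        using \<open>A \<subseteq> I\<close> XT by (intro prod_mono_ennreal) auto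
      then have "nexp (ennreal u * T w) * (\<Prod>i\<in>A. X i w) \<le> nexp (ennreal u * T w) * T w ^ card A"
        by (intro mult_left_mono) auto
      also have "\<dots> \<le> ennreal (fact (card A) / u ^ card A)"
        using power_mult_nexp_le[OF u] by (subst mult.commute)
      finally show ?thesis .
    qed
    then have "(\<integral>\<^sup>+w. nexp (ennreal u * T w) * (\<Prod>i\<in>A. X i w) \<partial>N) \<le> (\<integral>\<^sup>+w. ennreal (fact (card A) / u ^ card A) \<partial>N)"
      by (intro nn_integral_mono)
    then show ?thesis by (simp add: emeasure_space_1 le_less_trans[OF _ ennreal_less_top])
  qed
  have eq: "(\<integral>\<^sup>+w. nexp (ennreal u * T w) * (\<Prod>i\<in>I. X i w) \<partial>N1)
      = (\<integral>\<^sup>+w. nexp (ennreal u * T w) * (\<Prod>i\<in>I. X i w) \<partial>N2)" if u: "0 < u" for u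
  proof -
    obtain i0 where i0: "i0 \<in> I" using False by auto
    note [measurable] = meas(1)[OF N1] meas(1)[OF N2] meas(2)[OF N1 i0] meas(2)[OF N2 i0] g(1)
    have prod_meas: "(\<lambda>w. \<Prod>i\<in>A. X i w) \<in> borel_measurable N1" "(\<lambda>w. \<Prod>i\<in>A. X i w) \<in> borel_measurable N2"
      if "A \<subseteq> I" for A using that by (auto intro!: borel_measurable_prod_ennreal meas[OF N1] meas[OF N2])
    have lap: "(\<integral>\<^sup>+w. nexp (ennreal u * T w) * nexp (\<Sum>i\<in>I. t i * X i w) \<partial>N)
        = nexp (\<integral>\<^sup>+z. 1 - nexp (ennreal u * ennreal (fst z) + (\<Sum>i\<in>I. t i * g i z)) \<partial>levy_intensity \<theta> G \<rho>)"
      if N: "laplace_poisson (levy_intensity \<theta> G \<rho>) N" for N and t :: "'b \<Rightarrow> ennreal"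
    proof -
      have "ennreal u * T w + (\<Sum>i\<in>I. t i * X i w)
          = (\<Sum>k. ennreal u * ennreal (fst (w k)) + (\<Sum>i\<in>I. t i * g i (w k)))" for w
      proof -
        have "(\<Sum>i\<in>I. t i * X i w) = (\<Sum>k. \<Sum>i\<in>I. t i * g i (w k))"
          by (subst suminf_sum) (auto simp: X_def)
        then show ?thesis
          by (simp add: T_def suminf_add[OF summableI summableI] flip: ennreal_suminf_cmult)
      qed
      then have "(\<integral>\<^sup>+w. nexp (ennreal u * T w) * nexp (\<Sum>i\<in>I. t i * X i w) \<partial>N)
          = (\<integral>\<^sup>+w. nexp (\<Sum>k. ennreal u * ennreal (fst (w k)) + (\<Sum>i\<in>I. t i * g i (w k))) \<partial>N)"
        by (simp add: nexp_add[symmetric])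
      also have "\<dots> = nexp (\<integral>\<^sup>+z. 1 - nexp (ennreal u * ennreal (fst z) + (\<Sum>i\<in>I. t i * g i z)) \<partial>levy_intensity \<theta> G \<rho>)"
      proof (rule laplace_poissonD(3)[OF N, of "\<lambda>z. ennreal u * ennreal (fst z) + (\<Sum>i\<in>I. t i * g i z)"])
        show "(\<lambda>z. ennreal u * ennreal (fst z) + (\<Sum>i\<in>I. t i * g i z)) \<in> borel_measurable (levy_intensity \<theta> G \<rho>)"
          unfolding measurable_cong_sets[OF sets_levy_intensity refl] by measurable
      qed
      finally show ?thesis .
    qed
    have dens: "(\<integral>\<^sup>+w. F w \<partial>density N (\<lambda>w. nexp (ennreal u * T w))) = (\<integral>\<^sup>+w. nexp (ennreal u * T w) * F w \<partial>N)"
      if "F \<in> borel_measurable N" "laplace_poisson (levy_intensity \<theta> G \<rho>) N" for N F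
      using that meas(2)[OF that(2) i0] by (intro nn_integral_density) auto
    have "(\<integral>\<^sup>+w. (\<Prod>i\<in>I. X i w) \<partial>density N1 (\<lambda>w. nexp (ennreal u * T w)))
        = (\<integral>\<^sup>+w. (\<Prod>i\<in>I. X i w) \<partial>density N2 (\<lambda>w. nexp (ennreal u * T w)))"
    proof (rule prod_laplace_eq[OF I])
      show "(\<integral>\<^sup>+w. nexp (\<Sum>i\<in>I. t i * X i w) \<partial>density N1 (\<lambda>w. nexp (ennreal u * T w)))
          = (\<integral>\<^sup>+w. nexp (\<Sum>i\<in>I. t i * X i w) \<partial>density N2 (\<lambda>w. nexp (ennreal u * T w)))" for t
        by (subst (1 2) dens) (auto simp: lap N1 N2)
    qed (auto simp: dens N1 N2 prod_meas bound u meas)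
    then show ?thesis by (simp add: dens N1 N2 prod_meas)
  qed
  have main: "(\<integral>\<^sup>+w. (\<Prod>i\<in>I. X i w / T w) \<partial>N)
      = (\<integral>\<^sup>+u. gamma_weight n u * (\<integral>\<^sup>+w. nexp (ennreal u * T w) * (\<Prod>i\<in>I. X i w) \<partial>N) \<partial>lborel)"
    if N: "laplace_poisson (levy_intensity \<theta> G \<rho>) N" for N
  proof -
    interpret prob_space N by (rule laplace_poissonD[OF N])
    obtain i0 where i0: "i0 \<in> I" using False by auto
    note [measurable] = meas(1)[OF N] meas(2)[OF N i0]
    define R where "R w = (\<Prod>i\<in>I. X i w)" for w
    have [measurable]: "R \<in> borel_measurable N"
      unfolding R_def[abs_def] by (auto intro!: borel_measurable_prod_ennreal)
    have AE_T: "AE w in N. 0 < T w \<and> T w < top"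
      using AE_positive_summable[OF \<rho> \<theta> G N]
    proof eventually_elim
      case (elim w)
      then show ?case using suminf_ennreal_bounds[of w] by (auto simp: T_def)
    qed
    then have "(\<integral>\<^sup>+w. (\<Prod>i\<in>I. X i w / T w) \<partial>N) = (\<integral>\<^sup>+w. R w * inverse (T w ^ Suc n) \<partial>N)"
    proof (intro nn_integral_cong_AE, eventually_elim)
      case (elim w)
      then show ?case
        by (simp add: divide_ennreal_def prod.distrib n R_def ennreal_inverse_power del: power_Suc)
    qed
    also have "\<dots> = (\<integral>\<^sup>+u. gamma_weight n u * (\<integral>\<^sup>+w. nexp (ennreal u * T w) * R w \<partial>N) \<partial>lborel)"
      using AE_T by (intro nn_integral_gamma_mixture sigma_finite_measure_axioms) measurable
    finally show ?thesis unfolding R_def .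
  qed
  have "(\<integral>\<^sup>+w. (\<Prod>i\<in>I. X i w / T w) \<partial>N1) = (\<integral>\<^sup>+w. (\<Prod>i\<in>I. X i w / T w) \<partial>N2)"
    unfolding main[OF N1] main[OF N2] by (intro gamma_weight_cong_AE eq)
  then show ?thesis by (simp add: X_def T_def)
qed

section \<open>Normalized measures and samples\<close>

lemma divide_self_le_1: "x / x \<le> (1 :: ennreal)"
  by (cases "x = 0 \<or> x = top") (auto simp: ennreal_top_divide ennreal_divide_self less_top)

definition good_points :: "(nat \<Rightarrow> real \<times> 'a) \<Rightarrow> bool" where
  "good_points w \<longleftrightarrow> (\<forall>k. 0 < fst (w k)) \<and> summable (\<lambda>k. fst (w k))"

text \<open>The law of the index of a sampled atom. Separating indices from positions allows the
  same weights to be combined with other positions or with labels.\<close>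

definition weight_pmf :: "(nat \<Rightarrow> real \<times> 'a) \<Rightarrow> nat pmf" where
  "weight_pmf w = (if good_points w then embed_pmf (\<lambda>k. fst (w k) / (\<Sum>i. fst (w i))) else return_pmf 0)"

lemma pmf_weight:
  assumes "good_points w"
  shows "pmf (weight_pmf w) k = fst (w k) / (\<Sum>i. fst (w i))"
proof -
  have w: "\<And>k. 0 < fst (w k)" "summable (\<lambda>k. fst (w k))" using assms by (auto simp: good_points_def)
  have pos: "0 < (\<Sum>i. fst (w i))" using w by (intro suminf_pos)
  have "(\<integral>\<^sup>+k. ennreal (fst (w k) / (\<Sum>i. fst (w i))) \<partial>count_space UNIV) = (\<Sum>k. ennreal (fst (w k) / (\<Sum>i. fst (w i))))"
    by (rule nn_integral_count_space_nat)
  also have "\<dots> = ennreal (\<Sum>k. fst (w k) / (\<Sum>i. fst (w i)))"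
    using w pos by (intro suminf_ennreal2 summable_divide) (auto intro: less_imp_le)
  also have "(\<Sum>k. fst (w k) / (\<Sum>i. fst (w i))) = 1"
    using w pos by (subst suminf_divide) auto
  finally show ?thesis
    using assms w pos by (simp add: weight_pmf_def pmf_embed_pmf less_imp_le)
qed

lemma nn_integral_weight_pmf:
  assumes "good_points w"
  shows "(\<integral>\<^sup>+k. F k \<partial>measure_pmf (weight_pmf w))
    = (\<Sum>k. ennreal (fst (w k)) * F k) / (\<Sum>k. ennreal (fst (w k)))"
proof -
  have T: "(\<Sum>k. ennreal (fst (w k))) = ennreal (\<Sum>k. fst (w k))" "0 < (\<Sum>k. fst (w k))"
    using assms by (auto intro!: suminf_ennreal_bounds simp: good_points_def)
  have "(\<integral>\<^sup>+k. F k \<partial>measure_pmf (weight_pmf w)) = (\<Sum>k. ennreal (fst (w k) / (\<Sum>i. fst (w i))) * F k)"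
    by (simp add: nn_integral_measure_pmf nn_integral_count_space_nat pmf_weight[OF assms])
  also have "\<dots> = (\<Sum>k. ennreal (fst (w k)) * F k / ennreal (\<Sum>i. fst (w i)))"
  proof (intro suminf_cong)
    fix k
    have "ennreal (fst (w k) / (\<Sum>i. fst (w i))) = ennreal (fst (w k)) / ennreal (\<Sum>i. fst (w i))"
      using T assms by (intro divide_ennreal[symmetric]) (auto simp: good_points_def less_imp_le)
    then show "ennreal (fst (w k) / (\<Sum>i. fst (w i))) * F k = ennreal (fst (w k)) * F k / ennreal (\<Sum>i. fst (w i))"
      by (simp add: divide_ennreal_def mult_ac)
  qed
  finally show ?thesis by (simp add: divide_ennreal_def T)
qed

lemma emeasure_weight_pmf:
  assumes "good_points w"
  shows "emeasure (measure_pmf (weight_pmf w)) A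
    = (\<Sum>k. ennreal (fst (w k)) * indicator A k) / (\<Sum>k. ennreal (fst (w k)))"
  using nn_integral_weight_pmf[OF assms, of "indicator A"] by simp

lemma normalized_measure_eq:
  "good_points w \<Longrightarrow> normalized_measure w = map_pmf (\<lambda>k. snd (w k)) (weight_pmf w)"
  by (simp add: normalized_measure_def weight_pmf_def good_points_def)

lemma emeasure_normalized_measure:
  assumes "good_points w"
  shows "emeasure (measure_pmf (normalized_measure w)) A
    = (\<Sum>k. ennreal (fst (w k)) * indicator A (snd (w k))) / (\<Sum>k. ennreal (fst (w k)))"
  using emeasure_weight_pmf[OF assms, of "(\<lambda>k. snd (w k)) -` A"]
  by (simp add: normalized_measure_eq[OF assms] indicator_def)

lemma good_points_measurable [measurable]:
  fixes G :: "'a measure"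
  assumes "sets N = sets (PiM UNIV (\<lambda>_. borel \<Otimes>\<^sub>M G))"
  shows "Measurable.pred N good_points"
proof -
  note [measurable_cong] = assms
  have "good_points w \<longleftrightarrow> (\<forall>k. 0 < fst (w k)) \<and> (\<Sum>k. ennreal (fst (w k))) \<noteq> top" for w :: "nat \<Rightarrow> real \<times> 'a"
  proof
    assume "good_points w"
    then show "(\<forall>k. 0 < fst (w k)) \<and> (\<Sum>k. ennreal (fst (w k))) \<noteq> top"
      using suminf_ennreal_bounds(1)[of w] by (simp add: good_points_def)
  next
    assume "(\<forall>k. 0 < fst (w k)) \<and> (\<Sum>k. ennreal (fst (w k))) \<noteq> top"
    then show "good_points w"
      using summable_suminf_not_top[of "\<lambda>k. fst (w k)"] by (simp add: good_points_def less_imp_le)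
  qed
  then have "Measurable.pred N good_points
      \<longleftrightarrow> Measurable.pred N (\<lambda>w. (\<forall>k. 0 < fst (w k)) \<and> (\<Sum>k. ennreal (fst (w k))) \<noteq> top)"
    by (intro measurable_cong) blast
  also have "\<dots>" by measurable
  finally show ?thesis .
qed

definition distr_borel :: "'s::topological_space pmf \<Rightarrow> 's measure" where
  "distr_borel P = distr (measure_pmf P) borel (\<lambda>s. s)"

lemma emeasure_distr_borel: "A \<in> sets borel \<Longrightarrow> emeasure (distr_borel P) A = emeasure (measure_pmf P) A"
  unfolding distr_borel_def by (subst emeasure_distr) auto

lemma distr_borel_in_space: "distr_borel P \<in> space (prob_algebra borel)"
  unfolding distr_borel_def by (auto simp: space_prob_algebra intro!: measure_pmf.prob_space_distr)

lemma discrete_distr_space_alt: "discrete_distr_space = vimage_algebra UNIV distr_borel (prob_algebra borel)"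
  by (simp add: discrete_distr_space_def distr_borel_def[abs_def])

lemma emeasure_pmf_measurable:
  assumes "A \<in> sets borel"
  shows "(\<lambda>P. emeasure (measure_pmf P) A) \<in> borel_measurable discrete_distr_space"
proof -
  have "distr_borel \<in> discrete_distr_space \<rightarrow>\<^sub>M prob_algebra borel"
    unfolding discrete_distr_space_alt by (rule measurable_vimage_algebra1) (simp add: distr_borel_in_space)
  then have "(\<lambda>P. emeasure (distr_borel P) A) \<in> borel_measurable discrete_distr_space"
    by (rule measurable_compose[OF measurable_prob_algebraD measurable_emeasure_subprob_algebra[OF assms]])
  then show ?thesis by (simp add: emeasure_distr_borel[OF assms])
qed

lemma normalized_measure_measurable:
  fixes G :: "'s::topological_space measure"
  assumes N: "sets N = sets (PiM UNIV (\<lambda>_. borel \<Otimes>\<^sub>M G))" and G: "sets G = sets borel"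
  shows "normalized_measure \<in> N \<rightarrow>\<^sub>M discrete_distr_space"
  unfolding discrete_distr_space_alt
proof (rule measurable_vimage_algebra2)
  note [measurable_cong] = N
  note [measurable] = good_points_measurable[OF N]
  show "(\<lambda>w. distr_borel (normalized_measure w)) \<in> N \<rightarrow>\<^sub>M prob_algebra borel"
  proof (rule measurable_prob_algebraI[OF _ measurable_subprob_algebra])
    show "prob_space (distr_borel (normalized_measure w))" for w :: "nat \<Rightarrow> real \<times> 's"
      using distr_borel_in_space[of "normalized_measure w"] by (simp add: space_prob_algebra)
    then show "subprob_space (distr_borel (normalized_measure w))" for w :: "nat \<Rightarrow> real \<times> 's"
      by (rule prob_space_imp_subprob_space)
    show "sets (distr_borel (normalized_measure w)) = sets borel" for w :: "nat \<Rightarrow> real \<times> 's"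
      by (simp add: distr_borel_def)
    fix A :: "'s set" assume A: "A \<in> sets borel"
    then have [measurable]: "A \<in> sets G" using G by simp
    have "(\<lambda>w. emeasure (distr_borel (normalized_measure w)) A)
        = (\<lambda>w. if good_points w then (\<Sum>k. ennreal (fst (w k)) * indicator A (snd (w k))) / (\<Sum>k. ennreal (fst (w k)))
             else indicator A undefined)"
    proof
      fix w :: "nat \<Rightarrow> real \<times> 's"
      show "emeasure (distr_borel (normalized_measure w)) A
         = (if good_points w then (\<Sum>k. ennreal (fst (w k)) * indicator A (snd (w k))) / (\<Sum>k. ennreal (fst (w k)))
             else indicator A undefined)"
      proof (cases "good_points w")
        case False
        then have "normalized_measure w = return_pmf undefined"
          unfolding normalized_measure_def good_points_def by (rule if_not_P)
        then show ?thesis using False by (simp add: emeasure_distr_borel[OF A])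
      qed (simp add: emeasure_distr_borel[OF A] emeasure_normalized_measure)
    qed
    also have "\<dots> \<in> borel_measurable N" by measurable
    finally show "(\<lambda>w. emeasure (distr_borel (normalized_measure w)) A) \<in> borel_measurable N" .
  qed
qed auto

section \<open>Sampling as a probability kernel\<close>

definition sample_kernel :: "nat set \<Rightarrow> 's::topological_space pmf \<Rightarrow> (nat \<Rightarrow> 's) measure" where
  "sample_kernel I P = distr (measure_pmf (Pi_pmf I undefined (\<lambda>_. P))) (PiM I (\<lambda>_. borel)) (\<lambda>x. restrict x I)"

lemma nn_integral_sample_kernel:
  assumes "g \<in> borel_measurable (PiM I (\<lambda>_. borel))"
  shows "(\<integral>\<^sup>+x. g x \<partial>sample_kernel I P) = (\<integral>\<^sup>+x. g (restrict x I) \<partial>measure_pmf (Pi_pmf I undefined (\<lambda>_. P)))"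
  unfolding sample_kernel_def
  by (rule nn_integral_distr) (use assms in \<open>auto simp: space_PiM\<close>)

lemma emeasure_sample_kernel:
  assumes I: "finite I" and X: "\<And>i. i \<in> I \<Longrightarrow> X i \<in> sets borel"
  shows "emeasure (sample_kernel I P) (Pi\<^sub>E I X) = (\<Prod>i\<in>I. emeasure (measure_pmf P) (X i))"
proof -
  have "emeasure (sample_kernel I P) (Pi\<^sub>E I X)
      = emeasure (measure_pmf (Pi_pmf I undefined (\<lambda>_. P))) ((\<lambda>x. restrict x I) -` Pi\<^sub>E I X \<inter> UNIV)"
    unfolding sample_kernel_def using I X
    by (subst emeasure_distr) (auto simp: space_PiM intro!: sets_PiM_I_finite)
  also have "(\<lambda>x. restrict x I) -` Pi\<^sub>E I X \<inter> UNIV = Pi I X"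
    by (auto simp: restrict_PiE_iff)
  also have "emeasure (measure_pmf (Pi_pmf I undefined (\<lambda>_. P))) (Pi I X) = (\<Prod>i\<in>I. emeasure (measure_pmf P) (X i))"
    using I by (simp add: measure_pmf.emeasure_eq_measure measure_Pi_pmf_Pi prod_ennreal)
  finally show ?thesis .
qed

lemma prob_space_sample_kernel: "prob_space (sample_kernel I P)"
  unfolding sample_kernel_def by (rule measure_pmf.prob_space_distr) (auto simp: space_PiM)

text \<open>On a box the probability is a product of evaluations \<open>P(X i)\<close>, which are
  measurable by the choice of \<open>discrete_distr_space\<close>, and boxes generate the product
  sigma-algebra.\<close>

lemma sample_kernel_measurable:
  fixes I :: "nat set"
  assumes I: "finite I"
  shows "sample_kernel I \<in> (discrete_distr_space :: 's::topological_space pmf measure) \<rightarrow>\<^sub>M prob_algebra (PiM I (\<lambda>_. borel))"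
proof (rule measurable_prob_algebra_generated[OF sets_PiM Int_stable_prod_algebra prod_algebra_sets_into_space])
  fix A :: "(nat \<Rightarrow> 's) set" assume "A \<in> prod_algebra I (\<lambda>_. borel)"
  then obtain X where A: "A = Pi\<^sub>E I X" and X: "\<And>i. i \<in> I \<Longrightarrow> X i \<in> sets borel"
    by (auto simp: prod_algebra_eq_finite[OF I])
  show "(\<lambda>P. emeasure (sample_kernel I P) A) \<in> borel_measurable discrete_distr_space"
    using X by (simp add: A emeasure_sample_kernel[OF I] borel_measurable_prod_ennreal emeasure_pmf_measurable)
next
  show "prob_space (sample_kernel I P)" for P :: "'s pmf" by (rule prob_space_sample_kernel)
  show "sets (sample_kernel I P) = sets (PiM I (\<lambda>_. borel))" for P :: "'s pmf" by (simp add: sample_kernel_def)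
qed

lemma nn_integral_Pi_pmf_measurable:
  fixes I :: "nat set"
  assumes I: "finite I" and g: "g \<in> borel_measurable (PiM I (\<lambda>_. borel))"
  shows "(\<lambda>P. \<integral>\<^sup>+x. g (restrict x I) \<partial>measure_pmf (Pi_pmf I undefined (\<lambda>_. P)))
    \<in> borel_measurable (discrete_distr_space :: 's::topological_space pmf measure)"
  unfolding nn_integral_sample_kernel[OF g, symmetric]
  by (rule measurable_compose[OF measurable_prob_algebraD[OF sample_kernel_measurable[OF I]]
        nn_integral_measurable_subprob_algebra[OF g]])

lemma AE_good_points:
  assumes "levy_density \<rho>" "0 < \<theta>" "prob_space G" "laplace_poisson (levy_intensity \<theta> G \<rho>) N"
  shows "AE w in N. good_points w"
  using AE_positive_summable[OF assms] by (simp add: good_points_def)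

text \<open>On boxes the law of a sample is a mean of products of ratios of sums over the points,
  hence the same for any two sequences with the same Laplace functional. Boxes form a generating
  intersection-stable family, so the laws of the samples agree.\<close>

lemma nn_integral_normalized_measure_eq:
  fixes G :: "'s::topological_space measure" and I :: "nat set"
  assumes \<rho>: "levy_density \<rho>" and \<theta>: "0 < \<theta>" and G: "prob_space G" and GB: "sets G = sets borel"
    and N1: "laplace_poisson (levy_intensity \<theta> G \<rho>) N1" and N2: "laplace_poisson (levy_intensity \<theta> G \<rho>) N2"
    and I: "finite I" and g: "g \<in> borel_measurable (PiM I (\<lambda>_. borel))"
  shows "(\<integral>\<^sup>+w. \<integral>\<^sup>+x. g (restrict x I) \<partial>measure_pmf (Pi_pmf I undefined (\<lambda>_. normalized_measure w)) \<partial>N1)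
      = (\<integral>\<^sup>+w. \<integral>\<^sup>+x. g (restrict x I) \<partial>measure_pmf (Pi_pmf I undefined (\<lambda>_. normalized_measure w)) \<partial>N2)"
proof -
  define M where "M N = N \<bind> (\<lambda>w. sample_kernel I (normalized_measure w))" for N :: "(nat \<Rightarrow> real \<times> 's) measure"
  have K: "(\<lambda>w. sample_kernel I (normalized_measure w)) \<in> N \<rightarrow>\<^sub>M prob_algebra (PiM I (\<lambda>_. borel))"
    if "laplace_poisson (levy_intensity \<theta> G \<rho>) N" for N
    by (rule measurable_compose[OF normalized_measure_measurable[OF sets_laplace_levy[OF that] GB]
          sample_kernel_measurable[OF I]])
  have ne: "space N \<noteq> {}" if "laplace_poisson (levy_intensity \<theta> G \<rho>) N" for N
    using laplace_poissonD(1)[OF that] prob_space.not_empty by blast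
  have sets: "sets (M N) = sets (PiM I (\<lambda>_. borel))" if "laplace_poisson (levy_intensity \<theta> G \<rho>) N" for N
    unfolding M_def by (rule sets_bind) (auto simp: sample_kernel_def ne[OF that])
  have box: "emeasure (M N) (Pi\<^sub>E I A) = (\<integral>\<^sup>+w. (\<Prod>i\<in>I. (\<Sum>k. ennreal (fst (w k)) * indicator (A i) (snd (w k)))
        / (\<Sum>k. ennreal (fst (w k)))) \<partial>N)"
    if N: "laplace_poisson (levy_intensity \<theta> G \<rho>) N" and A: "\<And>i. i \<in> I \<Longrightarrow> A i \<in> sets borel" for N A
  proof -
    have "emeasure (M N) (Pi\<^sub>E I A) = (\<integral>\<^sup>+w. emeasure (sample_kernel I (normalized_measure w)) (Pi\<^sub>E I A) \<partial>N)"
      unfolding M_def using A I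
      by (intro emeasure_bind[OF ne[OF N] measurable_prob_algebraD[OF K[OF N]]] sets_PiM_I_finite) auto
    also have "\<dots> = (\<integral>\<^sup>+w. (\<Prod>i\<in>I. (\<Sum>k. ennreal (fst (w k)) * indicator (A i) (snd (w k)))
        / (\<Sum>k. ennreal (fst (w k)))) \<partial>N)"
      using AE_good_points[OF \<rho> \<theta> G N]
      by (intro nn_integral_cong_AE, eventually_elim)
        (simp add: emeasure_sample_kernel[OF I A] emeasure_normalized_measure)
    finally show ?thesis .
  qed
  have "M N1 = M N2"
  proof (rule measure_eqI_PiM_finite[OF I sets[OF N1] sets[OF N2]])
    fix A :: "nat \<Rightarrow> 's set" assume A: "\<And>i. i \<in> I \<Longrightarrow> A i \<in> sets borel"
    have "(\<integral>\<^sup>+w. (\<Prod>i\<in>I. (\<Sum>k. ennreal (fst (w k)) * indicator (A i) (snd (w k)))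
          / (\<Sum>k. ennreal (fst (w k)))) \<partial>N1) =
        (\<integral>\<^sup>+w. (\<Prod>i\<in>I. (\<Sum>k. ennreal (fst (w k)) * indicator (A i) (snd (w k)))
          / (\<Sum>k. ennreal (fst (w k)))) \<partial>N2)"
    proof (rule nn_integral_prod_ratio_eq[OF \<rho> \<theta> G N1 N2 I,
          of "\<lambda>i z. ennreal (fst z) * indicator (A i) (snd z)"])
      fix i assume "i \<in> I"
      then have [measurable]: "A i \<in> sets G" using A GB by simp
      show "(\<lambda>z. ennreal (fst z) * indicator (A i) (snd z)) \<in> borel_measurable (borel \<Otimes>\<^sub>M G)" by measurable
      show "ennreal (fst z) * indicator (A i) (snd z) \<le> ennreal (fst z)" for z
        by (auto simp: indicator_def)
    qed
    then show "emeasure (M N1) (Pi\<^sub>E I A) = emeasure (M N2) (Pi\<^sub>E I A)"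
      using box[OF N1, of A] box[OF N2, of A] A by simp
  next
    show "range (\<lambda>_::nat. Pi\<^sub>E I (\<lambda>_. UNIV)) \<subseteq> prod_algebra I (\<lambda>_. borel)"
      by (auto simp: prod_algebra_eq_finite[OF I])
    show "(\<Union>i::nat. Pi\<^sub>E I (\<lambda>_. UNIV)) = space (PiM I (\<lambda>_. borel))" by (simp add: space_PiM)
    have "(\<Prod>i\<in>I. (\<Sum>k. ennreal (fst (w k)) * indicator UNIV (snd (w k))) / (\<Sum>k. ennreal (fst (w k)))) \<le> 1"
      for w :: "nat \<Rightarrow> real \<times> 's"
      by (rule order_trans[OF prod_mono_ennreal[of _ _ "\<lambda>_. 1"]]) (auto simp: divide_self_le_1)
    then have "emeasure (M N1) (Pi\<^sub>E I (\<lambda>_. UNIV)) \<le> (\<integral>\<^sup>+w. 1 \<partial>N1)"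
      by (subst box[OF N1]) (auto simp del: indicator_UNIV nn_integral_const intro!: nn_integral_mono)
    then show "emeasure (M N1) (Pi\<^sub>E I (\<lambda>_. UNIV)) \<noteq> \<infinity>"
      using prob_space.emeasure_space_1[OF laplace_poissonD(1)[OF N1]] by (auto simp: top_unique)
  qed
  moreover have "(\<integral>\<^sup>+w. \<integral>\<^sup>+x. g (restrict x I) \<partial>measure_pmf (Pi_pmf I undefined (\<lambda>_. normalized_measure w)) \<partial>N)
      = (\<integral>\<^sup>+x. g x \<partial>M N)" if "laplace_poisson (levy_intensity \<theta> G \<rho>) N" for N
    unfolding M_def nn_integral_bind[OF g measurable_prob_algebraD[OF K[OF that]]] nn_integral_sample_kernel[OF g] ..
  ultimately show ?thesis using N1 N2 by simp
qed

section \<open>Averaging pairwise independent labels\<close>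

text \<open>Tonelli against the counting measure on the countable support. Measurability of each
  section in \<open>h\<close> is enough, which is what makes the exchange possible for evaluations
  \<open>h x\<close> that are not jointly measurable.\<close>

lemma nn_integral_pmf_swap:
  assumes H: "sigma_finite_measure H" and f: "\<And>x. x \<in> set_pmf p \<Longrightarrow> (\<lambda>h. f h x) \<in> borel_measurable H"
  shows "(\<integral>\<^sup>+h. \<integral>\<^sup>+x. f h x \<partial>measure_pmf p \<partial>H) = (\<integral>\<^sup>+x. \<integral>\<^sup>+h. f h x \<partial>H \<partial>measure_pmf p)"
proof -
  interpret H: sigma_finite_measure H by fact
  interpret C: sigma_finite_measure "count_space (set_pmf p)"
    by (rule sigma_finite_measure_count_space_countable) simp
  interpret P: pair_sigma_finite H "count_space (set_pmf p)" ..
  interpret P': pair_sigma_finite "count_space (set_pmf p)" H ..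
  have eq: "(\<integral>\<^sup>+x. g x \<partial>measure_pmf p) = (\<integral>\<^sup>+x. ennreal (pmf p x) * g x \<partial>count_space (set_pmf p))" for g
    unfolding nn_integral_measure_pmf
    by (subst nn_integral_count_space_indicator[where X = "set_pmf p"])
      (auto intro!: nn_integral_cong simp: indicator_def set_pmf_iff)
  have m: "(\<lambda>(x, h). ennreal (pmf p x) * f h x) \<in> borel_measurable (count_space (set_pmf p) \<Otimes>\<^sub>M H)"
    using f by (intro measurable_pair_measure_countable1) auto
  show ?thesis
    unfolding eq P'.Fubini'[OF m]
    by (intro nn_integral_cong nn_integral_cmult) (use f in auto)
qed

lemma hash_space:
  assumes "sets H = sets (PiM UNIV (\<lambda>_. count_space {1..J::nat}))"
  shows "space H = {h. \<forall>x. h x \<in> {1..J}}"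
  using sets_eq_imp_space_eq[OF assms] by (auto simp: space_PiM)

lemma hash_event:
  assumes H: "sets H = sets (PiM UNIV (\<lambda>_. count_space {1..J::nat}))" and K: "finite K"
  shows "{h \<in> space H. \<forall>k\<in>K. h (y k) = b k} \<in> sets H"
proof -
  note [measurable_cong] = H
  have [measurable]: "(\<lambda>h. h (y k)) \<in> H \<rightarrow>\<^sub>M count_space {1..J}" for k by measurable
  have [measurable]: "Measurable.pred (count_space {1..J}) (\<lambda>j. j = c)" for c by simp
  show ?thesis using K by measurable
qed

lemma emeasure_hash_labels:
  assumes H: "sets H = sets (PiM UNIV (\<lambda>_. count_space {1..J::nat}))" and K: "finite K"
  shows "emeasure H {h \<in> space H. restrict (\<lambda>k. h (y k)) K \<in> B}
    = (\<Sum>b\<in>PiE K (\<lambda>_. {1..J}) \<inter> B. emeasure H {h \<in> space H. \<forall>k\<in>K. h (y k) = b k})"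
proof -
  have "{h \<in> space H. restrict (\<lambda>k. h (y k)) K \<in> B}
      = (\<Union>b\<in>PiE K (\<lambda>_. {1..J}) \<inter> B. {h \<in> space H. \<forall>k\<in>K. h (y k) = b k})"
  proof (intro set_eqI iffI)
    fix h assume h: "h \<in> {h \<in> space H. restrict (\<lambda>k. h (y k)) K \<in> B}"
    then have "restrict (\<lambda>k. h (y k)) K \<in> PiE K (\<lambda>_. {1..J}) \<inter> B"
      using hash_space[OF H] by auto
    moreover have "h \<in> {h' \<in> space H. \<forall>k\<in>K. h' (y k) = restrict (\<lambda>k. h (y k)) K k}" using h by auto
    ultimately show "h \<in> (\<Union>b\<in>PiE K (\<lambda>_. {1..J}) \<inter> B. {h \<in> space H. \<forall>k\<in>K. h (y k) = b k})" by blast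
  next
    fix h assume "h \<in> (\<Union>b\<in>PiE K (\<lambda>_. {1..J}) \<inter> B. {h \<in> space H. \<forall>k\<in>K. h (y k) = b k})"
    then obtain b where b: "b \<in> PiE K (\<lambda>_. {1..J})" "b \<in> B" "h \<in> space H" "\<forall>k\<in>K. h (y k) = b k" by auto
    then have "restrict (\<lambda>k. h (y k)) K = b" by (intro ext) (auto simp: PiE_def extensional_def)
    then show "h \<in> {h \<in> space H. restrict (\<lambda>k. h (y k)) K \<in> B}" using b by simp
  qed
  also have "emeasure H \<dots> = (\<Sum>b\<in>PiE K (\<lambda>_. {1..J}) \<inter> B. emeasure H {h \<in> space H. \<forall>k\<in>K. h (y k) = b k})"
  proof (rule sum_emeasure[symmetric])
    show "disjoint_family_on (\<lambda>b. {h \<in> space H. \<forall>k\<in>K. h (y k) = b k}) (PiE K (\<lambda>_. {1..J}) \<inter> B)"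
      unfolding disjoint_family_on_def
    proof (intro ballI impI, rule ccontr)
      fix b c assume bc: "b \<in> PiE K (\<lambda>_. {1..J}) \<inter> B" "c \<in> PiE K (\<lambda>_. {1..J}) \<inter> B" "b \<noteq> c"
        "{h \<in> space H. \<forall>k\<in>K. h (y k) = b k} \<inter> {h \<in> space H. \<forall>k\<in>K. h (y k) = c k} \<noteq> {}"
      then have "\<forall>k\<in>K. b k = c k" by auto
      with bc(1,2) have "b = c" by (intro ext) (metis IntD1 PiE_arb)
      with bc(3) show False by simp
    qed
    show "(\<lambda>b. {h \<in> space H. \<forall>k\<in>K. h (y k) = b k}) ` (PiE K (\<lambda>_. {1..J}) \<inter> B) \<subseteq> sets H"
      using hash_event[OF H K] by auto
  qed (use K in \<open>auto intro!: finite_PiE finite_Int\<close>)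
  finally show ?thesis .
qed

lemma prob_space_uniform_labels: "1 \<le> J \<Longrightarrow> prob_space (uniform_count_measure {1..J::nat})"
  by (rule prob_space_uniform_count_measure) auto

abbreviation uniform_labels :: "nat \<Rightarrow> (nat \<Rightarrow> nat) measure" where
  "uniform_labels J \<equiv> PiM UNIV (\<lambda>_. uniform_count_measure {1..J})"

lemma sets_uniform_labels: "sets (uniform_labels J) = sets (PiM UNIV (\<lambda>_. count_space {1..J}))"
  by (intro sets_PiM_cong) (auto simp: sets_uniform_count_measure)

lemma emeasure_uniform_labels:
  assumes J: "1 \<le> J" and K: "finite K" and b: "\<And>k. k \<in> K \<Longrightarrow> b k \<in> {1..J}"
  shows "emeasure (uniform_labels J) {L \<in> space (uniform_labels J). \<forall>k\<in>K. L k = b k} = ennreal ((1 / J) ^ card K)"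
proof -
  have "emeasure (uniform_labels J) {L \<in> space (uniform_labels J). \<forall>k\<in>K. L k = b k}
      = (\<integral>\<^sup>+L. indicator {L \<in> space (uniform_labels J). \<forall>k\<in>K. L k = b k} L \<partial>uniform_labels J)"
    by (rule nn_integral_indicator[symmetric])
      (use hash_event[OF sets_uniform_labels K, of J "\<lambda>k. k" b] in auto)
  also have "\<dots> = (\<integral>\<^sup>+L. (\<Prod>k\<in>K. indicator {b k} (L k)) \<partial>uniform_labels J)"
    using K by (intro nn_integral_cong) (auto simp: indicator_def)
  also have "\<dots> = (\<Prod>k\<in>K. \<integral>\<^sup>+j. indicator {b k} j \<partial>uniform_count_measure {1..J})"
    by (rule nn_integral_PiM_UNIV_prod[OF prob_space_uniform_labels[OF J] K]) simp
  also have "\<dots> = (\<Prod>k\<in>K. ennreal (1 / J))"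
  proof (intro prod.cong refl)
    fix k assume "k \<in> K"
    then have "b k \<in> {1..J}" by (rule b)
    then have "(\<integral>\<^sup>+j. indicator {b k} j \<partial>uniform_count_measure {1..J}) = emeasure (uniform_count_measure {1..J}) {b k}"
      by (intro nn_integral_indicator) (auto simp: sets_uniform_count_measure)
    then show "(\<integral>\<^sup>+j. indicator {b k} j \<partial>uniform_count_measure {1..J}) = ennreal (1 / J)"
      using \<open>b k \<in> {1..J}\<close> by (simp add: emeasure_uniform_count_measure)
  qed
  finally show ?thesis by (simp add: ennreal_power)
qed

lemma PiM_UNIV_permute:
  assumes "prob_space G" "inj \<pi>"
  shows "distr (PiM UNIV (\<lambda>_::nat. G)) (PiM UNIV (\<lambda>_. G)) (\<lambda>Y i. Y (\<pi> i)) = PiM UNIV (\<lambda>_. G)"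
  using distr_PiM_reindex[of UNIV "\<lambda>_. G" \<pi> UNIV] assms by (simp add: restrict_UNIV)

text \<open>Given all the other coordinates, \<open>Y i\<close> has to hit the single point
  \<open>Y j\<close>, which a nonatomic law does not charge. Countably many pairs remain
  null.\<close>

lemma AE_PiM_distinct:
  fixes G :: "'s::{second_countable_topology, t2_space} measure"
  assumes G: "nonatomic_prob G"
  shows "AE Y in PiM UNIV (\<lambda>_::nat. G). inj Y"
proof -
  interpret G: prob_space G using G by (simp add: nonatomic_prob_def)
  have GB [measurable_cong]: "sets G = sets borel" using G by (simp add: nonatomic_prob_def)
  have *: "AE Y in PiM UNIV (\<lambda>_::nat. G). Y i \<noteq> Y j" if ij: "i \<noteq> j" for i j
  proof -
    interpret P: product_prob_space "\<lambda>_. G" "UNIV - {i}" ..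
    interpret GP: pair_prob_space G "PiM (UNIV - {i}) (\<lambda>_. G)" ..
    have ins: "insert i (UNIV - {i}) = UNIV" by auto
    have eq: "distr (G \<Otimes>\<^sub>M PiM (UNIV - {i}) (\<lambda>_. G)) (PiM UNIV (\<lambda>_. G)) (\<lambda>(x, X). X(i := x)) = PiM UNIV (\<lambda>_. G)"
      using distr_pair_PiM_eq_PiM[of "UNIV - {i}" "\<lambda>_. G" i] by (simp add: ins G.prob_space_axioms)
    have [measurable]: "(\<lambda>(x, X). X(i := x)) \<in> G \<Otimes>\<^sub>M PiM (UNIV - {i}) (\<lambda>_. G) \<rightarrow>\<^sub>M PiM UNIV (\<lambda>_. G)"
      using measurable_fun_upd[of UNIV "UNIV - {i}" i snd "G \<Otimes>\<^sub>M PiM (UNIV - {i}) (\<lambda>_. G)" "\<lambda>_. G" fst]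
      by (simp add: ins case_prod_unfold)
    have toG: "f \<in> borel_measurable M" if "f \<in> M \<rightarrow>\<^sub>M G" for f :: "'z \<Rightarrow> 's" and M
      using that measurable_cong_sets[OF refl GB] by blast
    have [measurable]: "(\<lambda>Y. Y l) \<in> borel_measurable (PiM UNIV (\<lambda>_::nat. G))" for l
      by (rule toG) measurable
    have "{Y \<in> space (PiM UNIV (\<lambda>_::nat. G)). Y i = Y j} \<in> sets (PiM UNIV (\<lambda>_::nat. G))"
      by (rule measurable_equality_set) measurable
    then have [measurable]: "Measurable.pred (PiM UNIV (\<lambda>_::nat. G)) (\<lambda>Y. Y i \<noteq> Y j)"
      by (intro pred_intros_logic) (simp add: pred_def)
    have j: "j \<in> UNIV - {i}" using ij by auto
    have [measurable]: "(\<lambda>z. snd z j) \<in> borel_measurable (G \<Otimes>\<^sub>M PiM (UNIV - {i}) (\<lambda>_. G))"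
      by (rule toG, rule measurable_compose[OF measurable_snd measurable_component_singleton[OF j]])
    have [measurable]: "fst \<in> borel_measurable (G \<Otimes>\<^sub>M PiM (UNIV - {i}) (\<lambda>_. G))"
      by (rule toG) (rule measurable_fst)
    have "emeasure (G \<Otimes>\<^sub>M PiM (UNIV - {i}) (\<lambda>_. G)) {z \<in> space (G \<Otimes>\<^sub>M PiM (UNIV - {i}) (\<lambda>_. G)). fst z = snd z j} = 0"
    proof -
      have m: "{z \<in> space (G \<Otimes>\<^sub>M PiM (UNIV - {i}) (\<lambda>_. G)). fst z = snd z j} \<in> sets (G \<Otimes>\<^sub>M PiM (UNIV - {i}) (\<lambda>_. G))"
        by (rule measurable_equality_set) measurable
      have "emeasure G ((\<lambda>x. (x, X)) -` {z \<in> space (G \<Otimes>\<^sub>M PiM (UNIV - {i}) (\<lambda>_. G)). fst z = snd z j}) = 0" for X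
      proof -
        have "emeasure G ((\<lambda>x. (x, X)) -` {z \<in> space (G \<Otimes>\<^sub>M PiM (UNIV - {i}) (\<lambda>_. G)). fst z = snd z j})
            \<le> emeasure G {X j}"
          by (intro emeasure_mono) (auto simp: GB)
        also have "\<dots> = 0" using G by (simp add: nonatomic_prob_def)
        finally show ?thesis by simp
      qed
      then show ?thesis
        by (subst GP.emeasure_pair_measure_alt2[OF m]) simp
    qed
    then have "AE z in G \<Otimes>\<^sub>M PiM (UNIV - {i}) (\<lambda>_. G). fst z \<noteq> snd z j"
      by (intro AE_I'[of "{z \<in> space (G \<Otimes>\<^sub>M PiM (UNIV - {i}) (\<lambda>_. G)). fst z = snd z j}"]) (auto simp: null_sets_def)
    then have "AE Y in distr (G \<Otimes>\<^sub>M PiM (UNIV - {i}) (\<lambda>_. G)) (PiM UNIV (\<lambda>_. G)) (\<lambda>(x, X). X(i := x)). Y i \<noteq> Y j"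
      by (subst AE_distr_iff) (use ij in \<open>auto simp: case_prod_unfold\<close>)
    then show ?thesis unfolding eq .
  qed
  have "AE Y in PiM UNIV (\<lambda>_::nat. G). \<forall>i j. i \<noteq> j \<longrightarrow> Y i \<noteq> Y j"
    unfolding AE_all_countable using * by auto
  then show ?thesis by (auto simp: inj_def)
qed

text \<open>Strong universality speaks only of pairs of points. A second point \<open>y\<close>
  supplies the pair, and summing over its \<open>J\<close> labels gives
  \<open>J / J ^ 2\<close>.\<close>

lemma hash_marginal:
  assumes H: "strongly_universal J H" and J: "1 \<le> J" and y: "y \<noteq> x" and j: "j \<in> {1..J}"
  shows "measure H {h \<in> space H. h x = j} = 1 / J"
proof -
  interpret prob_space H using H by (simp add: strongly_universal_def)
  have sH: "sets H = sets (PiM UNIV (\<lambda>_. count_space {1..J}))" using H by (simp add: strongly_universal_def)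
  have ev: "{h \<in> space H. h x = j \<and> h y = i} \<in> sets H" for i
  proof -
    have "{h \<in> space H. h x = j} \<inter> {h \<in> space H. h y = i} \<in> sets H"
      using hash_event[OF sH, of "{0::nat}" "\<lambda>_. x" "\<lambda>_. j"] hash_event[OF sH, of "{0::nat}" "\<lambda>_. y" "\<lambda>_. i"]
      by (intro sets.Int) simp_all
    also have "{h \<in> space H. h x = j} \<inter> {h \<in> space H. h y = i} = {h \<in> space H. h x = j \<and> h y = i}" by auto
    finally show ?thesis .
  qed
  have "{h \<in> space H. h x = j} = (\<Union>i\<in>{1..J}. {h \<in> space H. h x = j \<and> h y = i})"
    using hash_space[OF sH] by auto
  then have "measure H {h \<in> space H. h x = j} = (\<Sum>i\<in>{1..J}. measure H {h \<in> space H. h x = j \<and> h y = i})"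
    using ev by (simp add: disjoint_family_on_def finite_measure_finite_Union image_subset_iff disjoint_iff)
  also have "\<dots> = (\<Sum>i\<in>{1..J}. 1 / J ^ 2)"
    using H j y by (intro sum.cong refl) (auto simp: strongly_universal_def)
  finally show ?thesis using J by (simp add: power2_eq_square)
qed

text \<open>Averaging the label of one more point over many exchangeable points turns pairwise independence
  into full independence: the average concentrates at \<open>1 / J\<close> in mean square.\<close>

lemma hash_labels_bound:
  assumes H: "strongly_universal J H" and J: "1 \<le> J" and j: "j \<in> {1..J}"
    and Y: "inj Y" and Z: "Z \<in> sets H" and A: "finite A" "A \<noteq> {}"
  shows "\<bar>\<Sum>i\<in>A. measure H (Z \<inter> {h \<in> space H. h (Y i) = j}) - measure H Z / J\<bar> \<le> sqrt (card (A::nat set))"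
proof -
  interpret prob_space H using H by (simp add: strongly_universal_def)
  have sH: "sets H = sets (PiM UNIV (\<lambda>_. count_space {1..J}))" using H by (simp add: strongly_universal_def)
  define E where "E i = {h \<in> space H. h (Y i) = j}" for i
  have E [measurable]: "E i \<in> sets H" for i
    using hash_event[OF sH, of "{i}" Y "\<lambda>_. j"] by (simp add: E_def)
  have mE: "measure H (E i) = 1 / J" for i
    unfolding E_def using j J inj_eq[OF Y, of "Suc i" i] by (intro hash_marginal[OF H, of "Y (Suc i)"]) auto
  have mEE: "measure H (E i \<inter> E l) = 1 / J ^ 2" if "i \<noteq> l" for i l
  proof -
    have "E i \<inter> E l = {h \<in> space H. h (Y i) = j \<and> h (Y l) = j}" by (auto simp: E_def)
    moreover have "Y i \<noteq> Y l" using Y that by (auto simp: inj_def)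
    ultimately show ?thesis using H j by (simp add: strongly_universal_def)
  qed
  define W where "W i h = indicator (E i) h - 1 / real J" for i and h :: "'a \<Rightarrow> nat"
  define S where "S h = (\<Sum>i\<in>A. W i h)" for h
  have Wint [measurable]: "W i \<in> borel_measurable H" for i unfolding W_def[abs_def] by measurable
  have Wb: "\<bar>W i h\<bar> \<le> 1" for i h using J by (auto simp: W_def indicator_def field_simps abs_le_iff)
  have WW: "integrable H (\<lambda>h. W i h * W l h)" for i l
    by (rule integrable_const_bound[where B = 1]) (auto simp: abs_mult intro!: AE_I2 mult_le_one Wb)
  \<comment> \<open>The centred indicators of distinct points are uncorrelated by pairwise
    independence, so only the diagonal contributes to the variance of their sum.\<close>
  have EWW: "(\<integral>h. W i h * W l h \<partial>H) \<le> (if i = l then 1 else 0)" for i l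
  proof -
    have "W i h * W l h = indicator (E i \<inter> E l) h - (1 / J) * indicator (E i) h - (1 / J) * indicator (E l) h + 1 / J ^ 2" for h
      by (auto simp: W_def indicator_def power2_eq_square algebra_simps)
    then have "(\<integral>h. W i h * W l h \<partial>H) = measure H (E i \<inter> E l) - 1 / J * measure H (E i) - 1 / J * measure H (E l) + 1 / J ^ 2"
      by (simp add: prob_space fmeasurable_eq_sets less_top[symmetric])
    then have *: "(\<integral>h. W i h * W l h \<partial>H) = measure H (E i \<inter> E l) - 1 / J ^ 2"
      by (simp add: mE power2_eq_square)
    show ?thesis
    proof (cases "i = l")
      case True
      have "1 / real J \<le> 1" "0 \<le> 1 / real (J\<^sup>2)" using J by simp_all
      then have "1 / real J - 1 / real (J\<^sup>2) \<le> 1" by linarith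
      then show ?thesis using * mE[of l] True by simp
    qed (use * mEE in auto)
  qed
  have S2: "(\<integral>h. S h ^ 2 \<partial>H) \<le> card A"
  proof -
    have "(\<integral>h. S h ^ 2 \<partial>H) = (\<integral>h. (\<Sum>i\<in>A. \<Sum>l\<in>A. W i h * W l h) \<partial>H)"
      by (simp add: S_def power2_eq_square sum_product)
    also have "\<dots> = (\<Sum>i\<in>A. \<Sum>l\<in>A. \<integral>h. W i h * W l h \<partial>H)"
      by (simp add: Bochner_Integration.integral_sum WW)
    also have "\<dots> \<le> (\<Sum>i\<in>A. \<Sum>l\<in>A. if i = l then 1 else 0)" by (intro sum_mono EWW)
    also have "\<dots> = card A" using A by simp
    finally show ?thesis .
  qed
  have Sm [measurable]: "S \<in> borel_measurable H" unfolding S_def[abs_def] by measurable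
  have Sb: "\<bar>S h\<bar> \<le> card A" for h
    unfolding S_def
    by (rule order_trans[OF sum_abs]) (use sum_mono[of A "\<lambda>i. \<bar>W i h\<bar>" "\<lambda>_. 1"] Wb in simp)
  have S2i: "integrable H (\<lambda>h. S h ^ 2)"
  proof (rule integrable_const_bound[where B = "real (card A) ^ 2"])
    show "AE h in H. norm (S h ^ 2) \<le> real (card A) ^ 2"
      using Sb by (intro AE_I2) (auto simp: abs_le_square_iff[symmetric])
  qed measurable
  have ZSi: "integrable H (\<lambda>h. indicator Z h * S h)"
    by (rule integrable_const_bound[where B = "card A"]) (use Z Sb in \<open>auto simp: indicator_def intro!: AE_I2\<close>)
  define c where "c = sqrt (card A)"
  have c: "0 < c" "c * c = card A" using A by (auto simp: c_def card_gt_0_iff)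
  \<comment> \<open>The inequality of arithmetic and geometric means in place of Cauchy-Schwarz; the
    choice \<open>c = sqrt (card A)\<close> makes both terms contribute at most
    \<open>c / 2\<close>.\<close>
  have ineq: "\<bar>indicator Z h * S h\<bar> \<le> c / 2 + S h ^ 2 / (2 * c)" for h
  proof -
    have "0 \<le> (c - \<bar>S h\<bar>) ^ 2" by simp
    then have "2 * c * \<bar>S h\<bar> \<le> c * c + S h ^ 2" by (simp add: power2_eq_square algebra_simps)
    then have "\<bar>S h\<bar> \<le> c / 2 + S h ^ 2 / (2 * c)" using c by (simp add: field_simps power2_eq_square)
    moreover have "\<bar>indicator Z h * S h\<bar> \<le> \<bar>S h\<bar>" by (auto simp: indicator_def)
    ultimately show ?thesis by linarith
  qed
  have "\<bar>\<integral>h. indicator Z h * S h \<partial>H\<bar> \<le> (\<integral>h. \<bar>indicator Z h * S h\<bar> \<partial>H)" by (rule integral_abs_bound)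
  also have "\<dots> \<le> (\<integral>h. c / 2 + S h ^ 2 / (2 * c) \<partial>H)"
    using ZSi S2i ineq by (intro integral_mono) auto
  also have "\<dots> = c / 2 + (\<integral>h. S h ^ 2 \<partial>H) / (2 * c)"
    using S2i by (simp add: prob_space)
  also have "\<dots> \<le> c / 2 + (c * c) / (2 * c)"
    using S2 c by (intro add_left_mono divide_right_mono) auto
  also have "\<dots> = c" using c(1) by simp
  finally have "\<bar>\<integral>h. indicator Z h * S h \<partial>H\<bar> \<le> c" .
  moreover have "(\<integral>h. indicator Z h * S h \<partial>H) = (\<Sum>i\<in>A. measure H (Z \<inter> E i) - measure H Z / J)"
  proof -
    have "(\<integral>h. indicator Z h * S h \<partial>H) = (\<integral>h. (\<Sum>i\<in>A. indicator (Z \<inter> E i) h - indicator Z h / J) \<partial>H)"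
      by (intro Bochner_Integration.integral_cong)
        (auto simp: S_def W_def sum_distrib_left indicator_def intro!: sum.cong)
    also have "\<dots> = (\<Sum>i\<in>A. measure H (Z \<inter> E i) - measure H Z / J)"
      using Z by (subst Bochner_Integration.integral_sum) (auto simp: fmeasurable_eq_sets less_top[symmetric])
    finally show ?thesis .
  qed
  ultimately show ?thesis by (simp add: c_def E_def)
qed

lemma measure_hash_measurable:
  fixes G :: "'s::{second_countable_topology, t2_space} measure"
  assumes H: "measurable_hash H" and GB: "sets G = sets borel" and K: "finite K" and KK': "K \<subseteq> K'"
  shows "(\<lambda>Y. measure H {h \<in> space H. \<forall>k\<in>K. h (Y k) = b k}) \<in> borel_measurable (PiM K' (\<lambda>_. G))"
proof -
  note [measurable_cong] = GB
  define m where "m = card K"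
  obtain e where e: "bij_betw e {..<m} K"
    using ex_bij_betw_nat_finite[OF K] by (auto simp: m_def atLeast0LessThan)
  have [measurable]: "(\<lambda>x :: nat \<Rightarrow> 's. measure H {h \<in> space H. \<forall>i<m. h (x i) = b (e i)}) \<in> borel_measurable (PiM {..<m} (\<lambda>_. borel))"
    using H unfolding measurable_hash_def by (rule allE[of _ m]) (erule allE[of _ "\<lambda>i. b (e i)"])
  have [measurable]: "(\<lambda>Y. \<lambda>i\<in>{..<m}. Y (e i)) \<in> PiM K' (\<lambda>_. G) \<rightarrow>\<^sub>M PiM {..<m} (\<lambda>_. borel)"
  proof (rule measurable_restrict)
    fix i assume "i \<in> {..<m}"
    then have "e i \<in> K'" using bij_betwE[OF e] KK' by auto
    then show "(\<lambda>Y. Y (e i)) \<in> PiM K' (\<lambda>_. G) \<rightarrow>\<^sub>M borel" by measurable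
  qed
  have "(\<forall>k\<in>K. P k) \<longleftrightarrow> (\<forall>i<m. P (e i))" for P
    using bij_betw_imp_surj_on[OF e] by auto
  then have "(\<lambda>Y. measure H {h \<in> space H. \<forall>k\<in>K. h (Y k) = b k})
      = (\<lambda>Y. (\<lambda>x. measure H {h \<in> space H. \<forall>i<m. h (x i) = b (e i)}) (\<lambda>i\<in>{..<m}. Y (e i)))"
    by (auto simp: fun_eq_iff cong: conj_cong)
  also have "\<dots> \<in> borel_measurable (PiM K' (\<lambda>_. G))" by measurable
  finally show ?thesis .
qed

text \<open>Induction on the number of labels. As the positions are iid, the index \<open>k\<close>
  may be exchanged for any index outside \<open>K\<close>, so the error \<open>d\<close> in the
  product formula is the same for all of them. Its sum over \<open>n ^ 2\<close> fresh indices is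
  bounded by \<open>sqrt (n ^ 2) = n\<close>, hence \<open>n * \<bar>d\<bar> \<le> 1\<close> for
  every \<open>n\<close>.\<close>

lemma hash_labels_independent:
  fixes G :: "'s::{second_countable_topology, t2_space} measure"
  assumes G: "nonatomic_prob G" and H: "strongly_universal J H" and mH: "measurable_hash H" and J: "1 \<le> J"
    and K: "finite K" and b: "\<And>k. k \<in> K \<Longrightarrow> b k \<in> {1..J}"
  shows "(\<integral>Y. measure H {h \<in> space H. \<forall>k\<in>K. h (Y k) = b k} \<partial>PiM UNIV (\<lambda>_::nat. G)) = (1 / J) ^ card K"
  using K b
proof (induction K arbitrary: b rule: finite_induct)
  case empty
  interpret G: prob_space G using G by (simp add: nonatomic_prob_def)
  interpret P: prob_space "PiM UNIV (\<lambda>_::nat. G)" by (intro prob_space_PiM G.prob_space_axioms)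
  interpret H: prob_space H using H by (simp add: strongly_universal_def)
  show ?case by (simp add: H.prob_space P.prob_space)
next
  case (insert k K)
  interpret G: prob_space G using G by (simp add: nonatomic_prob_def)
  have GB: "sets G = sets borel" using G by (simp add: nonatomic_prob_def)
  interpret P: prob_space "PiM UNIV (\<lambda>_::nat. G)" by (intro prob_space_PiM G.prob_space_axioms)
  interpret H: prob_space H using H by (simp add: strongly_universal_def)
  have sH: "sets H = sets (PiM UNIV (\<lambda>_. count_space {1..J}))" using H by (simp add: strongly_universal_def)
  define V where "V k' Y = measure H ({h \<in> space H. \<forall>k\<in>K. h (Y k) = b k} \<inter> {h \<in> space H. h (Y k') = b k})" for k' Y
  define V0 where "V0 Y = measure H {h \<in> space H. \<forall>k\<in>K. h (Y k) = b k}" for Y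
  have Valt: "V k' Y = measure H {h \<in> space H. \<forall>i\<in>insert k' K. h (Y i) = (b(k' := b k)) i}" if "k' \<notin> K" for k' Y
    unfolding V_def using that by (intro arg_cong[where f = "measure H"]) auto
  have Vm [measurable]: "V k' \<in> borel_measurable (PiM UNIV (\<lambda>_. G))" if "k' \<notin> K" for k'
    unfolding Valt[OF that, abs_def] using insert.hyps by (intro measure_hash_measurable[OF mH GB]) auto
  have V0m [measurable]: "V0 \<in> borel_measurable (PiM UNIV (\<lambda>_. G))"
    unfolding V0_def[abs_def] using insert.hyps by (intro measure_hash_measurable[OF mH GB]) auto
  have Vi: "integrable (PiM UNIV (\<lambda>_. G)) (V k')" if "k' \<notin> K" for k'
    using that by (intro P.integrable_const_bound[where B = 1]) (auto simp: V_def)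
  have V0i: "integrable (PiM UNIV (\<lambda>_. G)) V0"
    by (intro P.integrable_const_bound[where B = 1]) (auto simp: V0_def)
  have V0: "(\<integral>Y. V0 Y \<partial>PiM UNIV (\<lambda>_. G)) = (1 / J) ^ card K"
    unfolding V0_def using insert.IH[of b] insert.prems by simp
  have sym: "(\<integral>Y. V k' Y \<partial>PiM UNIV (\<lambda>_. G)) = (\<integral>Y. V k Y \<partial>PiM UNIV (\<lambda>_. G))" if k': "k' \<notin> K" for k'
  proof -
    define \<pi> where "\<pi> i = (if i = k then k' else if i = k' then k else i)" for i
    have "inj \<pi>" by (auto simp: inj_def \<pi>_def)
    have "(\<integral>Y. V k Y \<partial>PiM UNIV (\<lambda>_. G)) = (\<integral>Y. V k Y \<partial>distr (PiM UNIV (\<lambda>_. G)) (PiM UNIV (\<lambda>_. G)) (\<lambda>Y i. Y (\<pi> i)))"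
      by (subst PiM_UNIV_permute) (auto simp: \<open>inj \<pi>\<close> G.prob_space_axioms)
    also have "\<dots> = (\<integral>Y. V k (\<lambda>i. Y (\<pi> i)) \<partial>PiM UNIV (\<lambda>_. G))"
      using insert.hyps by (intro integral_distr) (auto intro!: measurable_PiM_single' simp: space_PiM PiE_iff)
    also have "\<dots> = (\<integral>Y. V k' Y \<partial>PiM UNIV (\<lambda>_. G))"
    proof (intro Bochner_Integration.integral_cong refl)
      fix Y
      have "\<pi> i = i" if "i \<in> K" for i using that k' insert.hyps by (auto simp: \<pi>_def)
      moreover have "\<pi> k = k'" by (simp add: \<pi>_def)
      ultimately show "V k (\<lambda>i. Y (\<pi> i)) = V k' Y" by (simp add: V_def cong: conj_cong)
    qed
    finally show ?thesis by simp
  qed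
  define d where "d = (\<integral>Y. V k Y \<partial>PiM UNIV (\<lambda>_. G)) - (1 / J) ^ card K / J"
  have bound: "real n * \<bar>d\<bar> \<le> 1" if n: "0 < n" for n :: nat
  proof -
    define m where "m = Suc (Max (insert 0 K))"
    define A where "A = {m..<m + n ^ 2}"
    have A: "finite A" "A \<noteq> {}" "card A = n ^ 2" using n by (auto simp: A_def)
    have AK: "i \<notin> K" if "i \<in> A" for i
    proof
      assume "i \<in> K"
      then have "i \<le> Max (insert 0 K)" using insert.hyps by (intro Max_ge) auto
      then show False using that by (simp add: A_def m_def)
    qed
    have "real (n ^ 2) * d = (\<Sum>i\<in>A. (\<integral>Y. V i Y \<partial>PiM UNIV (\<lambda>_. G)) - (1 / J) ^ card K / J)"
      using AK A by (simp add: sym d_def)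
    also have "\<dots> = (\<integral>Y. (\<Sum>i\<in>A. V i Y - V0 Y / J) \<partial>PiM UNIV (\<lambda>_. G))"
      using Vi AK V0i by (subst Bochner_Integration.integral_sum) (auto simp: V0)
    finally have eq: "real (n ^ 2) * d = (\<integral>Y. (\<Sum>i\<in>A. V i Y - V0 Y / J) \<partial>PiM UNIV (\<lambda>_. G))" .
    have "\<bar>real (n ^ 2) * d\<bar> \<le> (\<integral>Y. \<bar>\<Sum>i\<in>A. V i Y - V0 Y / J\<bar> \<partial>PiM UNIV (\<lambda>_. G))"
      unfolding eq by (rule integral_abs_bound)
    also have "\<dots> \<le> (\<integral>Y. real n \<partial>PiM UNIV (\<lambda>_::nat. G))"
    proof (rule Bochner_Integration.integral_mono_AE)
      show "integrable (PiM UNIV (\<lambda>_. G)) (\<lambda>Y. \<bar>\<Sum>i\<in>A. V i Y - V0 Y / J\<bar>)"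
        using Vi AK V0i by auto
      show "AE Y in PiM UNIV (\<lambda>_. G). \<bar>\<Sum>i\<in>A. V i Y - V0 Y / J\<bar> \<le> real n"
        using AE_PiM_distinct[OF G]
      proof eventually_elim
        case (elim Y)
        have "{h \<in> space H. \<forall>k\<in>K. h (Y k) = b k} \<in> sets H"
          using hash_event[OF sH insert.hyps(1)] .
        from hash_labels_bound[OF H J _ elim this A(1,2), of "b k"] insert.prems
        show ?case by (simp add: V_def V0_def A)
      qed
    qed simp
    also have "\<dots> = real n" by (simp add: P.prob_space)
    finally show ?thesis using n by (simp add: abs_mult power2_eq_square)
  qed
  have "d = 0"
  proof (rule ccontr)
    assume "d \<noteq> 0"
    then obtain n :: nat where "1 / \<bar>d\<bar> < real n" using reals_Archimedean2 by blast
    moreover from this have "0 < n" using \<open>d \<noteq> 0\<close> by (cases n) (auto simp: not_less[symmetric])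
    ultimately show False using bound[of n] \<open>d \<noteq> 0\<close> by (simp add: field_simps)
  qed
  then show ?case
    using insert.hyps Valt[of k] by (simp add: d_def)
qed

text \<open>A finite summary of a sample, namely its coincidence relation and its labels, through
  which all events about frequencies, sketches and buckets factor. It does not mention the positions
  themselves, so sampled values can be replaced by the indices of the atoms.\<close>

definition pattern :: "nat set \<Rightarrow> ('a \<Rightarrow> nat) \<Rightarrow> (nat \<Rightarrow> 'a) \<Rightarrow> (nat \<times> nat) set \<times> (nat \<Rightarrow> nat)" where
  "pattern I h x = ({(i, l). i \<in> I \<and> l \<in> I \<and> x i = x l}, restrict (\<lambda>i. h (x i)) I)"

lemma pattern_event:
  assumes H: "sets H = sets (PiM UNIV (\<lambda>_. count_space {1..J::nat}))" and I: "finite I"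
  shows "{h \<in> space H. pattern I h x \<in> S} \<in> sets H"
proof -
  have "{h \<in> space H. pattern I h x \<in> S}
      = (\<Union>b\<in>PiE I (\<lambda>_. {1..J}) \<inter> {b. ({(i, l). i \<in> I \<and> l \<in> I \<and> x i = x l}, b) \<in> S}.
          {h \<in> space H. \<forall>i\<in>I. h (x i) = b i})" (is "?A = ?B")
  proof (intro set_eqI iffI)
    fix h assume h: "h \<in> ?A"
    then have "restrict (\<lambda>i. h (x i)) I \<in> PiE I (\<lambda>_. {1..J}) \<inter> {b. ({(i, l). i \<in> I \<and> l \<in> I \<and> x i = x l}, b) \<in> S}"
      using hash_space[OF H] by (auto simp: pattern_def)
    moreover have "h \<in> {h' \<in> space H. \<forall>i\<in>I. h' (x i) = restrict (\<lambda>i. h (x i)) I i}" using h by auto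
    ultimately show "h \<in> ?B" by blast
  next
    fix h assume "h \<in> ?B"
    then obtain b where b: "b \<in> PiE I (\<lambda>_. {1..J})" "({(i, l). i \<in> I \<and> l \<in> I \<and> x i = x l}, b) \<in> S"
      "h \<in> space H" "\<forall>i\<in>I. h (x i) = b i" by auto
    then have "restrict (\<lambda>i. h (x i)) I = b" by (intro ext) (auto simp: PiE_def extensional_def)
    then show "h \<in> ?A" using b by (simp add: pattern_def)
  qed
  also have "\<dots> \<in> sets H"
    using I hash_event[OF H I] by (intro sets.finite_UN finite_Int disjI1 finite_PiE) auto
  finally show ?thesis .
qed

lemma emeasure_pattern:
  assumes H: "sets H = sets (PiM UNIV (\<lambda>_. count_space {1..J::nat}))" and I: "finite I"
  shows "emeasure H {h \<in> space H. pattern I h x \<in> S}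
    = (\<Sum>b\<in>PiE I (\<lambda>_. {1..J}). of_bool (({(i, l). i \<in> I \<and> l \<in> I \<and> x i = x l}, b) \<in> S) *
        emeasure H {h \<in> space H. \<forall>i\<in>I. h (x i) = b i})"
proof -
  have "emeasure H {h \<in> space H. pattern I h x \<in> S}
      = (\<Sum>b\<in>PiE I (\<lambda>_. {1..J}) \<inter> {b. ({(i, l). i \<in> I \<and> l \<in> I \<and> x i = x l}, b) \<in> S}.
          emeasure H {h \<in> space H. \<forall>i\<in>I. h (x i) = b i})"
    using emeasure_hash_labels[OF H I, of x "{b. ({(i, l). i \<in> I \<and> l \<in> I \<and> x i = x l}, b) \<in> S}"]
    by (simp add: pattern_def)
  also have "\<dots> = (\<Sum>b\<in>PiE I (\<lambda>_. {1..J}). if ({(i, l). i \<in> I \<and> l \<in> I \<and> x i = x l}, b) \<in> S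
        then emeasure H {h \<in> space H. \<forall>i\<in>I. h (x i) = b i} else 0)"
    using I by (subst sum.inter_restrict) (auto intro!: finite_PiE sum.cong)
  finally show ?thesis by (simp add: of_bool_def if_distrib[of "\<lambda>c. c * _"] cong: if_cong)
qed

text \<open>Only finitely many coincidence relations on \<open>I\<close> exist, and each is a
  Boolean combination of events \<open>x i = x l\<close>, which are measurable in a second countable
  Hausdorff space. The label probabilities are measurable by \<open>measurable_hash\<close>.\<close>

lemma emeasure_pattern_measurable:
  fixes H :: "('s::{second_countable_topology, t2_space} \<Rightarrow> nat) measure"
  assumes H: "strongly_universal J H" and mH: "measurable_hash H" and I: "finite I"
  shows "(\<lambda>x. emeasure H {h \<in> space H. pattern I h x \<in> S}) \<in> borel_measurable (PiM I (\<lambda>_. borel))"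
proof -
  have sH: "sets H = sets (PiM UNIV (\<lambda>_. count_space {1..J}))" using H by (simp add: strongly_universal_def)
  interpret prob_space H using H by (simp add: strongly_universal_def)
  have [measurable]: "(\<lambda>x. emeasure H {h \<in> space H. \<forall>i\<in>I. h (x i) = b i}) \<in> borel_measurable (PiM I (\<lambda>_. borel))" for b
    unfolding emeasure_eq_measure using measure_hash_measurable[OF mH refl I order_refl] by measurable
  have [measurable]: "Measurable.pred (PiM I (\<lambda>_. borel :: 's measure)) (\<lambda>x. ({(i, l). i \<in> I \<and> l \<in> I \<and> x i = x l}, b) \<in> S)" for b
  proof -
    have *: "({(i, l). i \<in> I \<and> l \<in> I \<and> x i = x l}, b) \<in> S \<longleftrightarrow>
        (\<exists>R\<in>Pow (I \<times> I) \<inter> {R. (R, b) \<in> S}. \<forall>i\<in>I. \<forall>l\<in>I. x i = x l \<longleftrightarrow> (i, l) \<in> R)" for x :: "nat \<Rightarrow> 's"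
    proof
      assume "({(i, l). i \<in> I \<and> l \<in> I \<and> x i = x l}, b) \<in> S"
      then show "\<exists>R\<in>Pow (I \<times> I) \<inter> {R. (R, b) \<in> S}. \<forall>i\<in>I. \<forall>l\<in>I. x i = x l \<longleftrightarrow> (i, l) \<in> R"
        by (intro bexI[of _ "{(i, l). i \<in> I \<and> l \<in> I \<and> x i = x l}"]) auto
    next
      assume "\<exists>R\<in>Pow (I \<times> I) \<inter> {R. (R, b) \<in> S}. \<forall>i\<in>I. \<forall>l\<in>I. x i = x l \<longleftrightarrow> (i, l) \<in> R"
      then obtain R where R: "R \<subseteq> I \<times> I" "(R, b) \<in> S" "\<forall>i\<in>I. \<forall>l\<in>I. x i = x l \<longleftrightarrow> (i, l) \<in> R" by auto
      then have "{(i, l). i \<in> I \<and> l \<in> I \<and> x i = x l} = R" by auto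
      then show "({(i, l). i \<in> I \<and> l \<in> I \<and> x i = x l}, b) \<in> S" using R by simp
    qed
    have [measurable]: "Measurable.pred (PiM I (\<lambda>_. borel :: 's measure)) (\<lambda>x. x i = x l)" if "i \<in> I" "l \<in> I" for i l
      unfolding pred_def using that by (intro measurable_equality_set) measurable
    have fin: "finite (Pow (I \<times> I) \<inter> {R. (R, b) \<in> S})" using I by simp
    show ?thesis unfolding * using I fin by measurable
  qed
  show ?thesis unfolding emeasure_pattern[OF sH I] by measurable
qed

lemma pattern_inj:
  assumes "inj y"
  shows "pattern I h (\<lambda>i. y (\<kappa> i)) = ({(i, l). i \<in> I \<and> l \<in> I \<and> \<kappa> i = \<kappa> l},
    restrict (\<lambda>i. restrict (\<lambda>k. h (y k)) (\<kappa> ` I) (\<kappa> i)) I)"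
proof -
  have "restrict (\<lambda>i. restrict (\<lambda>k. h (y k)) (\<kappa> ` I) (\<kappa> i)) I = restrict (\<lambda>i. h (y (\<kappa> i))) I"
    by (intro ext) auto
  then show ?thesis using inj_eq[OF assms] by (simp add: pattern_def)
qed

lemma nn_integral_hash_pattern:
  fixes G :: "'s::{second_countable_topology, t2_space} measure" and \<kappa> :: "nat \<Rightarrow> nat"
  assumes G: "nonatomic_prob G" and H: "strongly_universal J H" and mH: "measurable_hash H" and J: "1 \<le> J"
    and I: "finite I"
  shows "(\<integral>\<^sup>+Y. emeasure H {h \<in> space H. pattern I h (\<lambda>i. Y (\<kappa> i)) \<in> S} \<partial>PiM UNIV (\<lambda>_::nat. G))
    = emeasure (uniform_labels J) {L \<in> space (uniform_labels J). pattern I L \<kappa> \<in> S}"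
proof -
  have sH: "sets H = sets (PiM UNIV (\<lambda>_. count_space {1..J}))" using H by (simp add: strongly_universal_def)
  have GB: "sets G = sets borel" using G by (simp add: nonatomic_prob_def)
  interpret G: prob_space G using G by (simp add: nonatomic_prob_def)
  interpret P: prob_space "PiM UNIV (\<lambda>_::nat. G)" by (intro prob_space_PiM G.prob_space_axioms)
  interpret H: prob_space H using H by (simp add: strongly_universal_def)
  define K where "K = \<kappa> ` I"
  have K: "finite K" using I by (simp add: K_def)
  define B where "B = {b. ({(i, l). i \<in> I \<and> l \<in> I \<and> \<kappa> i = \<kappa> l}, restrict (\<lambda>i. b (\<kappa> i)) I) \<in> S}"
  have "(\<integral>\<^sup>+Y. emeasure H {h \<in> space H. pattern I h (\<lambda>i. Y (\<kappa> i)) \<in> S} \<partial>PiM UNIV (\<lambda>_::nat. G))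
      = (\<integral>\<^sup>+Y. (\<Sum>b\<in>PiE K (\<lambda>_. {1..J}) \<inter> B. emeasure H {h \<in> space H. \<forall>k\<in>K. h (Y k) = b k}) \<partial>PiM UNIV (\<lambda>_::nat. G))"
    using AE_PiM_distinct[OF G]
  proof (intro nn_integral_cong_AE, eventually_elim)
    case (elim Y)
    have "{h \<in> space H. pattern I h (\<lambda>i. Y (\<kappa> i)) \<in> S} = {h \<in> space H. restrict (\<lambda>k. h (Y k)) K \<in> B}"
      by (simp only: pattern_inj[OF elim(2)] B_def K_def mem_Collect_eq)
    then show ?case by (simp only: emeasure_hash_labels[OF sH K])
  qed
  also have "\<dots> = (\<Sum>b\<in>PiE K (\<lambda>_. {1..J}) \<inter> B. \<integral>\<^sup>+Y. emeasure H {h \<in> space H. \<forall>k\<in>K. h (Y k) = b k} \<partial>PiM UNIV (\<lambda>_::nat. G))"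
    unfolding H.emeasure_eq_measure
    by (intro nn_integral_sum measurable_compose[OF _ measurable_ennreal] measure_hash_measurable[OF mH GB K]) auto
  also have "\<dots> = (\<Sum>b\<in>PiE K (\<lambda>_. {1..J}) \<inter> B. ennreal ((1 / J) ^ card K))"
  proof (intro sum.cong refl)
    fix b assume b: "b \<in> PiE K (\<lambda>_. {1..J}) \<inter> B"
    have "(\<integral>\<^sup>+Y. ennreal (measure H {h \<in> space H. \<forall>k\<in>K. h (Y k) = b k}) \<partial>PiM UNIV (\<lambda>_::nat. G))
        = ennreal (\<integral>Y. measure H {h \<in> space H. \<forall>k\<in>K. h (Y k) = b k} \<partial>PiM UNIV (\<lambda>_::nat. G))"
      by (intro nn_integral_eq_integral P.integrable_const_bound[where B = 1] measure_hash_measurable[OF mH GB K]) auto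
    also have "\<dots> = ennreal ((1 / J) ^ card K)"
      using b by (subst hash_labels_independent[OF G H mH J K]) auto
    finally show "(\<integral>\<^sup>+Y. emeasure H {h \<in> space H. \<forall>k\<in>K. h (Y k) = b k} \<partial>PiM UNIV (\<lambda>_::nat. G)) = ennreal ((1 / J) ^ card K)"
      by (simp add: H.emeasure_eq_measure)
  qed
  also have "\<dots> = (\<Sum>b\<in>PiE K (\<lambda>_. {1..J}) \<inter> B. emeasure (uniform_labels J) {L \<in> space (uniform_labels J). \<forall>k\<in>K. L k = b k})"
    by (intro sum.cong refl, subst emeasure_uniform_labels[OF J K]) auto
  also have "\<dots> = emeasure (uniform_labels J) {L \<in> space (uniform_labels J). restrict L K \<in> B}"
    using emeasure_hash_labels[OF sets_uniform_labels K, where y = "\<lambda>k. k" and B = B] by simp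
  also have "\<dots> = emeasure (uniform_labels J) {L \<in> space (uniform_labels J). pattern I L \<kappa> \<in> S}"
  proof -
    have "pattern I L \<kappa> \<in> S \<longleftrightarrow> restrict L K \<in> B" for L :: "nat \<Rightarrow> nat"
      using pattern_inj[where y = "\<lambda>k::nat. k" and I = I and h = L and \<kappa> = \<kappa>] by (simp only: B_def K_def mem_Collect_eq inj_on_id2)
    then show ?thesis by simp
  qed
  finally show ?thesis .
qed

lemma nn_integral_pmf_measurable:
  assumes f: "\<And>x. x \<in> set_pmf p \<Longrightarrow> (\<lambda>h. f h x) \<in> borel_measurable H"
  shows "(\<lambda>h. \<integral>\<^sup>+x. f h x \<partial>measure_pmf p) \<in> borel_measurable H"
proof -
  interpret C: sigma_finite_measure "count_space (set_pmf p)"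
    by (rule sigma_finite_measure_count_space_countable) simp
  have eq: "(\<integral>\<^sup>+x. g x \<partial>measure_pmf p) = (\<integral>\<^sup>+x. ennreal (pmf p x) * g x \<partial>count_space (set_pmf p))" for g
    unfolding nn_integral_measure_pmf
    by (subst nn_integral_count_space_indicator[where X = "set_pmf p"])
      (auto intro!: nn_integral_cong simp: indicator_def set_pmf_iff)
  have "(\<lambda>(x, h). ennreal (pmf p x) * f h x) \<in> borel_measurable (count_space (set_pmf p) \<Otimes>\<^sub>M H)"
    using f by (intro measurable_pair_measure_countable1) auto
  from measurable_pair_swap[OF this]
  have "(\<lambda>(h, x). ennreal (pmf p x) * f h x) \<in> borel_measurable (H \<Otimes>\<^sub>M count_space (set_pmf p))"
    by (simp add: case_prod_unfold)
  then show ?thesis unfolding eq by (rule C.borel_measurable_nn_integral)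
qed

definition pattern_prob :: "nat set \<Rightarrow> ((nat \<times> nat) set \<times> (nat \<Rightarrow> nat)) set \<Rightarrow> 'a pmf \<Rightarrow> ('a \<Rightarrow> nat) \<Rightarrow> ennreal" where
  "pattern_prob I S P h = emeasure (measure_pmf (Pi_pmf I undefined (\<lambda>_. P))) {x. pattern I h x \<in> S}"

lemma pattern_restrict: "pattern I h (restrict x I) = pattern I h x"
  by (auto simp: pattern_def intro!: restrict_ext)

lemma pattern_prob_measurable:
  assumes H: "sets H = sets (PiM UNIV (\<lambda>_. count_space {1..J::nat}))" and I: "finite I"
  shows "pattern_prob I S P \<in> borel_measurable H"
proof -
  have "(\<lambda>h. \<integral>\<^sup>+x. indicator {x. pattern I h x \<in> S} x \<partial>measure_pmf (Pi_pmf I undefined (\<lambda>_. P))) \<in> borel_measurable H"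
  proof (rule nn_integral_pmf_measurable)
    fix x
    have "(\<lambda>h. indicator {h \<in> space H. pattern I h x \<in> S} h :: ennreal) \<in> borel_measurable H"
      by (intro borel_measurable_indicator pattern_event[OF H I])
    then show "(\<lambda>h. indicator {x. pattern I h x \<in> S} x :: ennreal) \<in> borel_measurable H"
      by (rule measurable_cong[THEN iffD1, rotated]) (auto simp: indicator_def)
  qed
  then show ?thesis by (simp add: pattern_prob_def[abs_def])
qed

lemma nn_integral_pattern_prob:
  assumes P: "prob_space H" and H: "sets H = sets (PiM UNIV (\<lambda>_. count_space {1..J::nat}))" and I: "finite I"
  shows "(\<integral>\<^sup>+h. pattern_prob I S p h \<partial>H)
    = (\<integral>\<^sup>+x. emeasure H {h \<in> space H. pattern I h x \<in> S} \<partial>measure_pmf (Pi_pmf I undefined (\<lambda>_. p)))"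
proof -
  interpret prob_space H by fact
  have m: "(\<lambda>h. indicator {x. pattern I h x \<in> S} x :: ennreal) \<in> borel_measurable H" for x
  proof -
    have "(\<lambda>h. indicator {h \<in> space H. pattern I h x \<in> S} h :: ennreal) \<in> borel_measurable H"
      by (intro borel_measurable_indicator pattern_event[OF H I])
    then show ?thesis
      by (rule measurable_cong[THEN iffD1, rotated]) (auto simp: indicator_def)
  qed
  have "(\<integral>\<^sup>+h. pattern_prob I S p h \<partial>H)
      = (\<integral>\<^sup>+h. \<integral>\<^sup>+x. indicator {x. pattern I h x \<in> S} x \<partial>measure_pmf (Pi_pmf I undefined (\<lambda>_. p)) \<partial>H)"
    by (simp add: pattern_prob_def)
  also have "\<dots> = (\<integral>\<^sup>+x. \<integral>\<^sup>+h. indicator {x. pattern I h x \<in> S} x \<partial>H \<partial>measure_pmf (Pi_pmf I undefined (\<lambda>_. p)))"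
    by (rule nn_integral_pmf_swap[OF sigma_finite_measure_axioms m])
  also have "\<dots> = (\<integral>\<^sup>+x. emeasure H {h \<in> space H. pattern I h x \<in> S} \<partial>measure_pmf (Pi_pmf I undefined (\<lambda>_. p)))"
  proof (intro nn_integral_cong)
    fix x
    have "(\<integral>\<^sup>+h. indicator {x. pattern I h x \<in> S} x \<partial>H) = (\<integral>\<^sup>+h. indicator {h \<in> space H. pattern I h x \<in> S} h \<partial>H)"
      by (intro nn_integral_cong) (auto simp: indicator_def)
    then show "(\<integral>\<^sup>+h. indicator {x. pattern I h x \<in> S} x \<partial>H) = emeasure H {h \<in> space H. pattern I h x \<in> S}"
      using pattern_event[OF H I] by simp
  qed
  finally show ?thesis .
qed

lemma weight_pmf_measurable:
  assumes N: "sets N = sets (PiM UNIV (\<lambda>_. borel \<Otimes>\<^sub>M G))"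
  shows "(\<lambda>z. pmf (weight_pmf z) k) \<in> borel_measurable N"
proof -
  note [measurable_cong] = N
  note [measurable] = good_points_measurable[OF N]
  have eq: "pmf (weight_pmf z) k = (if good_points z then fst (z k) / enn2real (\<Sum>i. ennreal (fst (z i)))
      else pmf (return_pmf 0) k)" for z :: "nat \<Rightarrow> real \<times> 'a"
  proof (cases "good_points z")
    case True
    then have "(\<Sum>i. ennreal (fst (z i))) = ennreal (\<Sum>i. fst (z i))" "0 < (\<Sum>i. fst (z i))"
      by (auto intro!: suminf_ennreal_bounds simp: good_points_def)
    then show ?thesis using True by (simp add: pmf_weight)
  qed (simp add: weight_pmf_def)
  show ?thesis unfolding eq by measurable
qed

text \<open>The sampled indices range over a countable set, so the probability is a countable sum of
  products of weights with indicators of label events, each measurable in the marked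
  sequence.\<close>

lemma pattern_prob_weight_measurable:
  assumes I: "finite I"
  shows "(\<lambda>z. pattern_prob I S (weight_pmf z) (\<lambda>k. snd (z k)))
    \<in> borel_measurable (PiM UNIV (\<lambda>_. borel \<Otimes>\<^sub>M uniform_count_measure {1..J}))" (is "_ \<in> borel_measurable ?N")
proof -
  define A where "A = PiE I (\<lambda>_. UNIV :: nat set)"
  have A: "countable A" unfolding A_def using I by (intro countable_PiE) auto
  interpret C: sigma_finite_measure "count_space A"
    by (rule sigma_finite_measure_count_space_countable) (rule A)
  have eq: "pattern_prob I S (weight_pmf z) (\<lambda>k. snd (z k)) = (\<integral>\<^sup>+\<kappa>. (\<Prod>i\<in>I. ennreal (pmf (weight_pmf z) (\<kappa> i))) *
      indicator {z \<in> space ?N. pattern I (\<lambda>k. snd (z k)) \<kappa> \<in> S} z \<partial>count_space A)" if z: "z \<in> space ?N" for z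
  proof -
    let ?p = "Pi_pmf I undefined (\<lambda>_. weight_pmf z)"
    have out: "pmf ?p \<kappa> = 0" if "\<kappa> \<notin> A" for \<kappa>
      using that by (intro pmf_Pi_outside[OF I]) (auto simp: A_def PiE_def extensional_def)
    have "pattern_prob I S (weight_pmf z) (\<lambda>k. snd (z k))
        = (\<integral>\<^sup>+\<kappa>. ennreal (pmf ?p \<kappa>) * indicator {\<kappa>. pattern I (\<lambda>k. snd (z k)) \<kappa> \<in> S} \<kappa> \<partial>count_space UNIV)"
      unfolding pattern_prob_def by (subst nn_integral_measure_pmf[symmetric]) simp
    also have "\<dots> = (\<integral>\<^sup>+\<kappa>. ennreal (pmf ?p \<kappa>) * indicator {\<kappa>. pattern I (\<lambda>k. snd (z k)) \<kappa> \<in> S} \<kappa> \<partial>count_space A)"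
      by (subst nn_integral_count_space_indicator[where X = A])
        (auto intro!: nn_integral_cong simp: indicator_def out A_def)
    also have "\<dots> = (\<integral>\<^sup>+\<kappa>. (\<Prod>i\<in>I. ennreal (pmf (weight_pmf z) (\<kappa> i))) *
        indicator {z \<in> space ?N. pattern I (\<lambda>k. snd (z k)) \<kappa> \<in> S} z \<partial>count_space A)"
    proof (intro nn_integral_cong arg_cong2[where f = "(*)"])
      fix \<kappa> assume "\<kappa> \<in> space (count_space A)"
      then have "pmf ?p \<kappa> = (\<Prod>i\<in>I. pmf (weight_pmf z) (\<kappa> i))"
        by (intro pmf_Pi'[OF I]) (auto simp: A_def PiE_def extensional_def)
      then show "ennreal (pmf ?p \<kappa>) = (\<Prod>i\<in>I. ennreal (pmf (weight_pmf z) (\<kappa> i)))"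
        by (simp add: prod_ennreal)
    qed (use z in \<open>auto simp: indicator_def\<close>)
    finally show ?thesis .
  qed
  have "(\<lambda>z. \<integral>\<^sup>+\<kappa>. (\<Prod>i\<in>I. ennreal (pmf (weight_pmf z) (\<kappa> i))) *
      indicator {z \<in> space ?N. pattern I (\<lambda>k. snd (z k)) \<kappa> \<in> S} z \<partial>count_space A) \<in> borel_measurable ?N"
  proof (rule C.borel_measurable_nn_integral)
    have "(\<lambda>(\<kappa>, z). (\<Prod>i\<in>I. ennreal (pmf (weight_pmf z) (\<kappa> i))) *
        indicator {z \<in> space ?N. pattern I (\<lambda>k. snd (z k)) \<kappa> \<in> S} z) \<in> borel_measurable (count_space A \<Otimes>\<^sub>M ?N)"
    proof (intro measurable_pair_measure_countable1[OF A])
      fix \<kappa>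
      have [measurable]: "(\<lambda>z. pmf (weight_pmf z) k) \<in> borel_measurable ?N" for k
        by (rule weight_pmf_measurable) (rule refl)
      have l: "(\<lambda>z k. snd (z k)) \<in> ?N \<rightarrow>\<^sub>M uniform_labels J"
        by (intro measurable_PiM_single') (auto simp: space_PiM space_pair_measure PiE_iff mem_Times_iff)
      have "{z \<in> space ?N. pattern I (\<lambda>k. snd (z k)) \<kappa> \<in> S}
          = (\<lambda>z k. snd (z k)) -` {L \<in> space (uniform_labels J). pattern I L \<kappa> \<in> S} \<inter> space ?N"
        using measurable_space[OF l] by auto
      also have "\<dots> \<in> sets ?N"
        by (rule measurable_sets[OF l pattern_event[OF sets_uniform_labels I]])
      finally have [measurable]: "{z \<in> space ?N. pattern I (\<lambda>k. snd (z k)) \<kappa> \<in> S} \<in> sets ?N" .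
      show "(\<lambda>z. case (\<kappa>, z) of (\<kappa>, z) \<Rightarrow> (\<Prod>i\<in>I. ennreal (pmf (weight_pmf z) (\<kappa> i))) *
        indicator {z \<in> space ?N. pattern I (\<lambda>k. snd (z k)) \<kappa> \<in> S} z) \<in> borel_measurable ?N"
        by (simp only: prod.case) measurable
    qed
    from measurable_pair_swap[OF this]
    show "(\<lambda>(z, \<kappa>). (\<Prod>i\<in>I. ennreal (pmf (weight_pmf z) (\<kappa> i))) *
        indicator {z \<in> space ?N. pattern I (\<lambda>k. snd (z k)) \<kappa> \<in> S} z) \<in> borel_measurable (?N \<Otimes>\<^sub>M count_space A)"
      by (simp add: case_prod_unfold)
  qed
  then show ?thesis by (rule measurable_cong[THEN iffD1, rotated]) (simp add: eq)
qed

lemma nn_integral_Pi_pmf_map: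
  assumes I: "finite I"
  shows "(\<integral>\<^sup>+x. g (restrict x I) \<partial>measure_pmf (Pi_pmf I undefined (\<lambda>_. map_pmf Y p)))
    = (\<integral>\<^sup>+\<kappa>. g (restrict (\<lambda>i. Y (\<kappa> i)) I) \<partial>measure_pmf (Pi_pmf I undefined (\<lambda>_. p)))"
proof -
  \<comment> \<open>Mapping coordinates by \<open>Y\<close> sends the default value to
    \<open>Y undefined\<close>. The default is swapped back to \<open>undefined\<close>, and the
    restriction to \<open>I\<close> hides it on both sides.\<close>
  have "Pi_pmf I undefined (\<lambda>_. map_pmf Y p)
      = map_pmf (\<lambda>f x. if x \<in> I then f x else undefined) (Pi_pmf I (Y undefined) (\<lambda>_. map_pmf Y p))"
    by (rule Pi_pmf_default_swap[OF I, symmetric])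
  also have "Pi_pmf I (Y undefined) (\<lambda>_. map_pmf Y p) = map_pmf (\<lambda>h. Y \<circ> h) (Pi_pmf I undefined (\<lambda>_. p))"
    by (rule Pi_pmf_map[OF I]) simp
  finally have *: "Pi_pmf I undefined (\<lambda>_. map_pmf Y p)
      = map_pmf (\<lambda>f x. if x \<in> I then f x else undefined) (map_pmf (\<lambda>h. Y \<circ> h) (Pi_pmf I undefined (\<lambda>_. p)))" .
  have "restrict (\<lambda>x. if x \<in> I then (Y \<circ> \<kappa>) x else undefined) I = restrict (\<lambda>i. Y (\<kappa> i)) I" for \<kappa>
    by (auto simp: restrict_def)
  then show ?thesis unfolding * by simp
qed

text \<open>The reduced model: the atoms are the indices of the Poisson points with their weights,
  and the hash function is an iid uniform mark of each index. Bucket masses become sums over a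
  marked Poisson process.\<close>

definition expect_model :: "nat \<Rightarrow> (nat \<Rightarrow> real \<times> 'a) measure \<Rightarrow> (nat pmf \<Rightarrow> (nat \<Rightarrow> nat) \<Rightarrow> ennreal) \<Rightarrow> ennreal" where
  "expect_model J N F = (\<integral>\<^sup>+z. F (weight_pmf z) (\<lambda>k. snd (z k)) \<partial>marked N (uniform_count_measure {1..J}))"

text \<open>The hash is integrated out for each fixed sample, which leaves a measurable function of
  the sample. Its expectation does not see the enumeration of the points, so the positions may be
  taken independent of the weights; integrating them out before the sampled indices makes the labels
  iid uniform.\<close>

lemma pattern_prob_transfer:
  fixes G :: "'s::{second_countable_topology, t2_space} measure"
  assumes \<rho>: "levy_density \<rho>" and \<theta>: "0 < \<theta>" and G: "nonatomic_prob G"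
    and N: "laplace_poisson (levy_intensity \<theta> G \<rho>) N"
    and J: "1 \<le> J" and H: "strongly_universal J H" and mH: "measurable_hash H" and I: "finite I"
  shows "(\<lambda>P. \<integral>\<^sup>+h. pattern_prob I S P h \<partial>H) \<in> borel_measurable discrete_distr_space"
    and "(\<integral>\<^sup>+P. \<integral>\<^sup>+h. pattern_prob I S P h \<partial>H \<partial>distr N discrete_distr_space normalized_measure)
      = expect_model J N (pattern_prob I S)"
proof -
  have PG: "prob_space G" and GB: "sets G = sets borel" using G by (auto simp: nonatomic_prob_def)
  have \<rho>m: "set_borel_measurable lborel {0<..} \<rho>" using \<rho> by (simp add: levy_density_def)
  interpret G: prob_space G by fact
  interpret PY: prob_space "PiM UNIV (\<lambda>_::nat. G)" by (intro prob_space_PiM PG)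
  interpret U: prob_space "uniform_labels J" by (intro prob_space_PiM prob_space_uniform_labels J)
  have sH: "sets H = sets (PiM UNIV (\<lambda>_. count_space {1..J}))" and PH: "prob_space H"
    using H by (auto simp: strongly_universal_def)
  define g where "g x = emeasure H {h \<in> space H. pattern I h x \<in> S}" for x
  have gr: "g (restrict x I) = g x" for x by (simp add: g_def pattern_restrict)
  have gm [measurable]: "g \<in> borel_measurable (PiM I (\<lambda>_. borel))"
    unfolding g_def[abs_def] by (rule emeasure_pattern_measurable[OF H mH I])
  have inner: "(\<integral>\<^sup>+h. pattern_prob I S P h \<partial>H)
      = (\<integral>\<^sup>+x. g (restrict x I) \<partial>measure_pmf (Pi_pmf I undefined (\<lambda>_. P)))" for P
    unfolding gr unfolding g_def by (rule nn_integral_pattern_prob[OF PH sH I])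
  show meas: "(\<lambda>P. \<integral>\<^sup>+h. pattern_prob I S P h \<partial>H) \<in> borel_measurable discrete_distr_space"
    unfolding inner by (rule nn_integral_Pi_pmf_measurable[OF I gm])
  have nmm: "normalized_measure \<in> PiM UNIV (\<lambda>_. borel \<Otimes>\<^sub>M G) \<rightarrow>\<^sub>M discrete_distr_space"
    by (rule normalized_measure_measurable[OF refl GB])
  have "(\<integral>\<^sup>+P. \<integral>\<^sup>+h. pattern_prob I S P h \<partial>H \<partial>distr N discrete_distr_space normalized_measure)
      = (\<integral>\<^sup>+w. \<integral>\<^sup>+x. g (restrict x I) \<partial>measure_pmf (Pi_pmf I undefined (\<lambda>_. normalized_measure w)) \<partial>N)"
    using meas by (subst nn_integral_distr[OF normalized_measure_measurable[OF sets_laplace_levy[OF N] GB]]) (auto simp: inner)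
  \<comment> \<open>Marking \<open>N\<close> by \<open>G\<close> itself gives another sequence with
    the same intensity, in which the positions are independent of the weights.\<close>
  also have "\<dots> = (\<integral>\<^sup>+w. \<integral>\<^sup>+x. g (restrict x I) \<partial>measure_pmf (Pi_pmf I undefined (\<lambda>_. normalized_measure w)) \<partial>marked N G)"
    by (rule nn_integral_normalized_measure_eq[OF \<rho> \<theta> PG GB N laplace_marked[OF \<rho>m PG N PG] I gm])
  also have "\<dots> = (\<integral>\<^sup>+w. \<integral>\<^sup>+Y. \<integral>\<^sup>+x. g (restrict x I) \<partial>measure_pmf (Pi_pmf I undefined
      (\<lambda>_. normalized_measure (\<lambda>k. (fst (w k), Y k)))) \<partial>PiM UNIV (\<lambda>_. G) \<partial>N)"
    by (rule nn_integral_marked[OF N PG measurable_compose[OF nmm nn_integral_Pi_pmf_measurable[OF I gm]]])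
  also have "\<dots> = (\<integral>\<^sup>+w. \<integral>\<^sup>+L. pattern_prob I S (weight_pmf w) L \<partial>uniform_labels J \<partial>N)"
    using AE_good_points[OF \<rho> \<theta> PG N]
  proof (intro nn_integral_cong_AE, eventually_elim)
    case (elim w)
    have w: "weight_pmf (\<lambda>k. (fst (w k), Y k)) = weight_pmf w" "good_points (\<lambda>k. (fst (w k), Y k))" for Y :: "nat \<Rightarrow> 's"
      using elim by (simp_all add: weight_pmf_def good_points_def)
    have "(\<integral>\<^sup>+Y. \<integral>\<^sup>+x. g (restrict x I) \<partial>measure_pmf (Pi_pmf I undefined
        (\<lambda>_. normalized_measure (\<lambda>k. (fst (w k), Y k)))) \<partial>PiM UNIV (\<lambda>_. G))
      = (\<integral>\<^sup>+Y. \<integral>\<^sup>+\<kappa>. g (restrict (\<lambda>i. Y (\<kappa> i)) I) \<partial>measure_pmf (Pi_pmf I undefined (\<lambda>_. weight_pmf w)) \<partial>PiM UNIV (\<lambda>_. G))"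
      by (simp add: normalized_measure_eq w nn_integral_Pi_pmf_map[OF I])
    also have "\<dots> = (\<integral>\<^sup>+\<kappa>. \<integral>\<^sup>+Y. g (restrict (\<lambda>i. Y (\<kappa> i)) I) \<partial>PiM UNIV (\<lambda>_. G) \<partial>measure_pmf (Pi_pmf I undefined (\<lambda>_. weight_pmf w)))"
    proof (rule nn_integral_pmf_swap[OF PY.sigma_finite_measure_axioms])
      fix \<kappa> :: "nat \<Rightarrow> nat"
      have "(\<lambda>Y. restrict (\<lambda>i. Y (\<kappa> i)) I) \<in> PiM UNIV (\<lambda>_. G) \<rightarrow>\<^sub>M PiM I (\<lambda>_. borel)"
      proof (rule measurable_restrict)
        fix i
        have "(\<lambda>Y. Y (\<kappa> i)) \<in> PiM UNIV (\<lambda>_. G) \<rightarrow>\<^sub>M G" by simp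
        then show "(\<lambda>Y. Y (\<kappa> i)) \<in> borel_measurable (PiM UNIV (\<lambda>_. G))"
          using measurable_cong_sets[OF refl GB] by blast
      qed
      then show "(\<lambda>Y. g (restrict (\<lambda>i. Y (\<kappa> i)) I)) \<in> borel_measurable (PiM UNIV (\<lambda>_. G))"
        by (rule measurable_compose) (rule gm)
    qed
    also have "\<dots> = (\<integral>\<^sup>+\<kappa>. emeasure (uniform_labels J) {L \<in> space (uniform_labels J). pattern I L \<kappa> \<in> S}
        \<partial>measure_pmf (Pi_pmf I undefined (\<lambda>_. weight_pmf w)))"
      unfolding gr unfolding g_def by (subst nn_integral_hash_pattern[OF G H mH J I]) (rule refl)
    also have "\<dots> = (\<integral>\<^sup>+L. pattern_prob I S (weight_pmf w) L \<partial>uniform_labels J)"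
      by (rule nn_integral_pattern_prob[OF U.prob_space_axioms sets_uniform_labels I, symmetric])
    finally show ?case .
  qed
  also have "\<dots> = (\<integral>\<^sup>+w. \<integral>\<^sup>+L. pattern_prob I S (weight_pmf (\<lambda>k. (fst (w k), L k))) (\<lambda>k. snd (fst (w k), L k))
      \<partial>uniform_labels J \<partial>N)"
    by (simp add: weight_pmf_def good_points_def cong: if_cong)
  also have "\<dots> = expect_model J N (pattern_prob I S)"
    unfolding expect_model_def
    by (rule nn_integral_marked[OF N prob_space_uniform_labels[OF J] pattern_prob_weight_measurable[OF I], symmetric])
  finally show "(\<integral>\<^sup>+P. \<integral>\<^sup>+h. pattern_prob I S P h \<partial>H \<partial>distr N discrete_distr_space normalized_measure)
      = expect_model J N (pattern_prob I S)" .
qed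

lemma expect_P_h_eq_nn_integral:
  assumes H: "prob_space H" and sQ: "sets Q = sets discrete_distr_space"
    and F: "\<And>P. F P \<in> borel_measurable H" "\<And>P h. F P h \<le> 1"
    and E: "(\<lambda>P. \<integral>\<^sup>+h. F P h \<partial>H) \<in> borel_measurable discrete_distr_space"
  shows "expect_P_h Q H (\<lambda>P h. enn2real (F P h)) = enn2real (\<integral>\<^sup>+P. \<integral>\<^sup>+h. F P h \<partial>H \<partial>Q)"
proof -
  interpret prob_space H by fact
  have fin: "F P h < top" for P h using F(2)[of P h] by (rule le_less_trans) simp
  have le: "(\<integral>\<^sup>+h. F P h \<partial>H) \<le> 1" for P
    using nn_integral_mono[of H "F P" "\<lambda>_. 1"] F(2) by (simp add: emeasure_space_1)
  have fin2: "(\<integral>\<^sup>+h. F P h \<partial>H) < top" for P using le[of P] by (rule le_less_trans) simp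
  have inner: "(\<integral>h. enn2real (F P h) \<partial>H) = enn2real (\<integral>\<^sup>+h. F P h \<partial>H)" for P
    using F(1) fin by (subst integral_eq_nn_integral) auto
  have [measurable]: "(\<lambda>P. \<integral>\<^sup>+h. F P h \<partial>H) \<in> borel_measurable Q"
    using E measurable_cong_sets[OF sQ refl] by blast
  show ?thesis
    unfolding expect_P_h_def inner using fin2
    by (subst integral_eq_nn_integral) auto
qed

section \<open>The estimators as moments of bucket masses\<close>

definition label_mass :: "'a pmf \<Rightarrow> ('a \<Rightarrow> nat) \<Rightarrow> nat \<Rightarrow> ennreal" where
  "label_mass P h k = emeasure (measure_pmf P) {s. h s = k}"

text \<open>The sum \<open>S\<^sub>j\<close> of the squared weights in bucket \<open>j\<close>, as
  the mean of the weight of a sampled atom that falls into the bucket.\<close>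

definition square_mass :: "'a pmf \<Rightarrow> ('a \<Rightarrow> nat) \<Rightarrow> nat \<Rightarrow> ennreal" where
  "square_mass P h k = (\<integral>\<^sup>+s. indicator {s. h s = k} s * ennreal (pmf P s) \<partial>measure_pmf P)"

lemma emeasure_Pi_pmf_Pi:
  "finite I \<Longrightarrow> emeasure (measure_pmf (Pi_pmf I d (\<lambda>_. P))) (Pi I B) = (\<Prod>i\<in>I. emeasure (measure_pmf P) (B i))"
  by (simp add: measure_pmf.emeasure_eq_measure measure_Pi_pmf_Pi prod_ennreal)

text \<open>Conditioning on the value \<open>y\<close> at \<open>i0\<close>: the coincidence
  contributes the weight of \<open>y\<close> at \<open>i1\<close>, and the remaining coordinates
  stay independent.\<close>

lemma emeasure_Pi_pmf_coincidence:
  assumes I: "finite I" "i0 \<in> I" "i1 \<in> I" "i0 \<noteq> i1"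
  shows "emeasure (measure_pmf (Pi_pmf I d (\<lambda>_. P)))
      {x. x i0 = x i1 \<and> h (x i0) = j \<and> (\<forall>i\<in>I - {i0, i1}. x i \<in> B i)}
    = square_mass P h j * (\<Prod>i\<in>I - {i0, i1}. emeasure (measure_pmf P) (B i))"
proof -
  define A where "A = I - {i0}"
  have A: "finite A" "i0 \<notin> A" "I = insert i0 A" "i1 \<in> A" "A - {i1} = I - {i0, i1}" using I by (auto simp: A_def)
  have inner: "(\<integral>\<^sup>+f. indicator {x. x i0 = x i1 \<and> h (x i0) = j \<and> (\<forall>i\<in>I - {i0, i1}. x i \<in> B i)} (f(i0 := y)) \<partial>measure_pmf (Pi_pmf A d (\<lambda>_. P)))
      = indicator {s. h s = j} y * ennreal (pmf P y) * (\<Prod>i\<in>I - {i0, i1}. emeasure (measure_pmf P) (B i))" for y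
  proof -
    have "(\<integral>\<^sup>+f. indicator {x. x i0 = x i1 \<and> h (x i0) = j \<and> (\<forall>i\<in>I - {i0, i1}. x i \<in> B i)} (f(i0 := y)) \<partial>measure_pmf (Pi_pmf A d (\<lambda>_. P)))
       = (\<integral>\<^sup>+f. indicator {s. h s = j} y * indicator (Pi A (B(i1 := {y}))) f \<partial>measure_pmf (Pi_pmf A d (\<lambda>_. P)))"
      using I A by (intro nn_integral_cong) (auto simp: indicator_def Pi_iff)
    also have "\<dots> = indicator {s. h s = j} y * (\<Prod>i\<in>A. emeasure (measure_pmf P) ((B(i1 := {y})) i))"
      using A by (subst nn_integral_cmult) (auto simp: emeasure_Pi_pmf_Pi)
    also have "(\<Prod>i\<in>A. emeasure (measure_pmf P) ((B(i1 := {y})) i))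
        = emeasure (measure_pmf P) {y} * (\<Prod>i\<in>A - {i1}. emeasure (measure_pmf P) (B i))"
      using A by (subst prod.remove[of A i1]) auto
    finally show ?thesis by (simp only: A(5) emeasure_pmf_single mult.assoc)
  qed
  have "emeasure (measure_pmf (Pi_pmf I d (\<lambda>_. P)))
      {x. x i0 = x i1 \<and> h (x i0) = j \<and> (\<forall>i\<in>I - {i0, i1}. x i \<in> B i)}
    = (\<integral>\<^sup>+x. indicator {x. x i0 = x i1 \<and> h (x i0) = j \<and> (\<forall>i\<in>I - {i0, i1}. x i \<in> B i)} x \<partial>measure_pmf (Pi_pmf I d (\<lambda>_. P)))"
    by simp
  also have "\<dots> = (\<integral>\<^sup>+y. \<integral>\<^sup>+f. indicator {x. x i0 = x i1 \<and> h (x i0) = j \<and> (\<forall>i\<in>I - {i0, i1}. x i \<in> B i)} (f(i0 := y))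
      \<partial>measure_pmf (Pi_pmf A d (\<lambda>_. P)) \<partial>measure_pmf P)"
    unfolding A(3) Pi_pmf_insert[OF A(1,2)]
    by (simp only: nn_integral_map_pmf nn_integral_pair_pmf' prod.case)
  also have "\<dots> = square_mass P h j * (\<Prod>i\<in>I - {i0, i1}. emeasure (measure_pmf P) (B i))"
    unfolding inner square_mass_def by (rule nn_integral_multc) simp
  finally show ?thesis .
qed

text \<open>Among \<open>m + 2\<close> draws the first two coincide and fall into bucket
  \<open>j\<close>, and the other \<open>m\<close> avoid the bucket. The probability
  \<open>S\<^sub>j (1 - q\<^sub>j) ^ m\<close> yields, up to the factor \<open>m + 1\<close>, the
  terms of the expansion of \<open>S\<^sub>j / q\<^sub>j\<^sup>2\<close>.\<close>

definition ratio_patterns :: "nat \<Rightarrow> nat \<Rightarrow> ((nat \<times> nat) set \<times> (nat \<Rightarrow> nat)) set" where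
  "ratio_patterns j m = {(R, b). (0, 1) \<in> R \<and> b 0 = j \<and> (\<forall>i\<in>{2..<m + 2}. b i \<noteq> j)}"

lemma label_mass_le_1: "label_mass P h k \<le> 1"
  unfolding label_mass_def using measure_pmf.emeasure_le_1[of P] by simp

lemma pattern_prob_ratio:
  "pattern_prob {..<m + 2} (ratio_patterns j m) P h = square_mass P h j * (1 - label_mass P h j) ^ m"
proof -
  have "emeasure (measure_pmf P) {s. h s \<noteq> j} = 1 - label_mass P h j"
  proof -
    have "{s. h s \<noteq> j} = space (measure_pmf P) - {s. h s = j}" by auto
    then show ?thesis
      by (simp only:, subst emeasure_compl) (auto simp: label_mass_def measure_pmf.emeasure_space_1[simplified])
  qed
  moreover have "{x. pattern {..<m + 2} h x \<in> ratio_patterns j m}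
      = {x. x 0 = x 1 \<and> h (x 0) = j \<and> (\<forall>i\<in>{..<m + 2} - {0, 1}. x i \<in> {s. h s \<noteq> j})}"
    by (auto simp: pattern_def ratio_patterns_def)
  moreover have "emeasure (measure_pmf (Pi_pmf {..<m + 2} undefined (\<lambda>_. P)))
      {x. x 0 = x 1 \<and> h (x 0) = j \<and> (\<forall>i\<in>{..<m + 2} - {0, 1}. x i \<in> {s. h s \<noteq> j})}
      = square_mass P h j * (\<Prod>i\<in>{..<m + 2} - {0, 1}. emeasure (measure_pmf P) {s. h s \<noteq> j})"
    by (rule emeasure_Pi_pmf_coincidence) auto
  moreover have "card ({..<m + 2} - {0, 1}) = m" by (subst card_Diff_subset) auto
  ultimately show ?thesis
    unfolding pattern_prob_def by (simp only: prod_constant)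
qed

text \<open>The ratio \<open>S\<^sub>j / q\<^sub>j\<^sup>2\<close> defined as a series of pattern
  probabilities, so that a ratio of random masses can be transferred to the reduced model term by
  term.\<close>

definition square_ratio :: "'a pmf \<Rightarrow> ('a \<Rightarrow> nat) \<Rightarrow> nat \<Rightarrow> ennreal" where
  "square_ratio P h j = (\<Sum>m. of_nat (Suc m) * pattern_prob {..<m + 2} (ratio_patterns j m) P h)"

lemma square_mass_le: "square_mass P h j \<le> label_mass P h j ^ 2"
proof -
  have "square_mass P h j \<le> (\<integral>\<^sup>+s. indicator {s. h s = j} s * label_mass P h j \<partial>measure_pmf P)"
    unfolding square_mass_def
  proof (intro nn_integral_mono)
    fix s
    have "ennreal (pmf P s) \<le> label_mass P h j" if "h s = j"
      using that unfolding label_mass_def emeasure_pmf_single[symmetric] by (intro emeasure_mono) auto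
    then show "indicator {s. h s = j} s * ennreal (pmf P s) \<le> indicator {s. h s = j} s * label_mass P h j"
      by (auto simp: indicator_def)
  qed
  then show ?thesis by (simp add: nn_integral_multc label_mass_def power2_eq_square)
qed

text \<open>The value of \<open>\<Sum>k (k + 1) (1 - q)^k\<close> is \<open>1 / q\<^sup>2\<close>; the bound on \<open>a\<close> covers \<open>q = 0\<close>.\<close>

lemma geometric_square_series:
  assumes q: "q \<le> 1" and a: "a \<le> q ^ 2"
  shows "(\<Sum>m. of_nat (Suc m) * (a * (1 - q) ^ m)) = a / (q ^ 2 :: ennreal)"
proof -
  obtain r where r: "q = ennreal r" "0 \<le> r" "r \<le> 1"
    using q by (cases q) (auto simp: ennreal_le_1 top_unique)
  have S: "(\<Sum>m. of_nat (Suc m) * (a * (1 - q) ^ m)) = a * (\<Sum>m. ennreal (real (Suc m) * (1 - r) ^ m))"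
  proof -
    have "of_nat (Suc m) * (a * (1 - q) ^ m) = a * ennreal (real (Suc m) * (1 - r) ^ m)" for m
    proof -
      have "(1 - q) ^ m = ennreal ((1 - r) ^ m)"
        using r by (simp add: ennreal_minus ennreal_power flip: ennreal_1)
      moreover have "of_nat (Suc m) = ennreal (real (Suc m))" by (simp add: ennreal_of_nat_eq_real_of_nat)
      ultimately show ?thesis by (simp only: ennreal_mult'[of "real (Suc m)"] of_nat_0_le_iff mult_ac)
    qed
    then show ?thesis by (simp only: ennreal_suminf_cmult)
  qed
  show ?thesis
  proof (cases "r = 0")
    case True
    then show ?thesis using a r S by simp
  next
    case False
    then have "(\<lambda>m. real (Suc m) * (1 - r) ^ m) sums (1 / (1 - (1 - r)) ^ 2)"
      using r by (intro geometric_deriv_sums) auto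
    then have "(\<Sum>m. ennreal (real (Suc m) * (1 - r) ^ m)) = ennreal (1 / r ^ 2)"
      using r by (intro suminf_ennreal_eq) auto
    then show ?thesis
      unfolding S using False r
      by (simp only:) (simp add: divide_ennreal_def ennreal_power inverse_ennreal divide_inverse)
  qed
qed

lemma square_ratio_eq: "square_ratio P h j = square_mass P h j / label_mass P h j ^ 2"
  unfolding square_ratio_def pattern_prob_ratio by (rule geometric_square_series[OF label_mass_le_1 square_mass_le])

lemma square_ratio_le_1: "square_ratio P h j \<le> 1"
proof -
  have "square_ratio P h j \<le> label_mass P h j ^ 2 / label_mass P h j ^ 2"
    unfolding square_ratio_eq by (intro divide_right_mono_ennreal square_mass_le)
  also have "\<dots> \<le> 1" by (rule divide_self_le_1)
  finally show ?thesis .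
qed

lemma infsum_ratio_eq:
  "(\<Sum>\<^sub>\<infinity>s\<in>bucket P h j. (pmf P s / bucket_mass P h j)\<^sup>2) = enn2real (square_ratio P h j)"
proof -
  have bm: "bucket_mass P h j = measure (measure_pmf P) {s. h s = j}"
  proof -
    have "measure (measure_pmf P) {s. h s = j} = measure (measure_pmf P) (bucket P h j)"
      by (intro measure_prob_cong_0) (auto simp: bucket_def set_pmf_iff)
    also have "\<dots> = infsetsum (pmf P) (bucket P h j)" by (rule measure_pmf_conv_infsetsum)
    also have "\<dots> = bucket_mass P h j"
      unfolding bucket_mass_def by (rule infsetsum_infsum) (rule pmf_abs_summable)
    finally show ?thesis ..
  qed
  define q where "q = bucket_mass P h j"
  have q: "label_mass P h j = ennreal q" "0 \<le> q"
    by (auto simp: label_mass_def q_def bm measure_pmf.emeasure_eq_measure)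
  have sum2: "Infinite_Set_Sum.abs_summable_on (\<lambda>s. (pmf P s)\<^sup>2) (bucket P h j)"
    by (rule Infinite_Set_Sum.abs_summable_on_comparison_test[OF pmf_abs_summable[of P]])
      (auto simp: power2_eq_square pmf_le_1 mult_left_le)
  have "square_mass P h j = (\<integral>\<^sup>+s. ennreal ((pmf P s)\<^sup>2) \<partial>count_space (bucket P h j))"
    unfolding square_mass_def nn_integral_measure_pmf
    by (subst nn_integral_count_space_indicator[where X = "bucket P h j"])
      (auto intro!: nn_integral_cong simp: indicator_def bucket_def set_pmf_iff power2_eq_square ennreal_mult)
  also have "\<dots> = ennreal (infsum (\<lambda>s. (pmf P s)\<^sup>2) (bucket P h j))"
    by (subst nn_integral_conv_infsetsum) (auto simp: sum2 infsetsum_infsum)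
  finally have sm: "square_mass P h j = ennreal (infsum (\<lambda>s. (pmf P s)\<^sup>2) (bucket P h j))" .
  have "(\<Sum>\<^sub>\<infinity>s\<in>bucket P h j. (pmf P s / q)\<^sup>2) = (\<Sum>\<^sub>\<infinity>s\<in>bucket P h j. (pmf P s)\<^sup>2) / q\<^sup>2"
  proof -
    have "(pmf P s / q)\<^sup>2 = (pmf P s)\<^sup>2 * inverse (q\<^sup>2)" for s
      by (simp add: power_divide divide_inverse power_mult_distrib power_inverse)
    then show ?thesis
      using infsum_cmult_left'[of "\<lambda>s. (pmf P s)\<^sup>2" "inverse (q\<^sup>2)" "bucket P h j"]
      by (simp only: divide_inverse)
  qed
  moreover have "enn2real (square_ratio P h j) = (\<Sum>\<^sub>\<infinity>s\<in>bucket P h j. (pmf P s)\<^sup>2) / q\<^sup>2"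
  \<comment> \<open>For a bucket of mass 0 the square mass vanishes as well; division by 0 gives 0
    in the reals, and \<open>0 / 0 = 0\<close> in \<open>[0, \<infinity>]\<close>.\<close>
  proof (cases "q = 0")
    case True
    then have "square_mass P h j = 0" using square_mass_le[of P h j] q by simp
    then show ?thesis using True by (simp add: square_ratio_eq)
  next
    case False
    then show ?thesis
      using q by (simp add: square_ratio_eq sm ennreal_power divide_ennreal infsum_nonneg)
  qed
  ultimately show ?thesis by (simp add: q_def)
qed

definition label_product :: "nat \<Rightarrow> 'a pmf \<Rightarrow> ('a \<Rightarrow> nat) \<Rightarrow> (nat \<Rightarrow> nat) \<Rightarrow> ennreal" where
  "label_product J P h c = (\<Prod>k\<in>{1..J}. label_mass P h k ^ c k)"

lemma prod_label_mass:
  assumes A: "finite A" and b: "\<And>l. l \<in> A \<Longrightarrow> b l \<in> {1..J}"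
  shows "(\<Prod>l\<in>A. label_mass P h (b l)) = label_product J P h (\<lambda>k. card {l \<in> A. b l = k})"
proof -
  have "(\<Prod>l\<in>A. label_mass P h (b l)) = (\<Prod>k\<in>{1..J}. \<Prod>l | l \<in> A \<and> b l = k. label_mass P h (b l))"
    using A b by (intro prod.group[symmetric]) auto
  also have "\<dots> = (\<Prod>k\<in>{1..J}. label_mass P h k ^ card {l \<in> A. b l = k})"
    by (intro prod.cong refl) simp
  finally show ?thesis by (simp add: label_product_def)
qed

text \<open>The assignments of labels to the first \<open>n\<close> draws that produce the sketch
  \<open>c\<close>. Their number is a multinomial coefficient when \<open>c\<close> has total
  \<open>n\<close>.\<close>

definition label_vectors :: "nat \<Rightarrow> nat \<Rightarrow> (nat \<Rightarrow> nat) \<Rightarrow> (nat \<Rightarrow> nat) set" where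
  "label_vectors J n c = {b \<in> PiE {1..n} (\<lambda>_. {1..J}). \<forall>k\<in>{1..J}. card {i \<in> {1..n}. b i = k} = c k}"

lemma finite_label_vectors: "finite (label_vectors J n c)"
  by (rule finite_subset[of _ "PiE {1..n} (\<lambda>_. {1..J})"]) (auto simp: label_vectors_def intro: finite_PiE)

text \<open>A bijection of \<open>{1..n}\<close> with a set of \<open>c k\<close> tagged copies of
  each label \<open>k\<close> lists the labels with the required multiplicities. Nonemptiness is
  what allows the number of label vectors to be cancelled in the posterior.\<close>

lemma label_vectors_nonempty:
  assumes "(\<Sum>k=1..J. c k) = n"
  shows "label_vectors J n c \<noteq> {}"
proof -
  define D where "D = (SIGMA k:{1..J}. {..<c k})"
  have D: "finite D" "card D = n" using assms by (auto simp: D_def card_SigmaI)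
  obtain e where e: "bij_betw e {1..n} D"
    using finite_same_card_bij[of "{1..n}" D] D by auto
  define b where "b = restrict (\<lambda>i. fst (e i)) {1..n}"
  have "card {i \<in> {1..n}. b i = k} = c k" if "k \<in> {1..J}" for k
  proof -
    have "bij_betw e {i \<in> {1..n}. b i = k} ({k} \<times> {..<c k})"
    proof (rule bij_betw_subset[OF e])
      show "e ` {i \<in> {1..n}. b i = k} = {k} \<times> {..<c k}"
      proof (intro set_eqI iffI)
        fix d assume "d \<in> e ` {i \<in> {1..n}. b i = k}"
        then obtain i where "i \<in> {1..n}" "fst (e i) = k" "d = e i" by (auto simp: b_def)
        then show "d \<in> {k} \<times> {..<c k}" using bij_betwE[OF e] by (force simp: D_def)
      next
        fix d assume d: "d \<in> {k} \<times> {..<c k}"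
        then have "d \<in> D" using that by (auto simp: D_def)
        then obtain i where "i \<in> {1..n}" "d = e i" using bij_betw_imp_surj_on[OF e] by blast
        then show "d \<in> e ` {i \<in> {1..n}. b i = k}" using d by (auto simp: b_def)
      qed
    qed auto
    then show ?thesis by (auto dest: bij_betw_same_card)
  qed
  moreover have "b \<in> PiE {1..n} (\<lambda>_. {1..J})"
    using bij_betwE[OF e] by (force simp: b_def D_def)
  ultimately show ?thesis by (auto simp: label_vectors_def)
qed

definition sketch_patterns :: "nat \<Rightarrow> nat \<Rightarrow> (nat \<Rightarrow> nat) \<Rightarrow> nat \<Rightarrow> ((nat \<times> nat) set \<times> (nat \<Rightarrow> nat)) set" where
  "sketch_patterns J n c j = {(R, b). (\<forall>k\<in>{1..J}. (\<Sum>i=1..n. of_bool (b i = k)) = c k) \<and> b (n + 1) = j}"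

definition freq_patterns :: "nat \<Rightarrow> nat \<Rightarrow> (nat \<Rightarrow> nat) \<Rightarrow> nat \<Rightarrow> nat \<Rightarrow> ((nat \<times> nat) set \<times> (nat \<Rightarrow> nat)) set" where
  "freq_patterns J n c j r = {(R, b). (R, b) \<in> sketch_patterns J n c j \<and> (\<Sum>i=1..n. of_bool ((i, n + 1) \<in> R)) = r}"

lemma sketch_event:
  "(pattern {1..n + 1} h x \<in> sketch_patterns J n c j)
    \<longleftrightarrow> (\<forall>k\<in>{1..J}. sketch n h x k = c k) \<and> h (x (n + 1)) = j"
proof -
  have "(\<Sum>i=1..n. of_bool (restrict (\<lambda>i. h (x i)) {1..n + 1} i = k)) = sketch n h x k" for k
    unfolding sketch_def by (intro sum.cong) auto
  moreover have "restrict (\<lambda>i. h (x i)) {1..n + 1} (n + 1) = h (x (n + 1))" by simp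
  ultimately show ?thesis
    by (simp only: pattern_def sketch_patterns_def mem_Collect_eq prod.case)
qed

lemma freq_event:
  "(pattern {1..n + 1} h x \<in> freq_patterns J n c j r)
    \<longleftrightarrow> sample_freq n x = r \<and> (\<forall>k\<in>{1..J}. sketch n h x k = c k) \<and> h (x (n + 1)) = j"
proof -
  have "(\<Sum>i=1..n. of_bool ((i, n + 1) \<in> {(i, l). i \<in> {1..n + 1} \<and> l \<in> {1..n + 1} \<and> x i = x l})) = sample_freq n x"
    unfolding sample_freq_def by (intro sum.cong) auto
  then show ?thesis
    using sketch_event[of n h x J c j]
    by (simp only: pattern_def freq_patterns_def mem_Collect_eq prod.case conj_ac)
qed

lemma card_label_eq: "(\<Sum>i=1..n::nat. of_bool (b i = k)) = card {i \<in> {1..n}. b i = (k :: nat)}"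
proof -
  have "card {i \<in> {1..n}. b i = k} = (\<Sum>i\<in>{i \<in> {1..n}. b i = k}. 1)" by (rule card_eq_sum)
  also have "\<dots> = (\<Sum>i=1..n. if b i = k then 1 else 0)" by (rule sum.inter_filter) simp
  finally show ?thesis by (simp only: of_bool_def)
qed

lemma sketch_eq_card: "sketch n h x k = card {i \<in> {1..n}. h (x i) = k}"
  unfolding sketch_def by (rule card_label_eq)

lemma sketch_vectors:
  assumes h: "\<And>s. h s \<in> {1..J}"
  shows "(\<forall>k\<in>{1..J}. sketch n h x k = c k) \<longleftrightarrow> (\<exists>b\<in>label_vectors J n c. \<forall>l\<in>{1..n}. h (x l) = b l)"
proof
  assume L: "\<forall>k\<in>{1..J}. sketch n h x k = c k"
  define b where "b = restrict (\<lambda>i. h (x i)) {1..n}"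
  have eq: "{i \<in> {1..n}. b i = k} = {i \<in> {1..n}. h (x i) = k}" for k by (auto simp: b_def)
  have "b \<in> PiE {1..n} (\<lambda>_. {1..J})" using h by (auto simp: b_def)
  moreover have "\<forall>k\<in>{1..J}. card {i \<in> {1..n}. b i = k} = c k"
    using L by (simp only: eq sketch_eq_card)
  ultimately have "b \<in> label_vectors J n c" by (simp only: label_vectors_def mem_Collect_eq simp_thms)
  moreover have "\<forall>l\<in>{1..n}. h (x l) = b l" by (simp add: b_def)
  ultimately show "\<exists>b\<in>label_vectors J n c. \<forall>l\<in>{1..n}. h (x l) = b l" by blast
next
  assume "\<exists>b\<in>label_vectors J n c. \<forall>l\<in>{1..n}. h (x l) = b l"
  then obtain b where b: "b \<in> label_vectors J n c" "\<forall>l\<in>{1..n}. h (x l) = b l" by auto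
  have eq: "{i \<in> {1..n}. h (x i) = k} = {i \<in> {1..n}. b i = k}" for k using b(2) by auto
  have "\<forall>k\<in>{1..J}. card {i \<in> {1..n}. b i = k} = c k" using b(1) unfolding label_vectors_def by blast
  then show "\<forall>k\<in>{1..J}. sketch n h x k = c k" by (simp only: sketch_eq_card eq)
qed

lemma emeasure_sketch_vectors:
  fixes h :: "'a \<Rightarrow> nat"
  assumes h: "\<And>s. h s \<in> {1..J}"
  shows "emeasure (measure_pmf p) {x. (\<forall>k\<in>{1..J}. sketch n h x k = c k) \<and> Q x}
    = (\<Sum>b\<in>label_vectors J n c. emeasure (measure_pmf p) {x. (\<forall>l\<in>{1..n}. h (x l) = b l) \<and> Q x})"
proof -
  have "{x. (\<forall>k\<in>{1..J}. sketch n h x k = c k) \<and> Q x}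
      = (\<Union>b\<in>label_vectors J n c. {x. (\<forall>l\<in>{1..n}. h (x l) = b l) \<and> Q x})"
    unfolding sketch_vectors[of h, OF h] by auto
  also have "emeasure (measure_pmf p) \<dots> = (\<Sum>b\<in>label_vectors J n c. emeasure (measure_pmf p) {x. (\<forall>l\<in>{1..n}. h (x l) = b l) \<and> Q x})"
  proof (rule sum_emeasure[symmetric, OF _ _ finite_label_vectors])
    show "disjoint_family_on (\<lambda>b. {x. (\<forall>l\<in>{1..n}. h (x l) = b l) \<and> Q x}) (label_vectors J n c)"
      unfolding disjoint_family_on_def
    proof (intro ballI impI, rule ccontr)
      fix b b' assume b: "b \<in> label_vectors J n c" "b' \<in> label_vectors J n c" "b \<noteq> b'"
        "{x. (\<forall>l\<in>{1..n}. h (x l) = b l) \<and> Q x} \<inter> {x. (\<forall>l\<in>{1..n}. h (x l) = b' l) \<and> Q x} \<noteq> {}"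
      then have "\<forall>l\<in>{1..n}. b l = b' l" by auto
      with b(1,2) have "b = b'"
        by (intro extensionalityI[of b "{1..n}" b']) (auto simp: label_vectors_def PiE_def)
      with b(3) show False by simp
    qed
  qed auto
  finally show ?thesis .
qed

lemma pattern_prob_sketch:
  fixes h :: "'a \<Rightarrow> nat"
  assumes h: "\<And>s. h s \<in> {1..J}"
  shows "pattern_prob {1..n + 1} (sketch_patterns J n c j) P h
    = of_nat (card (label_vectors J n c)) * (label_mass P h j * label_product J P h c)"
proof -
  have "pattern_prob {1..n + 1} (sketch_patterns J n c j) P h
      = (\<Sum>b\<in>label_vectors J n c. emeasure (measure_pmf (Pi_pmf {1..n + 1} undefined (\<lambda>_. P)))
          {x. (\<forall>l\<in>{1..n}. h (x l) = b l) \<and> h (x (n + 1)) = j})"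
    unfolding pattern_prob_def sketch_event by (rule emeasure_sketch_vectors[OF h])
  also have "\<dots> = (\<Sum>b\<in>label_vectors J n c. label_mass P h j * label_product J P h c)"
  proof (intro sum.cong refl)
    fix b assume b: "b \<in> label_vectors J n c"
    have "{x. (\<forall>l\<in>{1..n}. h (x l) = b l) \<and> h (x (n + 1)) = j} = Pi {1..n + 1} (\<lambda>i. {s. h s = (b(n + 1 := j)) i})"
    proof -
      have ins: "{1..n + 1} = insert (n + 1) {1..n}" by auto
      show ?thesis unfolding ins by (auto simp: Pi_iff)
    qed
    then have "emeasure (measure_pmf (Pi_pmf {1..n + 1} undefined (\<lambda>_. P))) {x. (\<forall>l\<in>{1..n}. h (x l) = b l) \<and> h (x (n + 1)) = j}
        = (\<Prod>i\<in>{1..n + 1}. label_mass P h ((b(n + 1 := j)) i))"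
      by (simp only: emeasure_Pi_pmf_Pi finite_atLeastAtMost label_mass_def)
    also have "\<dots> = label_mass P h j * (\<Prod>l\<in>{1..n}. label_mass P h (b l))"
    proof -
      have "{1..n + 1} = insert (n + 1) {1..n}" by auto
      then show ?thesis
        by (simp only:, subst prod.insert) (auto intro!: arg_cong2[where f = "(*)"] prod.cong)
    qed
    also have "(\<Prod>l\<in>{1..n}. label_mass P h (b l)) = label_product J P h c"
      using b by (subst prod_label_mass[of _ _ J]) (auto simp: label_vectors_def label_product_def intro!: prod.cong)
    finally show "emeasure (measure_pmf (Pi_pmf {1..n + 1} undefined (\<lambda>_. P))) {x. (\<forall>l\<in>{1..n}. h (x l) = b l) \<and> h (x (n + 1)) = j}
        = label_mass P h j * label_product J P h c" .
  qed
  finally show ?thesis by simp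
qed

text \<open>The expected frequency on the event is the sum over \<open>i\<close> of the probability
  that draw \<open>i\<close> equals draw \<open>n + 1\<close>. For a fixed label vector, an index of
  label \<open>j\<close> exchanges two factors \<open>q\<^sub>j\<close> (its own and that of draw
  \<open>n + 1\<close>) for \<open>S\<^sub>j\<close>, and any other label makes the coincidence
  impossible; \<open>c j\<close> indices have label \<open>j\<close>.\<close>

lemma pattern_prob_freq:
  fixes h :: "'a \<Rightarrow> nat"
  assumes h: "\<And>s. h s \<in> {1..J}" and j: "j \<in> {1..J}"
  shows "(\<Sum>r=0..c j. of_nat r * pattern_prob {1..n + 1} (freq_patterns J n c j r) P h)
    = of_nat (card (label_vectors J n c)) * (of_nat (c j) * (square_mass P h j * label_product J P h (c(j := c j - 1))))"
proof -
  let ?p = "Pi_pmf {1..n + 1} undefined (\<lambda>_. P)"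
  define E where "E = {x. (\<forall>k\<in>{1..J}. sketch n h x k = c k) \<and> h (x (n + 1)) = j}"
  \<comment> \<open>On the event, draws equal to the last one lie in bucket \<open>j\<close>, so
    truncating the sum over \<open>r\<close> at \<open>c j\<close> loses nothing.\<close>
  have le: "sample_freq n x \<le> c j" if "x \<in> E" for x
  proof -
    have "sample_freq n x \<le> sketch n h x j"
      using that unfolding sample_freq_def sketch_def E_def by (intro sum_mono) auto
    then show ?thesis using that j by (simp add: E_def)
  qed
  have "(\<Sum>r=0..c j. of_nat r * pattern_prob {1..n + 1} (freq_patterns J n c j r) P h)
      = (\<integral>\<^sup>+x. (\<Sum>r=0..c j. of_nat r * indicator {x. sample_freq n x = r \<and> x \<in> E} x) \<partial>measure_pmf ?p)"
    unfolding pattern_prob_def freq_event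
    by (subst nn_integral_sum) (auto simp: nn_integral_cmult E_def)
  also have "\<dots> = (\<integral>\<^sup>+x. (\<Sum>i\<in>{1..n}. indicator {x. x (n + 1) = x i \<and> x \<in> E} x) \<partial>measure_pmf ?p)"
  proof (intro nn_integral_cong)
    fix x
    have "(\<Sum>r=0..c j. of_nat r * indicator {x. sample_freq n x = r \<and> x \<in> E} x)
        = (\<Sum>r=0..c j. if r = sample_freq n x then of_nat r * indicator E x else 0 :: ennreal)"
      by (intro sum.cong) (auto simp: indicator_def)
    also have "\<dots> = of_nat (sample_freq n x) * indicator E x"
      using le[of x] by (auto simp: indicator_def)
    also have "\<dots> = (\<Sum>i\<in>{1..n}. indicator {x. x (n + 1) = x i \<and> x \<in> E} x)"
      unfolding sample_freq_def of_nat_sum sum_distrib_right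
      by (intro sum.cong) (auto simp: indicator_def)
    finally show "(\<Sum>r=0..c j. of_nat r * indicator {x. sample_freq n x = r \<and> x \<in> E} x)
        = (\<Sum>i\<in>{1..n}. indicator {x. x (n + 1) = x i \<and> x \<in> E} x :: ennreal)" .
  qed
  also have "\<dots> = (\<Sum>i\<in>{1..n}. emeasure (measure_pmf ?p) {x. x (n + 1) = x i \<and> x \<in> E})"
    by (subst nn_integral_sum) auto
  also have "\<dots> = (\<Sum>i\<in>{1..n}. \<Sum>b\<in>label_vectors J n c. emeasure (measure_pmf ?p)
      {x. (\<forall>l\<in>{1..n}. h (x l) = b l) \<and> (h (x (n + 1)) = j \<and> x (n + 1) = x i)})"
  proof (intro sum.cong refl)
    fix i
    show "emeasure (measure_pmf ?p) {x. x (n + 1) = x i \<and> x \<in> E} = (\<Sum>b\<in>label_vectors J n c. emeasure (measure_pmf ?p)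
      {x. (\<forall>l\<in>{1..n}. h (x l) = b l) \<and> (h (x (n + 1)) = j \<and> x (n + 1) = x i)})"
    proof -
      have "{x. x (n + 1) = x i \<and> x \<in> E}
          = {x. (\<forall>k\<in>{1..J}. sketch n h x k = c k) \<and> (h (x (n + 1)) = j \<and> x (n + 1) = x i)}"
        by (auto simp only: E_def)
      then show ?thesis by (simp only: emeasure_sketch_vectors[OF h])
    qed
  qed
  also have "\<dots> = (\<Sum>b\<in>label_vectors J n c. \<Sum>i\<in>{1..n}. emeasure (measure_pmf ?p)
      {x. (\<forall>l\<in>{1..n}. h (x l) = b l) \<and> (h (x (n + 1)) = j \<and> x (n + 1) = x i)})"
    by (rule sum.swap)
  also have "\<dots> = (\<Sum>b\<in>label_vectors J n c. of_nat (c j) * (square_mass P h j * label_product J P h (c(j := c j - 1))))"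
  proof (intro sum.cong refl)
    fix b assume b: "b \<in> label_vectors J n c"
    have "emeasure (measure_pmf ?p) {x. (\<forall>l\<in>{1..n}. h (x l) = b l) \<and> (h (x (n + 1)) = j \<and> x (n + 1) = x i)}
        = (if b i = j then square_mass P h j * label_product J P h (c(j := c j - 1)) else 0)" if i: "i \<in> {1..n}" for i
    proof (cases "b i = j")
      case True
      have I: "{1..n + 1} - {n + 1, i} = {1..n} - {i}" using i by auto
      have ev: "{x. (\<forall>l\<in>{1..n}. h (x l) = b l) \<and> (h (x (n + 1)) = j \<and> x (n + 1) = x i)}
          = {x. x (n + 1) = x i \<and> h (x (n + 1)) = j \<and> (\<forall>l\<in>{1..n + 1} - {n + 1, i}. x l \<in> {s. h s = b l})}"
      proof -
        have ins: "{1..n} = insert i ({1..n} - {i})" using i by auto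
        show ?thesis unfolding I by (subst (1) ins) (use True in auto)
      qed
      have "emeasure (measure_pmf ?p) {x. (\<forall>l\<in>{1..n}. h (x l) = b l) \<and> (h (x (n + 1)) = j \<and> x (n + 1) = x i)}
          = square_mass P h j * (\<Prod>l\<in>{1..n} - {i}. label_mass P h (b l))"
      proof -
        have "emeasure (measure_pmf ?p) {x. x (n + 1) = x i \<and> h (x (n + 1)) = j \<and>
            (\<forall>l\<in>{1..n + 1} - {n + 1, i}. x l \<in> {s. h s = b l})}
          = square_mass P h j * (\<Prod>l\<in>{1..n + 1} - {n + 1, i}. emeasure (measure_pmf P) {s. h s = b l})"
          by (rule emeasure_Pi_pmf_coincidence) (use i in auto)
        then show ?thesis
          by (simp only: ev, simp only: I label_mass_def)
      qed
      also have "(\<Prod>l\<in>{1..n} - {i}. label_mass P h (b l)) = label_product J P h (\<lambda>k. card {l \<in> {1..n} - {i}. b l = k})"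
        using b by (intro prod_label_mass) (auto simp: label_vectors_def)
      also have "\<dots> = label_product J P h (c(j := c j - 1))"
        unfolding label_product_def
      proof (intro prod.cong refl arg_cong2[where f = "(^)"])
        fix k assume k: "k \<in> {1..J}"
        then have ck: "card {l \<in> {1..n}. b l = k} = c k" using b by (simp add: label_vectors_def)
        show "card {l \<in> {1..n} - {i}. b l = k} = (c(j := c j - 1)) k"
        proof (cases "k = j")
          case True
          have "{l \<in> {1..n} - {i}. b l = k} = {l \<in> {1..n}. b l = k} - {i}" by auto
          then show ?thesis using True \<open>b i = j\<close> i ck by (simp add: card_Diff_singleton)
        next
          case False
          then have "{l \<in> {1..n} - {i}. b l = k} = {l \<in> {1..n}. b l = k}" using \<open>b i = j\<close> by auto
          then show ?thesis using False ck by simp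
        qed
      qed
      finally show ?thesis using True by simp
    next
      case False
      then have "{x. (\<forall>l\<in>{1..n}. h (x l) = b l) \<and> (h (x (n + 1)) = j \<and> x (n + 1) = x i)} = {}"
        using i by auto
      then show ?thesis using False by (simp only: emeasure_empty if_False)
    qed
    then have "(\<Sum>i\<in>{1..n}. emeasure (measure_pmf ?p) {x. (\<forall>l\<in>{1..n}. h (x l) = b l) \<and> (h (x (n + 1)) = j \<and> x (n + 1) = x i)})
        = (\<Sum>i\<in>{1..n}. if b i = j then square_mass P h j * label_product J P h (c(j := c j - 1)) else 0)"
      by (intro sum.cong) auto
    also have "\<dots> = of_nat (card {i \<in> {1..n}. b i = j}) * (square_mass P h j * label_product J P h (c(j := c j - 1)))"
    proof -
      have "(\<Sum>i\<in>{1..n}. if b i = j then a else 0) = of_nat (card {i \<in> {1..n}. b i = j}) * a" for a :: ennreal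
        by (subst sum.inter_filter[symmetric]) simp_all
      then show ?thesis .
    qed
    finally show "(\<Sum>i\<in>{1..n}. emeasure (measure_pmf ?p) {x. (\<forall>l\<in>{1..n}. h (x l) = b l) \<and> (h (x (n + 1)) = j \<and> x (n + 1) = x i)})
        = of_nat (c j) * (square_mass P h j * label_product J P h (c(j := c j - 1)))"
      using b j by (simp add: label_vectors_def)
  qed
  finally show ?thesis by simp
qed

declare One_nat_def [simp del]

section \<open>The estimators for a fixed number of buckets\<close>

lemma space_marked_labels:
  assumes "z \<in> space (marked N (uniform_count_measure {1..J}))"
  shows "snd (z k) \<in> {1..J}"
proof -
  have "z \<in> space (PiM UNIV (\<lambda>_. borel \<Otimes>\<^sub>M uniform_count_measure {1..J}))"
    using assms by (simp add: marked_def)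
  then have "z k \<in> space (borel \<Otimes>\<^sub>M uniform_count_measure {1..J})"
    by (auto simp: space_PiM PiE_iff)
  then show ?thesis by (auto simp: space_pair_measure space_uniform_count_measure)
qed

lemma expect_model_cong:
  assumes "\<And>P h. (\<And>k. h k \<in> {1..J}) \<Longrightarrow> F P h = F' P h"
  shows "expect_model J N F = expect_model J N F'"
  unfolding expect_model_def by (intro nn_integral_cong assms space_marked_labels)

lemma sets_marked: "sets (marked N K) = sets (PiM UNIV (\<lambda>_. borel \<Otimes>\<^sub>M K))"
  by (simp add: marked_def)

lemma pattern_prob_model_measurable:
  "finite I \<Longrightarrow> (\<lambda>z. pattern_prob I S (weight_pmf z) (\<lambda>k. snd (z k)))
    \<in> borel_measurable (marked N (uniform_count_measure {1..J}))"
  using pattern_prob_weight_measurable[of I S J] measurable_cong_sets[OF sets_marked refl] by blast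

text \<open>The law of the points enters by its Laplace functional only. Inside, \<open>W\<close> is
  the sequence of weights with iid labels, on which all expectations of the reduced model are
  computed.\<close>

locale sketch_model =
  fixes \<theta> :: real and G :: "'s::{second_countable_topology, t2_space} measure" and \<rho> :: "real \<Rightarrow> real"
    and N :: "(nat \<Rightarrow> real \<times> 's) measure" and J :: nat and H :: "('s \<Rightarrow> nat) measure"
  assumes \<theta>: "0 < \<theta>" and G: "nonatomic_prob G" and \<rho>: "levy_density \<rho>"
    and N: "laplace_poisson (levy_intensity \<theta> G \<rho>) N"
    and J: "1 \<le> J" and H: "strongly_universal J H" and mH: "measurable_hash H"
begin

abbreviation Q where "Q \<equiv> distr N discrete_distr_space normalized_measure"
abbreviation W where "W \<equiv> marked N (uniform_count_measure {1..J})"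
abbreviation E where "E \<equiv> expect_model J N"

lemma PG: "prob_space G" and PH: "prob_space H" and sH: "sets H = sets (PiM UNIV (\<lambda>_. count_space {1..J}))"
  using G H by (auto simp: nonatomic_prob_def strongly_universal_def)

lemma \<rho>m: "set_borel_measurable lborel {0<..} \<rho>"
  using \<rho> by (simp add: levy_density_def)

lemma PU: "prob_space (uniform_count_measure {1..J})"
  by (rule prob_space_uniform_labels[OF J])

lemma lap_W: "laplace_poisson (levy_intensity \<theta> (uniform_count_measure {1..J}) \<rho>) W"
  by (rule laplace_marked[OF \<rho>m PG N PU])

sublocale W: prob_space W
  by (rule laplace_poissonD[OF lap_W])

lemma pattern_prob_le_1: "pattern_prob I S P h \<le> 1"
  unfolding pattern_prob_def by (rule measure_pmf.emeasure_le_1)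

lemma expect_pattern_prob:
  assumes "finite I"
  shows "expect_P_h Q H (\<lambda>P h. enn2real (pattern_prob I S P h)) = enn2real (E (pattern_prob I S))"
  using pattern_prob_transfer[OF \<rho> \<theta> G N J H mH assms]
  by (subst expect_P_h_eq_nn_integral[OF PH]) (auto simp: pattern_prob_le_1 pattern_prob_measurable[OF sH assms])

text \<open>The series of pattern probabilities is transferred term by term; as all terms are
  nonnegative, sums and integrals commute.\<close>

lemma expect_square_ratio:
  "expect_P_h Q H (\<lambda>P h. enn2real (square_ratio P h j)) = enn2real (E (\<lambda>P h. square_ratio P h j))"
proof -
  note tr = pattern_prob_transfer[OF \<rho> \<theta> G N J H mH finite_lessThan]
  note [measurable] = tr(1) pattern_prob_measurable[OF sH finite_lessThan]
    pattern_prob_model_measurable[OF finite_lessThan]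
  have inner: "(\<integral>\<^sup>+h. square_ratio P h j \<partial>H)
      = (\<Sum>m. of_nat (Suc m) * (\<integral>\<^sup>+h. pattern_prob {..<m + 2} (ratio_patterns j m) P h \<partial>H))" for P :: "'s pmf"
    unfolding square_ratio_def
    by (subst nn_integral_suminf) (auto simp: nn_integral_cmult simp del: of_nat_Suc intro!: measurable_compose[OF pattern_prob_measurable[OF sH finite_lessThan]])
  have m1: "(\<lambda>h. square_ratio P h j) \<in> borel_measurable H" for P :: "'s pmf"
    unfolding square_ratio_def by measurable
  have m2: "(\<lambda>P. \<integral>\<^sup>+h. square_ratio P h j \<partial>H) \<in> borel_measurable discrete_distr_space"
    unfolding inner by measurable
  have "(\<integral>\<^sup>+P. \<integral>\<^sup>+h. square_ratio P h j \<partial>H \<partial>Q)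
      = (\<Sum>m. \<integral>\<^sup>+P. of_nat (Suc m) * (\<integral>\<^sup>+h. pattern_prob {..<m + 2} (ratio_patterns j m) P h \<partial>H) \<partial>Q)"
    unfolding inner by (subst nn_integral_suminf) auto
  also have "\<dots> = (\<Sum>m. of_nat (Suc m) * E (pattern_prob {..<m + 2} (ratio_patterns j m)))"
    by (intro suminf_cong, subst nn_integral_cmult) (auto simp: tr(2))
  also have "\<dots> = E (\<lambda>P h. square_ratio P h j)"
    unfolding expect_model_def square_ratio_def
    by (subst nn_integral_suminf) (auto simp: nn_integral_cmult simp del: of_nat_Suc)
  finally show ?thesis
    by (subst expect_P_h_eq_nn_integral[OF PH]) (auto simp: m1 m2 square_ratio_le_1)
qed

lemma f_NRM_eq: "f_NRM Q H c j = real (c j) * enn2real (E (\<lambda>P h. square_ratio P h j))"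
  unfolding f_NRM_def infsum_ratio_eq expect_square_ratio[symmetric] expect_P_h_def by simp

lemma label_product_le_1: "label_product J P h c \<le> 1"
  unfolding label_product_def
  by (intro prod_le_1 conjI power_le_one) (auto intro: label_mass_le_1)

lemma square_mass_le_1: "square_mass P h j \<le> 1"
  using square_mass_le[of P h j] power_le_one[of "label_mass P h j" 2] label_mass_le_1[of P h j]
  by (auto intro: order_trans)

lemma E_le_1: "(\<And>P h. F P h \<le> 1) \<Longrightarrow> E F \<le> 1"
  using nn_integral_mono[of W "\<lambda>z. F (weight_pmf z) (\<lambda>k. snd (z k))" "\<lambda>_. 1"]
  by (simp add: expect_model_def W.emeasure_space_1)

lemma E_finite: "(\<And>P h. F P h \<le> 1) \<Longrightarrow> E F < top"
  using E_le_1[of F] by (auto intro: le_less_trans)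

lemma measurable_W_iff:
  "F \<in> borel_measurable W \<longleftrightarrow> F \<in> borel_measurable (PiM UNIV (\<lambda>_. borel \<Otimes>\<^sub>M uniform_count_measure {1..J}))"
  using measurable_cong_sets[OF sets_marked refl] by blast

lemma weight_nn_integral_measurable:
  assumes "\<And>k. F k \<in> borel_measurable W"
  shows "(\<lambda>z. \<integral>\<^sup>+k. F k z \<partial>measure_pmf (weight_pmf z)) \<in> borel_measurable W"
proof -
  have [measurable]: "(\<lambda>z. pmf (weight_pmf z) k) \<in> borel_measurable W" for k
    by (rule weight_pmf_measurable[OF sets_marked])
  note [measurable] = assms
  show ?thesis unfolding nn_integral_measure_pmf nn_integral_count_space_nat by measurable
qed

lemma label_indicator_measurable [measurable]:
  "(\<lambda>z. indicator {k. snd (z k) = j} k :: ennreal) \<in> borel_measurable W"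
proof -
  have "(\<lambda>z. indicator {j} (snd (z k)) :: ennreal) \<in> borel_measurable (PiM UNIV (\<lambda>_. borel \<Otimes>\<^sub>M uniform_count_measure {1..J}))"
  proof (rule measurable_compose[of "\<lambda>z. snd (z k)" _ "uniform_count_measure {1..J}"])
    show "(\<lambda>l. indicator {j} l :: ennreal) \<in> borel_measurable (uniform_count_measure {1..J})"
      by (simp add: measurable_cong_sets[OF sets_uniform_count_measure_count_space refl])
  qed measurable
  then show ?thesis by (simp add: measurable_W_iff indicator_def)
qed

lemma label_mass_measurable [measurable]: "(\<lambda>z. label_mass (weight_pmf z) (\<lambda>k. snd (z k)) j) \<in> borel_measurable W"
  using weight_nn_integral_measurable[of "\<lambda>k z. indicator {k. snd (z k) = j} k"]
  by (simp add: label_mass_def)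

lemma square_mass_measurable [measurable]: "(\<lambda>z. square_mass (weight_pmf z) (\<lambda>k. snd (z k)) j) \<in> borel_measurable W"
proof -
  have [measurable]: "(\<lambda>z. pmf (weight_pmf z) k) \<in> borel_measurable W" for k
    by (rule weight_pmf_measurable[OF sets_marked])
  show ?thesis unfolding square_mass_def
    by (rule weight_nn_integral_measurable) measurable
qed

lemma label_product_measurable [measurable]: "(\<lambda>z. label_product J (weight_pmf z) (\<lambda>k. snd (z k)) c) \<in> borel_measurable W"
  unfolding label_product_def by measurable

text \<open>The posterior weights share their denominator, so the posterior mean is the expected
  frequency on the observed event divided by the probability of the event. The number
  \<open>M\<close> of label vectors occurs in both and is not 0.\<close>

lemma f_BNP_eq:
  assumes c: "(\<Sum>k=1..J. c k) = n" and j: "j \<in> {1..J}"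
  shows "f_BNP J n Q H c j = real (c j) *
      (enn2real (E (\<lambda>P h. square_mass P h j * label_product J P h (c(j := c j - 1))))
        / enn2real (E (\<lambda>P h. label_mass P h j * label_product J P h c)))"
proof -
  let ?I = "{1..n + 1}"
  define M where "M = card (label_vectors J n c)"
  have M: "M > 0"
    using label_vectors_nonempty[OF c] finite_label_vectors by (simp add: M_def card_gt_0_iff)
  define A where "A = E (\<lambda>P h. square_mass P h j * label_product J P h (c(j := c j - 1)))"
  define D where "D = E (\<lambda>P h. label_mass P h j * label_product J P h c)"
  have den: "expect_P_h Q H (\<lambda>P h. measure_pmf.prob (iid_sample n P)
       {x. (\<forall>k\<in>{1..J}. sketch n h x k = c k) \<and> h (x (n + 1)) = j}) = real M * enn2real D"
  proof -
    have "expect_P_h Q H (\<lambda>P h. measure_pmf.prob (iid_sample n P)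
        {x. (\<forall>k\<in>{1..J}. sketch n h x k = c k) \<and> h (x (n + 1)) = j})
        = expect_P_h Q H (\<lambda>P h. enn2real (pattern_prob ?I (sketch_patterns J n c j) P h))"
      unfolding pattern_prob_def sketch_event iid_sample_def measure_def ..
    also have "\<dots> = enn2real (E (pattern_prob ?I (sketch_patterns J n c j)))"
      by (rule expect_pattern_prob) simp
    also have "E (pattern_prob ?I (sketch_patterns J n c j))
        = E (\<lambda>P h. of_nat M * (label_mass P h j * label_product J P h c))"
      unfolding M_def by (intro expect_model_cong pattern_prob_sketch)
    also have "\<dots> = of_nat M * D"
      unfolding expect_model_def D_def by (rule nn_integral_cmult) measurable
    finally show ?thesis by (simp add: enn2real_mult)
  qed
  define X where "X r = E (pattern_prob ?I (freq_patterns J n c j r))" for r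
  have num: "expect_P_h Q H (\<lambda>P h. measure_pmf.prob (iid_sample n P)
       {x. sample_freq n x = r \<and> (\<forall>k\<in>{1..J}. sketch n h x k = c k) \<and> h (x (n + 1)) = j}) = enn2real (X r)" for r
  proof -
    have "expect_P_h Q H (\<lambda>P h. measure_pmf.prob (iid_sample n P)
        {x. sample_freq n x = r \<and> (\<forall>k\<in>{1..J}. sketch n h x k = c k) \<and> h (x (n + 1)) = j})
        = expect_P_h Q H (\<lambda>P h. enn2real (pattern_prob ?I (freq_patterns J n c j r) P h))"
      unfolding pattern_prob_def freq_event iid_sample_def measure_def ..
    also have "\<dots> = enn2real (X r)"
      unfolding X_def by (rule expect_pattern_prob) simp
    finally show ?thesis .
  qed
  have [measurable]: "(\<lambda>z. pattern_prob ?I (freq_patterns J n c j r) (weight_pmf z) (\<lambda>k. snd (z k))) \<in> borel_measurable W" for r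
    by (rule pattern_prob_model_measurable) simp
  have "(\<Sum>r=0..c j. of_nat r * X r) = E (\<lambda>P h. \<Sum>r=0..c j. of_nat r * pattern_prob ?I (freq_patterns J n c j r) P h)"
    unfolding X_def expect_model_def
    by (subst nn_integral_sum) (auto simp: nn_integral_cmult)
  also have "\<dots> = E (\<lambda>P h. of_nat M * (of_nat (c j) * (square_mass P h j * label_product J P h (c(j := c j - 1)))))"
    unfolding M_def by (intro expect_model_cong pattern_prob_freq j)
  also have "\<dots> = of_nat M * (of_nat (c j) * A)"
    unfolding expect_model_def A_def by (subst nn_integral_cmult, measurable)+
  finally have sum: "(\<Sum>r=0..c j. of_nat r * X r) = of_nat M * (of_nat (c j) * A)" .
  have Xf: "X r < top" for r unfolding X_def by (rule E_finite) (rule pattern_prob_le_1)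
  have "(\<Sum>r=0..c j. real r * enn2real (X r)) = enn2real (\<Sum>r=0..c j. of_nat r * X r)"
    by (subst enn2real_sum) (auto simp: Xf enn2real_mult ennreal_mult_less_top of_nat_less_top)
  also have "\<dots> = real M * (real (c j) * enn2real A)"
    unfolding sum by (simp add: enn2real_mult)
  finally have sumr: "(\<Sum>r=0..c j. real r * enn2real (X r)) = real M * (real (c j) * enn2real A)" .
  have "f_BNP J n Q H c j = (\<Sum>r=0..c j. real r * enn2real (X r)) / (real M * enn2real D)"
    unfolding f_BNP_def posterior_freq_def num den by (simp add: sum_divide_distrib)
  then show ?thesis
    unfolding sumr using M by (simp add: A_def D_def)
qed

lemma AE_good_W: "AE z in W. good_points z"
  by (rule AE_good_points[OF \<rho> \<theta> PU lap_W])

lemma nn_integral_labels: "(\<integral>\<^sup>+l. F l \<partial>uniform_count_measure {1..J}) = ennreal (1 / J) * (\<Sum>l\<in>{1..J}. F l)"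
proof -
  have "(\<integral>\<^sup>+l. F l \<partial>uniform_count_measure {1..J}) = (\<Sum>l\<in>{1..J}. ennreal (1 / J) * F l)"
    unfolding uniform_count_measure_def by (subst nn_integral_point_measure_finite) (auto simp: mult.commute)
  then show ?thesis by (simp add: sum_distrib_left)
qed

lemma borel_measurable_labels: "F \<in> borel_measurable (borel \<Otimes>\<^sub>M uniform_count_measure {1..J})"
  if "\<And>l. l \<in> {1..J} \<Longrightarrow> (\<lambda>x. F (x, l)) \<in> borel_measurable borel"
proof -
  have "(\<lambda>(l, x). F (x, l)) \<in> borel_measurable (count_space {1..J} \<Otimes>\<^sub>M borel)"
    using that by (intro measurable_pair_measure_countable1) auto
  from measurable_pair_swap[OF this]
  have "F \<in> borel_measurable (borel \<Otimes>\<^sub>M count_space {1..J})" by (simp add: case_prod_unfold)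
  then show ?thesis
    using measurable_cong_sets[OF sets_pair_measure_cong[OF refl sets_uniform_count_measure_count_space] refl] by blast
qed

text \<open>Uniform labels split the intensity into \<open>J\<close> equal pieces of parameter
  \<open>\<theta> / J\<close>, one for each bucket.\<close>

lemma nn_integral_levy_labels:
  assumes F: "\<And>l. l \<in> {1..J} \<Longrightarrow> (\<lambda>x. F (x, l)) \<in> borel_measurable borel"
  shows "(\<integral>\<^sup>+z. F z \<partial>levy_intensity \<theta> (uniform_count_measure {1..J}) \<rho>)
    = (\<integral>\<^sup>+x. levy_weight (\<theta> / J) \<rho> x * (\<Sum>l\<in>{1..J}. F (x, l)) \<partial>lborel)"
proof -
  have "levy_weight \<theta> \<rho> x * (ennreal (1 / J) * y) = levy_weight (\<theta> / J) \<rho> x * y" for x y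
  proof (cases "0 < x")
    case True
    then have "0 \<le> \<theta> * \<rho> x" using \<rho> \<theta> by (simp add: levy_density_def)
    then have "ennreal (\<theta> * \<rho> x) * ennreal (1 / J) = ennreal (\<theta> / J * \<rho> x)"
      by (subst ennreal_mult''[symmetric]) auto
    then show ?thesis using True by (simp add: levy_weight_def mult.assoc[symmetric])
  qed (simp add: levy_weight_def)
  then show ?thesis
    by (subst nn_integral_levy_intensity[OF \<rho>m PU borel_measurable_labels[OF F]]) (simp_all add: nn_integral_labels)
qed

lemma laplace_labels:
  assumes F: "\<And>l. l \<in> {1..J} \<Longrightarrow> (\<lambda>x. F (x, l)) \<in> borel_measurable borel"
  shows "F \<in> borel_measurable (levy_intensity \<theta> (uniform_count_measure {1..J}) \<rho>)"
  using borel_measurable_labels[OF F] measurable_cong_sets[OF sets_levy_intensity refl] by blast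

text \<open>With \<open>f = top\<close> on label \<open>j\<close>, the Laplace functional is the
  probability that the label is absent. It equals
  \<open>exp (- (\<theta> / J) \<integral> \<rho>)\<close>, which is 0 because the Levy density has
  infinite integral.\<close>

lemma AE_label_occurs:
  assumes j: "j \<in> {1..J}"
  shows "AE z in W. \<exists>k. snd (z k) = j"
proof -
  define f :: "real \<times> nat \<Rightarrow> ennreal" where "f = (\<lambda>(x, l). if l = j then top else 0)"
  have fm: "\<And>l. (\<lambda>x. f (x, l)) \<in> borel_measurable borel" by (simp add: f_def)
  have "(\<integral>\<^sup>+z. nexp (\<Sum>k. f (z k)) \<partial>W) = nexp (\<integral>\<^sup>+x. levy_weight (\<theta> / J) \<rho> x * (\<Sum>l\<in>{1..J}. 1 - nexp (f (x, l))) \<partial>lborel)"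
    by (subst laplace_poissonD(3)[OF lap_W laplace_labels[OF fm]])
      (subst nn_integral_levy_labels, use fm in \<open>auto intro!: measurable_compose[OF _ nexp_measurable]\<close>)
  also have "(\<integral>\<^sup>+x. levy_weight (\<theta> / J) \<rho> x * (\<Sum>l\<in>{1..J}. 1 - nexp (f (x, l))) \<partial>lborel)
      = (\<integral>\<^sup>+x. ennreal (\<theta> / J) * (ennreal (\<rho> x) * indicator {0<..} x) \<partial>lborel)"
  proof (intro nn_integral_cong)
    fix x :: real
    have "(\<Sum>l\<in>{1..J}. 1 - nexp (f (x, l))) = (\<Sum>l\<in>{1..J}. if l = j then 1 else 0)"
      by (intro sum.cong) (auto simp: f_def)
    then have "(\<Sum>l\<in>{1..J}. 1 - nexp (f (x, l))) = 1" using j by simp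
    then show "levy_weight (\<theta> / J) \<rho> x * (\<Sum>l\<in>{1..J}. 1 - nexp (f (x, l)))
        = ennreal (\<theta> / J) * (ennreal (\<rho> x) * indicator {0<..} x)"
    proof (cases "0 < x")
      case True
      then have "ennreal (\<theta> / J * \<rho> x) = ennreal (\<theta> / J) * ennreal (\<rho> x)"
        using \<rho> \<theta> by (intro ennreal_mult) (auto simp: levy_density_def)
      then show ?thesis using True \<open>_ = 1\<close> by (simp only: levy_weight_def) simp
    qed (simp add: levy_weight_def)
  qed
  also have "\<dots> = ennreal (\<theta> / J) * (\<integral>\<^sup>+x. ennreal (\<rho> x) * indicator {0<..} x \<partial>lborel)"
  proof (rule nn_integral_cmult)
    have "(\<lambda>x. ennreal (indicator {0<..} x *\<^sub>R \<rho> x)) \<in> borel_measurable lborel"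
      using \<rho>m by (simp add: set_borel_measurable_def)
    also have "(\<lambda>x. ennreal (indicator {0<..} x *\<^sub>R \<rho> x)) = (\<lambda>x. ennreal (\<rho> x) * indicator {0<..} x)"
      by (auto simp: indicator_def fun_eq_iff)
    finally show "(\<lambda>x. ennreal (\<rho> x) * indicator {0<..} x) \<in> borel_measurable lborel" .
  qed
  also have "\<dots> = top"
    using \<rho> \<theta> J by (simp add: levy_density_def ennreal_mult_top)
  finally have "(\<integral>\<^sup>+z. nexp (\<Sum>k. f (z k)) \<partial>W) = 0" by simp
  moreover have "(\<lambda>z. nexp (\<Sum>k. f (z k))) \<in> borel_measurable W"
    using borel_measurable_labels[OF fm] unfolding measurable_W_iff by measurable
  ultimately have "AE z in W. nexp (\<Sum>k. f (z k)) = 0"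
    by (subst (asm) nn_integral_0_iff_AE) auto
  then show ?thesis
  proof eventually_elim
    case (elim z)
    show ?case
    proof (rule ccontr)
      assume "\<nexists>k. snd (z k) = j"
      then have "f (z k) = 0" for k by (simp add: f_def case_prod_unfold)
      then show False using elim by simp
    qed
  qed
qed

lemma AE_label_mass_pos:
  assumes j: "j \<in> {1..J}"
  shows "AE z in W. 0 < label_mass (weight_pmf z) (\<lambda>k. snd (z k)) j"
  using AE_label_occurs[OF j] AE_good_W
proof eventually_elim
  case (elim z)
  then obtain k where k: "snd (z k) = j" by auto
  have "0 < ennreal (pmf (weight_pmf z) k)"
    using elim(2) suminf_ennreal_bounds(2)[of z] by (auto simp: pmf_weight good_points_def)
  also have "ennreal (pmf (weight_pmf z) k) \<le> label_mass (weight_pmf z) (\<lambda>k. snd (z k)) j"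
    unfolding label_mass_def emeasure_pmf_single[symmetric] using k by (intro emeasure_mono) auto
  finally show ?case by simp
qed

text \<open>Every bucket has positive mass almost surely, so the denominator of the posterior does
  not vanish for any sketch.\<close>

lemma E_label_pos: "0 < E (\<lambda>P h. label_mass P h j * label_product J P h c)" if j: "j \<in> {1..J}"
proof -
  have "AE z in W. \<forall>k\<in>{1..J}. 0 < label_mass (weight_pmf z) (\<lambda>k. snd (z k)) k"
    by (intro AE_finite_allI AE_label_mass_pos) auto
  then have "AE z in W. label_mass (weight_pmf z) (\<lambda>k. snd (z k)) j * label_product J (weight_pmf z) (\<lambda>k. snd (z k)) c \<noteq> 0"
  proof eventually_elim
    case (elim z)
    then have nz: "\<forall>k\<in>{1..J}. label_mass (weight_pmf z) (\<lambda>k. snd (z k)) k \<noteq> 0"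
      by (metis less_irrefl)
    show ?case using nz bspec[OF nz j] by (simp add: label_product_def)
  qed
  note nz = this
  have "\<not> (AE z in W. label_mass (weight_pmf z) (\<lambda>k. snd (z k)) j * label_product J (weight_pmf z) (\<lambda>k. snd (z k)) c = 0)"
  proof
    assume "AE z in W. label_mass (weight_pmf z) (\<lambda>k. snd (z k)) j * label_product J (weight_pmf z) (\<lambda>k. snd (z k)) c = 0"
    with nz have "AE z in W. False" by eventually_elim simp
    then show False by (simp add: W.AE_False)
  qed
  then have "E (\<lambda>P h. label_mass P h j * label_product J P h c) \<noteq> 0"
    unfolding expect_model_def by (subst nn_integral_0_iff_AE) auto
  then show ?thesis by (simp add: zero_less_iff_neq_zero)
qed

text \<open>The ratio \<open>S\<^sub>j / q\<^sub>j\<^sup>2\<close> is uncorrelated with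
  \<open>q\<^sub>j\<^sup>2\<close> times any monomial in the bucket masses. The monomial is indexed
  by a finite set with repeated labels instead of exponents, so that each factor can be
  differentiated as a variable of its own.\<close>

definition uncorrelated :: "nat \<Rightarrow> bool" where
  "uncorrelated j \<longleftrightarrow> (\<forall>(A :: nat set) b. finite A \<longrightarrow> (\<forall>i\<in>A. b i \<in> {1..J}) \<longrightarrow>
     E (\<lambda>P h. square_mass P h j * (\<Prod>i\<in>A. label_mass P h (b i)))
     = E (\<lambda>P h. square_ratio P h j) * E (\<lambda>P h. label_mass P h j ^ 2 * (\<Prod>i\<in>A. label_mass P h (b i))))"

lemma square_product_le_1: "square_mass P h j * label_product J P h c \<le> 1"
  using mult_le_one[OF square_mass_le_1 _ label_product_le_1] by simp

lemma label_label_product_le_1: "label_mass P h j * label_product J P h c \<le> 1"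
  using mult_le_one[OF label_mass_le_1 _ label_product_le_1] by simp

lemma label_product_Suc:
  assumes j: "j \<in> {1..J}" and c: "0 < c j"
  shows "label_product J P h c = label_mass P h j * label_product J P h (c(j := c j - 1))"
proof -
  have "label_product J P h c = label_mass P h j ^ c j * (\<Prod>k\<in>{1..J} - {j}. label_mass P h k ^ c k)"
    unfolding label_product_def using j by (subst prod.remove[of _ j]) auto
  moreover have "label_product J P h (c(j := c j - 1)) = label_mass P h j ^ (c j - 1) * (\<Prod>k\<in>{1..J} - {j}. label_mass P h k ^ c k)"
    unfolding label_product_def using j by (subst prod.remove[of _ j]) (auto intro!: prod.cong arg_cong2[where f = "(*)"])
  ultimately show ?thesis using c by (simp add: mult.assoc[symmetric] power_eq_if)
qed

text \<open>After division by \<open>c j\<close>, coincidence is the moment identity for the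
  monomial with exponents \<open>c(j := c j - 1)\<close>. As \<open>c\<close> runs through the
  sketches with \<open>0 < c j\<close>, these exponents run through all vectors. For
  \<open>c j = 0\<close> both estimators are 0.\<close>

lemma estimators_coincide_iff:
  assumes j: "j \<in> {1..J}"
  shows "(\<forall>n c. (\<Sum>k=1..J. c k) = n \<longrightarrow> f_NRM Q H c j = f_BNP J n Q H c j) \<longleftrightarrow> uncorrelated j"
proof
  define r where "r = E (\<lambda>P h. square_ratio P h j)"
  have rf: "r < top" unfolding r_def by (rule E_finite) (rule square_ratio_le_1)
  have key: "f_NRM Q H c j = f_BNP J n Q H c j \<longleftrightarrow>
      E (\<lambda>P h. square_mass P h j * label_product J P h (c(j := c j - 1)))
      = r * E (\<lambda>P h. label_mass P h j ^ 2 * label_product J P h (c(j := c j - 1)))"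
    if c: "(\<Sum>k=1..J. c k) = n" and cj: "0 < c j" for n c
  proof -
    define A where "A = E (\<lambda>P h. square_mass P h j * label_product J P h (c(j := c j - 1)))"
    define D where "D = E (\<lambda>P h. label_mass P h j * label_product J P h c)"
    have D': "D = E (\<lambda>P h. label_mass P h j ^ 2 * label_product J P h (c(j := c j - 1)))"
      unfolding D_def label_product_Suc[where c = c, OF j cj] by (simp add: power2_eq_square mult.assoc)
    have Af: "A < top" unfolding A_def by (rule E_finite) (rule square_product_le_1)
    have Df: "D < top" unfolding D_def by (rule E_finite) (rule label_label_product_le_1)
    have Dp: "0 < D" unfolding D_def by (rule E_label_pos[OF j])
    have "f_NRM Q H c j = f_BNP J n Q H c j \<longleftrightarrow> enn2real r = enn2real A / enn2real D"
      unfolding f_NRM_eq f_BNP_eq[OF c j] r_def A_def D_def using cj by (subst mult_left_cancel) auto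
    also have "\<dots> \<longleftrightarrow> enn2real A = enn2real (r * D)"
    proof -
      have "enn2real D \<noteq> 0" using Dp Df by (auto simp: enn2real_eq_0_iff)
      then show ?thesis unfolding enn2real_mult by (auto simp: eq_divide_eq)
    qed
    also have "\<dots> \<longleftrightarrow> A = r * D"
    proof
      assume eq: "enn2real A = enn2real (r * D)"
      have "A = ennreal (enn2real A)" by (rule ennreal_enn2real[OF Af, symmetric])
      also have "\<dots> = r * D"
        unfolding eq using Df rf by (intro ennreal_enn2real) (simp add: ennreal_mult_less_top)
      finally show "A = r * D" .
    qed simp
    finally show ?thesis unfolding A_def D' .
  qed
  {
    assume L: "\<forall>n c. (\<Sum>k=1..J. c k) = n \<longrightarrow> f_NRM Q H c j = f_BNP J n Q H c j"
    show "uncorrelated j"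
      unfolding uncorrelated_def
    proof (intro allI impI)
      fix A :: "nat set" and b assume A: "finite A" "\<forall>i\<in>A. b i \<in> {1..J}"
      define c0 where "c0 k = card {l \<in> A. b l = k}" for k
      define c where "c = c0(j := Suc (c0 j))"
      have "c(j := c j - 1) = c0" by (simp add: c_def)
      moreover have "(\<Prod>i\<in>A. label_mass P h (b i)) = label_product J P h c0" for P :: "nat pmf" and h
        unfolding c0_def using A by (intro prod_label_mass) auto
      moreover have "0 < c j" by (simp add: c_def)
      ultimately show "E (\<lambda>P h. square_mass P h j * (\<Prod>i\<in>A. label_mass P h (b i)))
         = E (\<lambda>P h. square_ratio P h j) * E (\<lambda>P h. label_mass P h j ^ 2 * (\<Prod>i\<in>A. label_mass P h (b i)))"
        using L key[OF refl, of c] by (simp add: r_def)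
    qed
  next
    assume U: "uncorrelated j"
    show "\<forall>n c. (\<Sum>k=1..J. c k) = n \<longrightarrow> f_NRM Q H c j = f_BNP J n Q H c j"
    proof (intro allI impI)
      fix n and c :: "nat \<Rightarrow> nat" assume c: "(\<Sum>k=1..J. c k) = n"
      show "f_NRM Q H c j = f_BNP J n Q H c j"
      proof (cases "c j = 0")
        case True
        then show ?thesis unfolding f_NRM_eq f_BNP_eq[OF c j] by simp
      next
        case False
        define c0 where "c0 = c(j := c j - 1)"
        obtain b where b: "b \<in> label_vectors J (\<Sum>k=1..J. c0 k) c0"
          using label_vectors_nonempty[of c0 J, OF refl] by blast
        define A where "A = {1..\<Sum>k=1..J. c0 k}"
        have bA: "\<forall>i\<in>A. b i \<in> {1..J}" using b by (auto simp: label_vectors_def A_def)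
        have "(\<Prod>i\<in>A. label_mass P h (b i)) = label_product J P h c0" for P :: "nat pmf" and h
        proof -
          have "(\<Prod>i\<in>A. label_mass P h (b i)) = label_product J P h (\<lambda>k. card {l \<in> A. b l = k})"
            using bA by (intro prod_label_mass) (auto simp: A_def)
          also have "\<dots> = label_product J P h c0"
            using b by (auto simp: label_product_def label_vectors_def A_def intro!: prod.cong)
          finally show ?thesis .
        qed
        moreover have "finite A" by (simp add: A_def)
        ultimately show ?thesis
          using U[unfolded uncorrelated_def, rule_format, of A b] bA key[OF c] False by (simp add: r_def c0_def)
      qed
    qed
  }
qed

end

section \<open>Tilted moments\<close>

text \<open>The functions \<open>\<psi>\<close> and, below, \<open>\<kappa>\<^sub>n\<close>, without
  the factor \<open>\<theta>\<close>. The argument ranges over \<open>[0, \<infinity>]\<close>,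
  because the tilts of the buckets are arbitrary there.\<close>

definition laplace_exponent :: "(real \<Rightarrow> real) \<Rightarrow> ennreal \<Rightarrow> ennreal" where
  "laplace_exponent \<rho> u = (\<integral>\<^sup>+x. levy_weight 1 \<rho> x * (1 - nexp (u * ennreal x)) \<partial>lborel)"

definition levy_moment :: "(real \<Rightarrow> real) \<Rightarrow> nat \<Rightarrow> ennreal \<Rightarrow> ennreal" where
  "levy_moment \<rho> n u = (\<integral>\<^sup>+x. levy_weight 1 \<rho> x * (nexp (u * ennreal x) * ennreal x ^ n) \<partial>lborel)"

lemma laplace_exponent_0 [simp]: "laplace_exponent \<rho> 0 = 0"
  by (simp add: laplace_exponent_def)

lemma levy_weight_scale: "0 \<le> a \<Longrightarrow> levy_weight a \<rho> x = ennreal a * levy_weight 1 \<rho> x"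
  by (simp add: levy_weight_def ennreal_mult' mult_ac)

lemma nexp_mult_le: "nexp t * t \<le> 1 - nexp t"
proof (cases t)
  case (real r)
  have "exp (- r) * (1 + r) \<le> exp (- r) * exp r" by (intro mult_left_mono exp_ge_add_one_self) auto
  then have "exp (- r) * r \<le> 1 - exp (- r)" by (simp add: exp_minus algebra_simps)
  then show ?thesis
    using real by (simp add: nexp_ennreal ennreal_minus ennreal_mult'[symmetric] ennreal_leI flip: ennreal_1)
qed simp

text \<open>Half of the tilt absorbs the power: with \<open>t = u x / 2\<close>,
  \<open>exp (- 2 t) t ^ n \<le> 1 - exp (- t)\<close> for \<open>n = 1\<close> and
  \<open>n = 2\<close>, and the right side is integrable against \<open>\<rho>\<close>.\<close>

lemma levy_moment_finite:
  assumes \<rho>: "levy_density \<rho>" and u: "0 < u" and n: "n \<in> {1, 2}"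
  shows "levy_moment \<rho> n (ennreal u) < top"
proof -
  have [measurable]: "levy_weight 1 \<rho> \<in> borel_measurable borel"
    using \<rho> by (intro levy_weight_measurable) (simp add: levy_density_def)
  define v where "v = u / 2"
  have v: "0 < v" using u by (simp add: v_def)
  have bound: "nexp (ennreal u * ennreal x) * ennreal x ^ n \<le> ennreal (1 / v ^ n) * (1 - nexp (ennreal (v * x)))"
    if x: "0 < x" for x
  proof -
    define t where "t = ennreal (v * x)"
    have ux: "ennreal u * ennreal x = t + t"
      using u x by (simp add: t_def v_def ennreal_mult'[symmetric] ennreal_plus[symmetric] del: ennreal_plus)
    have xt: "ennreal x ^ n = ennreal (1 / v ^ n) * t ^ n"
      using v x by (simp add: t_def ennreal_power ennreal_mult'[symmetric] power_mult_distrib)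
    have "nexp (t + t) * t ^ n \<le> 1 - nexp t"
    proof (cases "n = 1")
      case True
      have "nexp (t + t) * t \<le> 1 * (nexp t * t)"
        by (simp only: nexp_add mult.assoc) (intro mult_right_mono, auto)
      also have "\<dots> \<le> 1 - nexp t" using nexp_mult_le[of t] by simp
      finally show ?thesis using True by simp
    next
      case False
      then have "n = 2" using n by simp
      then have "nexp (t + t) * t ^ n = (nexp t * t) * (nexp t * t)" by (simp add: nexp_add power2_eq_square mult_ac)
      also have "\<dots> \<le> (1 - nexp t) * 1"
      proof (intro mult_mono nexp_mult_le)
        have "1 - nexp t \<le> 1" by (rule diff_le_self_ennreal)
        then show "nexp t * t \<le> 1" using nexp_mult_le[of t] by (rule order_trans[rotated])
      qed auto
      finally show ?thesis by simp
    qed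
    then show ?thesis
      unfolding ux xt by (simp add: t_def[symmetric] mult.left_commute[of "nexp _"] mult_left_mono)
  qed
  have "levy_moment \<rho> n (ennreal u) \<le> (\<integral>\<^sup>+x. ennreal (1 / v ^ n) * (levy_weight 1 \<rho> x * (1 - nexp (ennreal (v * x)))) \<partial>lborel)"
    unfolding levy_moment_def
  proof (intro nn_integral_mono)
    fix x
    show "levy_weight 1 \<rho> x * (nexp (ennreal u * ennreal x) * ennreal x ^ n)
        \<le> ennreal (1 / v ^ n) * (levy_weight 1 \<rho> x * (1 - nexp (ennreal (v * x))))"
    proof (cases "0 < x")
      case True
      from mult_left_mono[OF bound[OF this], of "levy_weight 1 \<rho> x"] show ?thesis by (simp add: mult_ac)
    qed (simp add: levy_weight_def)
  qed
  also have "\<dots> = ennreal (1 / v ^ n) * (\<integral>\<^sup>+x. levy_weight 1 \<rho> x * (1 - nexp (ennreal (v * x))) \<partial>lborel)"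
    by (rule nn_integral_cmult) measurable
  also have "\<dots> < top"
    using laplace_exponent_finite[OF \<rho>, of 1 v] v by (simp add: ennreal_mult_less_top)
  finally show ?thesis .
qed

lemma levy_moment_antimono: "u \<le> v \<Longrightarrow> levy_moment \<rho> n v \<le> levy_moment \<rho> n u"
  unfolding levy_moment_def
  by (intro nn_integral_mono mult_left_mono mult_right_mono nexp_antimono) auto

lemma levy_moment_finite':
  assumes "levy_density \<rho>" "0 < u" "n \<in> {1, 2}"
  shows "levy_moment \<rho> n u < top"
proof -
  obtain v where v: "0 < v" "ennreal v \<le> u"
  proof (cases u)
    case (real r)
    then show ?thesis using assms(2) that[of r] by auto
  qed (use that[of 1] in auto)
  show ?thesis
    using levy_moment_antimono[OF v(2)] levy_moment_finite[OF assms(1) v(1) assms(3)] by (rule le_less_trans)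
qed

context sketch_model
begin

definition a where "a = \<theta> / J"

lemma a_pos: "0 < a"
  using \<theta> J by (simp add: a_def)

text \<open>The weights before normalization: the mass of bucket \<open>j\<close> is
  \<open>tot {j}\<close> over the total mass \<open>T = tot UNIV\<close>, and its square mass is
  \<open>sq j\<close> over \<open>T\<^sup>2\<close>.\<close>

definition tot :: "nat set \<Rightarrow> (nat \<Rightarrow> real \<times> nat) \<Rightarrow> ennreal" where
  "tot B z = (\<Sum>k. ennreal (fst (z k)) * indicator B (snd (z k)))"

definition sq :: "nat \<Rightarrow> (nat \<Rightarrow> real \<times> nat) \<Rightarrow> ennreal" where
  "sq j z = (\<Sum>k. ennreal (fst (z k)) ^ 2 * indicator {j} (snd (z k)))"

lemma levy_weight_1_measurable [measurable]: "levy_weight 1 \<rho> \<in> borel_measurable borel"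
  by (rule levy_weight_measurable[OF \<rho>m])

lemma suminf_labels_measurable:
  assumes "\<And>l. l \<in> {1..J} \<Longrightarrow> (\<lambda>x. F (x, l)) \<in> borel_measurable borel"
  shows "(\<lambda>z. \<Sum>k. F (z k) :: ennreal) \<in> borel_measurable W"
proof -
  note [measurable] = borel_measurable_labels[OF assms]
  show ?thesis unfolding measurable_W_iff by measurable
qed

lemma tot_measurable [measurable]: "tot B \<in> borel_measurable W"
  using suminf_labels_measurable[of "\<lambda>z. ennreal (fst z) * indicator B (snd z)"] by (simp add: tot_def[abs_def])

lemma sq_measurable [measurable]: "sq j \<in> borel_measurable W"
  using suminf_labels_measurable[of "\<lambda>z. ennreal (fst z) ^ 2 * indicator {j} (snd z)"] by (simp add: sq_def[abs_def])

lemma levy_labels_exponent: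
  "(\<integral>\<^sup>+z. 1 - nexp (u (snd z) * ennreal (fst z)) \<partial>levy_intensity \<theta> (uniform_count_measure {1..J}) \<rho>)
    = ennreal a * (\<Sum>l\<in>{1..J}. laplace_exponent \<rho> (u l))"
proof -
  have "(\<integral>\<^sup>+z. 1 - nexp (u (snd z) * ennreal (fst z)) \<partial>levy_intensity \<theta> (uniform_count_measure {1..J}) \<rho>)
      = (\<integral>\<^sup>+x. levy_weight a \<rho> x * (\<Sum>l\<in>{1..J}. 1 - nexp (u l * ennreal x)) \<partial>lborel)"
    unfolding a_def by (subst nn_integral_levy_labels) auto
  also have "\<dots> = (\<integral>\<^sup>+x. ennreal a * (\<Sum>l\<in>{1..J}. levy_weight 1 \<rho> x * (1 - nexp (u l * ennreal x))) \<partial>lborel)"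
    using a_pos by (simp add: levy_weight_scale[of a] sum_distrib_left mult.assoc)
  also have "\<dots> = ennreal a * (\<Sum>l\<in>{1..J}. laplace_exponent \<rho> (u l))"
    unfolding laplace_exponent_def by (subst nn_integral_cmult, measurable, subst nn_integral_sum, measurable)
  finally show ?thesis .
qed

lemma levy_labels_moment:
  assumes j: "j \<in> {1..J}"
  shows "(\<integral>\<^sup>+z. nexp (u (snd z) * ennreal (fst z)) * (ennreal (fst z) ^ n * indicator {j} (snd z))
      \<partial>levy_intensity \<theta> (uniform_count_measure {1..J}) \<rho>)
    = ennreal a * levy_moment \<rho> n (u j)"
proof -
  have "(\<integral>\<^sup>+z. nexp (u (snd z) * ennreal (fst z)) * (ennreal (fst z) ^ n * indicator {j} (snd z))
      \<partial>levy_intensity \<theta> (uniform_count_measure {1..J}) \<rho>)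
    = (\<integral>\<^sup>+x. levy_weight a \<rho> x * (\<Sum>l\<in>{1..J}. nexp (u l * ennreal x) * (ennreal x ^ n * indicator {j} l)) \<partial>lborel)"
    unfolding a_def by (subst nn_integral_levy_labels) auto
  also have "\<dots> = (\<integral>\<^sup>+x. ennreal a * (levy_weight 1 \<rho> x * (nexp (u j * ennreal x) * ennreal x ^ n)) \<partial>lborel)"
  proof (intro nn_integral_cong)
    fix x
    have "(\<Sum>l\<in>{1..J}. nexp (u l * ennreal x) * (ennreal x ^ n * indicator {j} l))
        = (\<Sum>l\<in>{1..J}. if l = j then nexp (u j * ennreal x) * ennreal x ^ n else 0)"
      by (intro sum.cong) (auto simp: indicator_def)
    then show "levy_weight a \<rho> x * (\<Sum>l\<in>{1..J}. nexp (u l * ennreal x) * (ennreal x ^ n * indicator {j} l))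
        = ennreal a * (levy_weight 1 \<rho> x * (nexp (u j * ennreal x) * ennreal x ^ n))"
      using j a_pos by (simp add: levy_weight_scale[of a] mult.assoc)
  qed
  also have "\<dots> = ennreal a * levy_moment \<rho> n (u j)"
    unfolding levy_moment_def by (rule nn_integral_cmult) measurable
  finally show ?thesis .
qed

lemma laplace_sq:
  assumes j: "j \<in> {1..J}"
  shows "(\<integral>\<^sup>+z. nexp (\<Sum>k. u (snd (z k)) * ennreal (fst (z k))) * sq j z \<partial>W)
    = nexp (ennreal a * (\<Sum>l\<in>{1..J}. laplace_exponent \<rho> (u l))) * (ennreal a * levy_moment \<rho> 2 (u j))"
  unfolding sq_def levy_labels_exponent[symmetric] levy_labels_moment[OF j, symmetric]
  by (rule campbell[OF lap_W]) (rule laplace_labels, simp)+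

text \<open>The second Campbell formula with both functionals equal to the total of bucket
  \<open>j\<close>. The diagonal gives the same \<open>\<kappa>\<^sub>2\<close> as the square sum,
  distinct pairs of points give the square of \<open>a \<kappa>\<^sub>1\<close>.\<close>

lemma laplace_tot2:
  assumes j: "j \<in> {1..J}" and u: "0 < u j"
  shows "(\<integral>\<^sup>+z. nexp (\<Sum>k. u (snd (z k)) * ennreal (fst (z k))) * tot {j} z ^ 2 \<partial>W)
    = nexp (ennreal a * (\<Sum>l\<in>{1..J}. laplace_exponent \<rho> (u l))) *
      (ennreal a * levy_moment \<rho> 2 (u j) + (ennreal a * levy_moment \<rho> 1 (u j)) ^ 2)"
proof -
  let ?\<nu> = "levy_intensity \<theta> (uniform_count_measure {1..J}) \<rho>"
  define f where "f z = u (snd z) * ennreal (fst z)" for z :: "real \<times> nat"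
  define g where "g z = ennreal (fst z) * indicator {j} (snd z)" for z :: "real \<times> nat"
  have fm: "f \<in> borel_measurable ?\<nu>" "g \<in> borel_measurable ?\<nu>"
    unfolding f_def[abs_def] g_def[abs_def] by (rule laplace_labels, simp)+
  have g1: "(\<integral>\<^sup>+z. nexp (f z) * g z \<partial>?\<nu>) = ennreal a * levy_moment \<rho> 1 (u j)"
    using levy_labels_moment[OF j, of u 1] by (simp add: f_def g_def)
  have g2: "(\<integral>\<^sup>+z. nexp (f z) * g z * g z \<partial>?\<nu>) = ennreal a * levy_moment \<rho> 2 (u j)"
  proof -
    have "nexp (f z) * g z * g z = nexp (u (snd z) * ennreal (fst z)) * (ennreal (fst z) ^ 2 * indicator {j} (snd z))" for z
      by (auto simp: f_def g_def indicator_def power2_eq_square mult_ac)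
    then show ?thesis using levy_labels_moment[OF j, of u 2] by simp
  qed
  have fin: "levy_moment \<rho> 1 (u j) < top" "levy_moment \<rho> 2 (u j) < top"
    using levy_moment_finite'[OF \<rho> u] by auto
  have "(\<integral>\<^sup>+z. nexp (\<Sum>k. f (z k)) * (\<Sum>k. g (z k)) * (\<Sum>k. g (z k)) \<partial>W)
    = nexp (\<integral>\<^sup>+z. 1 - nexp (f z) \<partial>?\<nu>) *
      ((\<integral>\<^sup>+z. nexp (f z) * g z * g z \<partial>?\<nu>) + (\<integral>\<^sup>+z. nexp (f z) * g z \<partial>?\<nu>) * (\<integral>\<^sup>+z. nexp (f z) * g z \<partial>?\<nu>))"
    by (rule campbell2[OF lap_W fm fm(2)]) (use fin in \<open>auto simp: g1 g2 ennreal_mult_less_top\<close>)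
  also have "\<dots> = nexp (ennreal a * (\<Sum>l\<in>{1..J}. laplace_exponent \<rho> (u l))) *
      (ennreal a * levy_moment \<rho> 2 (u j) + (ennreal a * levy_moment \<rho> 1 (u j)) ^ 2)"
    unfolding g1 g2 by (simp add: f_def levy_labels_exponent power2_eq_square)
  finally show ?thesis by (simp add: f_def g_def tot_def power2_eq_square mult.assoc)
qed

lemma tot_ge: "j \<in> B \<Longrightarrow> tot {j} z \<le> tot B z"
  unfolding tot_def by (intro suminf_le) (auto simp: indicator_def)

lemma tot_UNIV: "tot UNIV z = (\<Sum>k. ennreal (fst (z k)))"
  by (simp add: tot_def)

lemma tot_le_UNIV: "tot B z \<le> tot UNIV z"
  unfolding tot_def by (intro suminf_le) (auto simp: indicator_def)

lemma good_tot: "good_points z \<Longrightarrow> 0 < tot UNIV z \<and> tot UNIV z < top"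
  using suminf_ennreal_bounds[of z] by (simp add: tot_UNIV good_points_def)

lemma label_mass_tot:
  assumes "good_points z"
  shows "label_mass (weight_pmf z) (\<lambda>k. snd (z k)) j = tot {j} z / tot UNIV z"
  unfolding label_mass_def emeasure_weight_pmf[OF assms] tot_def
  by (simp add: indicator_def)

lemma square_mass_tot:
  assumes "good_points z"
  shows "square_mass (weight_pmf z) (\<lambda>k. snd (z k)) j = sq j z / tot UNIV z ^ 2"
proof -
  have T: "(\<Sum>k. ennreal (fst (z k))) = ennreal (\<Sum>k. fst (z k))" "0 < (\<Sum>k. fst (z k))"
    using assms by (auto intro!: suminf_ennreal_bounds simp: good_points_def)
  have "square_mass (weight_pmf z) (\<lambda>k. snd (z k)) j
      = (\<Sum>k. ennreal (fst (z k)) * (indicator {k. snd (z k) = j} k * ennreal (pmf (weight_pmf z) k))) / tot UNIV z"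
    unfolding square_mass_def tot_UNIV by (rule nn_integral_weight_pmf[OF assms])
  also have "(\<Sum>k. ennreal (fst (z k)) * (indicator {k. snd (z k) = j} k * ennreal (pmf (weight_pmf z) k)))
      = (\<Sum>k. ennreal (fst (z k)) ^ 2 * indicator {j} (snd (z k)) * inverse (tot UNIV z))"
  proof (intro suminf_cong)
    fix k
    have "ennreal (pmf (weight_pmf z) k) = ennreal (fst (z k)) * inverse (tot UNIV z)"
      using T assms by (simp add: pmf_weight tot_UNIV divide_ennreal[symmetric] good_points_def less_imp_le divide_ennreal_def)
    then show "ennreal (fst (z k)) * (indicator {k. snd (z k) = j} k * ennreal (pmf (weight_pmf z) k))
        = ennreal (fst (z k)) ^ 2 * indicator {j} (snd (z k)) * inverse (tot UNIV z)"
      by (simp add: indicator_def power2_eq_square mult_ac)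
  qed
  also have "\<dots> = sq j z * inverse (tot UNIV z)"
    by (simp add: sq_def)
  finally show ?thesis
    using T by (simp add: divide_ennreal_def tot_UNIV power2_eq_square ennreal_inverse_mult less_top mult.assoc)
qed

lemma AE_tot_pos:
  assumes j: "j \<in> {1..J}" and B: "j \<in> B"
  shows "AE z in W. 0 < tot B z \<and> tot B z < top"
  using AE_label_mass_pos[OF j] AE_good_W
proof eventually_elim
  case (elim z)
  then have "0 < tot {j} z" by (auto simp: label_mass_tot zero_less_iff_neq_zero)
  then show ?case
    using tot_ge[OF B, of z] tot_le_UNIV[of B z] good_tot[OF elim(2)] by (auto intro: less_le_trans le_less_trans)
qed

lemma suminf_weighted_labels: "(\<Sum>k. u (snd (z k)) * ennreal (fst (z k))) = (\<Sum>l\<in>{1..J}. u l * tot {l} z)"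
  if "\<And>k. snd (z k) \<in> {1..J}" for u :: "nat \<Rightarrow> ennreal"
proof -
  have "(\<Sum>l\<in>{1..J}. u l * tot {l} z) = (\<Sum>k. \<Sum>l\<in>{1..J}. u l * (ennreal (fst (z k)) * indicator {l} (snd (z k))))"
    unfolding tot_def ennreal_suminf_cmult[symmetric] by (rule suminf_sum[symmetric]) simp
  also have "\<dots> = (\<Sum>k. u (snd (z k)) * ennreal (fst (z k)))"
  proof (intro suminf_cong)
    fix k
    have "(\<Sum>l\<in>{1..J}. u l * (ennreal (fst (z k)) * indicator {l} (snd (z k))))
        = (\<Sum>l\<in>{1..J}. if l = snd (z k) then u (snd (z k)) * ennreal (fst (z k)) else 0)"
      by (intro sum.cong) (auto simp: indicator_def)
    then show "(\<Sum>l\<in>{1..J}. u l * (ennreal (fst (z k)) * indicator {l} (snd (z k)))) = u (snd (z k)) * ennreal (fst (z k))"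
      using that[of k] by simp
  qed
  finally show ?thesis ..
qed

lemma tot_sum: "finite B \<Longrightarrow> tot B z = (\<Sum>l\<in>B. tot {l} z)"
proof -
  assume B: "finite B"
  have "(\<Sum>l\<in>B. tot {l} z) = (\<Sum>k. \<Sum>l\<in>B. ennreal (fst (z k)) * indicator {l} (snd (z k)))"
    unfolding tot_def by (rule suminf_sum[symmetric]) simp
  also have "\<dots> = tot B z"
    unfolding tot_def using B
    by (intro suminf_cong) (simp add: indicator_def sum_distrib_left[symmetric] of_bool_def[symmetric] flip: sum_distrib_left)
  finally show ?thesis ..
qed

text \<open>For the gamma process the second moment of a bucket is proportional to its sum of squares, even
  after an arbitrary exponential tilt of the bucket totals.\<close>

lemma gamma_tilted_moments:
  assumes DP: "\<And>u. 0 < u \<Longrightarrow> levy_moment \<rho> 2 u = levy_moment \<rho> 1 u ^ 2" and j: "j \<in> {1..J}" and u: "0 < u j"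
  shows "(\<integral>\<^sup>+z. nexp (\<Sum>l\<in>{1..J}. u l * tot {l} z) * (ennreal (1 + a) * sq j z) \<partial>W)
    = (\<integral>\<^sup>+z. nexp (\<Sum>l\<in>{1..J}. u l * tot {l} z) * tot {j} z ^ 2 \<partial>W)"
proof -
  have um: "(\<lambda>z. \<Sum>k. u (snd (z k)) * ennreal (fst (z k))) \<in> borel_measurable W"
    by (rule suminf_labels_measurable[of "\<lambda>z. u (snd z) * ennreal (fst z)"]) simp
  have eq: "(\<integral>\<^sup>+z. nexp (\<Sum>l\<in>{1..J}. u l * tot {l} z) * F z \<partial>W)
      = (\<integral>\<^sup>+z. nexp (\<Sum>k. u (snd (z k)) * ennreal (fst (z k))) * F z \<partial>W)" for F
  proof (intro nn_integral_cong)
    fix z assume "z \<in> space W"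
    then have "(\<Sum>k. u (snd (z k)) * ennreal (fst (z k))) = (\<Sum>l\<in>{1..J}. u l * tot {l} z)"
      by (intro suminf_weighted_labels space_marked_labels)
    then show "nexp (\<Sum>l\<in>{1..J}. u l * tot {l} z) * F z
        = nexp (\<Sum>k. u (snd (z k)) * ennreal (fst (z k))) * F z"
      by (simp only:)
  qed
  have "(\<integral>\<^sup>+z. nexp (\<Sum>k. u (snd (z k)) * ennreal (fst (z k))) * (ennreal (1 + a) * sq j z) \<partial>W)
      = ennreal (1 + a) * (\<integral>\<^sup>+z. nexp (\<Sum>k. u (snd (z k)) * ennreal (fst (z k))) * sq j z \<partial>W)"
    using um by (subst nn_integral_cmult[symmetric]) (auto simp: mult_ac)
  also have "\<dots> = nexp (ennreal a * (\<Sum>l\<in>{1..J}. laplace_exponent \<rho> (u l))) *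
      (ennreal (1 + a) * (ennreal a * levy_moment \<rho> 2 (u j)))"
    unfolding laplace_sq[where u = u, OF j] by (simp only: mult_ac)
  also have "ennreal (1 + a) * (ennreal a * levy_moment \<rho> 2 (u j))
      = ennreal a * levy_moment \<rho> 2 (u j) + (ennreal a * levy_moment \<rho> 1 (u j)) ^ 2"
  proof -
    have "ennreal (1 + a) = 1 + ennreal a" using a_pos by simp
    then show ?thesis by (simp add: DP[OF u] power_mult_distrib distrib_left distrib_right power2_eq_square mult_ac)
  qed
  finally show ?thesis unfolding eq laplace_tot2[where u = u, OF j u] .
qed

end

section \<open>Sufficiency: the gamma process\<close>

lemma rescaled_square_ratio:
  assumes "0 < s" "0 < t"
  shows "(x / ennreal t ^ 2) / (ennreal s / ennreal t) ^ 2 = x * inverse (ennreal s ^ 2)"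
proof -
  have "inverse (ennreal t ^ 2) * inverse ((ennreal s / ennreal t) ^ 2) = ennreal (inverse (t ^ 2) * inverse ((s / t) ^ 2))"
    using assms by (simp add: divide_ennreal ennreal_power inverse_ennreal ennreal_mult)
  also have "inverse (t ^ 2) * inverse ((s / t) ^ 2) = inverse (s ^ 2)"
    using assms by (simp add: field_simps)
  finally show ?thesis
    using assms by (simp add: divide_ennreal_def[of x] divide_ennreal_def[of "x * _"] mult.assoc ennreal_power inverse_ennreal)
qed

context sketch_model
begin

lemma E_ratio: "E (\<lambda>P h. square_ratio P h j) = (\<integral>\<^sup>+z. sq j z / tot {j} z ^ 2 \<partial>W)"
  unfolding expect_model_def
  using AE_good_W
proof (intro nn_integral_cong_AE, eventually_elim)
  case (elim z)
  obtain t where t: "tot UNIV z = ennreal t" "0 < t" using good_tot[OF elim(2)] by (cases "tot UNIV z") auto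
  show ?case
  proof (cases "tot {j} z = 0")
    case True
    then have "square_mass (weight_pmf z) (\<lambda>k. snd (z k)) j = 0"
      using square_mass_le[of "weight_pmf z" "\<lambda>k. snd (z k)" j] by (simp add: label_mass_tot[OF elim(2)])
    moreover from this have "sq j z = 0"
      using t by (simp add: square_mass_tot[OF elim(2)] ennreal_divide_eq_0_iff ennreal_power)
    ultimately show ?thesis by (simp add: square_ratio_eq)
  next
    case False
    obtain q where q: "tot {j} z = ennreal q" "0 < q"
      using False tot_le_UNIV[of "{j}" z] t by (cases "tot {j} z") (auto simp: top_unique)
    show ?thesis
      unfolding square_ratio_eq label_mass_tot[OF elim(2)] square_mass_tot[OF elim(2)]
      by (simp only: t(1) q(1) rescaled_square_ratio[OF q(2) t(2)], simp only: divide_ennreal_def)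
  qed
qed

text \<open>The integrands are homogeneous of degree \<open>n + 2\<close> in the normalized masses,
  so they carry \<open>T ^ - (n + 2)\<close>, which is the gamma mixture of index
  \<open>n + 1\<close>.\<close>

lemma E_square_product:
  fixes A :: "nat set"
  assumes A: "finite A" and n: "n = card A"
  shows "E (\<lambda>P h. square_mass P h j * (\<Prod>i\<in>A. label_mass P h (b i)))
      = (\<integral>\<^sup>+u. gamma_weight (n + 1) u * (\<integral>\<^sup>+z. nexp (ennreal u * tot UNIV z) * (sq j z * (\<Prod>i\<in>A. tot {b i} z)) \<partial>W) \<partial>lborel)"
    and "E (\<lambda>P h. label_mass P h j ^ 2 * (\<Prod>i\<in>A. label_mass P h (b i)))
      = (\<integral>\<^sup>+u. gamma_weight (n + 1) u * (\<integral>\<^sup>+z. nexp (ennreal u * tot UNIV z) * (tot {j} z ^ 2 * (\<Prod>i\<in>A. tot {b i} z)) \<partial>W) \<partial>lborel)"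
proof -
  have pos: "AE z in W. 0 < tot UNIV z \<and> tot UNIV z < top"
    using AE_good_W by eventually_elim (rule good_tot)
  have inv: "(\<Prod>i\<in>A. x i / t) = (\<Prod>i\<in>A. x i) * inverse t ^ n" for x :: "nat \<Rightarrow> ennreal" and t
    by (simp add: divide_ennreal_def prod.distrib n)
  have invp: "inverse (t ^ m) = inverse t ^ m" if "0 < t" for t :: ennreal and m
    using that by (simp add: ennreal_inverse_power)
  have [measurable]: "(\<lambda>z. \<Prod>i\<in>A. tot {b i} z) \<in> borel_measurable W"
    by (intro borel_measurable_prod_ennreal) measurable
  have "E (\<lambda>P h. square_mass P h j * (\<Prod>i\<in>A. label_mass P h (b i)))
      = (\<integral>\<^sup>+z. (sq j z * (\<Prod>i\<in>A. tot {b i} z)) * inverse (tot UNIV z ^ Suc (n + 1)) \<partial>W)"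
    unfolding expect_model_def using AE_good_W pos
  proof (intro nn_integral_cong_AE, eventually_elim)
    case (elim z)
    have T: "0 < tot UNIV z" using elim by simp
    show ?case
      unfolding square_mass_tot[OF elim(3)] label_mass_tot[OF elim(3)] inv divide_ennreal_def[of "sq j z"] invp[OF T]
      by (simp add: power_add power2_eq_square mult_ac)
  qed
  then show "E (\<lambda>P h. square_mass P h j * (\<Prod>i\<in>A. label_mass P h (b i)))
      = (\<integral>\<^sup>+u. gamma_weight (n + 1) u * (\<integral>\<^sup>+z. nexp (ennreal u * tot UNIV z) * (sq j z * (\<Prod>i\<in>A. tot {b i} z)) \<partial>W) \<partial>lborel)"
    by (simp only:) (rule nn_integral_gamma_mixture[OF W.sigma_finite_measure_axioms _ _ pos], measurable)
  have "E (\<lambda>P h. label_mass P h j ^ 2 * (\<Prod>i\<in>A. label_mass P h (b i)))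
      = (\<integral>\<^sup>+z. (tot {j} z ^ 2 * (\<Prod>i\<in>A. tot {b i} z)) * inverse (tot UNIV z ^ Suc (n + 1)) \<partial>W)"
    unfolding expect_model_def using AE_good_W pos
  proof (intro nn_integral_cong_AE, eventually_elim)
    case (elim z)
    have T: "0 < tot UNIV z" using elim by simp
    show ?case
      unfolding label_mass_tot[OF elim(3)] inv divide_ennreal_def[of "tot {j} z"] invp[OF T] power_mult_distrib
      by (simp add: power_add power2_eq_square mult_ac)
  qed
  then show "E (\<lambda>P h. label_mass P h j ^ 2 * (\<Prod>i\<in>A. label_mass P h (b i)))
      = (\<integral>\<^sup>+u. gamma_weight (n + 1) u * (\<integral>\<^sup>+z. nexp (ennreal u * tot UNIV z) * (tot {j} z ^ 2 * (\<Prod>i\<in>A. tot {b i} z)) \<partial>W) \<partial>lborel)"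
    by (simp only:) (rule nn_integral_gamma_mixture[OF W.sigma_finite_measure_axioms _ _ pos], measurable)
qed

lemma sq_le: "good_points z \<Longrightarrow> sq j z \<le> tot UNIV z ^ 2"
proof -
  assume z: "good_points z"
  have "ennreal (fst (z k)) ^ 2 * indicator {j} (snd (z k)) \<le> ennreal (fst (z k)) * tot UNIV z" for k
  proof -
    have "ennreal (fst (z k)) \<le> tot UNIV z"
      unfolding tot_UNIV using sum_le_suminf[OF summableI, of "{k}" "\<lambda>k. ennreal (fst (z k))"] by simp
    then show ?thesis by (auto simp: indicator_def power2_eq_square intro: mult_left_mono)
  qed
  then have "sq j z \<le> (\<Sum>k. ennreal (fst (z k)) * tot UNIV z)"
    unfolding sq_def by (intro suminf_le) auto
  then show ?thesis by (simp add: tot_UNIV power2_eq_square)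
qed

text \<open>Weighting \<open>W\<close> by \<open>(1 + a) sq j\<close> or by
  \<open>tot {j} ^ 2\<close> gives the same integral of every exponential in the bucket totals.
  Hence the two weighted laws, tilted by the total mass, have the same mixed moments of bucket
  totals, which yields the moment identities up to the factor \<open>1 + a\<close>. Tilting bucket
  \<open>j\<close> alone identifies this factor as the reciprocal of
  \<open>E[S\<^sub>j / q\<^sub>j\<^sup>2]\<close>.\<close>

lemma gamma_uncorrelated:
  assumes DP: "\<And>u. 0 < u \<Longrightarrow> levy_moment \<rho> 2 u = levy_moment \<rho> 1 u ^ 2" and j: "j \<in> {1..J}"
  shows "uncorrelated j"
proof -
  have prods: "ennreal (1 + a) * E (\<lambda>P h. square_mass P h j * (\<Prod>i\<in>A. label_mass P h (b i)))
      = E (\<lambda>P h. label_mass P h j ^ 2 * (\<Prod>i\<in>A. label_mass P h (b i)))"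
    if A: "finite A" and b: "\<forall>i\<in>A. b i \<in> {1..J}" for A :: "nat set" and b
  proof -
    have [measurable]: "(\<lambda>z. \<Prod>i\<in>B. tot {b i} z) \<in> borel_measurable W" for B
      by (intro borel_measurable_prod_ennreal) measurable
    have inner: "(\<integral>\<^sup>+z. nexp (ennreal u * tot UNIV z) * ((ennreal (1 + a) * sq j z) * (\<Prod>i\<in>A. tot {b i} z)) \<partial>W)
        = (\<integral>\<^sup>+z. nexp (ennreal u * tot UNIV z) * (tot {j} z ^ 2 * (\<Prod>i\<in>A. tot {b i} z)) \<partial>W)" if u: "0 < u" for u
    proof -
      define M1 where "M1 = density W (\<lambda>z. nexp (ennreal u * tot UNIV z) * (ennreal (1 + a) * sq j z))"
      define M2 where "M2 = density W (\<lambda>z. nexp (ennreal u * tot UNIV z) * tot {j} z ^ 2)"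
      have d1: "(\<integral>\<^sup>+z. F z \<partial>M1) = (\<integral>\<^sup>+z. nexp (ennreal u * tot UNIV z) * (ennreal (1 + a) * sq j z) * F z \<partial>W)"
        if "F \<in> borel_measurable W" for F
        unfolding M1_def using that by (intro nn_integral_density) measurable
      have d2: "(\<integral>\<^sup>+z. F z \<partial>M2) = (\<integral>\<^sup>+z. nexp (ennreal u * tot UNIV z) * tot {j} z ^ 2 * F z \<partial>W)"
        if "F \<in> borel_measurable W" for F
        unfolding M2_def using that by (intro nn_integral_density) measurable
      have bound: "nexp (ennreal u * tot UNIV z) * (tot UNIV z ^ 2 * (\<Prod>i\<in>B. tot {b i} z))
          \<le> ennreal (fact (card B + 2) / u ^ (card B + 2))" for B z
      proof -
        have "(\<Prod>i\<in>B. tot {b i} z) \<le> (\<Prod>i\<in>B. tot UNIV z)"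
          by (intro prod_mono_ennreal tot_le_UNIV)
        then have "nexp (ennreal u * tot UNIV z) * (tot UNIV z ^ 2 * (\<Prod>i\<in>B. tot {b i} z))
            \<le> nexp (ennreal u * tot UNIV z) * (tot UNIV z ^ 2 * tot UNIV z ^ card B)"
          by (intro mult_left_mono) auto
        also have "\<dots> = tot UNIV z ^ (card B + 2) * nexp (ennreal u * tot UNIV z)"
          by (simp add: power_add power2_eq_square mult_ac)
        also have "\<dots> \<le> ennreal (fact (card B + 2) / u ^ (card B + 2))"
          by (rule power_mult_nexp_le[OF u])
        finally show ?thesis .
      qed
      have fin0: "(\<integral>\<^sup>+z. c * (nexp (ennreal u * tot UNIV z) * (tot UNIV z ^ 2 * (\<Prod>i\<in>B. tot {b i} z))) \<partial>W) < top"
        if "c < top" for B c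
      proof -
        have "(\<integral>\<^sup>+z. c * (nexp (ennreal u * tot UNIV z) * (tot UNIV z ^ 2 * (\<Prod>i\<in>B. tot {b i} z))) \<partial>W)
            \<le> (\<integral>\<^sup>+z. c * ennreal (fact (card B + 2) / u ^ (card B + 2)) \<partial>W)"
          by (intro nn_integral_mono mult_left_mono bound) auto
        also have "\<dots> < top" using that by (simp add: W.emeasure_space_1 ennreal_mult_less_top)
        finally show ?thesis .
      qed
      have "(\<integral>\<^sup>+z. (\<Prod>i\<in>A. tot {b i} z) \<partial>M1) = (\<integral>\<^sup>+z. (\<Prod>i\<in>A. tot {b i} z) \<partial>M2)"
      proof (rule prod_laplace_eq[OF A])
        fix t :: "nat \<Rightarrow> ennreal"
        \<comment> \<open>The tilt \<open>u\<close> of the total mass and the variables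
          \<open>t i\<close> of all factors with label \<open>l\<close> merge into one coefficient
          for bucket \<open>l\<close>.\<close>
        define v where "v l = ennreal u + (\<Sum>i | i \<in> A \<and> b i = l. t i)" for l
        have vj: "0 < v j" using u by (simp add: v_def zero_less_iff_neq_zero)
        have v: "ennreal u * tot UNIV z + (\<Sum>i\<in>A. t i * tot {b i} z) = (\<Sum>l\<in>{1..J}. v l * tot {l} z)"
          if z: "z \<in> space W" for z
        proof -
          have "(\<Sum>i\<in>A. t i * tot {b i} z) = (\<Sum>l\<in>{1..J}. \<Sum>i | i \<in> A \<and> b i = l. t i * tot {b i} z)"
            using A b by (intro sum.group[symmetric]) auto
          also have "\<dots> = (\<Sum>l\<in>{1..J}. (\<Sum>i | i \<in> A \<and> b i = l. t i) * tot {l} z)"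
            by (intro sum.cong refl) (simp add: sum_distrib_right)
          finally have 1: "(\<Sum>i\<in>A. t i * tot {b i} z) = (\<Sum>l\<in>{1..J}. (\<Sum>i | i \<in> A \<and> b i = l. t i) * tot {l} z)" .
          have "ennreal u * tot UNIV z = (\<Sum>k. (\<lambda>_. ennreal u) (snd (z k)) * ennreal (fst (z k)))"
            by (simp add: tot_UNIV)
          also have "\<dots> = (\<Sum>l\<in>{1..J}. ennreal u * tot {l} z)"
            by (rule suminf_weighted_labels) (rule space_marked_labels[OF z])
          finally have 2: "ennreal u * tot UNIV z = (\<Sum>l\<in>{1..J}. ennreal u * tot {l} z)" .
          show ?thesis unfolding 1 2 v_def by (simp add: sum.distrib distrib_right)
        qed
        have "(\<integral>\<^sup>+z. nexp (\<Sum>i\<in>A. t i * tot {b i} z) \<partial>M1)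
            = (\<integral>\<^sup>+z. nexp (\<Sum>l\<in>{1..J}. v l * tot {l} z) * (ennreal (1 + a) * sq j z) \<partial>W)"
        proof (subst d1)
          show "(\<integral>\<^sup>+z. nexp (ennreal u * tot UNIV z) * (ennreal (1 + a) * sq j z) * nexp (\<Sum>i\<in>A. t i * tot {b i} z) \<partial>W)
            = (\<integral>\<^sup>+z. nexp (\<Sum>l\<in>{1..J}. v l * tot {l} z) * (ennreal (1 + a) * sq j z) \<partial>W)"
          proof (intro nn_integral_cong)
            fix z assume "z \<in> space W"
            from v[OF this, symmetric]
            show "nexp (ennreal u * tot UNIV z) * (ennreal (1 + a) * sq j z) * nexp (\<Sum>i\<in>A. t i * tot {b i} z)
              = nexp (\<Sum>l\<in>{1..J}. v l * tot {l} z) * (ennreal (1 + a) * sq j z)"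
              by (simp only: nexp_add mult_ac)
          qed
        qed measurable
        also have "\<dots> = (\<integral>\<^sup>+z. nexp (\<Sum>l\<in>{1..J}. v l * tot {l} z) * tot {j} z ^ 2 \<partial>W)"
          by (rule gamma_tilted_moments[where u = v, OF DP j vj])
        also have "\<dots> = (\<integral>\<^sup>+z. nexp (\<Sum>i\<in>A. t i * tot {b i} z) \<partial>M2)"
        proof (subst d2)
          show "(\<integral>\<^sup>+z. nexp (\<Sum>l\<in>{1..J}. v l * tot {l} z) * tot {j} z ^ 2 \<partial>W)
            = (\<integral>\<^sup>+z. nexp (ennreal u * tot UNIV z) * tot {j} z ^ 2 * nexp (\<Sum>i\<in>A. t i * tot {b i} z) \<partial>W)"
          proof (intro nn_integral_cong)
            fix z assume "z \<in> space W"
            from v[OF this, symmetric]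
            show "nexp (\<Sum>l\<in>{1..J}. v l * tot {l} z) * tot {j} z ^ 2
              = nexp (ennreal u * tot UNIV z) * tot {j} z ^ 2 * nexp (\<Sum>i\<in>A. t i * tot {b i} z)"
              by (simp only: nexp_add mult_ac)
          qed
        qed measurable
        finally show "(\<integral>\<^sup>+z. nexp (\<Sum>i\<in>A. t i * tot {b i} z) \<partial>M1) = (\<integral>\<^sup>+z. nexp (\<Sum>i\<in>A. t i * tot {b i} z) \<partial>M2)" .
      next
        fix B assume "B \<subseteq> A"
        have "(\<integral>\<^sup>+z. (\<Prod>i\<in>B. tot {b i} z) \<partial>M1) = (\<integral>\<^sup>+z. nexp (ennreal u * tot UNIV z) * (ennreal (1 + a) * sq j z) * (\<Prod>i\<in>B. tot {b i} z) \<partial>W)"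
          by (rule d1) measurable
        also have "\<dots> \<le> (\<integral>\<^sup>+z. ennreal (1 + a) * (nexp (ennreal u * tot UNIV z) * (tot UNIV z ^ 2 * (\<Prod>i\<in>B. tot {b i} z))) \<partial>W)"
          using AE_good_W
        proof (intro nn_integral_mono_AE, eventually_elim)
          case (elim z)
          have "ennreal (1 + a) * (nexp (ennreal u * tot UNIV z) * (sq j z * (\<Prod>i\<in>B. tot {b i} z)))
              \<le> ennreal (1 + a) * (nexp (ennreal u * tot UNIV z) * (tot UNIV z ^ 2 * (\<Prod>i\<in>B. tot {b i} z)))"
            by (intro mult_left_mono mult_right_mono sq_le elim) auto
          then show ?case by (simp only: mult_ac)
        qed
        also have "\<dots> < top" by (rule fin0) simp
        finally show "(\<integral>\<^sup>+z. (\<Prod>i\<in>B. tot {b i} z) \<partial>M1) < top" .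
        have "(\<integral>\<^sup>+z. (\<Prod>i\<in>B. tot {b i} z) \<partial>M2) = (\<integral>\<^sup>+z. nexp (ennreal u * tot UNIV z) * tot {j} z ^ 2 * (\<Prod>i\<in>B. tot {b i} z) \<partial>W)"
          by (rule d2) measurable
        also have "\<dots> \<le> (\<integral>\<^sup>+z. 1 * (nexp (ennreal u * tot UNIV z) * (tot UNIV z ^ 2 * (\<Prod>i\<in>B. tot {b i} z))) \<partial>W)"
          by (intro nn_integral_mono) (simp add: mult.assoc, intro mult_left_mono mult_right_mono power_mono tot_le_UNIV, auto)
        also have "\<dots> < top" by (rule fin0) simp
        finally show "(\<integral>\<^sup>+z. (\<Prod>i\<in>B. tot {b i} z) \<partial>M2) < top" .
      qed (simp_all add: M1_def M2_def)
      then show ?thesis by (simp add: d1 d2 mult.assoc)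
    qed
    have "ennreal (1 + a) * E (\<lambda>P h. square_mass P h j * (\<Prod>i\<in>A. label_mass P h (b i)))
        = (\<integral>\<^sup>+u. gamma_weight (card A + 1) u * (ennreal (1 + a) * (\<integral>\<^sup>+z. nexp (ennreal u * tot UNIV z) * (sq j z * (\<Prod>i\<in>A. tot {b i} z)) \<partial>W)) \<partial>lborel)"
      unfolding E_square_product(1)[OF A refl]
      by (subst nn_integral_cmult[symmetric]) (auto simp: mult.left_commute)
    also have "\<dots> = (\<integral>\<^sup>+u. gamma_weight (card A + 1) u * (\<integral>\<^sup>+z. nexp (ennreal u * tot UNIV z) * (tot {j} z ^ 2 * (\<Prod>i\<in>A. tot {b i} z)) \<partial>W) \<partial>lborel)"
    proof (rule gamma_weight_cong_AE)
      fix u :: real assume u: "0 < u"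
      have "ennreal (1 + a) * (\<integral>\<^sup>+z. nexp (ennreal u * tot UNIV z) * (sq j z * (\<Prod>i\<in>A. tot {b i} z)) \<partial>W)
          = (\<integral>\<^sup>+z. nexp (ennreal u * tot UNIV z) * ((ennreal (1 + a) * sq j z) * (\<Prod>i\<in>A. tot {b i} z)) \<partial>W)"
        by (subst nn_integral_cmult[symmetric]) (auto simp: mult_ac)
      then show "ennreal (1 + a) * (\<integral>\<^sup>+z. nexp (ennreal u * tot UNIV z) * (sq j z * (\<Prod>i\<in>A. tot {b i} z)) \<partial>W)
          = (\<integral>\<^sup>+z. nexp (ennreal u * tot UNIV z) * (tot {j} z ^ 2 * (\<Prod>i\<in>A. tot {b i} z)) \<partial>W)"
        by (simp only: inner[OF u])
    qed
    also have "\<dots> = E (\<lambda>P h. label_mass P h j ^ 2 * (\<Prod>i\<in>A. label_mass P h (b i)))"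
      unfolding E_square_product(2)[OF A refl] ..
    finally show ?thesis .
  qed
  have pos: "AE z in W. 0 < tot {j} z \<and> tot {j} z < top" by (rule AE_tot_pos[OF j]) simp
  have one: "ennreal (1 + a) * E (\<lambda>P h. square_ratio P h j) = 1"
  proof -
    \<comment> \<open>A tilt of bucket \<open>j\<close> alone produces the inverse square of its own
      total, hence the ratio \<open>S\<^sub>j / q\<^sub>j\<^sup>2\<close>, in which the total mass
      cancels.\<close>
    define v where "v u l = (if l = j then ennreal u else 0)" for u and l :: nat
    have v: "(\<Sum>l\<in>{1..J}. v u l * tot {l} z) = ennreal u * tot {j} z" for u z
    proof -
      have "(\<Sum>l\<in>{1..J}. v u l * tot {l} z) = (\<Sum>l\<in>{1..J}. if l = j then ennreal u * tot {j} z else 0)"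
        by (intro sum.cong) (auto simp: v_def)
      then show ?thesis using j by simp
    qed
    have "ennreal (1 + a) * E (\<lambda>P h. square_ratio P h j) = (\<integral>\<^sup>+z. (ennreal (1 + a) * sq j z) * inverse (tot {j} z ^ Suc 1) \<partial>W)"
      unfolding E_ratio by (subst nn_integral_cmult[symmetric]) (auto simp: divide_ennreal_def power2_eq_square mult_ac)
    also have "\<dots> = (\<integral>\<^sup>+u. gamma_weight 1 u * (\<integral>\<^sup>+z. nexp (ennreal u * tot {j} z) * (ennreal (1 + a) * sq j z) \<partial>W) \<partial>lborel)"
      by (rule nn_integral_gamma_mixture[OF W.sigma_finite_measure_axioms _ _ pos]) measurable
    also have "\<dots> = (\<integral>\<^sup>+u. gamma_weight 1 u * (\<integral>\<^sup>+z. nexp (ennreal u * tot {j} z) * tot {j} z ^ 2 \<partial>W) \<partial>lborel)"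
    proof (rule gamma_weight_cong_AE)
      fix u :: real assume "0 < u"
      then have "0 < v u j" by (simp add: v_def)
      from gamma_tilted_moments[where u = "v u", OF DP j this]
      show "(\<integral>\<^sup>+z. nexp (ennreal u * tot {j} z) * (ennreal (1 + a) * sq j z) \<partial>W)
          = (\<integral>\<^sup>+z. nexp (ennreal u * tot {j} z) * tot {j} z ^ 2 \<partial>W)" by (simp add: v)
    qed
    also have "\<dots> = (\<integral>\<^sup>+z. tot {j} z ^ 2 * inverse (tot {j} z ^ Suc 1) \<partial>W)"
      by (rule nn_integral_gamma_mixture[OF W.sigma_finite_measure_axioms _ _ pos, symmetric]) measurable
    also have "\<dots> = (\<integral>\<^sup>+z. 1 \<partial>W)"
      using pos
    proof (intro nn_integral_cong_AE, eventually_elim)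
      case (elim z)
      then have "tot {j} z ^ Suc 1 \<noteq> 0" "tot {j} z ^ Suc 1 \<noteq> top"
        by (auto simp: ennreal_mult_eq_top_iff power2_eq_square)
      then show ?case
        using ennreal_divide_self[of "tot {j} z ^ Suc 1"]
        by (simp add: divide_ennreal_def less_top power2_eq_square)
    qed
    finally show ?thesis by (simp add: W.emeasure_space_1)
  qed
  show ?thesis
    unfolding uncorrelated_def
  proof (intro allI impI)
    fix A :: "nat set" and b assume Ab: "finite A" "\<forall>i\<in>A. b i \<in> {1..J}"
    let ?r = "E (\<lambda>P h. square_ratio P h j)" and ?s = "E (\<lambda>P h. square_mass P h j * (\<Prod>i\<in>A. label_mass P h (b i)))"
    have "?s = (ennreal (1 + a) * ?r) * ?s" unfolding one by simp
    also have "\<dots> = ?r * (ennreal (1 + a) * ?s)" by (simp only: mult_ac)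
    finally show "?s = ?r * E (\<lambda>P h. label_mass P h j ^ 2 * (\<Prod>i\<in>A. label_mass P h (b i)))"
      by (simp only: prods[OF Ab])
  qed
qed

section \<open>Necessity: integral identities for groups of buckets\<close>

text \<open>Let \<open>q\<close> be the mass of the buckets \<open>1..m\<close>. Monomials of degree
  \<open>k\<close> in the other masses add up to \<open>(1 - q) ^ k\<close>, and the weights
  \<open>k + 1\<close> turn these powers into \<open>1 / q\<^sup>2\<close>. In
  \<open>S\<^sub>1 / q\<^sup>2\<close> and \<open>q\<^sub>1\<^sup>2 / q\<^sup>2\<close> the total
  mass cancels, so only the tilt by the total of the \<open>m\<close> buckets is left, whose
  exponent is \<open>m a \<psi>\<close>. The power \<open>3 - n\<close> gives
  \<open>\<kappa>\<^sub>1\<^sup>2\<close> for \<open>n = 1\<close> and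
  \<open>\<kappa>\<^sub>2\<close> for \<open>n = 2\<close>. The bound by 1 comes from
  \<open>q\<^sub>1 \<le> q\<close> and supplies finiteness later on.\<close>

lemma uncorrelated_identity:
  assumes U: "uncorrelated 1" and m: "m \<in> {1..J}"
  defines "I n \<equiv> (\<integral>\<^sup>+u. gamma_weight 1 u * (nexp (ennreal (real m * a) * laplace_exponent \<rho> (ennreal u)) * levy_moment \<rho> n (ennreal u) ^ (3 - n)) \<partial>lborel)"
  shows "ennreal a * I 2 = E (\<lambda>P h. square_ratio P h 1) * (ennreal a * I 2 + ennreal (a ^ 2) * I 1)"
    and "ennreal a * I 2 + ennreal (a ^ 2) * I 1 \<le> 1"
proof -
  define B where "B = {1..m}"
  define D where "D = {m + 1..J}"
  have BD: "{1..J} = B \<union> D" "B \<inter> D = {}" "finite B" "finite D" "1 \<in> B" "card B = m" "B \<subseteq> {1..J}"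
    using m by (auto simp: B_def D_def)
  have one: "1 \<in> {1..J}" using J by simp
  define r where "r = E (\<lambda>P h. square_ratio P h 1)"
  define q where "q P h = (\<Sum>l\<in>B. label_mass P h l)" for P :: "nat pmf" and h
  have q_sum: "(\<Sum>l\<in>{1..J}. label_mass P h l) = 1" if h: "\<And>k. h k \<in> {1..J}" for P :: "nat pmf" and h
  proof -
    have "(\<Sum>l\<in>{1..J}. label_mass P h l) = emeasure (measure_pmf P) (\<Union>l\<in>{1..J}. {s. h s = l})"
      unfolding label_mass_def by (rule sum_emeasure) (auto simp: disjoint_family_on_def)
    also have "(\<Union>l\<in>{1..J}. {s. h s = l}) = space (measure_pmf P)" using h by auto
    finally show ?thesis by (simp add: measure_pmf.emeasure_space_1)
  qed
  have qD: "(\<Sum>l\<in>D. label_mass P h l) = 1 - q P h" and q1: "q P h \<le> 1" and q0: "label_mass P h 1 \<le> q P h"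
    if h: "\<And>k. h k \<in> {1..J}" for P :: "nat pmf" and h
  proof -
    have "q P h + (\<Sum>l\<in>D. label_mass P h l) = 1"
      using q_sum[OF h, of P] BD by (simp add: q_def sum.union_disjoint)
    moreover from this show "q P h \<le> 1" by (metis le_iff_add)
    ultimately show "(\<Sum>l\<in>D. label_mass P h l) = 1 - q P h"
      by (metis ennreal_add_diff_cancel_left ennreal_one_neq_top le_iff_add top_unique)
    show "label_mass P h 1 \<le> q P h" unfolding q_def using BD by (intro member_le_sum) auto
  qed
  have step: "E (\<lambda>P h. square_mass P h 1 * (1 - q P h) ^ k) = r * E (\<lambda>P h. label_mass P h 1 ^ 2 * (1 - q P h) ^ k)" for k
  proof -
    \<comment> \<open>The \<open>k\<close>-th power of the mass outside \<open>B\<close>, multiplied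
      out over all vectors of \<open>k\<close> labels in \<open>D\<close>.\<close>
    have expand: "(1 - q P h) ^ k = (\<Sum>b\<in>PiE {..<k} (\<lambda>_. D). \<Prod>i<k. label_mass P h (b i))"
      if h: "\<And>k. h k \<in> {1..J}" for P :: "nat pmf" and h
      unfolding qD[OF h, symmetric] using BD
      by (subst prod_sum_PiE[symmetric]) auto
    have fin: "finite (PiE {..<k} (\<lambda>_. D))" using BD by (intro finite_PiE) auto
    have [measurable]: "(\<lambda>z. \<Prod>i<k. label_mass (weight_pmf z) (\<lambda>k. snd (z k)) (b i)) \<in> borel_measurable W" for b
      by (intro borel_measurable_prod_ennreal) measurable
    have "E (\<lambda>P h. square_mass P h 1 * (1 - q P h) ^ k)
        = E (\<lambda>P h. \<Sum>b\<in>PiE {..<k} (\<lambda>_. D). square_mass P h 1 * (\<Prod>i<k. label_mass P h (b i)))"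
      by (intro expect_model_cong) (simp only: expand sum_distrib_left)
    also have "\<dots> = (\<Sum>b\<in>PiE {..<k} (\<lambda>_. D). E (\<lambda>P h. square_mass P h 1 * (\<Prod>i<k. label_mass P h (b i))))"
      unfolding expect_model_def by (rule nn_integral_sum) measurable
    also have "\<dots> = (\<Sum>b\<in>PiE {..<k} (\<lambda>_. D). r * E (\<lambda>P h. label_mass P h 1 ^ 2 * (\<Prod>i<k. label_mass P h (b i))))"
    proof (intro sum.cong refl)
      fix b assume "b \<in> PiE {..<k} (\<lambda>_. D)"
      then have "\<forall>i\<in>{..<k}. b i \<in> {1..J}" using BD by auto
      with U show "E (\<lambda>P h. square_mass P h 1 * (\<Prod>i<k. label_mass P h (b i)))
          = r * E (\<lambda>P h. label_mass P h 1 ^ 2 * (\<Prod>i<k. label_mass P h (b i)))"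
        unfolding uncorrelated_def r_def by blast
    qed
    also have "\<dots> = r * (\<Sum>b\<in>PiE {..<k} (\<lambda>_. D). E (\<lambda>P h. label_mass P h 1 ^ 2 * (\<Prod>i<k. label_mass P h (b i))))"
      by (rule sum_distrib_left[symmetric])
    also have "(\<Sum>b\<in>PiE {..<k} (\<lambda>_. D). E (\<lambda>P h. label_mass P h 1 ^ 2 * (\<Prod>i<k. label_mass P h (b i))))
        = E (\<lambda>P h. \<Sum>b\<in>PiE {..<k} (\<lambda>_. D). label_mass P h 1 ^ 2 * (\<Prod>i<k. label_mass P h (b i)))"
      unfolding expect_model_def by (rule nn_integral_sum[symmetric]) measurable
    also have "\<dots> = E (\<lambda>P h. label_mass P h 1 ^ 2 * (1 - q P h) ^ k)"
      by (intro expect_model_cong) (simp only: expand sum_distrib_left)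
    finally show ?thesis .
  qed
  have [measurable]: "(\<lambda>z. q (weight_pmf z) (\<lambda>k. snd (z k))) \<in> borel_measurable W"
    unfolding q_def by measurable
  have series: "E (\<lambda>P h. F P h / q P h ^ 2) = (\<Sum>k. of_nat (Suc k) * E (\<lambda>P h. F P h * (1 - q P h) ^ k))"
    if F: "\<And>P h. F P h \<le> label_mass P h 1 ^ 2" and Fm [measurable]: "(\<lambda>z. F (weight_pmf z) (\<lambda>k. snd (z k))) \<in> borel_measurable W" for F
  proof -
    have "E (\<lambda>P h. F P h / q P h ^ 2) = E (\<lambda>P h. \<Sum>k. of_nat (Suc k) * (F P h * (1 - q P h) ^ k))"
    proof (rule expect_model_cong)
      fix P :: "nat pmf" and h :: "nat \<Rightarrow> nat" assume h: "\<And>k. h k \<in> {1..J}"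
      have "label_mass P h 1 ^ 2 \<le> q P h ^ 2" by (intro power_mono q0 h) auto
      with F[of P h] have "F P h \<le> q P h ^ 2" by (rule order_trans)
      from geometric_square_series[OF q1[OF h] this]
      show "F P h / q P h ^ 2 = (\<Sum>k. of_nat (Suc k) * (F P h * (1 - q P h) ^ k))" ..
    qed
    also have "\<dots> = (\<Sum>k. of_nat (Suc k) * E (\<lambda>P h. F P h * (1 - q P h) ^ k))"
      unfolding expect_model_def
      by (subst nn_integral_suminf) (auto simp: nn_integral_cmult simp del: of_nat_Suc)
    finally show ?thesis .
  qed
  have qtot: "q (weight_pmf z) (\<lambda>k. snd (z k)) = tot B z / tot UNIV z" if "good_points z" for z
    unfolding q_def tot_sum[OF BD(3), of z] label_mass_tot[OF that]
    by (simp add: divide_ennreal_def sum_distrib_right)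
  have pos: "AE z in W. 0 < tot B z \<and> tot B z < top" by (rule AE_tot_pos[OF one BD(5)])
  have scale: "(x / ennreal t ^ 2) / (ennreal s / ennreal t) ^ 2 = x * inverse (ennreal s ^ Suc 1)" if "0 < s" "0 < t" for x s t
    using rescaled_square_ratio[OF that] by (simp add: power2_eq_square)
  define v where "v u l = (if l \<in> B then ennreal u else 0)" for u and l :: nat
  have v1: "v u 1 = ennreal u" for u using BD by (simp add: v_def)
  have v: "(\<Sum>k. v u (snd (z k)) * ennreal (fst (z k))) = ennreal u * tot B z" for u and z :: "nat \<Rightarrow> real \<times> nat"
  proof -
    have "(\<Sum>k. v u (snd (z k)) * ennreal (fst (z k))) = (\<Sum>k. ennreal u * (ennreal (fst (z k)) * indicator B (snd (z k))))"
      by (intro suminf_cong) (auto simp: v_def indicator_def)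
    then show ?thesis by (simp add: tot_def)
  qed
  have ve: "(\<Sum>l\<in>{1..J}. laplace_exponent \<rho> (v u l)) = of_nat m * laplace_exponent \<rho> (ennreal u)" for u
  proof -
    have "(\<Sum>l\<in>{1..J}. laplace_exponent \<rho> (v u l)) = (\<Sum>l\<in>{1..J}. if l \<in> B then laplace_exponent \<rho> (ennreal u) else 0)"
      by (intro sum.cong) (auto simp: v_def)
    also have "\<dots> = (\<Sum>l\<in>B. laplace_exponent \<rho> (ennreal u))"
      using BD(7) by (subst sum.inter_restrict[symmetric]) (auto simp: Int_absorb1)
    finally show ?thesis by (simp add: BD(6))
  qed
  have ma: "ennreal a * (of_nat m * x) = ennreal (real m * a) * x" for x
    using a_pos by (simp add: ennreal_mult'' ennreal_of_nat_eq_real_of_nat mult_ac)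
  have sqm: "(\<integral>\<^sup>+z. nexp (ennreal u * tot B z) * sq 1 z \<partial>W)
      = nexp (ennreal (real m * a) * laplace_exponent \<rho> (ennreal u)) * (ennreal a * levy_moment \<rho> 2 (ennreal u))" for u
    using laplace_sq[OF one, of "v u"] unfolding v ve ma v1 .
  have totm: "(\<integral>\<^sup>+z. nexp (ennreal u * tot B z) * tot {1} z ^ 2 \<partial>W)
      = nexp (ennreal (real m * a) * laplace_exponent \<rho> (ennreal u)) *
        (ennreal a * levy_moment \<rho> 2 (ennreal u) + (ennreal a * levy_moment \<rho> 1 (ennreal u)) ^ 2)" if "0 < u" for u
    using laplace_tot2[OF one, of "v u"] that unfolding v ve ma v1 by simp
  have [measurable]: "levy_moment \<rho> n \<in> borel_measurable borel" for n
    unfolding levy_moment_def[abs_def] by measurable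
  have [measurable]: "laplace_exponent \<rho> \<in> borel_measurable borel"
    unfolding laplace_exponent_def[abs_def] by measurable
  have L: "E (\<lambda>P h. square_mass P h 1 / q P h ^ 2) = ennreal a * I 2"
  proof -
    have "E (\<lambda>P h. square_mass P h 1 / q P h ^ 2) = (\<integral>\<^sup>+z. sq 1 z * inverse (tot B z ^ Suc 1) \<partial>W)"
      unfolding expect_model_def using AE_good_W pos
    proof (intro nn_integral_cong_AE, eventually_elim)
      case (elim z)
      obtain t where t: "tot UNIV z = ennreal t" "0 < t" using good_tot[OF elim(3)] by (cases "tot UNIV z") auto
      obtain s where s: "tot B z = ennreal s" "0 < s" using elim(4) by (cases "tot B z") auto
      show ?case unfolding qtot[OF elim(3)] square_mass_tot[OF elim(3)] t(1) s(1) by (rule scale[OF s(2) t(2)])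
    qed
    also have "\<dots> = (\<integral>\<^sup>+u. gamma_weight 1 u * (nexp (ennreal (real m * a) * laplace_exponent \<rho> (ennreal u)) * (ennreal a * levy_moment \<rho> 2 (ennreal u))) \<partial>lborel)"
      unfolding sqm[symmetric] by (rule nn_integral_gamma_mixture[OF W.sigma_finite_measure_axioms _ _ pos]) measurable
    also have "\<dots> = (\<integral>\<^sup>+u. ennreal a * (gamma_weight 1 u * (nexp (ennreal (real m * a) * laplace_exponent \<rho> (ennreal u)) * levy_moment \<rho> 2 (ennreal u))) \<partial>lborel)"
      by (simp only: mult_ac)
    also have "\<dots> = ennreal a * I 2"
      unfolding I_def by (subst nn_integral_cmult) auto
    finally show ?thesis .
  qed
  have R: "E (\<lambda>P h. label_mass P h 1 ^ 2 / q P h ^ 2) = ennreal a * I 2 + ennreal (a ^ 2) * I 1"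
  proof -
    have "E (\<lambda>P h. label_mass P h 1 ^ 2 / q P h ^ 2) = (\<integral>\<^sup>+z. tot {1} z ^ 2 * inverse (tot B z ^ Suc 1) \<partial>W)"
      unfolding expect_model_def using AE_good_W pos
    proof (intro nn_integral_cong_AE, eventually_elim)
      case (elim z)
      obtain t where t: "tot UNIV z = ennreal t" "0 < t" using good_tot[OF elim(3)] by (cases "tot UNIV z") auto
      obtain s where s: "tot B z = ennreal s" "0 < s" using elim(4) by (cases "tot B z") auto
      have "(tot {1} z / ennreal t) ^ 2 = tot {1} z ^ 2 / ennreal t ^ 2"
        using t(2) by (simp add: divide_ennreal_def power_mult_distrib ennreal_inverse_power)
      then show ?case unfolding qtot[OF elim(3)] label_mass_tot[OF elim(3)] t(1) s(1) using scale[OF s(2) t(2)] by simp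
    qed
    also have "\<dots> = (\<integral>\<^sup>+u. gamma_weight 1 u * (\<integral>\<^sup>+z. nexp (ennreal u * tot B z) * tot {1} z ^ 2 \<partial>W) \<partial>lborel)"
      by (rule nn_integral_gamma_mixture[OF W.sigma_finite_measure_axioms _ _ pos]) measurable
    also have "\<dots> = (\<integral>\<^sup>+u. gamma_weight 1 u * (nexp (ennreal (real m * a) * laplace_exponent \<rho> (ennreal u)) *
        (ennreal a * levy_moment \<rho> 2 (ennreal u) + (ennreal a * levy_moment \<rho> 1 (ennreal u)) ^ 2)) \<partial>lborel)"
      by (rule gamma_weight_cong_AE) (rule totm)
    also have "\<dots> = (\<integral>\<^sup>+u. ennreal a * (gamma_weight 1 u * (nexp (ennreal (real m * a) * laplace_exponent \<rho> (ennreal u)) * levy_moment \<rho> 2 (ennreal u)))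
        + ennreal (a ^ 2) * (gamma_weight 1 u * (nexp (ennreal (real m * a) * laplace_exponent \<rho> (ennreal u)) * levy_moment \<rho> 1 (ennreal u) ^ 2)) \<partial>lborel)"
      using a_pos by (simp add: distrib_left power_mult_distrib ennreal_power mult_ac)
    also have "\<dots> = ennreal a * I 2 + ennreal (a ^ 2) * I 1"
      unfolding I_def by (subst nn_integral_add, measurable, (subst nn_integral_cmult, measurable)+)
    finally show ?thesis .
  qed
  show "ennreal a * I 2 = E (\<lambda>P h. square_ratio P h 1) * (ennreal a * I 2 + ennreal (a ^ 2) * I 1)"
  proof -
    have "ennreal a * I 2 = (\<Sum>k. of_nat (Suc k) * E (\<lambda>P h. square_mass P h 1 * (1 - q P h) ^ k))"
      unfolding L[symmetric] by (rule series[OF square_mass_le]) measurable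
    also have "\<dots> = r * (\<Sum>k. of_nat (Suc k) * E (\<lambda>P h. label_mass P h 1 ^ 2 * (1 - q P h) ^ k))"
      unfolding step by (simp only: mult.left_commute[of _ r] ennreal_suminf_cmult)
    also have "(\<Sum>k. of_nat (Suc k) * E (\<lambda>P h. label_mass P h 1 ^ 2 * (1 - q P h) ^ k)) = ennreal a * I 2 + ennreal (a ^ 2) * I 1"
      unfolding R[symmetric] by (rule series[OF order_refl, symmetric]) measurable
    finally show ?thesis unfolding r_def .
  qed
  show "ennreal a * I 2 + ennreal (a ^ 2) * I 1 \<le> 1"
  proof -
    have "E (\<lambda>P h. label_mass P h 1 ^ 2 / q P h ^ 2) \<le> E (\<lambda>P h. 1)"
      unfolding expect_model_def
    proof (intro nn_integral_mono)
      fix z assume "z \<in> space W"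
      then have "label_mass (weight_pmf z) (\<lambda>k. snd (z k)) 1 ^ 2 \<le> q (weight_pmf z) (\<lambda>k. snd (z k)) ^ 2"
        by (intro power_mono q0 space_marked_labels) auto
      from divide_right_mono_ennreal[OF this]
      show "label_mass (weight_pmf z) (\<lambda>k. snd (z k)) 1 ^ 2 / q (weight_pmf z) (\<lambda>k. snd (z k)) ^ 2 \<le> 1"
        by (rule order_trans) (rule divide_self_le_1)
    qed
    also have "E (\<lambda>P h. 1) = 1" by (simp add: expect_model_def W.emeasure_space_1)
    finally show ?thesis unfolding R .
  qed
qed

end

section \<open>Uniqueness of Laplace transforms\<close>

text \<open>Identity theorem for zeros accumulating at the centre. Once the coefficients below
  \<open>n\<close> vanish, \<open>f x / x ^ n\<close> is a power series with constant term
  \<open>d n\<close>, and it is 0 along the sequence \<open>e\<close>.\<close>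

lemma powser_coeff_zero:
  fixes d :: "nat \<Rightarrow> real"
  assumes r: "0 < r" and sm: "\<And>x. \<bar>x\<bar> < r \<Longrightarrow> (\<lambda>n. d n * x ^ n) sums f x"
    and e: "\<And>k. 0 < e k \<and> e k < r" "e \<longlonglongrightarrow> 0" and fe: "\<And>k::nat. f (e k) = 0"
  shows "d n = 0"
proof (induction n rule: less_induct)
  case (less n)
  define h where "h x = (if x = 0 then d n else f x / x ^ n)" for x
  have "(\<lambda>m. d (m + n) * x ^ m) sums h x" if x: "norm x < r" for x
  proof (cases "x = 0")
    case True
    then show ?thesis using powser_sums_zero[of "\<lambda>m. d (m + n)"] by (simp add: h_def)
  next
    case False
    have "(\<lambda>m. d (m + n) * x ^ (m + n)) sums (f x - (\<Sum>i<n. d i * x ^ i))"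
      using sums_split_initial_segment[OF sm, of x n] x by simp
    then have "(\<lambda>m. d (m + n) * x ^ (m + n) / x ^ n) sums (f x / x ^ n)"
      using less by (intro sums_divide) simp
    then show ?thesis using False by (simp add: h_def power_add)
  qed
  then have "h \<midarrow>0\<rightarrow> d (0 + n)" by (rule powser_limit_0[OF r])
  moreover have "filterlim e (at 0) sequentially"
    using e by (intro filterlim_atI) (auto simp: less_imp_neq[symmetric])
  ultimately have "(\<lambda>k. h (e k)) \<longlonglongrightarrow> d n"
    using filterlim_compose by fastforce
  moreover have "h (e k) = 0" for k using e(1)[of k] fe[of k] by (simp add: h_def)
  ultimately show ?case by (simp add: LIMSEQ_const_iff)
qed

definition laplace_transform :: "real measure \<Rightarrow> real \<Rightarrow> ennreal" where
  "laplace_transform M c = (\<integral>\<^sup>+v. ennreal (exp (- (c * v))) \<partial>M)"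

text \<open>\<open>exp (e v)\<close> is expanded under the integral. The partial sums are dominated
  by \<open>exp (- (t - \<bar>e\<bar>) v)\<close>, which is integrable, so the expansion around
  \<open>t\<close> converges with radius \<open>t\<close>, up to the boundary of the
  half-line.\<close>

lemma laplace_powser:
  assumes M: "sets M = sets borel" and nn: "AE v in M. 0 \<le> v"
    and fin: "\<And>c. 0 < c \<Longrightarrow> laplace_transform M c < top" and t: "0 < t" and e: "\<bar>e\<bar> < t"
  shows "(\<lambda>n. (\<integral>v. v ^ n / fact n * exp (- (t * v)) \<partial>M) * e ^ n) sums enn2real (laplace_transform M (t - e))"
proof -
  have [measurable_cong]: "sets M = sets borel" by fact
  have term_eq: "(\<lambda>n. (v ^ n / fact n * exp (- (t * v))) * x ^ n) sums exp (- ((t - x) * v))" for v x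
  proof -
    have "(\<lambda>n. (x * v) ^ n /\<^sub>R fact n * exp (- (t * v))) sums (exp (x * v) * exp (- (t * v)))"
      by (intro sums_mult2 exp_converges)
    then show ?thesis
      by (simp add: exp_add[symmetric] algebra_simps power_mult_distrib divide_inverse)
  qed
  define f where "f n v = (v ^ n / fact n * exp (- (t * v))) * e ^ n" for n v
  have nf: "norm (f n v) = (v ^ n / fact n * exp (- (t * v))) * \<bar>e\<bar> ^ n" if "0 \<le> v" for n v
    using that by (simp add: f_def abs_mult power_abs)
  have int_exp: "integrable M (\<lambda>v. exp (- (c * v)))" if "0 < c" for c
    using fin[OF that] by (intro integrableI_bounded) (auto simp: laplace_transform_def)
  have part: "(\<Sum>i<n. norm (f i v)) \<le> exp (- ((t - \<bar>e\<bar>) * v))" if "0 \<le> v" for n v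
  proof -
    have "(\<Sum>i<n. (v ^ i / fact i * exp (- (t * v))) * \<bar>e\<bar> ^ i) \<le> exp (- ((t - \<bar>e\<bar>) * v))"
      using sum_le_suminf[OF sums_summable[OF term_eq[of v "\<bar>e\<bar>"]], of "{..<n}"] that
        sums_unique[OF term_eq[of v "\<bar>e\<bar>"]] by simp
    then show ?thesis using nf[OF that] by simp
  qed
  have int: "integrable M (f n)" for n
  proof (rule Bochner_Integration.integrable_bound[OF int_exp])
    show "0 < t - \<bar>e\<bar>" using e by simp
    show "AE v in M. norm (f n v) \<le> norm (exp (- ((t - \<bar>e\<bar>) * v)))"
      using nn
    proof eventually_elim
      case (elim v)
      have "norm (f n v) \<le> (\<Sum>i<Suc n. norm (f i v))" by (intro member_le_sum) auto
      also have "\<dots> \<le> exp (- ((t - \<bar>e\<bar>) * v))" by (rule part[OF elim])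
      finally show ?case by simp
    qed
    show "f n \<in> borel_measurable M" unfolding f_def[abs_def] by measurable
  qed
  have "(\<lambda>n. integral\<^sup>L M (f n)) sums (\<integral>v. (\<Sum>n. f n v) \<partial>M)"
  proof (rule sums_integral[OF int])
    show "AE v in M. summable (\<lambda>n. norm (f n v))"
      using nn
    proof eventually_elim
      case (elim v)
      show ?case
        by (rule summableI_nonneg_bounded[where x = "exp (- ((t - \<bar>e\<bar>) * v))"]) (simp, rule part[OF elim])
    qed
    show "summable (\<lambda>n. \<integral>v. norm (f n v) \<partial>M)"
    proof (rule summableI_nonneg_bounded)
      fix n
      have le: "AE v in M. (\<Sum>i<n. norm (f i v)) \<le> exp (- ((t - \<bar>e\<bar>) * v))"
        using nn by eventually_elim (rule part)
      have "(\<Sum>i<n. \<integral>v. norm (f i v) \<partial>M) = (\<integral>v. (\<Sum>i<n. norm (f i v)) \<partial>M)"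
        using int by (intro Bochner_Integration.integral_sum[symmetric]) auto
      also have "\<dots> \<le> (\<integral>v. exp (- ((t - \<bar>e\<bar>) * v)) \<partial>M)"
        using int int_exp[of "t - \<bar>e\<bar>"] e
        by (intro integral_mono_AE le) auto
      finally show "(\<Sum>i<n. \<integral>v. norm (f i v) \<partial>M) \<le> (\<integral>v. exp (- ((t - \<bar>e\<bar>) * v)) \<partial>M)" .
    qed auto
  qed
  also have "(\<integral>v. (\<Sum>n. f n v) \<partial>M) = (\<integral>v. exp (- ((t - e) * v)) \<partial>M)"
    using term_eq by (intro Bochner_Integration.integral_cong) (auto simp: f_def sums_iff)
  also have "\<dots> = enn2real (laplace_transform M (t - e))"
    unfolding laplace_transform_def by (intro integral_eq_nn_integral) auto
  finally show ?thesis by (simp add: f_def)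
qed

text \<open>Agreement along a sequence tending to \<open>t\<close> forces equal Taylor coefficients
  at \<open>t\<close>, hence agreement on the whole disk of convergence, the interval
  \<open>(0, 2 t)\<close>.\<close>

lemma laplace_transform_extend:
  assumes M1: "sets M1 = sets borel" "AE v in M1. 0 \<le> v" "\<And>c. 0 < c \<Longrightarrow> laplace_transform M1 c < top"
    and M2: "sets M2 = sets borel" "AE v in M2. 0 \<le> v" "\<And>c. 0 < c \<Longrightarrow> laplace_transform M2 c < top"
    and t: "0 < t"
    and e: "\<And>k::nat. 0 < e k \<and> e k < t" "e \<longlonglongrightarrow> 0"
    and eq: "\<And>k. laplace_transform M1 (t - e k) = laplace_transform M2 (t - e k)"
    and c: "0 < c" "c < 2 * t"
  shows "laplace_transform M1 c = laplace_transform M2 c"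
proof -
  define d where "d n = (\<integral>v. v ^ n / fact n * exp (- (t * v)) \<partial>M1) - (\<integral>v. v ^ n / fact n * exp (- (t * v)) \<partial>M2)" for n
  have s: "(\<lambda>n. d n * x ^ n) sums (enn2real (laplace_transform M1 (t - x)) - enn2real (laplace_transform M2 (t - x)))"
    if "\<bar>x\<bar> < t" for x
    unfolding d_def left_diff_distrib
    by (intro sums_diff laplace_powser M1 M2 t that)
  have "d n = 0" for n
    by (rule powser_coeff_zero[OF t s e]) (simp_all only: eq diff_self)
  moreover have "\<bar>t - c\<bar> < t" using c by auto
  ultimately have "(\<lambda>n. 0) sums (enn2real (laplace_transform M1 c) - enn2real (laplace_transform M2 c))"
    using s[of "t - c"] by simp
  then have r: "enn2real (laplace_transform M1 c) = enn2real (laplace_transform M2 c)"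
    using sums_unique2[OF _ sums_zero] by fastforce
  show ?thesis
    by (rule trans[OF sym[OF ennreal_enn2real[OF M1(3)[OF c(1)]]]])
      (simp only: r ennreal_enn2real[OF M2(3)[OF c(1)]])
qed

text \<open>Analytic continuation by doubling: agreement below \<open>t' = 2 ^ Suc k * t\<close>
  provides points accumulating at \<open>t'\<close>, and the disk around \<open>t'\<close> reaches
  \<open>2 t'\<close>.\<close>

lemma laplace_transform_eq:
  assumes M1: "sets M1 = sets borel" "AE v in M1. 0 \<le> v" "\<And>c. 0 < c \<Longrightarrow> laplace_transform M1 c < top"
    and M2: "sets M2 = sets borel" "AE v in M2. 0 \<le> v" "\<And>c. 0 < c \<Longrightarrow> laplace_transform M2 c < top"
    and t: "0 < t"
    and e: "\<And>k::nat. 0 < e k \<and> e k < t" "e \<longlonglongrightarrow> 0"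
    and eq: "\<And>k. laplace_transform M1 (t - e k) = laplace_transform M2 (t - e k)"
    and c: "0 < c"
  shows "laplace_transform M1 c = laplace_transform M2 c"
proof -
  have all: "\<forall>c. 0 < c \<longrightarrow> c < 2 ^ Suc k * t \<longrightarrow> laplace_transform M1 c = laplace_transform M2 c" for k
  proof (induction k)
    case 0
    then show ?case using laplace_transform_extend[OF M1 M2 t e eq] by simp
  next
    case (Suc k)
    define t' where "t' = 2 ^ Suc k * t"
    have t': "0 < t'" using t by (simp add: t'_def)
    define e' where "e' n = t' / real (n + 2)" for n
    have e': "0 < e' n \<and> e' n < t'" for n 
    proof -
      have "t' * 1 < t' * real (n + 2)" using t' by (intro mult_strict_left_mono) auto
      then show ?thesis using t' by (simp add: e'_def divide_less_eq)
    qed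
    have e'0: "e' \<longlonglongrightarrow> 0" unfolding e'_def by real_asymp
    have "laplace_transform M1 (t' - e' n) = laplace_transform M2 (t' - e' n)" for n
    proof -
      have "t' - e' n < 2 ^ Suc k * t" using e'[of n] by (simp add: t'_def)
      then show ?thesis using Suc e'[of n] by simp
    qed
    from laplace_transform_extend[OF M1 M2 t' e' e'0 this]
    show ?case by (simp add: t'_def mult_ac)
  qed
  obtain k where "c / t < 2 ^ k"
    using real_arch_pow[of 2 "c / t"] by auto
  then have "c < 2 ^ k * t" using t by (simp add: field_simps)
  also have "2 ^ k * t \<le> 2 ^ Suc k * t" using t by (intro mult_right_mono) auto
  finally have "c < 2 ^ Suc k * t" .
  then show ?thesis using all c by blast
qed

text \<open>Laplace transforms at the positive integers are the moments of the image under \<open>v \<mapsto> exp (- v)\<close>,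
  which lives on the unit interval.\<close>

lemma laplace_transform_unique:
  assumes M1: "sets M1 = sets borel" "AE v in M1. 0 \<le> v"
    and M2: "sets M2 = sets borel" "AE v in M2. 0 \<le> v"
    and eq: "\<And>c. 0 < c \<Longrightarrow> laplace_transform M1 c = laplace_transform M2 c"
    and fin: "0 < laplace_transform M1 1" "laplace_transform M1 1 < top"
  shows "M1 = M2"
proof -
  obtain l where l: "laplace_transform M1 1 = ennreal l" "0 < l"
    using fin by (cases "laplace_transform M1 1") auto
  \<comment> \<open>The measure itself may have infinite mass; the density
    \<open>exp (- v) / l\<close> makes it a probability measure. It is undone at the end by the
    density \<open>l * exp v\<close>.\<close>
  define D where "D M = density M (\<lambda>v. ennreal (exp (- v) / l))" for M :: "real measure"
  define X where "X M = distr (D M) borel (\<lambda>v. exp (- v))" for M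
  have sD: "sets (D M) = sets M" for M by (simp add: D_def)
  have gen: "real_distribution (X M)" "(\<lambda>k. \<integral>x. x ^ k \<partial>X M) = (\<lambda>k. enn2real (laplace_transform M (real k + 1)) / l)"
     "integrable (X M) (\<lambda>x. x ^ k)" "(\<integral>x. \<bar>x\<bar> ^ k \<partial>X M) \<le> 1"
    if M: "sets M = sets borel" "AE v in M. 0 \<le> v" and L1: "laplace_transform M 1 = ennreal l" for M k
  proof -
    have [measurable_cong]: "sets M = sets borel" by fact
    have [measurable_cong]: "sets (D M) = sets borel" using M by (simp add: sD)
    have nnD: "(\<integral>\<^sup>+v. ennreal (exp (- v) ^ k) \<partial>D M) = laplace_transform M (real k + 1) / ennreal l" for k
    proof -
      have "(\<integral>\<^sup>+v. ennreal (exp (- v) ^ k) \<partial>D M) = (\<integral>\<^sup>+v. ennreal (exp (- v) / l) * ennreal (exp (- v) ^ k) \<partial>M)"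
        unfolding D_def by (rule nn_integral_density) measurable
      also have "\<dots> = (\<integral>\<^sup>+v. ennreal (exp (- ((real k + 1) * v))) / ennreal l \<partial>M)"
      proof (intro nn_integral_cong)
        fix v
        have "exp (- v) / l * exp (- v) ^ k = exp (- ((real k + 1) * v)) / l"
        proof -
          have "exp (- v) * exp (- v) ^ k = exp (- ((real k + 1) * v))"
            by (simp add: exp_of_nat_mult[symmetric] exp_add[symmetric] algebra_simps)
          then show ?thesis by simp
        qed
        then show "ennreal (exp (- v) / l) * ennreal (exp (- v) ^ k) = ennreal (exp (- ((real k + 1) * v))) / ennreal l"
          using l by (simp add: ennreal_mult'[symmetric] divide_ennreal)
      qed
      also have "\<dots> = laplace_transform M (real k + 1) / ennreal l"
        unfolding laplace_transform_def by (rule nn_integral_divide) measurable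
      finally show ?thesis .
    qed
    have "emeasure (D M) (space (D M)) = 1"
      using nnD[of 0] L1 l by (simp add: divide_ennreal)
    then interpret PD: prob_space "D M" by (rule prob_spaceI)
    have mX: "(\<lambda>v. exp (- v)) \<in> D M \<rightarrow>\<^sub>M borel" by measurable
    show rd: "real_distribution (X M)"
      unfolding X_def by (rule PD.real_distribution_distr[OF mX])
    have "AE v in D M. exp (- v) \<le> 1"
      unfolding D_def using M(2) by (subst AE_density) auto
    then have intD: "integrable (D M) (\<lambda>v. exp (- v) ^ k)" for k
      by (intro PD.integrable_const_bound[where B = 1]) (auto elim!: eventually_mono intro: power_le_one)
    show "integrable (X M) (\<lambda>x. x ^ k)"
      unfolding X_def by (subst integrable_distr_eq[OF mX]) (auto simp: intD)
    have mom: "(\<integral>x. x ^ k \<partial>X M) = enn2real (laplace_transform M (real k + 1)) / l" for k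
    proof -
      have "(\<integral>x. x ^ k \<partial>X M) = (\<integral>v. exp (- v) ^ k \<partial>D M)"
        unfolding X_def by (rule integral_distr[OF mX]) measurable
      also have "\<dots> = enn2real (\<integral>\<^sup>+v. ennreal (exp (- v) ^ k) \<partial>D M)"
        by (intro integral_eq_nn_integral) auto
      also have "\<dots> = enn2real (laplace_transform M (real k + 1)) / l"
        unfolding nnD using l by (simp add: divide_ennreal_def enn2real_mult inverse_ennreal divide_inverse)
      finally show ?thesis .
    qed
    then show "(\<lambda>k. \<integral>x. x ^ k \<partial>X M) = (\<lambda>k. enn2real (laplace_transform M (real k + 1)) / l)" by auto
    have "(\<integral>x. \<bar>x\<bar> ^ k \<partial>X M) = (\<integral>v. \<bar>exp (- v)\<bar> ^ k \<partial>D M)"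
      unfolding X_def by (rule integral_distr[OF mX]) measurable
    also have "\<dots> \<le> (\<integral>v. 1 \<partial>D M)"
      using intD \<open>AE v in D M. exp (- v) \<le> 1\<close>
      by (intro integral_mono_AE) (auto elim!: eventually_mono intro: power_le_one)
    finally show "(\<integral>x. \<bar>x\<bar> ^ k \<partial>X M) \<le> 1" by (simp add: PD.prob_space)
  qed
  have L2: "laplace_transform M2 1 = ennreal l" using eq[of 1] l by simp
  note g1 = gen[OF M1 l(1)] and g2 = gen[OF M2 L2]
  \<comment> \<open>All absolute moments are at most 1, so the Taylor error
    \<open>2 * \<bar>t\<bar> ^ n / fact n\<close> of the characteristic function tends to 0 for
    every \<open>t\<close>; the moments determine the law.\<close>
  have char_lim: "(\<lambda>n. \<Sum>k\<le>n. ((\<i> * t) ^ k / fact k) * complex_of_real (enn2real (laplace_transform M (real k + 1)) / l)) \<longlonglongrightarrow> char (X M) t"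
    if M: "sets M = sets borel" "AE v in M. 0 \<le> v" and L1: "laplace_transform M 1 = ennreal l" for M and t :: real
  proof -
    note g = gen[OF M L1]
    interpret real_distribution "X M" by (rule g(1))
    have lim: "(\<lambda>n. 2 * \<bar>t\<bar> ^ n / fact n) \<longlonglongrightarrow> 0"
      using tendsto_mult[OF tendsto_const[of 2] summable_LIMSEQ_zero[OF summable_exp_generic[of "\<bar>t\<bar>"]]]
      by (simp add: divide_inverse mult_ac)
    have bd: "norm ((\<Sum>k\<le>n. ((\<i> * t) ^ k / fact k) * complex_of_real (enn2real (laplace_transform M (real k + 1)) / l)) - char (X M) t)
        \<le> 2 * \<bar>t\<bar> ^ n / fact n" for n
    proof -
      have "(2 * \<bar>t\<bar> ^ n / fact n) * expectation (\<lambda>x. \<bar>x\<bar> ^ n) \<le> 2 * \<bar>t\<bar> ^ n / fact n * 1"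
        using g(4)[of n] by (intro mult_left_mono) auto
      with char_approx1[of n t, OF g(3)] show ?thesis
        unfolding fun_cong[OF g(2)] by (simp add: norm_minus_commute)
    qed
    have "(\<lambda>n. (\<Sum>k\<le>n. ((\<i> * t) ^ k / fact k) * complex_of_real (enn2real (laplace_transform M (real k + 1)) / l)) - char (X M) t) \<longlonglongrightarrow> 0"
      by (rule Lim_null_comparison[OF always_eventually[OF allI[OF bd]] lim])
    then show ?thesis by (rule LIM_zero_cancel)
  qed
  have "char (X M1) t = char (X M2) t" for t
  proof (rule LIMSEQ_unique[OF char_lim[OF M1 l(1)]])
    show "(\<lambda>n. \<Sum>k\<le>n. ((\<i> * t) ^ k / fact k) * complex_of_real (enn2real (laplace_transform M1 (real k + 1)) / l)) \<longlonglongrightarrow> char (X M2) t"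
      using char_lim[OF M2 L2, of t] eq by simp
  qed
  then have XX: "X M1 = X M2"
    by (intro Levy_uniqueness g1(1) g2(1)) auto
  have recover: "M = density (distr (X M) borel (\<lambda>y. - ln y)) (\<lambda>v. ennreal (l * exp v))" if M: "sets M = sets borel" for M
  proof -
    have [measurable_cong]: "sets M = sets borel" by fact
    have [measurable_cong]: "sets (D M) = sets borel" using M by (simp add: sD)
    have "distr (X M) borel (\<lambda>y. - ln y) = distr (D M) borel ((\<lambda>y. - ln y) \<circ> (\<lambda>v. exp (- v)))"
      unfolding X_def by (rule distr_distr) measurable
    also have "\<dots> = distr (D M) (D M) (\<lambda>v. v)"
      using M by (intro distr_cong) (auto simp: sD)
    also have "\<dots> = D M" by (rule distr_id)
    finally have "density (distr (X M) borel (\<lambda>y. - ln y)) (\<lambda>v. ennreal (l * exp v)) = density (D M) (\<lambda>v. ennreal (l * exp v))"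
      by simp
    also have "\<dots> = density M (\<lambda>v. ennreal (exp (- v) / l) * ennreal (l * exp v))"
      unfolding D_def by (rule density_density_eq) measurable
    also have "\<dots> = density M (\<lambda>_. 1)"
    proof (intro density_cong)
      show "AE v in M. ennreal (exp (- v) / l) * ennreal (l * exp v) = 1"
        using l by (intro AE_I2) (simp add: ennreal_mult'[symmetric] exp_minus)
    qed measurable
    finally show ?thesis by (simp add: density_1)
  qed
  show ?thesis using recover[OF M1(1)] recover[OF M2(1)] XX by simp
qed

section \<open>The differential equation for the Levy moments\<close>

text \<open>Convexity of the exponential: it lies above its tangents, taken at \<open>t\<close> for
  the first bound and at \<open>s\<close> for the second.\<close>

lemma exp_slope:
  fixes s t x :: real
  shows "exp (- (t * x)) + (t - s) * (exp (- (t * x)) * x) \<le> exp (- (s * x))"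
    and "exp (- (s * x)) \<le> exp (- (t * x)) + (t - s) * (exp (- (s * x)) * x)"
proof -
  have "exp (- (t * x)) * (1 + (t - s) * x) \<le> exp (- (t * x)) * exp ((t - s) * x)"
    by (intro mult_left_mono exp_ge_add_one_self) auto
  then show "exp (- (t * x)) + (t - s) * (exp (- (t * x)) * x) \<le> exp (- (s * x))"
    by (simp add: exp_add[symmetric] algebra_simps)
  have "exp (- (s * x)) * (1 + - ((t - s) * x)) \<le> exp (- (s * x)) * exp (- ((t - s) * x))"
    by (intro mult_left_mono exp_ge_add_one_self) auto
  then show "exp (- (s * x)) \<le> exp (- (t * x)) + (t - s) * (exp (- (s * x)) * x)"
    by (simp add: exp_add[symmetric] algebra_simps)
qed

lemma nn_integral_gamma_pos:
  assumes [measurable]: "F \<in> borel_measurable borel" and pos: "\<And>u. 0 < u \<Longrightarrow> 0 < F u"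
  shows "0 < (\<integral>\<^sup>+u. gamma_weight 1 u * F u \<partial>lborel)"
proof (rule ccontr)
  assume "\<not> ?thesis"
  then have "AE u in lborel. gamma_weight 1 u * F u = 0"
    by (subst (asm) not_gr_zero, subst (asm) nn_integral_0_iff_AE) auto
  then have "AE u in lborel. u \<notin> {0<..<1::real}"
    by eventually_elim (use pos in \<open>force simp: gamma_weight_def indicator_def\<close>)
  then have "emeasure lborel {0<..<1::real} = 0"
    by (subst (asm) AE_iff_measurable[where N = "{0<..<1}"]) auto
  then show False by simp
qed

text \<open>On \<open>{s<..t}\<close> the weight lies between \<open>s\<close> and \<open>t\<close>,
  and the antitone \<open>F\<close> between \<open>F t\<close> and \<open>F s\<close>. Shrinking
  intervals will recover values of \<open>F\<close> from integrals.\<close>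

lemma gamma_interval_bounds:
  assumes [measurable]: "F \<in> borel_measurable borel" and anti: "\<And>u v. 0 < u \<Longrightarrow> u \<le> v \<Longrightarrow> F v \<le> F u"
    and st: "0 < s" "s < t"
  shows "(\<integral>\<^sup>+u. gamma_weight 1 u * (F u * indicator {s<..t} u) \<partial>lborel) \<le> ennreal (t * (t - s)) * F s"
    and "ennreal (s * (t - s)) * F t \<le> (\<integral>\<^sup>+u. gamma_weight 1 u * (F u * indicator {s<..t} u) \<partial>lborel)"
proof -
  have vol: "(\<integral>\<^sup>+u. (ennreal c * F v) * indicator {s<..t} u \<partial>lborel) = ennreal (c * (t - s)) * F v" if "0 \<le> c" for c v
    using that st by (subst nn_integral_cmult_indicator) (auto simp: ennreal_mult' mult_ac)
  have "(\<integral>\<^sup>+u. gamma_weight 1 u * (F u * indicator {s<..t} u) \<partial>lborel) \<le> (\<integral>\<^sup>+u. (ennreal t * F s) * indicator {s<..t} u \<partial>lborel)"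
  proof (intro nn_integral_mono)
    fix u
    show "gamma_weight 1 u * (F u * indicator {s<..t} u) \<le> ennreal t * F s * indicator {s<..t} u"
      using st anti[of s u] by (auto simp: gamma_weight_def indicator_def intro!: mult_mono ennreal_leI)
  qed
  then show "(\<integral>\<^sup>+u. gamma_weight 1 u * (F u * indicator {s<..t} u) \<partial>lborel) \<le> ennreal (t * (t - s)) * F s"
    using vol[of t s] st by simp
  have "(\<integral>\<^sup>+u. (ennreal s * F t) * indicator {s<..t} u \<partial>lborel) \<le> (\<integral>\<^sup>+u. gamma_weight 1 u * (F u * indicator {s<..t} u) \<partial>lborel)"
  proof (intro nn_integral_mono)
    fix u
    show "ennreal s * F t * indicator {s<..t} u \<le> gamma_weight 1 u * (F u * indicator {s<..t} u)"
      using st anti[of u t] by (auto simp: gamma_weight_def indicator_def intro!: mult_mono ennreal_leI)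
  qed
  then show "ennreal (s * (t - s)) * F t \<le> (\<integral>\<^sup>+u. gamma_weight 1 u * (F u * indicator {s<..t} u) \<partial>lborel)"
    using vol[of s t] st by simp
qed

lemma nn_integral_ge_add_cmult:
  fixes f g h :: "'a \<Rightarrow> ennreal"
  assumes [measurable]: "f \<in> borel_measurable M" "g \<in> borel_measurable M"
    and le: "\<And>x. f x + c * g x \<le> h x"
  shows "(\<integral>\<^sup>+x. f x \<partial>M) + c * (\<integral>\<^sup>+x. g x \<partial>M) \<le> (\<integral>\<^sup>+x. h x \<partial>M)"
proof -
  have "(\<integral>\<^sup>+x. f x \<partial>M) + c * (\<integral>\<^sup>+x. g x \<partial>M) = (\<integral>\<^sup>+x. f x + c * g x \<partial>M)"
    by (subst nn_integral_add) (auto simp: nn_integral_cmult)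
  also have "\<dots> \<le> (\<integral>\<^sup>+x. h x \<partial>M)" by (intro nn_integral_mono le)
  finally show ?thesis .
qed

lemma nn_integral_le_add_cmult:
  fixes f g h :: "'a \<Rightarrow> ennreal"
  assumes [measurable]: "f \<in> borel_measurable M" "g \<in> borel_measurable M"
    and le: "\<And>x. h x \<le> f x + c * g x"
  shows "(\<integral>\<^sup>+x. h x \<partial>M) \<le> (\<integral>\<^sup>+x. f x \<partial>M) + c * (\<integral>\<^sup>+x. g x \<partial>M)"
proof -
  have "(\<integral>\<^sup>+x. h x \<partial>M) \<le> (\<integral>\<^sup>+x. f x + c * g x \<partial>M)" by (intro nn_integral_mono le)
  also have "\<dots> = (\<integral>\<^sup>+x. f x \<partial>M) + c * (\<integral>\<^sup>+x. g x \<partial>M)"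
    by (subst nn_integral_add) (auto simp: nn_integral_cmult)
  finally show ?thesis .
qed

context
  fixes \<rho> :: "real \<Rightarrow> real"
  assumes levy: "levy_density \<rho>"
begin

lemma levy_weight_one_measurable [measurable]: "levy_weight 1 \<rho> \<in> borel_measurable borel"
  using levy by (intro levy_weight_measurable) (simp add: levy_density_def)

lemma levy_moment_measurable [measurable]: "(\<lambda>u. levy_moment \<rho> n (ennreal u)) \<in> borel_measurable borel"
  unfolding levy_moment_def by measurable

lemma laplace_exponent_measurable [measurable]: "(\<lambda>u. laplace_exponent \<rho> (ennreal u)) \<in> borel_measurable borel"
  unfolding laplace_exponent_def by measurable

lemma laplace_exponent_ennreal_finite: "0 \<le> u \<Longrightarrow> laplace_exponent \<rho> (ennreal u) < top"
  using laplace_exponent_finite[OF levy, of 1 u] by (simp add: laplace_exponent_def ennreal_mult')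

text \<open>The tangent bounds integrated against the Levy density: difference quotients of
  \<open>\<kappa>\<^sub>n\<close> lie between the values of
  \<open>- \<kappa>\<^sub>n\<^sub>+\<^sub>1\<close> at the two ends. These bounds stand in for
  differentiation under the integral, and hold in \<open>[0, \<infinity>]\<close> even where
  \<open>\<kappa>\<^sub>n\<close> is infinite.\<close>

lemma levy_moment_slope:
  assumes st: "0 \<le> s" "s \<le> t"
  shows "levy_moment \<rho> n (ennreal t) + ennreal (t - s) * levy_moment \<rho> (Suc n) (ennreal t) \<le> levy_moment \<rho> n (ennreal s)"
    and "levy_moment \<rho> n (ennreal s) \<le> levy_moment \<rho> n (ennreal t) + ennreal (t - s) * levy_moment \<rho> (Suc n) (ennreal s)"
    and "laplace_exponent \<rho> (ennreal s) + ennreal (t - s) * levy_moment \<rho> 1 (ennreal t) \<le> laplace_exponent \<rho> (ennreal t)"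
proof -
  have e: "nexp (ennreal u * ennreal x) = ennreal (exp (- (u * x)))" if "0 \<le> u" "0 \<le> x" for u x
    using that by (simp add: ennreal_mult'[symmetric] nexp_ennreal)
  have split: "levy_weight 1 \<rho> x * (y + c * z) = levy_weight 1 \<rho> x * y + c * (levy_weight 1 \<rho> x * z)" for x y c z
    by (simp add: distrib_left mult_ac)
  have w0: "levy_weight 1 \<rho> x = 0" if "\<not> 0 < x" for x using that by (simp add: levy_weight_def)
  show "levy_moment \<rho> n (ennreal t) + ennreal (t - s) * levy_moment \<rho> (Suc n) (ennreal t) \<le> levy_moment \<rho> n (ennreal s)"
    unfolding levy_moment_def
  proof (rule nn_integral_ge_add_cmult)
    fix x :: real
    show "levy_weight 1 \<rho> x * (nexp (ennreal t * ennreal x) * ennreal x ^ n)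
        + ennreal (t - s) * (levy_weight 1 \<rho> x * (nexp (ennreal t * ennreal x) * ennreal x ^ Suc n))
        \<le> levy_weight 1 \<rho> x * (nexp (ennreal s * ennreal x) * ennreal x ^ n)"
    proof (cases "0 < x")
      case True
      have "(exp (- (t * x)) + (t - s) * (exp (- (t * x)) * x)) * x ^ n \<le> exp (- (s * x)) * x ^ n"
        using True by (intro mult_right_mono exp_slope) auto
      then have "ennreal (exp (- (t * x)) * x ^ n) + ennreal ((t - s) * (exp (- (t * x)) * x ^ Suc n)) \<le> ennreal (exp (- (s * x)) * x ^ n)"
        using True st by (subst ennreal_plus[symmetric]) (auto intro!: ennreal_leI simp: algebra_simps)
      then show ?thesis
        unfolding split[symmetric]
        using True st by (intro mult_left_mono) (simp_all add: e ennreal_mult' ennreal_power[symmetric] del: power_Suc)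
    qed (simp add: w0)
  qed measurable
  show "levy_moment \<rho> n (ennreal s) \<le> levy_moment \<rho> n (ennreal t) + ennreal (t - s) * levy_moment \<rho> (Suc n) (ennreal s)"
    unfolding levy_moment_def
  proof (rule nn_integral_le_add_cmult)
    fix x :: real
    show "levy_weight 1 \<rho> x * (nexp (ennreal s * ennreal x) * ennreal x ^ n)
        \<le> levy_weight 1 \<rho> x * (nexp (ennreal t * ennreal x) * ennreal x ^ n)
        + ennreal (t - s) * (levy_weight 1 \<rho> x * (nexp (ennreal s * ennreal x) * ennreal x ^ Suc n))"
    proof (cases "0 < x")
      case True
      have "exp (- (s * x)) * x ^ n \<le> (exp (- (t * x)) + (t - s) * (exp (- (s * x)) * x)) * x ^ n"
        using True by (intro mult_right_mono exp_slope) auto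
      then have "ennreal (exp (- (s * x)) * x ^ n) \<le> ennreal (exp (- (t * x)) * x ^ n) + ennreal ((t - s) * (exp (- (s * x)) * x ^ Suc n))"
        using True st by (subst ennreal_plus[symmetric]) (auto intro!: ennreal_leI simp: algebra_simps)
      then show ?thesis
        unfolding split[symmetric]
        using True st by (intro mult_left_mono) (simp_all add: e ennreal_mult' ennreal_power[symmetric] del: power_Suc)
    qed (simp add: w0)
  qed measurable
  show "laplace_exponent \<rho> (ennreal s) + ennreal (t - s) * levy_moment \<rho> 1 (ennreal t) \<le> laplace_exponent \<rho> (ennreal t)"
    unfolding levy_moment_def laplace_exponent_def
  proof (rule nn_integral_ge_add_cmult)
    fix x :: real
    show "levy_weight 1 \<rho> x * (1 - nexp (ennreal s * ennreal x))
        + ennreal (t - s) * (levy_weight 1 \<rho> x * (nexp (ennreal t * ennreal x) * ennreal x ^ 1))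
        \<le> levy_weight 1 \<rho> x * (1 - nexp (ennreal t * ennreal x))"
    proof (cases "0 < x")
      case True
      have "1 - exp (- (s * x)) + (t - s) * (exp (- (t * x)) * x) \<le> 1 - exp (- (t * x))"
        using exp_slope(1)[of t x s] by simp
      then have "ennreal (1 - exp (- (s * x))) + ennreal ((t - s) * (exp (- (t * x)) * x)) \<le> ennreal (1 - exp (- (t * x)))"
        using True st by (subst ennreal_plus[symmetric]) (auto intro!: ennreal_leI simp del: ennreal_plus)
      then show ?thesis
        unfolding split[symmetric]
        using True st by (intro mult_left_mono) (simp_all add: e ennreal_mult' ennreal_minus flip: ennreal_1)
    qed (simp add: w0)
  qed measurable
qed

text \<open>A vanishing moment would make \<open>\<rho>\<close> vanish almost everywhere on the
  positive axis, against its infinite integral.\<close>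

lemma levy_moment_pos: "0 \<le> u \<Longrightarrow> 0 < levy_moment \<rho> n (ennreal u)"
proof (rule ccontr)
  assume u: "0 \<le> u" and "\<not> 0 < levy_moment \<rho> n (ennreal u)"
  then have "AE x in lborel. levy_weight 1 \<rho> x * (nexp (ennreal u * ennreal x) * ennreal x ^ n) = 0"
    unfolding levy_moment_def by (subst (asm) not_gr_zero, subst (asm) nn_integral_0_iff_AE) auto
  then have "AE x in lborel. ennreal (\<rho> x) * indicator {0<..} x = 0"
    by eventually_elim (auto simp: levy_weight_def indicator_def ennreal_mult_eq_top_iff split: if_splits)
  then have "(\<integral>\<^sup>+x\<in>{0<..}. ennreal (\<rho> x) \<partial>lborel) = (\<integral>\<^sup>+(x::real). 0 \<partial>lborel)"
    by (intro nn_integral_cong_AE)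
  then show False using levy by (simp add: levy_density_def)
qed

definition moment :: "nat \<Rightarrow> real \<Rightarrow> real" where
  "moment n u = enn2real (levy_moment \<rho> n (ennreal u))"

definition exponent :: "real \<Rightarrow> real" where
  "exponent u = enn2real (laplace_exponent \<rho> (ennreal u))"

lemma exponent_measurable [measurable]: "exponent \<in> borel_measurable borel"
  unfolding exponent_def[abs_def] by measurable

lemma ennreal_moment: "0 < u \<Longrightarrow> n \<in> {1, 2} \<Longrightarrow> levy_moment \<rho> n (ennreal u) = ennreal (moment n u)"
  using levy_moment_finite[OF levy] by (simp add: moment_def)

lemma ennreal_exponent: "0 \<le> u \<Longrightarrow> laplace_exponent \<rho> (ennreal u) = ennreal (exponent u)"
  using laplace_exponent_ennreal_finite by (simp add: exponent_def)

lemma moment_nonneg [simp]: "0 \<le> moment n u" and exponent_nonneg [simp]: "0 \<le> exponent u"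
  by (simp_all add: moment_def exponent_def)

lemma moment_pos: "0 < u \<Longrightarrow> n \<in> {1, 2} \<Longrightarrow> 0 < moment n u"
  using levy_moment_pos[of u n] ennreal_moment[of u n] by simp

lemma moment_antimono: "0 < s \<Longrightarrow> s \<le> t \<Longrightarrow> n \<in> {1, 2} \<Longrightarrow> moment n t \<le> moment n s"
  using levy_moment_antimono[of "ennreal s" "ennreal t" \<rho> n] levy_moment_finite[OF levy]
  unfolding moment_def by (intro enn2real_mono) (auto intro: ennreal_leI)

lemma moment_slope:
  assumes st: "0 < s" "s \<le> t"
  shows "moment 1 t + (t - s) * moment 2 t \<le> moment 1 s"
    and "moment 1 s \<le> moment 1 t + (t - s) * moment 2 s"
    and "exponent s + (t - s) * moment 1 t \<le> exponent t"
proof -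
  have S: "Suc 1 = 2" by simp
  show "moment 1 t + (t - s) * moment 2 t \<le> moment 1 s" "moment 1 s \<le> moment 1 t + (t - s) * moment 2 s"
    "exponent s + (t - s) * moment 1 t \<le> exponent t"
    using levy_moment_slope(1,2)[of s t 1] levy_moment_slope(3)[of s t] st unfolding S
    by (simp_all add: ennreal_moment ennreal_exponent ennreal_mult'[symmetric] ennreal_plus[symmetric] del: ennreal_plus)
qed

lemma exponent_less:
  assumes "0 < s" "s < t"
  shows "exponent s < exponent t"
proof -
  have "0 < (t - s) * moment 1 t" using assms by (intro mult_pos_pos moment_pos) auto
  then show ?thesis using moment_slope(3)[of s t] assms by linarith
qed

text \<open>Near \<open>u\<close> the slope of \<open>\<kappa>\<^sub>1\<close> is bounded by
  \<open>\<kappa>\<^sub>2\<close> at \<open>u / 2\<close>, as \<open>\<kappa>\<^sub>2\<close> is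
  antitone.\<close>

lemma moment_continuous: "0 < u \<Longrightarrow> isCont (moment 1) u"
proof -
  assume u: "0 < u"
  have "\<forall>\<^sub>F y in at u. norm (moment 1 y - moment 1 u) \<le> \<bar>y - u\<bar> * moment 2 (u / 2)"
  proof (rule eventually_at_topological[THEN iffD2], intro exI conjI ballI impI)
    show "open {u / 2<..}" "u \<in> {u / 2<..}" using u by auto
    fix y assume y: "y \<in> {u / 2<..}"
    show "norm (moment 1 y - moment 1 u) \<le> \<bar>y - u\<bar> * moment 2 (u / 2)"
    proof (cases "y \<le> u")
      case True
      have "moment 1 y - moment 1 u \<le> (u - y) * moment 2 y" using moment_slope(2)[of y u] True y u by simp
      also have "\<dots> \<le> (u - y) * moment 2 (u / 2)" using True y u by (intro mult_left_mono moment_antimono) auto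
      finally show ?thesis using moment_antimono[of y u 1] True y u by simp
    next
      case False
      have "moment 1 u - moment 1 y \<le> (y - u) * moment 2 u" using moment_slope(2)[of u y] False y u by simp
      also have "\<dots> \<le> (y - u) * moment 2 (u / 2)" using False y u by (intro mult_left_mono moment_antimono) auto
      finally show ?thesis using moment_antimono[of u y 1] False y u by simp
    qed
  qed
  moreover have "(\<lambda>y. \<bar>y - u\<bar> * moment 2 (u / 2)) \<midarrow>u\<rightarrow> 0"
    by (auto intro!: tendsto_eq_intros)
  ultimately have "(\<lambda>y. moment 1 y - moment 1 u) \<midarrow>u\<rightarrow> 0" by (rule Lim_null_comparison)
  then show ?thesis unfolding isCont_def by (rule LIM_zero_cancel)
qed

text \<open>As a function of \<open>c\<close>, \<open>I n c\<close> is the Laplace transform of the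
  image under \<open>\<psi>\<close> of the measure with density \<open>u \<kappa>\<^sub>2(u)\<close>
  or \<open>u \<kappa>\<^sub>1(u)\<^sup>2\<close>. Agreement along the sequence makes the two images
  equal after scaling by \<open>\<Lambda>\<close>. Since \<open>\<psi>\<close> is strictly
  increasing, intervals pull back to intervals, and monotonicity of both densities turns equal
  integrals into bounds at every single point.\<close>

lemma moments_proportional:
  fixes \<Lambda> t :: real
  defines "I n c \<equiv> (\<integral>\<^sup>+u. gamma_weight 1 u * (nexp (ennreal c * laplace_exponent \<rho> (ennreal u)) * levy_moment \<rho> n (ennreal u) ^ (3 - n)) \<partial>lborel)"
  assumes \<Lambda>: "0 < \<Lambda>" and t: "0 < t" and e: "\<And>k::nat. 0 < e k \<and> e k < t" "e \<longlonglongrightarrow> 0"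
    and eq: "\<And>k. I 2 (t - e k) = ennreal \<Lambda> * I 1 (t - e k)"
    and fin: "\<And>c n. 0 < c \<Longrightarrow> n \<in> {1, 2} \<Longrightarrow> I n c < top"
    and u: "0 < u"
  shows "moment 2 u = \<Lambda> * moment 1 u ^ 2"
proof -
  define w where "w n u = (if n = 1 then ennreal \<Lambda> else 1) * levy_moment \<rho> n (ennreal u) ^ (3 - n)" for n u
  have [measurable]: "w n \<in> borel_measurable borel" for n unfolding w_def[abs_def] by measurable
  define M where "M n = distr (density lborel (\<lambda>u. gamma_weight 1 u * w n u)) borel exponent" for n
  have emM: "(\<integral>\<^sup>+v. F v \<partial>M n) = (\<integral>\<^sup>+u. gamma_weight 1 u * (w n u * F (exponent u)) \<partial>lborel)"
    if [measurable]: "F \<in> borel_measurable borel" for F n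
    unfolding M_def by (subst nn_integral_distr, simp, simp, subst nn_integral_density) (auto simp: mult_ac)
  have LT: "laplace_transform (M n) c = (if n = 1 then ennreal \<Lambda> else 1) * I n c" if c: "0 \<le> c" for n c
  proof -
    have "laplace_transform (M n) c = (\<integral>\<^sup>+u. gamma_weight 1 u * (w n u * ennreal (exp (- (c * exponent u)))) \<partial>lborel)"
      unfolding laplace_transform_def by (rule emM) measurable
    also have "\<dots> = (\<integral>\<^sup>+u. gamma_weight 1 u * (w n u * nexp (ennreal c * laplace_exponent \<rho> (ennreal u))) \<partial>lborel)"
      using c by (intro gamma_weight_cong_AE) (simp add: ennreal_exponent ennreal_mult'[symmetric] nexp_ennreal)
    also have "\<dots> = (\<integral>\<^sup>+u. (if n = 1 then ennreal \<Lambda> else 1) * (gamma_weight 1 u * (nexp (ennreal c * laplace_exponent \<rho> (ennreal u)) * levy_moment \<rho> n (ennreal u) ^ (3 - n))) \<partial>lborel)"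
      by (intro nn_integral_cong) (simp add: w_def mult_ac)
    also have "\<dots> = (if n = 1 then ennreal \<Lambda> else 1) * I n c"
      unfolding I_def by (rule nn_integral_cmult) measurable
    finally show ?thesis .
  qed
  have sM: "sets (M n) = sets borel" for n by (simp add: M_def)
  have nnM: "AE v in M n. 0 \<le> v" for n
    unfolding M_def by (subst AE_distr_iff) auto
  have finM: "laplace_transform (M n) c < top" if "0 < c" "n \<in> {1, 2}" for n c
    using fin[OF that] that by (auto simp: LT ennreal_mult_less_top)
  have eqM: "laplace_transform (M 2) (t - e k) = laplace_transform (M 1) (t - e k)" for k
    using eq[of k] e(1)[of k] by (simp add: LT)
  have all: "laplace_transform (M 2) c = laplace_transform (M 1) c" if "0 < c" for c
    by (rule laplace_transform_eq[OF sM nnM _ sM nnM _ t e eqM that]) (auto intro!: finM)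
  have pos: "0 < laplace_transform (M 2) 1"
  proof -
    have "0 < (\<integral>\<^sup>+u. gamma_weight 1 u * (w 2 u * ennreal (exp (- (1 * exponent u)))) \<partial>lborel)"
      by (rule nn_integral_gamma_pos) (auto simp: w_def ennreal_zero_less_mult_iff intro: levy_moment_pos)
    then show ?thesis unfolding laplace_transform_def by (subst emM) auto
  qed
  have MM: "M 2 = M 1"
    by (rule laplace_transform_unique[OF sM nnM sM nnM all pos finM]) auto
  have anti: "w n y \<le> w n x" if "0 < x" "x \<le> y" for n x y
    unfolding w_def using that
    by (intro mult_left_mono power_mono levy_moment_antimono ennreal_leI) auto
  have interval: "(\<integral>\<^sup>+u. gamma_weight 1 u * (w n u * indicator {x<..y} u) \<partial>lborel) = emeasure (M n) {exponent x<..exponent y}"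
    if xy: "0 < x" "x < y" for n x y
  proof -
    have "emeasure (M n) {exponent x<..exponent y} = (\<integral>\<^sup>+v. indicator {exponent x<..exponent y} v \<partial>M n)"
      by (simp add: sM)
    also have "\<dots> = (\<integral>\<^sup>+u. gamma_weight 1 u * (w n u * indicator {exponent x<..exponent y} (exponent u)) \<partial>lborel)"
      by (rule emM) measurable
    also have "\<dots> = (\<integral>\<^sup>+u. gamma_weight 1 u * (w n u * indicator {x<..y} u) \<partial>lborel)"
    proof (rule gamma_weight_cong_AE)
      fix u :: real assume u: "0 < u"
      have "exponent x < exponent u \<longleftrightarrow> x < u" "exponent u \<le> exponent y \<longleftrightarrow> u \<le> y"
        using exponent_less[of x u] exponent_less[of u x] exponent_less[of u y] exponent_less[of y u] u xy
        by (cases x u rule: linorder_cases; cases u y rule: linorder_cases; force)+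
      then show "w n u * indicator {exponent x<..exponent y} (exponent u) = w n u * indicator {x<..y} u"
        by (simp add: indicator_def)
    qed
    finally show ?thesis by simp
  qed
  have sandwich: "ennreal (x * (y - x)) * w n y \<le> ennreal (y * (y - x)) * w m x" if xy: "0 < x" "x < y" and nm: "n \<in> {1, 2}" "m \<in> {1, 2}" for n m x y
  proof -
    have "ennreal (x * (y - x)) * w n y \<le> emeasure (M n) {exponent x<..exponent y}"
      unfolding interval[OF xy, symmetric] by (rule gamma_interval_bounds(2)[OF _ _ xy]) (auto intro: anti)
    also have "\<dots> = emeasure (M m) {exponent x<..exponent y}" using nm MM by auto
    also have "\<dots> \<le> ennreal (y * (y - x)) * w m x"
      unfolding interval[OF xy, symmetric] by (rule gamma_interval_bounds(1)[OF _ _ xy]) (auto intro: anti)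
    finally show ?thesis .
  qed
  have w2: "w 2 x = ennreal (moment 2 x)" and w1: "w 1 x = ennreal (\<Lambda> * moment 1 x ^ 2)" if "0 < x" for x
    using that \<Lambda> by (simp_all add: w_def ennreal_moment ennreal_power ennreal_mult'[symmetric])
  have real_sandwich: "x * moment 2 y \<le> y * (\<Lambda> * moment 1 x ^ 2)" "x * (\<Lambda> * moment 1 y ^ 2) \<le> y * moment 2 x"
    if xy: "0 < x" "x < y" for x y
  proof -
    have cancel: "x * A \<le> y * B" if "ennreal (x * (y - x)) * ennreal A \<le> ennreal (y * (y - x)) * ennreal B" "0 \<le> A" "0 \<le> B" for A B
    proof -
      have "(x * (y - x)) * A \<le> (y * (y - x)) * B"
        using that xy by (simp add: ennreal_mult[symmetric])
      then have "(y - x) * (x * A) \<le> (y - x) * (y * B)" by (simp add: mult_ac)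
      then show ?thesis using xy by simp
    qed
    show "x * moment 2 y \<le> y * (\<Lambda> * moment 1 x ^ 2)" "x * (\<Lambda> * moment 1 y ^ 2) \<le> y * moment 2 x"
      using sandwich[OF xy, of 2 1] sandwich[OF xy, of 1 2] xy \<Lambda>
      by (intro cancel; simp add: w1 w2)+
  qed
  \<comment> \<open>The bounds are used with \<open>\<kappa>\<^sub>2\<close> at the fixed point
    \<open>u\<close> and \<open>\<kappa>\<^sub>1\<close> at a point approaching \<open>u\<close>,
    from the left for one inequality and from the right for the other, so continuity of
    \<open>\<kappa>\<^sub>1\<close> suffices.\<close>
  have cont: "(\<lambda>x. moment 1 x) \<midarrow>u\<rightarrow> moment 1 u"
    using moment_continuous[OF u] by (simp add: isCont_def)
  have "u * moment 2 u \<le> u * (\<Lambda> * moment 1 u ^ 2)"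
  proof (rule tendsto_le)
    show "((\<lambda>x. u * (\<Lambda> * moment 1 x ^ 2)) \<longlongrightarrow> u * (\<Lambda> * moment 1 u ^ 2)) (at_left u)"
      by (intro tendsto_intros filterlim_mono[OF cont]) (auto simp: at_le)
    show "((\<lambda>x. x * moment 2 u) \<longlongrightarrow> u * moment 2 u) (at_left u)"
      by (intro tendsto_intros)
    show "\<forall>\<^sub>F x in at_left u. x * moment 2 u \<le> u * (\<Lambda> * moment 1 x ^ 2)"
      using eventually_at_left_real[OF u] by eventually_elim (auto intro: real_sandwich)
  qed simp
  moreover have "u * (\<Lambda> * moment 1 u ^ 2) \<le> u * moment 2 u"
  proof (rule tendsto_le)
    show "((\<lambda>y. u * (\<Lambda> * moment 1 y ^ 2)) \<longlongrightarrow> u * (\<Lambda> * moment 1 u ^ 2)) (at_right u)"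
      by (intro tendsto_intros filterlim_mono[OF cont]) (auto simp: at_le)
    show "((\<lambda>y. y * moment 2 u) \<longlongrightarrow> u * moment 2 u) (at_right u)"
      by (intro tendsto_intros)
    show "\<forall>\<^sub>F y in at_right u. u * (\<Lambda> * moment 1 y ^ 2) \<le> y * moment 2 u"
      using eventually_at_right_less[of u] by eventually_elim (auto intro: real_sandwich u)
  qed simp
  ultimately show ?thesis using u by simp
qed

end

section \<open>Solving the differential equation\<close>

context
  fixes \<rho> :: "real \<Rightarrow> real" and \<Lambda> :: real
  assumes levy: "levy_density \<rho>" and \<Lambda>: "0 < \<Lambda>"
    and proportional: "\<And>u. 0 < u \<Longrightarrow> moment \<rho> 2 u = \<Lambda> * moment \<rho> 1 u ^ 2"
begin

text \<open>The slope bounds confine the difference quotient to the interval between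
  \<open>- \<kappa>\<^sub>2(y)\<close> and \<open>- \<kappa>\<^sub>2(u)\<close>, which shrinks
  because proportionality transfers continuity from \<open>\<kappa>\<^sub>1\<close> to
  \<open>\<kappa>\<^sub>2\<close>.\<close>

lemma moment_has_derivative:
  assumes u: "0 < u"
  shows "(moment \<rho> 1 has_real_derivative - moment \<rho> 2 u) (at u)"
proof -
  let ?q = "\<lambda>y. (moment \<rho> 1 y - moment \<rho> 1 u) / (y - u)"
  have bound: "norm (?q y - - moment \<rho> 2 u) \<le> \<bar>moment \<rho> 2 y - moment \<rho> 2 u\<bar>" if y: "0 < y" "y \<noteq> u" for y
  proof (cases "y < u")
    case True
    have "- moment \<rho> 2 y \<le> ?q y" "?q y \<le> - moment \<rho> 2 u"
      using moment_slope[OF levy, of y u] True y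
      by (simp_all add: neg_divide_le_eq neg_le_divide_eq algebra_simps)
    then show ?thesis by simp
  next
    case False
    have "- moment \<rho> 2 u \<le> ?q y" "?q y \<le> - moment \<rho> 2 y"
      using moment_slope[OF levy, of u y] False y u
      by (simp_all add: pos_divide_le_eq pos_le_divide_eq algebra_simps)
    then show ?thesis by simp
  qed
  have "\<forall>\<^sub>F y in at u. 0 < y"
    using u by (intro order_tendstoD(1)[OF tendsto_ident_at])
  then have ev: "\<forall>\<^sub>F y in at u. norm (?q y - - moment \<rho> 2 u) \<le> \<bar>moment \<rho> 2 y - moment \<rho> 2 u\<bar>"
    using eventually_neq_at_within[of u u UNIV] by eventually_elim (rule bound)
  have "(\<lambda>y. \<Lambda> * moment \<rho> 1 y ^ 2) \<midarrow>u\<rightarrow> \<Lambda> * moment \<rho> 1 u ^ 2"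
    using moment_continuous[OF levy u] unfolding isCont_def by (intro tendsto_intros)
  moreover have "\<forall>\<^sub>F y in at u. \<Lambda> * moment \<rho> 1 y ^ 2 = moment \<rho> 2 y"
    using \<open>\<forall>\<^sub>F y in at u. 0 < y\<close> by eventually_elim (rule proportional[symmetric])
  ultimately have "moment \<rho> 2 \<midarrow>u\<rightarrow> moment \<rho> 2 u"
    unfolding proportional[OF u] by (rule Lim_transform_eventually)
  then have "(\<lambda>y. \<bar>moment \<rho> 2 y - moment \<rho> 2 u\<bar>) \<midarrow>u\<rightarrow> 0"
    by (intro tendsto_rabs_zero LIM_zero)
  from Lim_null_comparison[OF ev this] show ?thesis
    unfolding has_field_derivative_iff by (rule LIM_zero_cancel)
qed

text \<open>By \<open>\<kappa>\<^sub>1' = - \<Lambda> \<kappa>\<^sub>1\<^sup>2\<close> the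
  reciprocal of \<open>\<kappa>\<^sub>1\<close> is affine with slope \<open>\<Lambda>\<close>. A
  negative intercept contradicts positivity of \<open>\<kappa>\<^sub>1\<close>, and the intercept 0
  makes \<open>\<psi>\<close> diverge logarithmically at 0.\<close>

lemma moment_reciprocal: "\<exists>\<beta>>0. \<forall>u>0. moment \<rho> 1 u = 1 / (\<Lambda> * (u + \<beta>))"
proof -
  have pos: "0 < moment \<rho> 1 u" if "0 < u" for u using moment_pos[OF levy that] by simp
  have "\<exists>\<kappa>. \<forall>u\<in>{0<..}. inverse (moment \<rho> 1 u) - \<Lambda> * u = \<kappa>"
  proof (rule has_field_derivative_zero_constant)
    fix u :: real assume "u \<in> {0<..}"
    then have u: "0 < u" by simp
    have "((\<lambda>u. inverse (moment \<rho> 1 u) - \<Lambda> * u) has_real_derivative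
        - (inverse (moment \<rho> 1 u) * (- moment \<rho> 2 u) * inverse (moment \<rho> 1 u)) - \<Lambda> * 1) (at u)"
      using pos[OF u] by (intro DERIV_diff DERIV_inverse' DERIV_cmult DERIV_ident moment_has_derivative u) auto
    moreover have "- (inverse (moment \<rho> 1 u) * (- moment \<rho> 2 u) * inverse (moment \<rho> 1 u)) - \<Lambda> * 1 = 0"
      using pos[OF u] by (simp add: proportional[OF u] power2_eq_square field_simps)
    ultimately show "((\<lambda>u. inverse (moment \<rho> 1 u) - \<Lambda> * u) has_real_derivative 0) (at u within {0<..})"
      by (simp add: has_field_derivative_at_within)
  qed simp
  then obtain \<kappa> where \<kappa>: "inverse (moment \<rho> 1 u) = \<Lambda> * u + \<kappa>" if "0 < u" for u
    by (auto simp: algebra_simps)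
  have m: "moment \<rho> 1 u = 1 / (\<Lambda> * u + \<kappa>)" if "0 < u" for u
    unfolding \<kappa>[OF that, symmetric] by (simp add: divide_inverse)
  have "0 \<le> \<kappa>"
  proof (rule ccontr)
    \<comment> \<open>At \<open>u = - \<kappa> / \<Lambda>\<close> the formula reads
      \<open>1 / 0 = 0\<close>, while the moment is positive.\<close>
    assume "\<not> 0 \<le> \<kappa>"
    then have "0 < - \<kappa> / \<Lambda>" using \<Lambda> by (simp add: divide_neg_pos)
    from pos[OF this] show False unfolding m[OF \<open>0 < - \<kappa> / \<Lambda>\<close>] using \<Lambda> by simp
  qed
  moreover have "\<kappa> \<noteq> 0"
  proof
    assume k0: "\<kappa> = 0"
    \<comment> \<open>Between \<open>t / 2\<close> and \<open>t\<close> the exponent grows by at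
      least \<open>(t / 2) \<kappa>\<^sub>1(t) = 1 / (2 \<Lambda>)\<close> if
      \<open>\<kappa>\<^sub>1(t) = 1 / (\<Lambda> t)\<close>, independently of
      \<open>t\<close>.\<close>
    define d where "d = 1 / (2 * \<Lambda>)"
    have "exponent \<rho> ((1 / 2) ^ n) + real n * d \<le> exponent \<rho> 1" for n
    proof (induction n)
      case (Suc n)
      let ?t = "(1 / 2) ^ n :: real"
      have "exponent \<rho> ((1 / 2) * ?t) + (?t - (1 / 2) * ?t) * moment \<rho> 1 ?t \<le> exponent \<rho> ?t"
        by (rule moment_slope(3)[OF levy]) auto
      moreover have "(?t - (1 / 2) * ?t) * moment \<rho> 1 ?t = d"
        using \<Lambda> by (simp add: m k0 d_def field_simps)
      ultimately show ?case using Suc by (simp add: distrib_right)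
    qed simp
    moreover obtain n where "exponent \<rho> 1 < real n * d"
      using ex_less_of_nat_mult[of d] \<Lambda> by (auto simp: d_def)
    ultimately show False
      using exponent_nonneg[OF levy, of "(1 / 2) ^ n"] by (smt (verit))
  qed
  ultimately have "0 < \<kappa> / \<Lambda>" using \<Lambda> by simp
  moreover have "moment \<rho> 1 u = 1 / (\<Lambda> * (u + \<kappa> / \<Lambda>))" if "0 < u" for u
    using m[OF that] \<Lambda> by (simp add: distrib_left)
  ultimately show ?thesis by blast
qed

text \<open>\<open>\<kappa>\<^sub>1\<close> is the Laplace transform of
  \<open>x \<rho>(x) dx\<close>, and \<open>1 / (\<Lambda> (c + \<beta>))\<close> is that of
  \<open>exp (- \<beta> x) / \<Lambda> dx\<close>. Uniqueness identifies the two densities almost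
  everywhere.\<close>

lemma gamma_levy_density: "\<exists>\<beta>>0. AE x in lborel. 0 < x \<longrightarrow> \<rho> x = exp (- (\<beta> * x)) / (\<Lambda> * x)"
proof -
  obtain \<beta> where \<beta>: "0 < \<beta>" and m: "\<And>u. 0 < u \<Longrightarrow> moment \<rho> 1 u = 1 / (\<Lambda> * (u + \<beta>))"
    using moment_reciprocal by blast
  note [measurable] = levy_weight_one_measurable[OF levy]
  define M1 where "M1 = density lborel (\<lambda>x. levy_weight 1 \<rho> x * ennreal x)"
  define M2 where "M2 = density lborel (\<lambda>x. indicator {0..} x * ennreal (exp (- (\<beta> * x)) / \<Lambda>))"
  have s: "sets M1 = sets borel" "sets M2 = sets borel" by (simp_all add: M1_def M2_def)
  have nn: "AE x in M1. 0 \<le> x" "AE x in M2. 0 \<le> x"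
    unfolding M1_def M2_def
    by (subst AE_density, measurable, rule AE_I2, simp add: levy_weight_def indicator_def)+
  have L1: "laplace_transform M1 c = ennreal (1 / (\<Lambda> * (c + \<beta>)))" if c: "0 < c" for c
  proof -
    have "laplace_transform M1 c = (\<integral>\<^sup>+x. levy_weight 1 \<rho> x * ennreal x * ennreal (exp (- (c * x))) \<partial>lborel)"
      unfolding laplace_transform_def M1_def by (rule nn_integral_density) measurable
    also have "\<dots> = levy_moment \<rho> 1 (ennreal c)"
      unfolding levy_moment_def
    proof (intro nn_integral_cong)
      fix x :: real
      show "levy_weight 1 \<rho> x * ennreal x * ennreal (exp (- (c * x))) = levy_weight 1 \<rho> x * (nexp (ennreal c * ennreal x) * ennreal x ^ 1)"
      proof (cases "0 < x")
        case True
        then have "nexp (ennreal c * ennreal x) = ennreal (exp (- (c * x)))"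
          using c by (simp add: ennreal_mult'[symmetric] nexp_ennreal)
        then show ?thesis by (simp add: mult_ac)
      qed (simp add: levy_weight_def)
    qed
    also have "\<dots> = ennreal (1 / (\<Lambda> * (c + \<beta>)))"
      using ennreal_moment[OF levy c, of 1] m[OF c] by simp
    finally show ?thesis .
  qed
  have L2: "laplace_transform M2 c = ennreal (1 / (\<Lambda> * (c + \<beta>)))" if c: "0 < c" for c
  proof -
    have "laplace_transform M2 c = (\<integral>\<^sup>+x. indicator {0..} x * ennreal (exp (- (\<beta> * x)) / \<Lambda>) * ennreal (exp (- (c * x))) \<partial>lborel)"
      unfolding laplace_transform_def M2_def by (rule nn_integral_density) measurable
    also have "\<dots> = (\<integral>\<^sup>+x. ennreal (1 / \<Lambda>) * (indicator {0..} x * ennreal (x ^ 0 * exp (- (x * (c + \<beta>))))) \<partial>lborel)"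
    proof (intro nn_integral_cong)
      fix x :: real
      have "exp (- (\<beta> * x)) / \<Lambda> * exp (- (c * x)) = 1 / \<Lambda> * (x ^ 0 * exp (- (x * (c + \<beta>))))"
        by (simp add: exp_add[symmetric] algebra_simps)
      then show "indicator {0..} x * ennreal (exp (- (\<beta> * x)) / \<Lambda>) * ennreal (exp (- (c * x)))
          = ennreal (1 / \<Lambda>) * (indicator {0..} x * ennreal (x ^ 0 * exp (- (x * (c + \<beta>)))))"
        using \<Lambda> by (auto simp: indicator_def ennreal_mult'[symmetric] simp del: power_0)
    qed
    also have "\<dots> = ennreal (1 / \<Lambda>) * (\<integral>\<^sup>+x. indicator {0..} x * ennreal (x ^ 0 * exp (- (x * (c + \<beta>)))) \<partial>lborel)"
      by (rule nn_integral_cmult) measurable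
    also have "\<dots> = ennreal (1 / (\<Lambda> * (c + \<beta>)))"
      using c \<beta> \<Lambda> by (subst nn_integral_power_exp) (auto simp: ennreal_mult'[symmetric])
    finally show ?thesis .
  qed
  have "M1 = M2"
  proof (rule laplace_transform_unique[OF s(1) nn(1) s(2) nn(2)])
    show "laplace_transform M1 c = laplace_transform M2 c" if "0 < c" for c using that by (simp add: L1 L2)
    show "0 < laplace_transform M1 1" "laplace_transform M1 1 < top" using \<Lambda> \<beta> by (simp_all add: L1)
  qed
  then have "AE x in lborel. levy_weight 1 \<rho> x * ennreal x = indicator {0..} x * ennreal (exp (- (\<beta> * x)) / \<Lambda>)"
    unfolding M1_def M2_def by (subst (asm) sigma_finite_measure.density_unique_iff[OF sigma_finite_lborel]) measurable
  then have "AE x in lborel. 0 < x \<longrightarrow> \<rho> x = exp (- (\<beta> * x)) / (\<Lambda> * x)"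
  proof eventually_elim
    case (elim x)
    show ?case
    proof
      assume x: "0 < x"
      then have "0 \<le> \<rho> x" using levy by (simp add: levy_density_def)
      then have "\<rho> x * x = exp (- (\<beta> * x)) / \<Lambda>"
        using elim x \<Lambda> by (simp add: levy_weight_def ennreal_mult'[symmetric])
      then show "\<rho> x = exp (- (\<beta> * x)) / (\<Lambda> * x)" using x \<Lambda> by (simp add: field_simps)
    qed
  qed
  then show ?thesis using \<beta> by blast
qed

end

text \<open>The only place where different numbers of buckets are compared. The factor relating the
  two integrals is constant in \<open>m\<close> for each \<open>J\<close>, and the common point
  \<open>m = J\<close>, that is \<open>c = \<theta>\<close>, ties these factors together.\<close>

lemma uncorrelated_imp_gamma:
  fixes G :: "'s::{second_countable_topology, t2_space} measure"
  assumes models: "\<And>J. 1 \<le> J \<Longrightarrow> sketch_model \<theta> G \<rho> N J (H J)"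
    and U: "\<And>J. 1 \<le> J \<Longrightarrow> sketch_model.uncorrelated N J 1"
  shows "\<exists>\<Lambda>>0. \<exists>\<beta>>0. AE x in lborel. 0 < x \<longrightarrow> \<rho> x = exp (- (\<beta> * x)) / (\<Lambda> * x)"
proof -
  interpret S1: sketch_model \<theta> G \<rho> N 1 "H 1" by (rule models) simp
  have levy: "levy_density \<rho>" and \<theta>: "0 < \<theta>" by (rule S1.\<rho> S1.\<theta>)+
  note [measurable] = levy_moment_measurable[OF levy] laplace_exponent_measurable[OF levy]
  define I where "I n c = (\<integral>\<^sup>+u. gamma_weight 1 u * (nexp (ennreal c * laplace_exponent \<rho> (ennreal u)) * levy_moment \<rho> n (ennreal u) ^ (3 - n)) \<partial>lborel)" for n c
  \<comment> \<open>The identities leave the locale here, so that \<open>J\<close> can vary;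
    \<open>R\<close> is \<open>E[S\<^sub>1 / q\<^sub>1\<^sup>2]\<close>, which may depend on
    \<open>J\<close>.\<close>
  have "\<exists>R\<le>1. \<forall>m\<in>{1..J}. ennreal (\<theta> / J) * I 2 (real m * (\<theta> / J)) = R * (ennreal (\<theta> / J) * I 2 (real m * (\<theta> / J)) + ennreal ((\<theta> / J) ^ 2) * I 1 (real m * (\<theta> / J)))
      \<and> ennreal (\<theta> / J) * I 2 (real m * (\<theta> / J)) + ennreal ((\<theta> / J) ^ 2) * I 1 (real m * (\<theta> / J)) \<le> 1"
    if J: "1 \<le> J" for J
  proof -
    interpret S: sketch_model \<theta> G \<rho> N J "H J" by (rule models[OF J])
    show ?thesis
      unfolding I_def
      using S.uncorrelated_identity[OF U[OF J], unfolded S.a_def]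
      by (intro exI[of _ "S.E (\<lambda>P h. square_ratio P h 1)"] conjI ballI S.E_le_1 square_ratio_le_1)
  qed
  then obtain R where R: "\<And>J::nat. 1 \<le> J \<Longrightarrow> R J \<le> 1"
    and id: "\<And>(J::nat) (m::nat). 1 \<le> J \<Longrightarrow> m \<in> {1..J} \<Longrightarrow> ennreal (\<theta> / J) * I 2 (real m * (\<theta> / J)) = R J * (ennreal (\<theta> / J) * I 2 (real m * (\<theta> / J)) + ennreal ((\<theta> / J) ^ 2) * I 1 (real m * (\<theta> / J)))"
    and le: "\<And>(J::nat) (m::nat). 1 \<le> J \<Longrightarrow> m \<in> {1..J} \<Longrightarrow> ennreal (\<theta> / J) * I 2 (real m * (\<theta> / J)) + ennreal ((\<theta> / J) ^ 2) * I 1 (real m * (\<theta> / J)) \<le> 1"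
    by metis
  \<comment> \<open>For \<open>J > \<theta> / c\<close> the bound by 1 with \<open>m = 1\<close>
    makes the integral finite at \<open>\<theta> / J \<le> c\<close>, and the integral decreases in
    its argument.\<close>
  have fin: "I n c < top" if c: "0 < c" and n: "n \<in> {1, 2}" for n c
  proof -
    obtain J :: nat where J: "\<theta> / c < real J" using reals_Archimedean2 by blast
    then have J1: "1 \<le> J" using c \<theta> by (cases J) (auto simp: divide_less_0_iff)
    define a where "a = \<theta> / J"
    have a: "0 < a" "a \<le> c" using J J1 c \<theta> by (auto simp: a_def field_simps)
    have "ennreal a * I 2 a + ennreal (a ^ 2) * I 1 a \<le> 1"
      using le[OF J1, of 1] J1 unfolding a_def[symmetric] by simp
    then have "ennreal a * I 2 a + ennreal (a ^ 2) * I 1 a < top"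
      by (rule le_less_trans) simp
    then have "I n a < top"
      using n a by (auto simp: ennreal_mult_less_top)
    moreover have "I n c \<le> I n a"
      unfolding I_def using a by (intro nn_integral_mono mult_left_mono mult_right_mono nexp_antimono ennreal_leI) auto
    ultimately show ?thesis by (rule le_less_trans[rotated])
  qed
  have pos: "0 < I n c" if c: "0 < c" for n c
    unfolding I_def
  proof (rule nn_integral_gamma_pos)
    fix u :: real assume u: "0 < u"
    have "ennreal c * laplace_exponent \<rho> (ennreal u) \<noteq> top"
      using laplace_exponent_ennreal_finite[OF levy, of u] u by (auto simp: ennreal_mult_eq_top_iff)
    then have "0 < nexp (ennreal c * laplace_exponent \<rho> (ennreal u))"
      by (simp add: zero_less_iff_neq_zero)
    then show "0 < nexp (ennreal c * laplace_exponent \<rho> (ennreal u)) * levy_moment \<rho> n (ennreal u) ^ (3 - n)"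
      using levy_moment_pos[OF levy, of u n] u by (simp add: ennreal_zero_less_mult_iff zero_less_iff_neq_zero)
  qed measurable
  define i where "i n c = enn2real (I n c)" for n c
  have I: "I n c = ennreal (i n c)" if "0 < c" "n \<in> {1, 2}" for n c
    using fin[OF that] by (simp add: i_def)
  have ipos: "0 < i n c" if "0 < c" "n \<in> {1, 2}" for n c
    using pos[OF that(1), of n] I[OF that] by simp
  have key: "\<exists>l. \<forall>m\<in>{1..J}. i 2 (real m * (\<theta> / J)) = l * i 1 (real m * (\<theta> / J))" if J: "1 \<le> J" for J
  proof -
    define a where "a = \<theta> / J"
    have a: "0 < a" using J \<theta> by (simp add: a_def)
    obtain r where r: "R J = ennreal r" "0 \<le> r" "r \<le> 1"
      using R[OF J] by (cases "R J") (auto simp: top_unique)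
    have eq: "(1 - r) * i 2 (real m * a) = r * a * i 1 (real m * a)" if m: "m \<in> {1..J}" for m
    proof -
      have c: "0 < real m * a" using a m by simp
      have "ennreal (a * i 2 (real m * a)) = ennreal (r * (a * i 2 (real m * a) + a ^ 2 * i 1 (real m * a)))"
        using id[OF J m, folded a_def] ipos[OF c, of 1] ipos[OF c, of 2] a r
        by (simp add: I[OF c] ennreal_mult'[symmetric] ennreal_plus[symmetric] del: ennreal_plus)
      then have "a * i 2 (real m * a) = r * (a * i 2 (real m * a) + a ^ 2 * i 1 (real m * a))"
        using ipos[OF c, of 1] ipos[OF c, of 2] a r by (subst (asm) ennreal_inj) auto
      then have "a * ((1 - r) * i 2 (real m * a)) = a * (r * a * i 1 (real m * a))"
        by (simp add: algebra_simps power2_eq_square)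
      then show ?thesis using a by simp
    qed
    \<comment> \<open>With \<open>r = 1\<close> the identity would make \<open>i 1\<close>
      vanish.\<close>
    have "r \<noteq> 1" using eq[of 1] ipos[of "real 1 * a" 1] a J by auto
    then show ?thesis
      unfolding a_def[symmetric]
      by (intro exI[of _ "r * a / (1 - r)"] ballI) (use eq r in \<open>simp add: field_simps\<close>)
  qed
  define \<Lambda> where "\<Lambda> = i 2 \<theta> / i 1 \<theta>"
  have \<Lambda>: "0 < \<Lambda>" using ipos[OF \<theta>] by (simp add: \<Lambda>_def)
  have ratio: "i 2 (real m * (\<theta> / J)) = \<Lambda> * i 1 (real m * (\<theta> / J))" if J: "1 \<le> J" and m: "m \<in> {1..J}" for J m
  proof -
    obtain l where l: "\<And>m. m \<in> {1..J} \<Longrightarrow> i 2 (real m * (\<theta> / J)) = l * i 1 (real m * (\<theta> / J))"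
      using key[OF J] by blast
    have "i 2 \<theta> = l * i 1 \<theta>" using l[of J] J by simp
    then have "l = \<Lambda>" using ipos[OF \<theta>, of 1] by (simp add: \<Lambda>_def)
    then show ?thesis using l[OF m] by simp
  qed
  \<comment> \<open>The points \<open>\<theta> - e k = (k + 1) \<theta> / (k + 2)\<close> belong to
    \<open>J = k + 2\<close> and \<open>m = k + 1\<close>.\<close>
  define e where "e k = \<theta> / real (k + 2)" for k
  have e: "0 < e k \<and> e k < \<theta>" for k
  proof -
    have "\<theta> * 1 < \<theta> * real (k + 2)" using \<theta> by (intro mult_strict_left_mono) auto
    then show ?thesis using \<theta> by (simp add: e_def divide_less_eq)
  qed
  have e0: "e \<longlonglongrightarrow> 0" unfolding e_def by real_asymp
  have Ieq: "I 2 (\<theta> - e k) = ennreal \<Lambda> * I 1 (\<theta> - e k)" for k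
  proof -
    have "\<theta> - e k = real (k + 1) * (\<theta> / real (k + 2))"
      by (simp add: e_def field_simps)
    then have "i 2 (\<theta> - e k) = \<Lambda> * i 1 (\<theta> - e k)"
      using ratio[of "k + 2" "k + 1"] by simp
    then show ?thesis
      using e[of k] \<Lambda> by (simp add: I ennreal_mult')
  qed
  have "moment \<rho> 2 u = \<Lambda> * moment \<rho> 1 u ^ 2" if "0 < u" for u
    by (rule moments_proportional[OF levy \<Lambda> \<theta> e e0 Ieq[unfolded I_def] fin[unfolded I_def] that])
  from gamma_levy_density[OF levy \<Lambda> this] \<Lambda> show ?thesis by blast
qed

section \<open>The Dirichlet process\<close>

lemma measurable_map_points:
  assumes N: "sets N = sets (PiM UNIV (\<lambda>_. \<nu>))" and \<phi>: "\<phi> \<in> \<nu> \<rightarrow>\<^sub>M M"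
  shows "(\<lambda>w k. \<phi> (w k)) \<in> N \<rightarrow>\<^sub>M PiM UNIV (\<lambda>_. M)"
proof (rule measurable_PiM_single')
  have comp: "(\<lambda>w. w k) \<in> N \<rightarrow>\<^sub>M \<nu>" for k
    unfolding measurable_cong_sets[OF N refl] by (rule measurable_component_singleton) simp
  then show "(\<lambda>w. \<phi> (w k)) \<in> N \<rightarrow>\<^sub>M M" for k
    by (rule measurable_compose) (rule \<phi>)
  show "(\<lambda>w k. \<phi> (w k)) \<in> space N \<rightarrow> (\<Pi>\<^sub>E k\<in>UNIV. space M)"
    using measurable_space[OF \<phi> measurable_space[OF comp]] by (auto simp: PiE_def)
qed

text \<open>Mapping theorem in the counting form that \<open>NRM_law\<close> asks for: the image has
  as many points in \<open>B\<close> as the original has in the preimage of \<open>B\<close>, and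
  preimages of disjoint sets are disjoint.\<close>

lemma poisson_process_points_image:
  assumes pp: "poisson_process_points \<nu> N" and \<phi> [measurable]: "\<phi> \<in> \<nu> \<rightarrow>\<^sub>M M" and U: "space \<nu> = UNIV"
  shows "poisson_process_points (distr \<nu> M \<phi>) (distr N (PiM UNIV (\<lambda>_. M)) (\<lambda>w k. \<phi> (w k)))"
proof -
  define \<Phi> where "\<Phi> w k = \<phi> (w k)" for w :: "nat \<Rightarrow> 'a" and k
  define N' where "N' = distr N (PiM UNIV (\<lambda>_::nat. M)) \<Phi>"
  have PN: "prob_space N" and sN: "sets N = sets (PiM UNIV (\<lambda>_. \<nu>))"
    and fin: "\<And>B m. B \<in> sets \<nu> \<Longrightarrow> emeasure \<nu> B < \<infinity> \<Longrightarrow> measure N {w \<in> space N. num_points w B = enat m} = measure \<nu> B ^ m / fact m * exp (- measure \<nu> B)"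
    and inf: "\<And>B. B \<in> sets \<nu> \<Longrightarrow> emeasure \<nu> B = \<infinity> \<Longrightarrow> AE w in N. num_points w B = \<infinity>"
    and ind: "\<And>(I :: nat set) B. finite I \<Longrightarrow> \<forall>i\<in>I. B i \<in> sets \<nu> \<Longrightarrow> disjoint_family_on B I \<Longrightarrow>
        prob_space.indep_vars N (\<lambda>_. count_space UNIV) (\<lambda>i w. num_points w (B i)) I"
    using pp unfolding poisson_process_points_def by blast+
  interpret N: prob_space N by (rule PN)
  note [measurable_cong] = sN
  have \<Phi> [measurable]: "\<Phi> \<in> N \<rightarrow>\<^sub>M PiM UNIV (\<lambda>_. M)"
    unfolding \<Phi>_def[abs_def] by (rule measurable_map_points[OF sN \<phi>])
  interpret N': prob_space N' unfolding N'_def by (rule N.prob_space_distr) measurable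
  have sN': "sets N' = sets (PiM UNIV (\<lambda>_. M))" by (simp add: N'_def)
  have np: "num_points (\<Phi> w) B = num_points w (\<phi> -` B)" for w B
    by (simp add: num_points_def \<Phi>_def)
  have sB [simp]: "\<phi> -` B \<in> sets \<nu>" if "B \<in> sets M" for B
    using measurable_sets[OF \<phi> that] by (simp add: U)
  have em: "emeasure (distr \<nu> M \<phi>) B = emeasure \<nu> (\<phi> -` B)" if "B \<in> sets M" for B
    using that by (simp add: emeasure_distr U)
  then have me: "measure (distr \<nu> M \<phi>) B = measure \<nu> (\<phi> -` B)" if "B \<in> sets M" for B
    using that by (simp add: measure_def)
  have mnp: "(\<lambda>w. num_points w B) \<in> PiM UNIV (\<lambda>_::nat. M) \<rightarrow>\<^sub>M count_space UNIV" if "B \<in> sets M" for B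
    by (rule num_points_measurable[OF refl that])
  have mset: "{w \<in> space (PiM UNIV (\<lambda>_::nat. M)). num_points w B = a} \<in> sets (PiM UNIV (\<lambda>_. M))" if "B \<in> sets M" for B a
  proof -
    have "{w \<in> space (PiM UNIV (\<lambda>_::nat. M)). num_points w B = a} = (\<lambda>w. num_points w B) -` {a} \<inter> space (PiM UNIV (\<lambda>_. M))"
      by auto
    also have "\<dots> \<in> sets (PiM UNIV (\<lambda>_. M))" by (rule measurable_sets[OF mnp[OF that]]) simp
    finally show ?thesis .
  qed
  have mnpN': "(\<lambda>w. num_points w B) \<in> N' \<rightarrow>\<^sub>M count_space UNIV" if "B \<in> sets M" for B
    by (rule num_points_measurable[OF sN' that])
  have sp: "\<Phi> w \<in> space (PiM UNIV (\<lambda>_. M))" if "w \<in> space N" for w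
    using measurable_space[OF \<Phi> that] .
  have "poisson_process_points (distr \<nu> M \<phi>) N'"
    unfolding poisson_process_points_def
  proof (intro conjI ballI impI allI)
    show "prob_space N'" by (rule N'.prob_space_axioms)
    show "sets N' = sets (PiM UNIV (\<lambda>_. distr \<nu> M \<phi>))" unfolding sN' by (intro sets_PiM_cong) auto
  next
    fix B m assume "B \<in> sets (distr \<nu> M \<phi>)" and f: "emeasure (distr \<nu> M \<phi>) B < \<infinity>"
    then have B: "B \<in> sets M" by simp
    have "{w \<in> space N. num_points w (\<phi> -` B) = enat m} = \<Phi> -` {w \<in> space (PiM UNIV (\<lambda>_::nat. M)). num_points w B = enat m} \<inter> space N"
      using sp by (auto simp: np)
    then have "measure N' {w \<in> space N'. num_points w B = enat m} = measure N {w \<in> space N. num_points w (\<phi> -` B) = enat m}"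
      unfolding N'_def space_distr by (simp only: measure_distr[OF \<Phi> mset[OF B]])
    then show "measure N' {w \<in> space N'. num_points w B = enat m} = measure (distr \<nu> M \<phi>) B ^ m / fact m * exp (- measure (distr \<nu> M \<phi>) B)"
      using fin[OF sB[OF B], of m] f by (simp add: em me B)
  next
    fix B assume "B \<in> sets (distr \<nu> M \<phi>)" and f: "emeasure (distr \<nu> M \<phi>) B = \<infinity>"
    then have B: "B \<in> sets M" by simp
    show "AE w in N'. num_points w B = \<infinity>"
      unfolding N'_def AE_distr_iff[OF \<Phi> mset[OF B]] np
      using f by (intro inf sB B) (simp add: em B)
  next
    fix I :: "nat set" and B :: "nat \<Rightarrow> 'b set"
    assume I: "finite I" and "\<forall>i\<in>I. B i \<in> sets (distr \<nu> M \<phi>)" and d: "disjoint_family_on B I"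
    then have B: "B i \<in> sets M" if "i \<in> I" for i using that by simp
    show "N'.indep_vars (\<lambda>_. count_space UNIV) (\<lambda>i w. num_points w (B i)) I"
    \<comment> \<open>Independence is moved to the image law through its characterization by a
      product distribution, which assumes a nonempty index set.\<close>
    proof (cases "I = {}")
      case True
      then show ?thesis by (simp add: N'.indep_vars_def N'.indep_sets_def)
    next
      case False
      have "disjoint_family_on (\<lambda>i. \<phi> -` B i) I"
        using d by (force simp: disjoint_family_on_def)
      then have indN: "N.indep_vars (\<lambda>_. count_space UNIV) (\<lambda>i w. num_points (\<Phi> w) (B i)) I"
        unfolding np using B by (intro ind I) auto
      have mN: "(\<lambda>w. num_points (\<Phi> w) (B i)) \<in> N \<rightarrow>\<^sub>M count_space UNIV" if "i \<in> I" for i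
        by (rule measurable_compose[OF \<Phi> mnp[OF B[OF that]]])
      have eq: "distr N (PiM I (\<lambda>_. count_space UNIV)) (\<lambda>w. \<lambda>i\<in>I. num_points (\<Phi> w) (B i))
          = PiM I (\<lambda>i. distr N (count_space UNIV) (\<lambda>w. num_points (\<Phi> w) (B i)))"
        by (rule N.indep_vars_iff_distr_eq_PiM'[THEN iffD1, OF False mN indN])
      have "distr N' (PiM I (\<lambda>_. count_space UNIV)) (\<lambda>w. \<lambda>i\<in>I. num_points w (B i))
          = distr N (PiM I (\<lambda>_. count_space UNIV)) (\<lambda>w. \<lambda>i\<in>I. num_points (\<Phi> w) (B i))"
        unfolding N'_def by (subst distr_distr[OF measurable_restrict[OF mnp[OF B]] \<Phi>]) (auto simp: comp_def)
      also note eq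
      also have "PiM I (\<lambda>i. distr N (count_space UNIV) (\<lambda>w. num_points (\<Phi> w) (B i)))
          = PiM I (\<lambda>i. distr N' (count_space UNIV) (\<lambda>w. num_points w (B i)))"
      proof (intro PiM_cong refl)
        fix i assume i: "i \<in> I"
        show "distr N (count_space UNIV) (\<lambda>w. num_points (\<Phi> w) (B i)) = distr N' (count_space UNIV) (\<lambda>w. num_points w (B i))"
          unfolding N'_def by (subst distr_distr[OF mnp[OF B[OF i]] \<Phi>]) (simp add: comp_def)
      qed
      finally show ?thesis
        by (intro N'.indep_vars_iff_distr_eq_PiM'[THEN iffD2, OF False] mnpN' B) auto
    qed
  qed
  then show ?thesis by (simp add: N'_def \<Phi>_def[abs_def])
qed

lemma levy_density_exp: "levy_density (\<lambda>x. exp (- x) / x)"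
  unfolding levy_density_def
proof (intro conjI allI impI)
  show "0 \<le> exp (- x) / x" if "0 < x" for x :: real using that by simp
  show "set_borel_measurable lborel {0<..} (\<lambda>x::real. exp (- x) / x)"
    unfolding set_borel_measurable_def by measurable
  define X where "X = (\<integral>\<^sup>+x\<in>{0<..}. ennreal (exp (- x) / x) \<partial>lborel)"
  \<comment> \<open>On \<open>{exp (- n)..1}\<close> the density is at least
    \<open>exp (- 1) / x\<close>, and \<open>1 / x\<close> has integral \<open>n\<close>
    there.\<close>
  have X: "ennreal (exp (- 1) * real n) \<le> X" for n
  proof -
    have "ennreal (exp (- 1) * real n) = ennreal (exp (- 1) * ln 1 - exp (- 1) * ln (exp (- real n)))" by simp
    also have "\<dots> = (\<integral>\<^sup>+x. ennreal (exp (- 1) * (1 / x)) * indicator {exp (- real n)..1} x \<partial>lborel)"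
    proof (rule nn_integral_FTC_Icc[where F = "\<lambda>x. exp (- 1) * ln x", symmetric])
      fix x :: real assume "x \<in> {exp (- real n)..1}"
      then have x: "0 < x" using less_le_trans[OF exp_gt_zero] by auto
      show "DERIV (\<lambda>x. exp (- 1) * ln x) x :> exp (- 1) * (1 / x)"
        using x by (auto intro!: derivative_eq_intros)
    next
      fix x :: real assume "x \<in> {exp (- real n)..1}"
      then have x: "0 < x" using less_le_trans[OF exp_gt_zero] by auto
      show "0 \<le> exp (- 1) * (1 / x)" using x by simp
    qed auto
    also have "\<dots> \<le> X"
      unfolding X_def
    proof (intro nn_integral_mono)
      fix x :: real
      show "ennreal (exp (- 1) * (1 / x)) * indicator {exp (- real n)..1} x \<le> ennreal (exp (- x) / x) * indicator {0<..} x"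
      proof (cases "x \<in> {exp (- real n)..1}")
        case True
        then have x: "0 < x" "x \<le> 1" using less_le_trans[OF exp_gt_zero] by auto
        then have "exp (- 1) * (1 / x) \<le> exp (- x) / x" by (simp add: divide_right_mono)
        then show ?thesis using x True by (simp add: ennreal_leI)
      qed simp
    qed
    finally show ?thesis .
  qed
  show "X = \<infinity>"
  proof (cases X)
    case (real r)
    obtain n where "r < real n * exp (- 1)"
      using ex_less_of_nat_mult[of "exp (- 1)" r] by auto
    then show ?thesis using X[of n] real by (simp add: mult.commute)
  qed simp
  fix u :: real assume u: "0 < u"
  have "(\<integral>\<^sup>+x\<in>{0<..}. ennreal ((1 - exp (- u * x)) * (exp (- x) / x)) \<partial>lborel)
      \<le> (\<integral>\<^sup>+x. ennreal u * (indicator {0..} x * ennreal (x ^ 0 * exp (- (x * 1)))) \<partial>lborel)"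
  proof (intro nn_integral_mono)
    fix x :: real
    show "ennreal ((1 - exp (- u * x)) * (exp (- x) / x)) * indicator {0<..} x
        \<le> ennreal u * (indicator {0..} x * ennreal (x ^ 0 * exp (- (x * 1))))"
    proof (cases "0 < x")
      case True
      have "(1 - exp (- u * x)) * (exp (- x) / x) \<le> (u * x) * (exp (- x) / x)"
        using True exp_ge_add_one_self[of "- u * x"] by (intro mult_right_mono) auto
      also have "\<dots> = u * exp (- x)" using True by simp
      finally show ?thesis using True u by (simp add: ennreal_mult'[symmetric] ennreal_leI)
    qed simp
  qed
  also have "\<dots> = ennreal u * (\<integral>\<^sup>+x. indicator {0..} x * ennreal (x ^ 0 * exp (- (x * 1))) \<partial>lborel)"
    by (rule nn_integral_cmult) measurable
  also have "\<dots> < \<infinity>"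
    by (subst nn_integral_power_exp) (auto simp: ennreal_mult_less_top)
  finally show "(\<integral>\<^sup>+x\<in>{0<..}. ennreal ((1 - exp (- u * x)) * (exp (- x) / x)) \<partial>lborel) < \<infinity>" .
qed

lemma levy_moment_exp:
  assumes r: "0 \<le> r"
  shows "levy_moment (\<lambda>x. exp (- x) / x) (Suc n) (ennreal r) = ennreal (fact n / (1 + r) ^ Suc n)"
proof -
  have "levy_moment (\<lambda>x. exp (- x) / x) (Suc n) (ennreal r)
      = (\<integral>\<^sup>+x. indicator {0..} x * ennreal (x ^ n * exp (- (x * (1 + r)))) \<partial>lborel)"
    unfolding levy_moment_def
  proof (intro nn_integral_cong_AE)
    have "AE x in lborel. x \<noteq> (0::real)" by (rule AE_lborel_singleton)
    then show "AE x in lborel. levy_weight 1 (\<lambda>x. exp (- x) / x) x * (nexp (ennreal r * ennreal x) * ennreal x ^ Suc n)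
        = indicator {0..} x * ennreal (x ^ n * exp (- (x * (1 + r))))"
    proof eventually_elim
      case (elim x)
      show ?case
      proof (cases "0 < x")
        case True
        have "exp (- x) / x * (exp (- (r * x)) * x ^ Suc n) = x ^ n * exp (- (x * (1 + r)))"
          using True by (simp add: exp_add[symmetric] exp_minus field_simps)
        then show ?thesis
          using True r by (simp add: levy_weight_def ennreal_mult'[symmetric] nexp_ennreal ennreal_power del: power_Suc)
      qed (use elim in \<open>simp add: levy_weight_def\<close>)
    qed
  qed
  also have "\<dots> = ennreal (fact n / (1 + r) ^ Suc n)"
    using r by (intro nn_integral_power_exp) simp
  finally show ?thesis .
qed

text \<open>For finite \<open>u\<close> the two moments are \<open>1 / (1 + u)\<^sup>2\<close> and
  \<open>1 / (1 + u)\<close>; an infinite tilt kills both.\<close>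

lemma levy_moment_exp_square:
  assumes "0 < u"
  shows "levy_moment (\<lambda>x. exp (- x) / x) 2 u = levy_moment (\<lambda>x. exp (- x) / x) 1 u ^ 2"
proof (cases u)
  case (real r)
  have S: "(2::nat) = Suc (Suc 0)" "(1::nat) = Suc 0" by simp_all
  have "levy_moment (\<lambda>x. exp (- x) / x) 1 u = ennreal (1 / (1 + r))" "levy_moment (\<lambda>x. exp (- x) / x) 2 u = ennreal (1 / (1 + r) ^ 2)"
    unfolding S using real by (simp_all add: levy_moment_exp)
  then show ?thesis using real by (simp add: ennreal_power power_divide)
next
  case top
  have z: "levy_weight 1 (\<lambda>x. exp (- x) / x) x * (nexp (top * ennreal x) * y) = 0" for x y
    by (cases "0 < x") (auto simp: levy_weight_def ennreal_top_mult)
  show ?thesis unfolding top levy_moment_def z by simp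
qed

text \<open>The substitution \<open>y = \<beta> x\<close> leaves \<open>dx / x\<close> invariant, so
  it only turns \<open>exp (- \<beta> x)\<close> into \<open>exp (- y)\<close>. The factor
  \<open>1 / \<Lambda>\<close> cannot be scaled away and moves into the parameter
  \<open>\<theta> / \<Lambda>\<close>.\<close>

lemma levy_intensity_rescale:
  assumes \<rho>: "set_borel_measurable lborel {0<..} \<rho>" and G: "prob_space G"
    and pos: "0 < \<beta>" "0 < \<Lambda>" "0 < \<theta>"
    and AE: "AE x in lborel. 0 < x \<longrightarrow> \<rho> x = exp (- (\<beta> * x)) / (\<Lambda> * x)"
  shows "levy_intensity (\<theta> / \<Lambda>) G (\<lambda>x. exp (- x) / x) = distr (levy_intensity \<theta> G \<rho>) (borel \<Otimes>\<^sub>M G) (\<lambda>(x, s). (\<beta> * x, s))"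
proof (rule measure_eqI)
  let ?e = "\<lambda>x::real. exp (- x) / x"
  interpret prob_space G by fact
  have e: "set_borel_measurable lborel {0<..} ?e"
    using levy_density_exp by (simp add: levy_density_def)
  note [measurable] = levy_weight_measurable[OF e]
  show "sets (levy_intensity (\<theta> / \<Lambda>) G ?e) = sets (distr (levy_intensity \<theta> G \<rho>) (borel \<Otimes>\<^sub>M G) (\<lambda>(x, s). (\<beta> * x, s)))"
    by (simp add: sets_levy_intensity)
  fix A assume "A \<in> sets (levy_intensity (\<theta> / \<Lambda>) G ?e)"
  then have A [measurable]: "A \<in> sets (borel \<Otimes>\<^sub>M G)" by (simp add: sets_levy_intensity)
  note [measurable_cong] = sets_levy_intensity[of \<theta> G \<rho>]
  define g where "g y = (\<integral>\<^sup>+s. indicator A (y, s) \<partial>G)" for y :: real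
  have [measurable]: "g \<in> borel_measurable borel" unfolding g_def[abs_def] by measurable
  have "emeasure (levy_intensity (\<theta> / \<Lambda>) G ?e) A = (\<integral>\<^sup>+z. indicator A z \<partial>levy_intensity (\<theta> / \<Lambda>) G ?e)"
    using A by (simp add: sets_levy_intensity)
  also have "\<dots> = (\<integral>\<^sup>+y. levy_weight (\<theta> / \<Lambda>) ?e y * g y \<partial>lborel)"
    unfolding g_def by (rule nn_integral_levy_intensity[OF e G]) measurable
  also have "\<dots> = ennreal \<bar>\<beta>\<bar> * (\<integral>\<^sup>+x. levy_weight (\<theta> / \<Lambda>) ?e (0 + \<beta> * x) * g (0 + \<beta> * x) \<partial>lborel)"
    using pos by (intro nn_integral_real_affine) auto
  also have "\<dots> = (\<integral>\<^sup>+x. ennreal \<bar>\<beta>\<bar> * (levy_weight (\<theta> / \<Lambda>) ?e (0 + \<beta> * x) * g (0 + \<beta> * x)) \<partial>lborel)"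
    by (rule nn_integral_cmult[symmetric]) measurable
  also have "\<dots> = (\<integral>\<^sup>+x. levy_weight \<theta> \<rho> x * g (\<beta> * x) \<partial>lborel)"
  proof (rule nn_integral_cong_AE)
    show "AE x in lborel. ennreal \<bar>\<beta>\<bar> * (levy_weight (\<theta> / \<Lambda>) ?e (0 + \<beta> * x) * g (0 + \<beta> * x)) = levy_weight \<theta> \<rho> x * g (\<beta> * x)"
      using AE
    proof eventually_elim
      case (elim x)
      have "ennreal \<bar>\<beta>\<bar> * levy_weight (\<theta> / \<Lambda>) ?e (\<beta> * x) = levy_weight \<theta> \<rho> x"
        using elim pos by (cases "0 < x") (auto simp: levy_weight_def ennreal_mult'[symmetric] zero_less_mult_iff)
      then show ?case by (simp add: mult.assoc[symmetric])
    qed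
  qed
  also have "\<dots> = (\<integral>\<^sup>+x. levy_weight \<theta> \<rho> x * (\<integral>\<^sup>+s. indicator A (case (x, s) of (x, s) \<Rightarrow> (\<beta> * x, s)) \<partial>G) \<partial>lborel)"
    by (simp add: g_def)
  also have "\<dots> = (\<integral>\<^sup>+z. indicator A (case z of (x, s) \<Rightarrow> (\<beta> * x, s)) \<partial>levy_intensity \<theta> G \<rho>)"
    by (rule nn_integral_levy_intensity[OF \<rho> G, symmetric]) measurable
  also have "\<dots> = (\<integral>\<^sup>+z. indicator A z \<partial>distr (levy_intensity \<theta> G \<rho>) (borel \<Otimes>\<^sub>M G) (\<lambda>(x, s). (\<beta> * x, s)))"
    by (rule nn_integral_distr[symmetric]) measurable
  also have "\<dots> = emeasure (distr (levy_intensity \<theta> G \<rho>) (borel \<Otimes>\<^sub>M G) (\<lambda>(x, s). (\<beta> * x, s))) A"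
    by simp
  finally show "emeasure (levy_intensity (\<theta> / \<Lambda>) G ?e) A = emeasure (distr (levy_intensity \<theta> G \<rho>) (borel \<Otimes>\<^sub>M G) (\<lambda>(x, s). (\<beta> * x, s))) A" .
qed

lemma normalized_measure_scale:
  assumes \<beta>: "0 < \<beta>"
  shows "normalized_measure (\<lambda>k. case w k of (x, s) \<Rightarrow> (\<beta> * x, s)) = normalized_measure w"
proof -
  have "(\<Sum>i. \<beta> * fst (w i)) = \<beta> * (\<Sum>i. fst (w i))" if "summable (\<lambda>k. fst (w k))"
    using that by (rule suminf_mult)
  moreover have "summable (\<lambda>k. \<beta> * fst (w k)) \<longleftrightarrow> summable (\<lambda>k. fst (w k))"
    using \<beta> by (simp add: summable_cmult_iff)
  ultimately show ?thesis
    using \<beta> by (simp add: normalized_measure_def case_prod_unfold zero_less_mult_iff)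
qed

theorem theorem5:
  fixes \<theta> :: real
    and G\<^sub>0 :: "'s::{second_countable_topology, t2_space} measure"
    and \<rho> :: "real \<Rightarrow> real"
    and Q :: "'s pmf measure"
    and H :: "nat \<Rightarrow> ('s \<Rightarrow> nat) measure"
  assumes "0 < \<theta>"
    and "nonatomic_prob G\<^sub>0"
    and "levy_density \<rho>"
    and "NRM_law \<theta> G\<^sub>0 \<rho> Q"
    and "\<And>J. 1 \<le> J \<Longrightarrow> strongly_universal J (H J)"
    and "\<And>J. 1 \<le> J \<Longrightarrow> measurable_hash (H J)"
  shows "(\<forall>J\<ge>1. \<forall>n. \<forall>c. (\<Sum>k=1..J. c k) = n \<longrightarrow>
            (\<forall>j\<in>{1..J}. f_NRM Q (H J) c j = f_BNP J n Q (H J) c j))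
         \<longleftrightarrow> dirichlet_process_law Q"
proof
  assume coincide: "\<forall>J\<ge>1. \<forall>n. \<forall>c. (\<Sum>k=1..J. c k) = n \<longrightarrow>
            (\<forall>j\<in>{1..J}. f_NRM Q (H J) c j = f_BNP J n Q (H J) c j)"
  obtain N where pp: "poisson_process_points (levy_intensity \<theta> G\<^sub>0 \<rho>) N"
    and Q: "Q = distr N discrete_distr_space normalized_measure"
    using assms(4) by (auto simp: NRM_law_def)
  have models: "sketch_model \<theta> G\<^sub>0 \<rho> N J (H J)" if "1 \<le> J" for J
    using that assms poisson_imp_laplace[OF pp] by unfold_locales auto
  have "sketch_model.uncorrelated N J 1" if J: "1 \<le> J" for J
    using coincide J sketch_model.estimators_coincide_iff[OF models[OF J], of 1] unfolding Q by auto
  from uncorrelated_imp_gamma[OF models this]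
  obtain \<Lambda> \<beta> where pos: "0 < \<Lambda>" "0 < \<beta>" and AE: "AE x in lborel. 0 < x \<longrightarrow> \<rho> x = exp (- (\<beta> * x)) / (\<Lambda> * x)"
    by auto
  have G: "prob_space G\<^sub>0" "sets G\<^sub>0 = sets borel" using assms(2) by (auto simp: nonatomic_prob_def)
  have \<rho>: "set_borel_measurable lborel {0<..} \<rho>" using assms(3) by (simp add: levy_density_def)
  define \<phi> :: "real \<times> 's \<Rightarrow> real \<times> 's" where "\<phi> = (\<lambda>(x, s). (\<beta> * x, s))"
  define N' where "N' = distr N (PiM UNIV (\<lambda>_. borel \<Otimes>\<^sub>M G\<^sub>0)) (\<lambda>w k. \<phi> (w k))"
  have m\<phi>: "\<phi> \<in> levy_intensity \<theta> G\<^sub>0 \<rho> \<rightarrow>\<^sub>M borel \<Otimes>\<^sub>M G\<^sub>0"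
    unfolding \<phi>_def measurable_cong_sets[OF sets_levy_intensity refl] by measurable
  have "space (levy_intensity \<theta> G\<^sub>0 \<rho>) = UNIV"
    using sets_eq_imp_space_eq[OF sets_levy_intensity[of \<theta> G\<^sub>0 \<rho>]] sets_eq_imp_space_eq[OF G(2)]
    by (simp add: space_pair_measure)
  from poisson_process_points_image[OF pp m\<phi> this]
  have pp': "poisson_process_points (levy_intensity (\<theta> / \<Lambda>) G\<^sub>0 (\<lambda>x. exp (- x) / x)) N'"
    unfolding N'_def \<phi>_def levy_intensity_rescale[OF \<rho> G(1) pos(2,1) assms(1) AE] .
  have "(\<lambda>w k. \<phi> (w k)) \<in> N \<rightarrow>\<^sub>M PiM UNIV (\<lambda>_. borel \<Otimes>\<^sub>M G\<^sub>0)"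
    by (rule measurable_map_points[OF _ m\<phi>]) (use pp in \<open>simp add: poisson_process_points_def\<close>)
  then have "distr N' discrete_distr_space normalized_measure = distr N discrete_distr_space (normalized_measure \<circ> (\<lambda>w k. \<phi> (w k)))"
    unfolding N'_def by (intro distr_distr normalized_measure_measurable[OF refl G(2)])
  also have "\<dots> = Q"
    unfolding Q by (simp add: comp_def \<phi>_def normalized_measure_scale[OF pos(2)])
  \<comment> \<open>Normalization cancels the factor \<open>\<beta>\<close>, so the rescaled points,
    which have the intensity of a gamma process, produce the same law \<open>Q\<close>.\<close>
  finally have "Q = distr N' discrete_distr_space normalized_measure" by (rule sym)
  then show "dirichlet_process_law Q"
    unfolding dirichlet_process_law_def NRM_law_def
    using pp' assms(1,2) pos by (intro exI[of _ "\<theta> / \<Lambda>"] exI[of _ "G\<^sub>0"] exI[of _ N'] conjI) auto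
next
  assume "dirichlet_process_law Q"
  then obtain \<alpha> and G :: "'s measure" and N where \<alpha>: "0 < \<alpha>" and G: "nonatomic_prob G"
    and pp: "poisson_process_points (levy_intensity \<alpha> G (\<lambda>x. exp (- x) / x)) N"
    and Q: "Q = distr N discrete_distr_space normalized_measure"
    by (auto simp: dirichlet_process_law_def NRM_law_def)
  \<comment> \<open>The model is set up with the parameters and the point process of the Dirichlet
    representation of \<open>Q\<close>. This is legitimate because both estimators depend on the
    prior through \<open>Q\<close> only.\<close>
  have models: "sketch_model \<alpha> G (\<lambda>x. exp (- x) / x) N J (H J)" if "1 \<le> J" for J
    using that assms \<alpha> G levy_density_exp poisson_imp_laplace[OF pp] by unfold_locales auto
  have "sketch_model.uncorrelated N J j" if J: "1 \<le> J" and j: "j \<in> {1..J}" for J j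
    by (rule sketch_model.gamma_uncorrelated[OF models[OF J] levy_moment_exp_square j])
  then show "\<forall>J\<ge>1. \<forall>n. \<forall>c. (\<Sum>k=1..J. c k) = n \<longrightarrow>
            (\<forall>j\<in>{1..J}. f_NRM Q (H J) c j = f_BNP J n Q (H J) c j)"
    using sketch_model.estimators_coincide_iff[OF models] unfolding Q by blast
qed

end
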